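(* Let $Z$ be a standard normal random variable and, for each $k$, let $\boldsymbol\pi\sim\mathrm{Unif}(\Pi_k)$. There exists a universal constant $\sigma^2>0$ such that, as $k\to\infty$, $$\frac{\beta(\boldsymbol\pi)-\beta_k^{\mathrm{typ}}}{k^{3/2}}\ \longrightarrow\ \sigma Z\quad\text{in distribution}.$$ In particular, for every $\varepsilon>0$, $$\frac{\left|\left\{\pi\in\Pi_k:\ \beta(\pi)\in[c_{\mathrm{typ}}k^2-\varepsilon k^2,\ c_{\mathrm{typ}}k^2+\varepsilon k^2]\right\}\right|}{|\Pi_k|}=1-o(1)\qquad(k\to\infty).$$
   Context: $\Pi_k$ is the set of permutations of $[k]=\{1,\dots,k\}$. Let $X_1,X_2,\dots$ be i.i.d. uniform on $[0,1]$. For $\pi\in\Pi_k$, $\mathrm{OA}(\pi)$ is the set of sequences of stopping times $1\le\tau_1<\dots<\tau_k$ with respect to the natural filtration $\sigma(X_1,\dots,X_t)$ such that almost surely $(X_{\tau_1},\dots,X_{\tau_k})$ is order-isomorphic to $\pi$, i.e. $\pi(i)<\pi(j)\Leftrightarrow X_{\tau_i}<X_{\tau_j}$ for all $i,j\in[k]$. Define $\beta(\pi):=\inf_{(\tau_1,\dots,\tau_k)\in\mathrm{OA}(\pi)}\mathbb E[\tau_k]$, $\beta_k^{\mathrm{typ}}:=\mathbb E_{\pi\sim\mathrm{Unif}(\Pi_k)}[\beta(\pi)]$, and $c_{\mathrm{typ}}:=\lim_{k\to\infty}\beta_k^{\mathrm{typ}}/k^2$ (this limit exists). *)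

theory Defs
  imports "HOL-Probability.Probability"
begin

definition perms :: "nat \<Rightarrow> (nat \<Rightarrow> nat) set" where
  "perms k = {\<pi>. \<pi> permutes {1..k}}"

text \<open>
  The i.i.d. uniform sequence is realised on its canonical space: \<open>X t\<close> is the coordinate
  \<open>\<lambda>\<omega>. \<omega> t\<close> for \<open>t \<ge> 1\<close>.
\<close>
definition unif_seq :: "(nat \<Rightarrow> real) measure" where
  "unif_seq = PiM {1..} (\<lambda>_. uniform_measure lborel {0..1})"

text \<open>
  Times are extended naturals, so that the library's \<^const>\<open>stopping_time\<close> allows the value
  \<open>\<infinity>\<close>. This matters: the raw (uncompleted) filtration generally admits no everywhere-finite
  stopping times with the required almost sure property, so stopping times are only required to
  be finite almost surely. At \<open>t = \<infinity>\<close> the condition \<open>\<tau> \<le> \<infinity>\<close> is void.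
\<close>
definition nat_filtration :: "enat \<Rightarrow> (nat \<Rightarrow> real) measure" where
  "nat_filtration t = sigma (space unif_seq)
     {(\<lambda>\<omega>. \<omega> i) -` A \<inter> space unif_seq | i A. 1 \<le> i \<and> enat i \<le> t \<and> A \<in> sets (borel :: real measure)}"

definition OA :: "nat \<Rightarrow> (nat \<Rightarrow> nat) \<Rightarrow> (nat \<Rightarrow> (nat \<Rightarrow> real) \<Rightarrow> enat) set" where
  "OA k \<pi> = {\<tau>.
     (\<forall>i\<in>{1..k}. stopping_time nat_filtration (\<tau> i)) \<and>
     (AE \<omega> in unif_seq.
        (\<forall>i\<in>{1..k}. 1 \<le> \<tau> i \<omega> \<and> \<tau> i \<omega> < \<infinity>) \<and>
        strict_mono_on {1..k} (\<lambda>i. \<tau> i \<omega>) \<and>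
        (\<forall>i\<in>{1..k}. \<forall>j\<in>{1..k}.
           \<pi> i < \<pi> j \<longleftrightarrow> \<omega> (the_enat (\<tau> i \<omega>)) < \<omega> (the_enat (\<tau> j \<omega>))))}"

text \<open>
  For \<open>k \<ge> 1\<close> and \<open>\<pi> \<in> perms k\<close> the infimum is finite (let \<open>\<tau> i\<close> be the first time after
  \<open>\<tau> (i - 1)\<close> at which a value falls in \<open>[(\<pi> i - 1) / k, \<pi> i / k)\<close>; the expectation is \<open>k\<^sup>2\<close>),
  so the conversion to a real number loses nothing. The case \<open>k = 0\<close> is irrelevant to the
  asymptotics.
\<close>
definition beta :: "nat \<Rightarrow> (nat \<Rightarrow> nat) \<Rightarrow> real" where
  "beta k \<pi> = enn2real (INF \<tau>\<in>OA k \<pi>. \<integral>\<^sup>+ \<omega>. ennreal_of_enat (\<tau> k \<omega>) \<partial>unif_seq)"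

definition beta_typ :: "nat \<Rightarrow> real" where
  "beta_typ k = measure_pmf.expectation (pmf_of_set (perms k)) (beta k)"

definition c_typ :: real where
  "c_typ = lim (\<lambda>k. beta_typ k / real k ^ 2)"

end

theory Submission
  imports Defs
begin

text \<open>
  Read a permutation \<open>\<pi>\<close> as a set of insertions: after \<open>n\<close> selections
  the interval \<open>[0, 1]\<close> is cut into gaps, and the next value must fall into a prescribed gap. The
  order of insertions is a binary search tree over the ranks \<open>1, \<dots>, k\<close>; the node that owns the
  ranks strictly between \<open>i\<close> and \<open>j\<close> is the one with the smallest insertion time. Once a value is
  placed in a gap, the two parts no longer interact except through the common clock, and expected
  waiting times scale like the inverse length of the gap. So a subtree in a gap of length \<open>l\<close> should
  be charged \<open>V / l\<close>, where \<open>V\<close> depends on the shape of the subtree only, and the recursion for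
  \<open>V\<close> is one step of optimal stopping: if the two subtrees are worth \<open>a\<close> and \<open>b\<close>, one more
  observation \<open>x\<close> saves \<open>(V - a/x - b/(1-x))\<^sup>+\<close>, and \<open>V\<close> is the level at which the expected saving
  equals the price \<open>1\<close> of an observation (\<open>cost\<close>). These savings telescope along the tree
  (\<open>sum_node_drop\<close>). Since every observation saves at most \<open>1\<close> on average, whatever the strategy, and
  exactly \<open>1\<close> if profitable values are always accepted, \<open>\<beta>(\<pi>)\<close> is the value of the whole tree
  (\<open>beta_eq_tree_cost\<close>): \<open>\<beta>(\<pi>) = G\<^sup>2\<close>, where \<open>G\<close> is \<open>tree_cost\<close> of the inverse permutation.

  In terms of \<open>G\<close>, the square root of the value, the recursion is almost additive. Completing the
  square in \<open>p\<^sup>2/x + q\<^sup>2/(1-x)\<close> shows that joining subtrees of costs \<open>p\<close> and \<open>q\<close> costs \<open>p + q\<close> plus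
  an \<open>excess\<close> of order \<open>min(p,q) powr (-1/3)\<close>. Hence \<open>G\<close> is a sum of small contributions of the
  nodes, and the contribution of a node depends only on the order of the insertion times inside the
  interval of ranks that it owns (\<open>tree_cost_eq_sum\<close>).

  For a uniformly random permutation the insertion times may be replaced by an independent uniform
  sequence (\<open>uniform_perm_average\<close>). A given interval of length \<open>d\<close> is owned by a node with
  probability of order \<open>d powr (-2)\<close>, and the second moment of its contribution is of order
  \<open>d powr (-5/2)\<close> (\<open>node_term_second_moment\<close>). This decay is strong enough to cut the line into
  blocks of length \<open>L\<close> and to drop all intervals that are not inside a block: the error in mean
  square is at most a fraction of \<open>n\<close> that vanishes as \<open>L\<close> grows (\<open>deviation_approx\<close>). The block sums are independent and identically
  distributed, so the classical central limit theorem applies to them, and letting \<open>L\<close> tend to infinity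
  yields the central limit theorem for \<open>G\<close> (\<open>tree_cost_clt\<close>).

  The limit is not degenerate. Three consecutive ranks can form a subtree that is a path or one that
  is a cherry (a root with two leaves), and swapping two insertion times turns one into the other.
  The two shapes have different costs, and the difference survives on its way to the root because the cost of
  a large tree has slope \<open>1 - O(p powr (-4/3))\<close> in the cost \<open>p\<close> of a subtree, which makes the product
  of the slopes along a path bounded below (\<open>tree_cost_swap\<close>). Correlating \<open>G\<close> with linearly many
  such independent local choices shows that its variance is at least linear
  (\<open>deviation_variance_ge\<close>).

  Finally \<open>G = \<mu>\<^sub>k + \<surd>k D\<close> with \<open>\<mu>\<^sub>k / k\<close> convergent to a constant \<open>\<gamma> > 0\<close> and \<open>D\<close> asymptotically normal, so
  \<open>\<beta> = G\<^sup>2 = \<mu>\<^sub>k\<^sup>2 + 2 \<mu>\<^sub>k \<surd>k D + k D\<^sup>2\<close> is asymptotically normal on the scale \<open>k powr (3/2)\<close>, with limit scale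
  \<open>2 \<gamma>\<close> times that of \<open>D\<close>, and \<open>c_typ = \<gamma>\<^sup>2\<close>. The concentration statement follows from the same
  expansion by Markov's inequality.
\<close>

section \<open>The value of a gap\<close>

text \<open>
  A node whose two subtrees are worth \<open>a\<close> and \<open>b\<close> is to be placed in a gap of length \<open>1\<close>. Placing it
  at \<open>x\<close> leaves gaps of lengths \<open>x\<close> and \<open>1 - x\<close>, with values \<open>a / x\<close> and \<open>b / (1 - x)\<close>. If the gap is valued \<open>V\<close>, this is the
  expected saving of one observation that may be refused; refusal is the truncation
  at zero by \<^const>\<open>ennreal\<close>.
\<close>
definition surplus :: "real \<Rightarrow> real \<Rightarrow> real \<Rightarrow> ennreal" where
  "surplus V a b = (\<integral>\<^sup>+x. ennreal (V - a / x - b / (1 - x)) * indicator {0<..<1} x \<partial>lborel)"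

text \<open>
  An observation costs one unit of time, so in equilibrium it saves \<open>1\<close> on average; see
  \<open>surplus_cost\<close> below.
\<close>
definition cost :: "real \<Rightarrow> real \<Rightarrow> real" where
  "cost a b = Inf {V. 1 \<le> surplus V a b}"

lemma surplus_mono: "V \<le> V' \<Longrightarrow> surplus V a b \<le> surplus V' a b"
  unfolding surplus_def
  by (intro nn_integral_mono mult_right_mono ennreal_leI) auto

lemma surplus_antimono_right: "b \<le> b' \<Longrightarrow> surplus V a b' \<le> surplus V a b"
  unfolding surplus_def
  by (intro nn_integral_mono) (auto simp: indicator_def intro!: ennreal_leI divide_right_mono)

lemma surplus_lipschitz:
  assumes "V \<le> V'" shows "surplus V' a b \<le> surplus V a b + ennreal (V' - V)"
proof -
  have "surplus V' a b \<le> (\<integral>\<^sup>+x. ennreal (V - a / x - b / (1 - x)) * indicator {0<..<1} x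
      + ennreal (V' - V) * indicator {0<..<1::real} x \<partial>lborel)"
    unfolding surplus_def
  proof (rule nn_integral_mono)
    fix x :: real
    have "ennreal (V' - a / x - b / (1 - x)) \<le> ennreal (max 0 (V - a / x - b / (1 - x)) + (V' - V))"
      using assms by (intro ennreal_leI) auto
    also have "\<dots> = ennreal (max 0 (V - a / x - b / (1 - x))) + ennreal (V' - V)"
      using assms by (intro ennreal_plus) auto
    also have "ennreal (max 0 (V - a / x - b / (1 - x))) = ennreal (V - a / x - b / (1 - x))"
      by (simp add: max_def ennreal_neg)
    finally show "ennreal (V' - a / x - b / (1 - x)) * indicator {0<..<1} x
       \<le> ennreal (V - a / x - b / (1 - x)) * indicator {0<..<1} x + ennreal (V' - V) * indicator {0<..<1} x"
      by (auto simp: indicator_def)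
  qed
  also have "\<dots> = surplus V a b + ennreal (V' - V)"
    unfolding surplus_def by (subst nn_integral_add) (auto simp: nn_integral_cmult)
  finally show ?thesis .
qed

text \<open>
  All upper bounds on \<^const>\<open>cost\<close> arise by exhibiting a window of length \<open>w\<close> in which acceptance saves at
  least \<open>c\<close>, with \<open>c * w = 1\<close>.
\<close>
lemma surplus_ge:
  assumes w: "0 \<le> w" "0 \<le> x0" "x0 + w \<le> 1" and c: "0 \<le> c"
    and le: "\<And>x. x0 < x \<Longrightarrow> x < x0 + w \<Longrightarrow> c \<le> V - a / x - b / (1 - x)"
  shows "ennreal (c * w) \<le> surplus V a b"
proof -
  have "ennreal (c * w) = (\<integral>\<^sup>+x. ennreal c * indicator {x0<..<x0 + w} x \<partial>lborel)"
    using w c by (simp add: nn_integral_cmult ennreal_mult)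
  also have "\<dots> \<le> surplus V a b"
    unfolding surplus_def
    by (intro nn_integral_mono) (use w le in \<open>auto simp: indicator_def intro!: ennreal_leI\<close>)
  finally show ?thesis .
qed

lemma surplus_le:
  assumes "0 \<le> a" "0 \<le> b"
  shows "surplus V a b \<le> ennreal V"
proof -
  have "surplus V a b \<le> (\<integral>\<^sup>+x. ennreal V * indicator {0<..<1::real} x \<partial>lborel)"
    unfolding surplus_def
  proof (intro nn_integral_mono)
    fix x :: real
    have "0 < x \<Longrightarrow> x < 1 \<Longrightarrow> 0 \<le> a / x" "0 < x \<Longrightarrow> x < 1 \<Longrightarrow> 0 \<le> b / (1 - x)" using assms by auto
    then show "ennreal (V - a / x - b / (1 - x)) * indicator {0<..<1} x \<le> ennreal V * indicator {0<..<1} x"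
      by (auto simp: indicator_def intro!: ennreal_leI)
  qed
  also have "\<dots> = ennreal V" by (simp add: nn_integral_cmult)
  finally show ?thesis .
qed

lemma surplus_commute: "surplus V a b = surplus V b a"
proof -
  have "surplus V a b = (\<integral>\<^sup>+x. ennreal (V - a / (1 + (-1) * x) - b / (1 - (1 + (-1) * x)))
      * indicator {0<..<1} (1 + (-1) * x) \<partial>lborel)"
    unfolding surplus_def by (subst nn_integral_real_affine[of _ "-1" 1]) simp_all
  also have "\<dots> = surplus V b a"
    unfolding surplus_def
    by (intro nn_integral_cong) (auto simp: indicator_def algebra_simps)
  finally show ?thesis .
qed

lemma cost_commute: "cost a b = cost b a"
  unfolding cost_def by (simp add: surplus_commute[of _ a b])

context
  fixes a b :: real
  assumes ab: "0 \<le> a" "0 \<le> b"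
begin

lemma surplus_unbounded: "\<exists>V. 1 \<le> surplus V a b"
proof -
  have "ennreal (3 * (1/3)) \<le> surplus (3 * a + 3 * b + 3) a b"
  proof (rule surplus_ge[where ?x0.0 = "1/3"])
    fix x :: real assume x: "1/3 < x" "x < 1/3 + 1/3"
    have "a / x \<le> a / (1/3)" "b / (1 - x) \<le> b / (1/3)"
      using x ab by (intro divide_left_mono; simp)+
    then show "3 \<le> 3 * a + 3 * b + 3 - a / x - b / (1 - x)" by simp
  qed auto
  then show ?thesis by auto
qed

lemma one_le_if_surplus: "1 \<le> surplus V a b \<Longrightarrow> 1 \<le> V"
  using surplus_le[OF ab, of V] by (metis ennreal_1 ennreal_le_iff2 order_trans not_one_le_zero)

lemma cost_le: "1 \<le> surplus V a b \<Longrightarrow> cost a b \<le> V"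
  unfolding cost_def by (rule cInf_lower) (auto intro!: bdd_belowI[where m=1] one_le_if_surplus)

lemma cost_ge_1: "1 \<le> cost a b"
  unfolding cost_def
  by (rule cInf_greatest) (use surplus_unbounded one_le_if_surplus in auto)

text \<open>
  Continuity of the surplus in \<open>V\<close>, quantified by \<open>surplus_lipschitz\<close>, turns the infimum into an equation.
\<close>
lemma surplus_cost: "surplus (cost a b) a b = 1"
proof (rule antisym)
  show "surplus (cost a b) a b \<le> 1"
  proof (rule ennreal_le_epsilon)
    fix e :: real assume e: "0 < e"
    have "surplus (cost a b) a b \<le> surplus (cost a b - e) a b + ennreal (cost a b - (cost a b - e))"
      using e by (intro surplus_lipschitz) auto
    also have "surplus (cost a b - e) a b \<le> 1"
    proof (rule ccontr)
      assume "\<not> surplus (cost a b - e) a b \<le> 1"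
      then have "cost a b \<le> cost a b - e" by (intro cost_le) auto
      then show False using e by simp
    qed
    finally show "surplus (cost a b) a b \<le> 1 + ennreal e" by (simp add: add_mono)
  qed
  show "1 \<le> surplus (cost a b) a b"
  proof (rule ennreal_le_epsilon)
    fix e :: real assume e: "0 < e"
    obtain V where V: "1 \<le> surplus V a b" "V < cost a b + e"
    proof -
      have "\<exists>V\<in>{V. 1 \<le> surplus V a b}. V < cost a b + e"
        using surplus_unbounded e unfolding cost_def
        by (intro cInf_lessD) auto
      then show ?thesis using that by auto
    qed
    have "1 \<le> surplus V a b" by fact
    also have "\<dots> \<le> surplus (cost a b) a b + ennreal (V - cost a b)"
      by (rule surplus_lipschitz) (rule cost_le, fact)
    also have "\<dots> \<le> surplus (cost a b) a b + ennreal e"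
      using V by (intro add_left_mono ennreal_leI) auto
    finally show "1 \<le> surplus (cost a b) a b + ennreal e" .
  qed
qed

lemma cost_le_iff: "cost a b \<le> V \<longleftrightarrow> 1 \<le> surplus V a b"
  using cost_le surplus_cost surplus_mono[of "cost a b" V a b] by auto

lemma cost_greater: "surplus V a b < 1 \<Longrightarrow> V < cost a b"
  using cost_le_iff[of V] by auto

end

lemma cost_mono_left:
  assumes "0 \<le> a" "a \<le> a'" "0 \<le> b" shows "cost a b \<le> cost a' b"
proof -
  have "1 = surplus (cost a' b) a' b" using assms by (simp add: surplus_cost)
  also have "\<dots> \<le> surplus (cost a' b) a b"
    using assms by (simp add: surplus_commute[of _ _ b] surplus_antimono_right)
  finally show ?thesis using assms by (intro cost_le) auto
qed

text \<open>
  On the scale of square roots the cost is additive up to a small error, because the least value of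
  \<open>p\<^sup>2 / x + q\<^sup>2 / (1 - x)\<close> is \<open>(p + q)\<^sup>2\<close>.
\<close>
definition root_cost :: "real \<Rightarrow> real \<Rightarrow> real" where
  "root_cost p q = sqrt (cost (p\<^sup>2) (q\<^sup>2))"

lemma root_cost_commute: "root_cost p q = root_cost q p"
  by (simp add: root_cost_def cost_commute)

lemma root_cost_sq: "(root_cost p q)\<^sup>2 = cost (p\<^sup>2) (q\<^sup>2)"
  unfolding root_cost_def using cost_ge_1[of "p\<^sup>2" "q\<^sup>2"] by simp

lemma root_cost_ge_1: "1 \<le> root_cost p q"
  unfolding root_cost_def using cost_ge_1[of "p\<^sup>2" "q\<^sup>2"] by simp

lemma root_cost_0_0: "root_cost 0 0 = 1"
proof -
  have "surplus 1 0 0 = 1" unfolding surplus_def by simp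
  then have "cost 0 0 \<le> 1" by (intro cost_le) auto
  then show ?thesis using cost_ge_1[of 0 0] by (simp add: root_cost_def)
qed

text \<open>
  Completing the square: the ideal position is \<open>x = p / (p + q)\<close>, and the last term is the penalty for
  missing it.
\<close>
lemma hitting_cost_identity:
  fixes p q x :: real
  assumes "0 < x" "x < 1"
  shows "p\<^sup>2 / x + q\<^sup>2 / (1 - x) = (p + q)\<^sup>2 + (p - (p + q) * x)\<^sup>2 / (x * (1 - x))"
  using assms by (simp add: field_simps power2_eq_square)

lemma root_cost_superadditive:
  assumes "0 \<le> p" "0 \<le> q" shows "p + q < root_cost p q"
proof -
  have "surplus ((p + q)\<^sup>2) (p\<^sup>2) (q\<^sup>2) = (\<integral>\<^sup>+(x::real). 0 \<partial>lborel)"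
    unfolding surplus_def
  proof (rule nn_integral_cong)
    fix x :: real
    show "ennreal ((p + q)\<^sup>2 - p\<^sup>2 / x - q\<^sup>2 / (1 - x)) * indicator {0<..<1} x = 0"
    proof (cases "0 < x \<and> x < 1")
      case True
      then have "0 \<le> (p - (p + q) * x)\<^sup>2 / (x * (1 - x))" by auto
      then have "(p + q)\<^sup>2 - p\<^sup>2 / x - q\<^sup>2 / (1 - x) \<le> 0"
        using hitting_cost_identity[of x p q] True by linarith
      then show ?thesis by (simp add: ennreal_neg)
    qed auto
  qed
  then have "(p + q)\<^sup>2 < (root_cost p q)\<^sup>2"
    unfolding root_cost_sq by (intro cost_greater) auto
  then show ?thesis using root_cost_ge_1[of p q] assms by (smt (verit) power_mono)
qed

lemma root_cost_mono:
  assumes "0 \<le> p" "p \<le> p'" shows "root_cost p q \<le> root_cost p' q"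
  unfolding root_cost_def using assms by (intro real_sqrt_le_mono cost_mono_left) (auto intro: power_mono)

section \<open>The excess over additivity\<close>

definition excess :: "real \<Rightarrow> real \<Rightarrow> real" where
  "excess p q = root_cost p q - p - q"

lemma excess_commute: "excess p q = excess q p"
  by (simp add: excess_def root_cost_commute[of p q])

lemma excess_pos: "0 \<le> p \<Longrightarrow> 0 \<le> q \<Longrightarrow> 0 < excess p q"
  using root_cost_superadditive[of p q] by (simp add: excess_def)

lemma excess_le_if_surplus:
  assumes "0 \<le> p" "0 \<le> q" "1 \<le> surplus ((p + q)\<^sup>2 + 2 * (p + q) * c) (p\<^sup>2) (q\<^sup>2)" "0 \<le> c"
  shows "excess p q \<le> c"
proof -
  have "(root_cost p q)\<^sup>2 \<le> (p + q)\<^sup>2 + 2 * (p + q) * c"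
    unfolding root_cost_sq using assms by (intro cost_le) auto
  also have "\<dots> \<le> (p + q + c)\<^sup>2" by (simp add: power2_eq_square algebra_simps)
  finally have "root_cost p q \<le> p + q + c" by (rule power2_le_imp_le) (use assms in auto)
  then show ?thesis by (simp add: excess_def)
qed

text \<open>
  With \<open>S = p + q\<close> and \<open>s = p powr (1/3)\<close>, accept exactly in the window of length
  \<open>s / (2 * S)\<close> to the right of the ideal position \<open>p / S\<close>. The length is chosen so that the penalty stays below
  \<open>S / s\<close> there, a fraction of the surplus \<open>3 * S / s\<close> that is granted, and what remains, \<open>2 * S / s\<close>, times the
  length of the window is \<open>1\<close>. To the right of \<open>p / S \<le> 1/2\<close> the denominator
  \<open>x * (1 - x)\<close> cannot be too small.
\<close>
lemma excess_le_cbrt_aux: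
  assumes p: "1 \<le> p" "p \<le> q"
  shows "excess p q \<le> 3/2 * p powr (-1/3)"
proof (rule excess_le_if_surplus)
  define s where "s = p powr (1/3)"
  have s1: "1 \<le> s" unfolding s_def using p by (intro ge_one_powr_ge_zero) auto
  have "s ^ 3 = s powr real 3" using s1 by (subst powr_realpow) auto
  then have s3: "s ^ 3 = p" unfolding s_def using p by (simp add: powr_powr)
  have inv: "p powr (-1/3) = 1 / s" unfolding s_def using powr_minus_divide[of p "1/3"] by simp
  define S where "S = p + q"
  have S: "2 * p \<le> S" "2 \<le> S" "0 < S" using p by (auto simp: S_def)
  define w where "w = s / (2 * S)"
  have w0: "0 < w" using s1 S by (auto simp: w_def)
  have sp: "s \<le> p" using s1 s3 by (metis one_le_numeral power_increasing power_one_right)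
  have wx: "w \<le> p / (2 * S)" unfolding w_def using sp S by (intro divide_right_mono) auto
  have px: "p / S \<le> 1/2" using S by (simp add: field_simps)
  have "ennreal (2 * S / s * w) \<le> surplus (S\<^sup>2 + 3 * S / s) (p\<^sup>2) (q\<^sup>2)"
  proof (rule surplus_ge[where ?x0.0 = "p / S"])
    show "0 \<le> w" using w0 by simp
    show "0 \<le> p / S" using p S by simp
    show "p / S + w \<le> 1" using wx px by simp
    show "0 \<le> 2 * S / s" using S s1 by simp
    fix x assume x: "p / S < x" "x < p / S + w"
    have x0: "0 < x" using x p S by (smt (verit) divide_pos_pos)
    have x34: "x < 3/4" using x wx px by simp
    have xl: "p / (4 * S) \<le> x * (1 - x)"
    proof -
      have "p / S * (1/4) \<le> x * (1 - x)" using x x34 x0 by (intro mult_mono) auto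
      then show ?thesis by simp
    qed
    have "(p - S * x)\<^sup>2 \<le> (S * w)\<^sup>2"
    proof (rule abs_le_square_iff[THEN iffD1])
      have "p < S * x" "S * x < p + S * w" using x S by (auto simp: field_simps)
      then show "\<bar>p - S * x\<bar> \<le> \<bar>S * w\<bar>" by auto
    qed
    also have "S * w = s / 2" using S by (simp add: w_def)
    finally have num: "(p - S * x)\<^sup>2 \<le> s\<^sup>2 / 4" by (simp add: power_divide)
    have "(p - S * x)\<^sup>2 / (x * (1 - x)) \<le> (s\<^sup>2 / 4) / (p / (4 * S))"
      using num xl p S by (intro frac_le) auto
    also have "\<dots> = S / s" using S s1 p unfolding s3[symmetric]
      by (simp add: field_simps power2_eq_square power3_eq_cube)
    finally have "(p - S * x)\<^sup>2 / (x * (1 - x)) \<le> S / s" .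
    then show "2 * S / s \<le> S\<^sup>2 + 3 * S / s - p\<^sup>2 / x - q\<^sup>2 / (1 - x)"
      using hitting_cost_identity[of x p q] x0 x34 unfolding S_def[symmetric] by (simp add: diff_divide_distrib)
  qed
  moreover have w1: "2 * S / s * w = 1" using S s1 by (simp add: w_def)
  moreover have "S\<^sup>2 + 3 * S / s = (p + q)\<^sup>2 + 2 * (p + q) * (3/2 * p powr (-1/3))"
    unfolding inv S_def using s1 by (simp add: field_simps)
  ultimately show "1 \<le> surplus ((p + q)\<^sup>2 + 2 * (p + q) * (3/2 * p powr (-1/3))) (p\<^sup>2) (q\<^sup>2)"
    by (metis ennreal_1)
qed (use p in auto)

text \<open>
  Without a left subtree the ideal position is the end \<open>x = 0\<close> of the gap, where the penalty is linear instead of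
  quadratic; this costs a constant instead of a negative power.
\<close>
lemma excess_0_le:
  assumes q: "q = 0 \<or> 1 \<le> q"
  shows "excess 0 q \<le> 3/2"
proof (cases "q = 0")
  case True then show ?thesis by (simp add: excess_def root_cost_0_0)
next
  case False
  then have q1: "1 \<le> q" using q by auto
  have "ennreal (2 * q * (1 / (2 * q))) \<le> surplus (q\<^sup>2 + 3 * q) (0\<^sup>2) (q\<^sup>2)"
  proof (rule surplus_ge[where ?x0.0 = 0])
    show "0 + 1 / (2 * q) \<le> 1" using q1 by (simp add: field_simps)
    fix x :: real assume x: "0 < x" "x < 0 + 1 / (2 * q)"
    have qx: "q * x \<le> 1/2" using x q1 by (simp add: field_simps)
    moreover have "1 * x \<le> q * x" using x q1 by (intro mult_right_mono) auto
    ultimately have x2: "x \<le> 1/2" by simp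
    have "q\<^sup>2 / (1 - x) = q\<^sup>2 + q * ((q * x) / (1 - x))" using x2 by (simp add: field_simps power2_eq_square)
    also have "\<dots> \<le> q\<^sup>2 + q * ((1/2) / (1/2))"
      using qx x2 x q1 by (intro add_left_mono mult_left_mono frac_le) auto
    finally show "2 * q \<le> q\<^sup>2 + 3 * q - 0\<^sup>2 / x - q\<^sup>2 / (1 - x)" by simp
  qed (use q1 in auto)
  then show ?thesis using q1 by (intro excess_le_if_surplus) (auto simp: algebra_simps)
qed

lemma excess_le_cbrt:
  assumes "p = 0 \<or> 1 \<le> p" "q = 0 \<or> 1 \<le> q"
  shows "excess p q \<le> 3/2 * max 1 (min p q) powr (-1/3)"
proof (cases "p = 0 \<or> q = 0")
  case True
  then have "max 1 (min p q) = 1" using assms by auto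
  then show ?thesis using True assms excess_0_le[of p] excess_0_le[of q] excess_commute[of p q] by auto
next
  case False
  then have 1: "1 \<le> p" "1 \<le> q" using assms by auto
  then show ?thesis
  proof (cases "p \<le> q")
    case True then show ?thesis using 1 excess_le_cbrt_aux[of p q] by (simp add: min_def max_def)
  next
    case False then show ?thesis using 1 excess_le_cbrt_aux[of q p] excess_commute[of p q]
      by (simp add: min_def max_def)
  qed
qed

lemma excess_le_3_2:
  assumes "p = 0 \<or> 1 \<le> p" "q = 0 \<or> 1 \<le> q"
  shows "excess p q \<le> 3/2"
proof -
  have "max 1 (min p q) powr (-1/3) \<le> 1 powr (-1/3)" by (intro powr_mono2') auto
  then show ?thesis using excess_le_cbrt[OF assms] by simp
qed

section \<open>Lower bounds and the sensitivity of the cost\<close>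

text \<open>
  The estimate \<open>1 / (1 - x) \<ge> 1 + x\<close> dominates the integrand of the surplus by a triangle of area
  \<open>(d / q)\<^sup>2 / 2\<close>, where \<open>q\<^sup>2 + d = (q + 1/2)\<^sup>2\<close>; this area is less than \<open>1\<close>. Excess bounded below
  at nodes with one child makes the cost of a tree at least linear in its size.
\<close>
lemma excess_0_ge:
  assumes q: "1 \<le> q"
  shows "1/2 \<le> excess 0 q"
proof -
  define d where "d = 1/4 + q"
  have d0: "0 \<le> d" using q by (simp add: d_def)
  have "surplus (q\<^sup>2 + d) (0\<^sup>2) (q\<^sup>2) \<le> (\<integral>\<^sup>+x. ennreal (d - q\<^sup>2 * x) * indicator {0..d / q\<^sup>2} x \<partial>lborel)"
    unfolding surplus_def
  proof (rule nn_integral_mono)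
    fix x :: real
    show "ennreal (q\<^sup>2 + d - 0\<^sup>2 / x - q\<^sup>2 / (1 - x)) * indicator {0<..<1} x
      \<le> ennreal (d - q\<^sup>2 * x) * indicator {0..d / q\<^sup>2} x"
    proof (cases "0 < x \<and> x < 1")
      case True
      have "(1 + x) * (1 - x) \<le> 1" by (simp add: algebra_simps)
      then have "1 + x \<le> 1 / (1 - x)" using True by (simp add: field_simps)
      then have "q\<^sup>2 * (1 + x) \<le> q\<^sup>2 * (1 / (1 - x))" by (intro mult_left_mono) auto
      then have *: "q\<^sup>2 + d - 0\<^sup>2 / x - q\<^sup>2 / (1 - x) \<le> d - q\<^sup>2 * x" by (simp add: algebra_simps)
      show ?thesis
      proof (cases "x \<le> d / q\<^sup>2")
        case T: True
        then show ?thesis using True * by (simp add: ennreal_leI)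
      next
        case False
        then have "d - q\<^sup>2 * x \<le> 0" using q by (simp add: field_simps)
        then show ?thesis using * False by (simp add: ennreal_neg)
      qed
    qed auto
  qed
  also have "\<dots> = ennreal ((d * (d / q\<^sup>2) - q\<^sup>2 * (d / q\<^sup>2)\<^sup>2 / 2) - (d * 0 - q\<^sup>2 * 0\<^sup>2 / 2))"
  proof (rule nn_integral_FTC_Icc[where F="\<lambda>x. d * x - q\<^sup>2 * x\<^sup>2 / 2"])
    fix x :: real assume "x \<in> {0..d / q\<^sup>2}"
    then show "0 \<le> d - q\<^sup>2 * x" using q by (simp add: field_simps)
    show "((\<lambda>x. d * x - q\<^sup>2 * x\<^sup>2 / 2) has_real_derivative d - q\<^sup>2 * x) (at x)"
      by (auto intro!: derivative_eq_intros simp: field_simps)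
  qed (use d0 in auto)
  also have "(d * (d / q\<^sup>2) - q\<^sup>2 * (d / q\<^sup>2)\<^sup>2 / 2) - (d * 0 - q\<^sup>2 * 0\<^sup>2 / 2) = (d / q)\<^sup>2 / 2"
    using q by (simp add: field_simps power2_eq_square)
  also have "ennreal \<dots> < 1"
  proof -
    have "d / q \<le> 5/4" using q by (simp add: d_def field_simps)
    then have "(d / q)\<^sup>2 \<le> (5/4)\<^sup>2" using d0 q by (intro power_mono) auto
    then have "(d / q)\<^sup>2 < 2" by (rule le_less_trans) (simp add: power2_eq_square)
    then show ?thesis by (simp add: ennreal_less_one_iff del: power_divide)
  qed
  finally have "q\<^sup>2 + d < (root_cost 0 q)\<^sup>2"
    unfolding root_cost_sq by (intro cost_greater) auto
  moreover have "q\<^sup>2 + d = (q + 1/2)\<^sup>2" by (simp add: d_def power2_eq_square algebra_simps)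
  ultimately have "q + 1/2 < root_cost 0 q" using root_cost_ge_1[of 0 q] by (simp add: power2_less_imp_less)
  then show ?thesis by (simp add: excess_def)
qed

text \<open>
  By the envelope principle the slope of the cost in \<open>a\<close> is the average of \<open>1 / x\<close> over the set \<open>A\<close>
  of accepted values. This set is an interval, between the roots of a quadratic polynomial, with centre
  \<open>c = (V + a' - b) / (2 * V)\<close>; by Jensen's inequality the slope is at least \<open>m = 1 / c\<close>. For finite
  increments the convexity of \<open>1 / x\<close> enters through its tangent \<open>2 * m - m\<^sup>2 * x\<close> at \<open>c\<close>, whose
  deviation from the constant \<open>m\<close> integrates to zero over the symmetric interval \<open>A\<close>. So lowering
  \<open>V\<close> by \<open>(a' - a) * m\<close> keeps the surplus at least \<open>1\<close>.
\<close>
lemma cost_slope: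
  assumes a: "0 \<le> a" "a < a'" and b: "0 \<le> b"
  shows "(a' - a) * (2 * cost a' b / (cost a' b + a' - b)) \<le> cost a' b - cost a b"
proof -
  define V where "V = cost a' b"
  define m where "m = 2 * V / (V + a' - b)"
  define c where "c = (V + a' - b) / (2 * V)"
  have a'0: "0 < a'" using a by simp
  have S: "(sqrt a' + sqrt b)\<^sup>2 < V"
  proof -
    have "sqrt a' + sqrt b < root_cost (sqrt a') (sqrt b)"
      using a'0 b by (intro root_cost_superadditive) auto
    then have "(sqrt a' + sqrt b)\<^sup>2 < (root_cost (sqrt a') (sqrt b))\<^sup>2"
      using a'0 b by (intro power_strict_mono) auto
    then show ?thesis unfolding root_cost_sq V_def using a'0 b by simp
  qed
  have S2: "(sqrt a' + sqrt b)\<^sup>2 = a' + b + 2 * (sqrt a' * sqrt b)"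
    using a'0 b by (simp add: power2_eq_square algebra_simps)
  have ab0: "0 \<le> sqrt a' * sqrt b" using a'0 b by simp
  have V0: "0 < V" "b < V" "a' < V" using S S2 ab0 a'0 b by linarith+
  have "V + a' - b \<noteq> 0" using V0 a'0 by linarith
  then have c01: "0 < c" "c < 1" "m * c = 1" using V0 a'0 b by (auto simp: c_def m_def)
  have m0: "0 < m" using V0 a'0 by (simp add: m_def)
  have disc: "0 < c\<^sup>2 - a' / V"
  proof -
    have "2 * (sqrt a' * sqrt V) < V + a' - b"
    proof -
      have "sqrt a' + sqrt b < sqrt V" using S a'0 b by (intro real_less_rsqrt)
      then have "(sqrt b)\<^sup>2 < (sqrt V - sqrt a')\<^sup>2" using b by (intro power_strict_mono) auto
      then show ?thesis using b V0 a'0 by (simp add: power2_diff algebra_simps)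
    qed
    then have "(2 * (sqrt a' * sqrt V))\<^sup>2 < (V + a' - b)\<^sup>2" using a'0 V0 by (intro power_strict_mono) auto
    then have "4 * (a' * V) < (V + a' - b)\<^sup>2" using a'0 V0 by (simp add: power_mult_distrib)
    then have "4 * (a' * V) / (4 * V\<^sup>2) < (V + a' - b)\<^sup>2 / (4 * V\<^sup>2)"
      using V0 by (intro divide_strict_right_mono) auto
    then show ?thesis using V0 by (simp add: c_def power_divide power_mult_distrib power2_eq_square[of V])
  qed
  define w where "w = sqrt (c\<^sup>2 - a' / V)"
  have w0: "0 < w" "w\<^sup>2 = c\<^sup>2 - a' / V" using disc by (auto simp: w_def)
  have quad: "(V - a' / x - b / (1 - x)) * (x * (1 - x)) = V * (w\<^sup>2 - (x - c)\<^sup>2)" if "0 < x" "x < 1" for x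
  proof -
    have "V * c\<^sup>2 - a' - V * (x - c)\<^sup>2 = (V + a' - b) * x - V * x\<^sup>2 - a'"
      using V0 by (simp add: c_def field_simps power2_eq_square)
    moreover have "V * (w\<^sup>2 - (x - c)\<^sup>2) = V * c\<^sup>2 - a' - V * (x - c)\<^sup>2"
      unfolding w0 using V0 by (simp add: right_diff_distrib)
    moreover have "(V - a' / x - b / (1 - x)) * (x * (1 - x)) = V * (x * (1 - x)) - a' * (1 - x) - b * x"
      using that by (simp add: left_diff_distrib)
    ultimately show ?thesis by (simp add: algebra_simps power2_eq_square)
  qed
  have wc: "w < c"
  proof (rule power2_less_imp_less)
    have "0 < a' / V" using a'0 V0 by simp
    then show "w\<^sup>2 < c\<^sup>2" using w0 by linarith
  qed (use c01 in simp)
  have wc1: "w \<le> 1 - c"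
  proof (rule power2_le_imp_le)
    have "(1 - c)\<^sup>2 - c\<^sup>2 = 1 - 2 * c" by (simp add: power2_eq_square algebra_simps)
    also have "\<dots> = (b - a') / V" using V0 by (simp add: c_def field_simps)
    also have "\<dots> = b / V - a' / V" by (rule diff_divide_distrib)
    finally have "(1 - c)\<^sup>2 - c\<^sup>2 = b / V - a' / V" .
    moreover have "0 \<le> b / V" using b V0 by simp
    ultimately show "w\<^sup>2 \<le> (1 - c)\<^sup>2" using w0 by linarith
  qed (use c01 in simp)
  define A where "A = {c - w<..<c + w}"
  have A01: "x \<in> A \<Longrightarrow> 0 < x \<and> x < 1" for x using wc wc1 by (auto simp: A_def)
  have inA: "x \<in> A \<longleftrightarrow> 0 < V - a' / x - b / (1 - x)" if x: "0 < x" "x < 1" for x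
  proof -
    have "x \<in> A \<longleftrightarrow> \<bar>x - c\<bar> < \<bar>w\<bar>" using w0 by (auto simp: A_def)
    also have "\<dots> \<longleftrightarrow> (x - c)\<^sup>2 < w\<^sup>2" by (metis abs_le_square_iff not_less)
    also have "\<dots> \<longleftrightarrow> 0 < V * (w\<^sup>2 - (x - c)\<^sup>2)" using V0 by (simp add: zero_less_mult_iff)
    also have "\<dots> \<longleftrightarrow> 0 < V - a' / x - b / (1 - x)"
    proof -
      have "0 < x * (1 - x)" using x by simp
      then show ?thesis unfolding quad[OF x, symmetric] by (metis zero_less_mult_pos2 mult_pos_pos)
    qed
    finally show ?thesis .
  qed
  have "surplus V a' b = (\<integral>\<^sup>+x. ennreal ((V - a' / x - b / (1 - x)) * indicator A x) \<partial>lborel)"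
    unfolding surplus_def
  proof (rule nn_integral_cong)
    fix x :: real
    show "ennreal (V - a' / x - b / (1 - x)) * indicator {0<..<1} x
      = ennreal ((V - a' / x - b / (1 - x)) * indicator A x)"
    proof (cases "x \<in> A")
      case True
      then show ?thesis using A01[OF True] by simp
    next
      case False
      then have "0 < x \<Longrightarrow> x < 1 \<Longrightarrow> V - a' / x - b / (1 - x) \<le> 0" using inA[of x] by simp
      then show ?thesis using False by (auto simp: indicator_def ennreal_neg)
    qed
  qed
  moreover have Vs: "surplus V a' b = 1" unfolding V_def using a b by (intro surplus_cost) auto
  ultimately have nn: "(\<integral>\<^sup>+x. ennreal ((V - a' / x - b / (1 - x)) * indicator A x) \<partial>lborel) = ennreal 1" by simp
  have gi: "has_bochner_integral lborel (\<lambda>x. (V - a' / x - b / (1 - x)) * indicator A x) 1"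
    by (rule has_bochner_integral_nn_integral[OF _ _ _ nn])
       (use inA A01 in \<open>auto simp: indicator_def A_def intro!: AE_I2 less_imp_le\<close>)
  have li: "has_bochner_integral lborel (\<lambda>x. (a' - a) * (m - m\<^sup>2 * x) * indicator A x) 0"
  proof -
    have "has_bochner_integral lborel (\<lambda>x. (a' - a) * (m - m\<^sup>2 * x) * indicator {c - w..c + w} x)
      ((a' - a) * (m * (c + w) - m\<^sup>2 * (c + w)\<^sup>2 / 2) - (a' - a) * (m * (c - w) - m\<^sup>2 * (c - w)\<^sup>2 / 2))"
      by (rule has_bochner_integral_FTC_Icc_real[where F="\<lambda>x. (a' - a) * (m * x - m\<^sup>2 * x\<^sup>2 / 2)"])
         (use w0 in \<open>auto intro!: derivative_eq_intros continuous_intros\<close>)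
    also have "((a' - a) * (m * (c + w) - m\<^sup>2 * (c + w)\<^sup>2 / 2) - (a' - a) * (m * (c - w) - m\<^sup>2 * (c - w)\<^sup>2 / 2))
       = (a' - a) * (2 * w * m * (1 - m * c))"
      by (simp add: field_simps power2_eq_square)
    also have "\<dots> = 0" using c01 by simp
    finally have *: "has_bochner_integral lborel
      (\<lambda>x. (a' - a) * (m - m\<^sup>2 * x) * indicator {c - w..c + w} x) 0" .
    have "AE x in lborel. x \<noteq> c - w \<and> x \<noteq> c + w"
      by (intro AE_conjI AE_lborel_singleton)
    then have "AE x in lborel. (a' - a) * (m - m\<^sup>2 * x) * indicator {c - w..c + w} x
      = (a' - a) * (m - m\<^sup>2 * x) * indicator A x"
      by eventually_elim (auto simp: A_def indicator_def)
    then show ?thesis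
      using * by (subst (asm) has_bochner_integral_cong_AE) (auto simp: A_def)
  qed
  define h where "h x = (V - a' / x - b / (1 - x)) * indicator A x + (a' - a) * (m - m\<^sup>2 * x) * indicator A x" for x
  have hi: "has_bochner_integral lborel h 1"
    using has_bochner_integral_add[OF gi li] by (simp add: h_def[abs_def])
  have int_h: "integrable lborel h" and h1: "integral\<^sup>L lborel h = 1"
    using hi by (auto simp: has_bochner_integral_iff)
  have "ennreal 1 \<le> ennreal (integral\<^sup>L lborel (\<lambda>x. max 0 (h x)))"
    unfolding h1[symmetric] using int_h by (intro ennreal_leI integral_mono integrable_max) auto
  also have "\<dots> = (\<integral>\<^sup>+x. ennreal (max 0 (h x)) \<partial>lborel)"
    using int_h by (intro nn_integral_eq_integral[symmetric] integrable_max) auto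
  also have "\<dots> \<le> surplus (V - (a' - a) * m) a b"
    unfolding surplus_def
  proof (rule nn_integral_mono)
    fix x :: real
    show "ennreal (max 0 (h x)) \<le> ennreal (V - (a' - a) * m - a / x - b / (1 - x)) * indicator {0<..<1} x"
    proof (cases "x \<in> A")
      case True
      then have x: "0 < x" "x < 1" using A01 by auto
      have "0 \<le> (1 - m * x)\<^sup>2 / x" using x by simp
      also have "\<dots> = 1 / x - (2 * m - m\<^sup>2 * x)" using x by (simp add: power2_eq_square field_simps)
      finally have "(a' - a) * (2 * m - m\<^sup>2 * x) \<le> (a' - a) * (1 / x)"
        using a by (intro mult_left_mono) auto
      then have "h x \<le> V - (a' - a) * m - a / x - b / (1 - x)"
        using True by (simp add: h_def algebra_simps diff_divide_distrib)
      then have "ennreal (max 0 (h x)) \<le> ennreal (V - (a' - a) * m - a / x - b / (1 - x))"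
        by (cases "h x \<le> 0") (auto simp: max_def intro!: ennreal_leI)
      then show ?thesis using x by simp
    qed (simp add: h_def)
  qed
  finally have "cost a b \<le> V - (a' - a) * m"
    using a b by (intro cost_le) auto
  then show ?thesis unfolding V_def[symmetric] m_def by simp
qed

text \<open>
  The slope bound, rewritten for square roots. The loss \<open>3 * p powr (-4/3)\<close> against slope \<open>1\<close> is the
  ratio of the excess, of order \<open>p powr (-1/3)\<close>, to \<open>p\<close>; it matters that it is summable over the
  sizes of nested trees. The quadratic error comes from \<open>s + s' \<le> 2 * s'\<close> and disappears when the
  interval is subdivided.
\<close>
lemma root_cost_slope_local:
  assumes p: "1 \<le> p" "p < p'" and q: "q = 0 \<or> 1 \<le> q"
  shows "(p' - p) / (1 + 3 * p powr (-4/3)) - (p' - p)\<^sup>2 / 2 \<le> root_cost p' q - root_cost p q"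
proof -
  define s where "s = root_cost p q"
  define s' where "s' = root_cost p' q"
  define r where "r = s' - p' - q"
  define e where "e = r * (2 * q + r)"
  define M where "M = 2 * s'\<^sup>2 / (s'\<^sup>2 + p'\<^sup>2 - q\<^sup>2)"
  have q0: "0 \<le> q" using q by auto
  have r: "0 < r" using excess_pos[of p' q] p q0 by (simp add: r_def s'_def excess_def)
  have rle: "r \<le> 3/2 * max 1 (min p' q) powr (-1/3)" "r \<le> 3/2"
    using excess_le_cbrt[of p' q] excess_le_3_2[of p' q] p q by (auto simp: r_def s'_def excess_def)
  have s's: "p' \<le> s'" "s \<le> s'" "0 < s" "0 < s'"
    using r q0 p root_cost_ge_1[of p q] root_cost_mono[of p p' q]
    by (auto simp: r_def s'_def s_def)
  have den: "s'\<^sup>2 + p'\<^sup>2 - q\<^sup>2 = 2 * p' * s' + e"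
    by (simp add: e_def r_def power2_eq_square algebra_simps)
  have e0: "0 \<le> e" using r q0 by (simp add: e_def)
  \<comment> \<open>the excess decays with the smaller subtree: either this is \<open>p'\<close>, or \<open>q \<le> p'\<close> and the factor \<open>2 * q + r\<close> is small as well\<close>
  have e: "e \<le> 6 * p' powr (-1/3) * s'"
  proof (cases "p' \<le> q")
    case True
    then have "max 1 (min p' q) = p'" using p by (simp add: min_def max_def)
    then have "e \<le> (3/2 * p' powr (-1/3)) * (2 * s')"
      unfolding e_def using rle r q0 p by (intro mult_mono) (auto simp: r_def)
    also have "\<dots> \<le> 6 * p' powr (-1/3) * s'" using s's by simp
    finally show ?thesis .
  next
    case False
    define t where "t = max 1 q"
    have t: "1 \<le> t" "q \<le> t" "t \<le> p'" "max 1 (min p' q) = t" using False p by (auto simp: t_def)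
    have "e \<le> (3/2 * t powr (-1/3)) * (4 * t)"
      unfolding e_def using rle t r q0 by (intro mult_mono) auto
    also have "\<dots> = 6 * (t powr (-1/3) * t powr 1)" using t by simp
    also have "t powr (-1/3) * t powr 1 = t powr (2/3)" by (subst powr_add[symmetric]) simp
    also have "t powr (2/3) \<le> p' powr (2/3)" using t by (intro powr_mono2) auto
    also have "p' powr (2/3) = p' powr (-1/3) * p' powr 1" by (subst powr_add[symmetric]) simp
    also have "\<dots> \<le> p' powr (-1/3) * s'" using p s's by (intro mult_left_mono) auto
    finally show ?thesis by simp
  qed
  have slope: "1 / (1 + 3 * p powr (-4/3)) \<le> p' * M / s'"
  proof -
    have "p' * M / s' = (2 * p' * s') / (2 * p' * s' + e)"
      unfolding M_def den using s's by (simp add: power2_eq_square)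
    also have "\<dots> = 1 / ((2 * p' * s' + e) / (2 * p' * s'))" by simp
    also have "(2 * p' * s' + e) / (2 * p' * s') = 1 + e / (2 * p' * s')"
      using p s's unfolding add_divide_distrib by simp
    finally have "p' * M / s' = 1 / (1 + e / (2 * p' * s'))" .
    moreover have "e / (2 * p' * s') \<le> 3 * p powr (-4/3)"
    proof -
      have "e / (2 * p' * s') \<le> (6 * p' powr (-1/3) * s') / (2 * p' * s')"
        using e p s's by (intro divide_right_mono) auto
      also have "\<dots> = 3 * (p' powr (-1/3) / p' powr 1)" using p s's by simp
      also have "p' powr (-1/3) / p' powr 1 = p' powr (-4/3)" by (subst powr_diff[symmetric]) simp
      also have "\<dots> \<le> p powr (-4/3)" using p by (intro powr_mono2') auto
      finally show ?thesis by simp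
    qed
    moreover have "0 \<le> e / (2 * p' * s')" using e0 p s's by auto
    ultimately show ?thesis by (simp add: frac_le)
  qed
  have Mle: "M / (2 * s') \<le> 1/2"
  proof -
    have "M / (2 * s') = s' / (2 * p' * s' + e)" unfolding M_def den using s's by (simp add: power2_eq_square)
    also have "\<dots> \<le> s' / (2 * p' * s')" using e0 p s's by (intro divide_left_mono) (auto intro!: mult_pos_pos add_pos_nonneg)
    also have "\<dots> \<le> 1/2" using s's p by (simp add: field_simps)
    finally show ?thesis .
  qed
  have M0: "0 \<le> M" unfolding M_def den using e0 p s's by auto
  have "(p'\<^sup>2 - p\<^sup>2) * M \<le> s'\<^sup>2 - s\<^sup>2"
    using cost_slope[of "p\<^sup>2" "p'\<^sup>2" "q\<^sup>2"] p unfolding M_def s'_def s_def root_cost_sq by (auto simp: power_strict_mono)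
  also have "\<dots> = (s' - s) * (s' + s)" by (simp add: power2_eq_square algebra_simps)
  also have "\<dots> \<le> (s' - s) * (2 * s')" using s's by (intro mult_left_mono) auto
  finally have "(p'\<^sup>2 - p\<^sup>2) * M / (2 * s') \<le> s' - s" using s's by (simp add: field_simps)
  also have "(p'\<^sup>2 - p\<^sup>2) * M / (2 * s') = (p' - p) * (p' * M / s') - (p' - p)\<^sup>2 * (M / (2 * s'))"
    using s's by (simp add: field_simps power2_eq_square)
  finally have 1: "(p' - p) * (p' * M / s') - (p' - p)\<^sup>2 * (M / (2 * s')) \<le> s' - s" .
  have "(p' - p) * (1 / (1 + 3 * p powr (-4/3))) \<le> (p' - p) * (p' * M / s')"
    using slope p by (intro mult_left_mono) auto
  moreover have "(p' - p)\<^sup>2 * (M / (2 * s')) \<le> (p' - p)\<^sup>2 * (1/2)"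
    using Mle by (intro mult_left_mono) auto
  ultimately show ?thesis using 1 unfolding s'_def s_def by simp
qed

text \<open>
  Telescoping over \<open>n\<close> equal steps reduces the quadratic error by the factor \<open>n\<close>.
\<close>
lemma linear_lower_bound_if_local:
  fixes g :: "real \<Rightarrow> real"
  assumes ab: "a \<le> b"
    and loc: "\<And>x y. a \<le> x \<Longrightarrow> x < y \<Longrightarrow> y \<le> b \<Longrightarrow> c * (y - x) - K * (y - x)\<^sup>2 \<le> g y - g x"
  shows "c * (b - a) \<le> g b - g a"
proof (cases "a = b")
  case False
  then have ab: "a < b" using ab by simp
  have "c * (b - a) - K * (b - a)\<^sup>2 / real n \<le> g b - g a" if n: "0 < n" for n :: nat
  proof -
    define x where "x i = a + real i * ((b - a) / real n)" for i :: nat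
    have st: "x (Suc i) - x i = (b - a) / real n" for i
      unfolding x_def by (simp add: distrib_right[of 1 "real i"] del: times_divide_eq_right)
    have x0: "x 0 = a" "x n = b" using n by (auto simp: x_def)
    have "(\<Sum>i<n. c * (x (Suc i) - x i) - K * (x (Suc i) - x i)\<^sup>2) \<le> (\<Sum>i<n. g (x (Suc i)) - g (x i))"
    proof (intro sum_mono loc)
      fix i assume i: "i \<in> {..<n}"
      show "a \<le> x i" using ab by (simp add: x_def)
      have "0 < (b - a) / real n" using ab n by simp
      then show "x i < x (Suc i)" using st[of i] by linarith
      have "real (Suc i) * ((b - a) / real n) \<le> real n * ((b - a) / real n)"
        using i ab n by (intro mult_right_mono) auto
      then show "x (Suc i) \<le> b" using n by (simp add: x_def)
    qed
    also have "(\<Sum>i<n. g (x (Suc i)) - g (x i)) = g b - g a" by (subst sum_lessThan_telescope) (simp add: x0)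
    also have "(\<Sum>i<n. c * (x (Suc i) - x i) - K * (x (Suc i) - x i)\<^sup>2)
      = real n * (c * ((b - a) / real n) - K * ((b - a) / real n)\<^sup>2)" unfolding st by simp
    also have "\<dots> = c * (b - a) - K * (b - a)\<^sup>2 / real n"
      using n by (simp add: power2_eq_square right_diff_distrib)
        (simp add: diff_divide_distrib[symmetric] right_diff_distrib[symmetric])
    finally show ?thesis .
  qed
  moreover have "(\<lambda>n. c * (b - a) - K * (b - a)\<^sup>2 / real n) \<longlonglongrightarrow> c * (b - a) - 0"
    by (intro tendsto_diff tendsto_const tendsto_divide_0[OF tendsto_const] filterlim_at_top_imp_at_infinity filterlim_real_sequentially)
  ultimately show ?thesis
    by (intro LIMSEQ_le_const2[of _ "c * (b - a)"] exI[of _ 1]) auto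
qed simp

lemma root_cost_slope:
  assumes "1 \<le> p" "p \<le> p'" and q: "q = 0 \<or> 1 \<le> q"
  shows "(p' - p) / (1 + 3 * p powr (-4/3)) \<le> root_cost p' q - root_cost p q"
proof -
  have "1 / (1 + 3 * p powr (-4/3)) * (p' - p) \<le> root_cost p' q - root_cost p q"
  proof (rule linear_lower_bound_if_local[where K="1/2"])
    fix x y assume xy: "p \<le> x" "x < y" "y \<le> p'"
    have "x powr (-4/3) \<le> p powr (-4/3)" using xy assms by (intro powr_mono2') auto
    then have "1 / (1 + 3 * p powr (-4/3)) \<le> 1 / (1 + 3 * x powr (-4/3))"
      by (intro divide_left_mono) (auto intro!: mult_pos_pos add_pos_nonneg)
    then have "1 / (1 + 3 * p powr (-4/3)) * (y - x) \<le> 1 / (1 + 3 * x powr (-4/3)) * (y - x)"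
      using xy by (intro mult_right_mono) auto
    then show "1 / (1 + 3 * p powr (-4/3)) * (y - x) - 1/2 * (y - x)\<^sup>2 \<le> root_cost y q - root_cost x q"
      using root_cost_slope_local[of x y q] xy assms by simp
  qed (use assms in auto)
  then show ?thesis by simp
qed

lemma surplus_0_left:
  assumes "0 < b" "b < V"
  shows "surplus V 0 b = ennreal (V - b - b * ln (V / b))"
proof -
  define z where "z = 1 - b / V"
  have z: "0 < z" "z < 1" using assms by (auto simp: z_def)
  have pos: "0 \<le> V - b / (1 - x) \<longleftrightarrow> x \<le> z" if "x < 1" for x
    using that assms by (simp add: z_def field_simps)
  have "surplus V 0 b = (\<integral>\<^sup>+x. ennreal (V - b / (1 - x)) * indicator {0..z} x \<partial>lborel)"
    unfolding surplus_def
  proof (intro nn_integral_cong_AE)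
    have "AE x in lborel. x \<noteq> (0::real)" by (rule AE_lborel_singleton)
    then show "AE x in lborel. ennreal (V - 0 / x - b / (1 - x)) * indicator {0<..<1} x
      = ennreal (V - b / (1 - x)) * indicator {0..z} x"
    proof eventually_elim
      case (elim x)
      then show ?case using pos[of x] z by (auto simp: indicator_def ennreal_neg)
    qed
  qed
  also have "\<dots> = ennreal ((V * z + b * ln (1 - z)) - (V * 0 + b * ln (1 - 0)))"
  proof (rule nn_integral_FTC_Icc)
    fix x assume x: "x \<in> {0..z}"
    then show "0 \<le> V - b / (1 - x)" using pos[of x] z by auto
    show "((\<lambda>x. V * x + b * ln (1 - x)) has_real_derivative V - b / (1 - x)) (at x)"
      using x z by (auto intro!: derivative_eq_intros simp: field_simps)
  qed (use z in auto)
  also have "V * z + b * ln (1 - z) - (V * 0 + b * ln (1 - 0)) = V - b - b * ln (V / b)"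
    using assms by (simp add: z_def ln_div field_simps)
  finally show ?thesis .
qed

text \<open>
  The two shapes of a search tree with three nodes that matter later: a path, whose nodes have one
  child each, and a cherry, a root with two leaves. The surplus has closed forms with logarithms, and \<open>6.3\<close>
  separates the two costs. The intermediate value \<open>3.14\<close> is a lower bound for a path of two nodes.
\<close>
lemma cost_path3_greater_cherry: "cost 1 1 < cost 0 (cost 0 1)"
proof -
  have ln2: "693/1000 \<le> ln (2::real)" "ln (2::real) \<le> 25/36"
    using ln_approx_bounds[of 2 3] ln2_le_25_over_36 by (simp_all add: eval_nat_numeral)
  have c01: "314/100 < cost 0 1"
  proof (rule cost_greater)
    have "114/100 < ln (314/100 :: real)"
      using ln_approx_bounds[of "314/100" 5] by (simp add: eval_nat_numeral)
    then show "surplus (314/100) 0 1 < 1" by (subst surplus_0_left) (auto simp: ennreal_less_one_iff)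
  qed auto
  have "63/10 < cost 0 (314/100)"
  proof (rule cost_greater)
    have "ln 2 \<le> ln (630/314 :: real)" by simp
    then have "693/1000 \<le> ln (630/314 :: real)" using ln2 by linarith
    then show "surplus (63/10) 0 (314/100) < 1"
      by (subst surplus_0_left) (auto simp: ennreal_less_one_iff)
  qed auto
  moreover have "cost 0 (314/100) \<le> cost 0 (cost 0 1)"
    using c01 cost_mono_left[of "314/100" "cost 0 1" 0] by (simp add: cost_commute[of 0])
  moreover have "cost 1 1 \<le> 63/10"
  proof (rule cost_le)
    have "1 \<le> ennreal ((63/10 * (4/5) - ln (4/5) + ln (1 - 4/5)) - (63/10 * (1/5) - ln (1/5) + ln (1 - 1/5)))"
    proof -
      have "ln (4/5 :: real) = 2 * ln 2 - ln 5" "ln (1/5 :: real) = - ln 5"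
        using ln_realpow[of 2 2] by (auto simp: ln_div)
      then show ?thesis using ln2 by (subst ennreal_1[symmetric], intro ennreal_leI) (simp add: field_simps)
    qed
    also have "\<dots> = (\<integral>\<^sup>+x. ennreal (63/10 - 1 / x - 1 / (1 - x)) * indicator {1/5..4/5} x \<partial>lborel)"
    proof (rule nn_integral_FTC_Icc[symmetric])
      fix x :: real assume "x \<in> {1/5..4/5}"
      then have x: "1/5 \<le> x" "x \<le> 4/5" by auto
      have "0 \<le> (x - 1/5) * (4/5 - x)" using x by auto
      also have "\<dots> = x * (1 - x) - 4/25" by algebra
      finally have "1 \<le> 63/10 * (x * (1 - x))" by simp
      then show "0 \<le> 63/10 - 1 / x - 1 / (1 - x)" using x by (simp add: field_simps)
      show "((\<lambda>x. 63/10 * x - ln x + ln (1 - x)) has_real_derivative 63/10 - 1 / x - 1 / (1 - x)) (at x)"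
        using x by (auto intro!: derivative_eq_intros simp: field_simps)
    qed auto
    also have "\<dots> \<le> surplus (63/10) 1 1"
      unfolding surplus_def by (intro nn_integral_mono) (auto simp: indicator_def)
    finally show "1 \<le> surplus (63/10) 1 1" .
  qed auto
  ultimately show ?thesis by linarith
qed

lemma root_cost_path3_greater_cherry: "root_cost 1 1 < root_cost 0 (root_cost 0 1)"
  unfolding root_cost_def using cost_path3_greater_cherry cost_ge_1[of 0 1] by simp

lemma surplus_measurable [measurable]:
  assumes [measurable]: "f \<in> borel_measurable M" "g \<in> borel_measurable M"
  shows "(\<lambda>\<omega>. surplus V (f \<omega>) (g \<omega>)) \<in> borel_measurable M"
  unfolding surplus_def by measurable

lemma root_cost_measurable [measurable]:
  assumes [measurable]: "f \<in> borel_measurable M" "g \<in> borel_measurable M"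
  shows "(\<lambda>\<omega>. root_cost (f \<omega>) (g \<omega>)) \<in> borel_measurable M"
proof -
  have "(\<lambda>\<omega>. cost ((f \<omega>)\<^sup>2) ((g \<omega>)\<^sup>2)) \<in> borel_measurable M"
  proof (subst borel_measurable_iff_le, intro allI)
    fix V
    show "{\<omega> \<in> space M. cost ((f \<omega>)\<^sup>2) ((g \<omega>)\<^sup>2) \<le> V} \<in> sets M"
      by (subst cost_le_iff) auto
  qed
  then show ?thesis unfolding root_cost_def by measurable
qed

section \<open>The cost of a search tree\<close>

text \<open>
  The root of the search tree on the positions strictly between \<open>i\<close> and \<open>j\<close>, when position \<open>l\<close> is
  inserted at time \<open>u l\<close>. Resolving ties to the left makes the function total; ties have no
  influence on permutations and have probability zero for random times.
\<close>
definition argmin_between :: "(nat \<Rightarrow> 'a::linorder) \<Rightarrow> nat \<Rightarrow> nat \<Rightarrow> nat" where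
  "argmin_between u i j = (LEAST m. i < m \<and> m < j \<and> (\<forall>l. i < l \<and> l < j \<longrightarrow> u m \<le> u l))"

lemma argmin_between_props:
  assumes "i + 1 < j"
  shows "i < argmin_between u i j" "argmin_between u i j < j"
    "\<And>l. i < l \<Longrightarrow> l < j \<Longrightarrow> u (argmin_between u i j) \<le> u l"
    "\<And>l. i < l \<Longrightarrow> l < argmin_between u i j \<Longrightarrow> u (argmin_between u i j) < u l"
proof -
  let ?P = "\<lambda>m. i < m \<and> m < j \<and> (\<forall>l. i < l \<and> l < j \<longrightarrow> u m \<le> u l)"
  obtain m where "is_arg_min u (\<lambda>m. m \<in> {i<..<j}) m"
    using ex_is_arg_min_if_finite[of "{i<..<j}" u] assms by (force simp: greaterThanLessThan_eq_iff)
  then have "?P m" by (auto simp: is_arg_min_linorder)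
  then have "?P (argmin_between u i j)" unfolding argmin_between_def by (rule LeastI)
  then show 1: "i < argmin_between u i j" "argmin_between u i j < j"
    "\<And>l. i < l \<Longrightarrow> l < j \<Longrightarrow> u (argmin_between u i j) \<le> u l" by auto
  fix l assume l: "i < l" "l < argmin_between u i j"
  then have "\<not> ?P l" unfolding argmin_between_def by (intro not_less_Least)
  then obtain l' where "i < l'" "l' < j" "u l' < u l" using l 1 by force
  then show "u (argmin_between u i j) < u l" using 1(3)[of l'] by auto
qed

lemma argmin_between_eqI:
  assumes "i < m" "m < j" "\<And>l. i < l \<Longrightarrow> l < m \<Longrightarrow> u m < u l" "\<And>l. m < l \<Longrightarrow> l < j \<Longrightarrow> u m \<le> u l"
  shows "argmin_between u i j = m"
  unfolding argmin_between_def
proof (rule Least_equality)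
  show "i < m \<and> m < j \<and> (\<forall>l. i < l \<and> l < j \<longrightarrow> u m \<le> u l)"
    using assms by (metis less_imp_le linorder_neqE_nat order_refl)
  fix y assume "i < y \<and> y < j \<and> (\<forall>l. i < l \<and> l < j \<longrightarrow> u y \<le> u l)"
  then show "m \<le> y" using assms by (meson leD not_le)
qed

lemma argmin_between_cong:
  fixes u :: "nat \<Rightarrow> 'a::linorder" and v :: "nat \<Rightarrow> 'b::linorder"
  assumes "i + 1 < j"
    and "\<And>a b. i < a \<Longrightarrow> a < j \<Longrightarrow> i < b \<Longrightarrow> b < j \<Longrightarrow> u a < u b \<longleftrightarrow> v a < v b"
  shows "argmin_between u i j = argmin_between v i j"
proof (rule argmin_between_eqI)
  note p = argmin_between_props[OF assms(1), where u=v]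
  show "i < argmin_between v i j" "argmin_between v i j < j" using p by auto
  show "u (argmin_between v i j) < u l" if "i < l" "l < argmin_between v i j" for l
    using assms(2)[of "argmin_between v i j" l] p that by auto
  show "u (argmin_between v i j) \<le> u l" if "argmin_between v i j < l" "l < j" for l
    using assms(2)[of l "argmin_between v i j"] p(1,2) p(3)[of l] that by (auto simp: not_less[symmetric])
qed

lemma argmin_between_less:
  assumes "i + 1 < j" "inj_on u {i<..<j}" "i < l" "l < j" "l \<noteq> argmin_between u i j"
  shows "u (argmin_between u i j) < u l"
proof -
  note p = argmin_between_props[OF assms(1), where u=u]
  have "u l \<noteq> u (argmin_between u i j)"
    using inj_onD[OF assms(2), of l "argmin_between u i j"] assms(3-5) p(1,2) by auto
  then show ?thesis using p(3)[of l] assms(3,4) by simp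
qed

text \<open>
  The positions \<open>i\<close> and \<open>j\<close> are the walls of the gap and do not belong to the tree. The order type of
  \<open>u\<close> is general so that permutations and real sequences can be treated alike.
\<close>
function tree_cost :: "(nat \<Rightarrow> 'a::linorder) \<Rightarrow> nat \<Rightarrow> nat \<Rightarrow> real" where
  "tree_cost u i j = (if i + 1 < j
     then root_cost (tree_cost u i (argmin_between u i j)) (tree_cost u (argmin_between u i j) j)
     else 0)"
  by auto
termination
proof (relation "Wellfounded.measure (\<lambda>(u, i, j). j - i)", goal_cases)
  case (2 u i j)
  then show ?case using argmin_between_props(1,2)[where i=i and j=j and u=u] by simp
next
  case (3 u i j)
  then show ?case using argmin_between_props(1,2)[where i=i and j=j and u=u] by simp
qed simp

declare tree_cost.simps [simp del]

lemma tree_cost_empty [simp]: "j \<le> i + 1 \<Longrightarrow> tree_cost u i j = 0"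
  by (simp add: tree_cost.simps)

lemma tree_cost_rec:
  "i + 1 < j \<Longrightarrow> tree_cost u i j
    = root_cost (tree_cost u i (argmin_between u i j)) (tree_cost u (argmin_between u i j) j)"
  by (simp add: tree_cost.simps)

lemma interval_induct [case_names less]:
  assumes "\<And>i j. (\<And>i' j'. j' - i' < j - i \<Longrightarrow> P i' j') \<Longrightarrow> P i j"
  shows "P (i::nat) (j::nat)"
  by (induction "j - i" arbitrary: i j rule: less_induct) (use assms in blast)

lemma tree_cost_cong:
  fixes u :: "nat \<Rightarrow> 'a::linorder" and v :: "nat \<Rightarrow> 'b::linorder"
  assumes "\<And>a b. i < a \<Longrightarrow> a < j \<Longrightarrow> i < b \<Longrightarrow> b < j \<Longrightarrow> u a < u b \<longleftrightarrow> v a < v b"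
  shows "tree_cost u i j = tree_cost v i j"
  using assms
proof (induction i j rule: interval_induct)
  case (less i j)
  show ?case
  proof (cases "i + 1 < j")
    case True
    note p = argmin_between_props(1,2)[OF True, where u=v]
    have e: "argmin_between u i j = argmin_between v i j"
      using True less.prems by (rule argmin_between_cong)
    have "tree_cost u i (argmin_between v i j) = tree_cost v i (argmin_between v i j)"
      using p by (intro less.IH less.prems) auto
    moreover have "tree_cost u (argmin_between v i j) j = tree_cost v (argmin_between v i j) j"
      using p by (intro less.IH less.prems) auto
    ultimately show ?thesis using True e by (simp add: tree_cost_rec)
  qed simp
qed

lemma tree_cost_ge_1: "i + 1 < j \<Longrightarrow> 1 \<le> tree_cost u i j"
  by (simp add: tree_cost_rec root_cost_ge_1)

lemma tree_cost_0_or: "tree_cost u i j = 0 \<or> 1 \<le> tree_cost u i j"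
  using tree_cost_ge_1[of i j u] tree_cost_empty[of j i u] by linarith

lemma tree_cost_nonneg: "0 \<le> tree_cost u i j"
  using tree_cost_0_or[of u i j] by auto

definition node_excess :: "(nat \<Rightarrow> 'a::linorder) \<Rightarrow> nat \<Rightarrow> nat \<Rightarrow> real" where
  "node_excess u i j = (if i + 1 < j
     then excess (tree_cost u i (argmin_between u i j)) (tree_cost u (argmin_between u i j) j)
     else 0)"

lemma node_excess_nonneg: "0 \<le> node_excess u i j"
  unfolding node_excess_def by (simp add: excess_pos tree_cost_nonneg less_imp_le)

lemma node_excess_le: "node_excess u i j \<le> 3/2"
proof -
  have "excess (tree_cost u i (argmin_between u i j)) (tree_cost u (argmin_between u i j) j) \<le> 3/2"
    by (intro excess_le_3_2 tree_cost_0_or)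
  then show ?thesis by (simp add: node_excess_def)
qed

lemma tree_cost_split:
  assumes "i + 1 < j"
  shows "tree_cost u i j = tree_cost u i (argmin_between u i j) + tree_cost u (argmin_between u i j) j + node_excess u i j"
  using assms by (simp add: tree_cost_rec node_excess_def excess_def)

text \<open>
  The lengths of adjacent intervals add up, so superadditivity suffices at nodes with two
  children. At a node with one child the empty side has length \<open>1\<close> and no cost, and the excess of at least \<open>1/2\<close>
  makes up for it.
\<close>
lemma tree_cost_ge: "i + 1 < j \<Longrightarrow> real (j - i) / 2 \<le> tree_cost u i j"
proof (induction i j rule: interval_induct)
  case (less i j)
  define m where "m = argmin_between u i j"
  have m: "i < m" "m < j" using argmin_between_props(1,2)[OF less.prems, where u=u] by (auto simp: m_def)
  have rec: "tree_cost u i j = root_cost (tree_cost u i m) (tree_cost u m j)"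
    using less.prems by (simp add: tree_cost_rec m_def)
  have L: "i + 1 < m \<Longrightarrow> real (m - i) / 2 \<le> tree_cost u i m" using less.IH[of m i] m by auto
  have R: "m + 1 < j \<Longrightarrow> real (j - m) / 2 \<le> tree_cost u m j" using less.IH[of j m] m by auto
  have sup: "tree_cost u i m + tree_cost u m j < tree_cost u i j"
    unfolding rec by (intro root_cost_superadditive tree_cost_nonneg)
  consider "i + 1 < m" "m + 1 < j" | "m = i + 1" "m + 1 < j" | "i + 1 < m" "j = m + 1" | "m = i + 1" "j = m + 1"
    using m by linarith
  then show ?case
  proof cases
    case 1 then show ?thesis using L R sup m by simp
  next
    case 2
    then have "1/2 \<le> excess 0 (tree_cost u m j)" by (intro excess_0_ge tree_cost_ge_1)
    then show ?thesis using 2 R rec by (simp add: excess_def)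
  next
    case 3
    then have "1/2 \<le> excess 0 (tree_cost u i m)" by (intro excess_0_ge tree_cost_ge_1) auto
    then show ?thesis using 3 L rec m by (simp add: excess_def root_cost_commute[of _ 0])
  next
    case 4 then show ?thesis using rec by (simp add: root_cost_0_0)
  qed
qed

lemma tree_cost_le: "tree_cost u i j \<le> 3/2 * real (j - i - 1)"
proof (induction i j rule: interval_induct)
  case (less i j)
  show ?case
  proof (cases "i + 1 < j")
    case True
    define m where "m = argmin_between u i j"
    have m: "i < m" "m < j" using argmin_between_props(1,2)[OF True, where u=u] by (auto simp: m_def)
    have "tree_cost u i j \<le> 3/2 * real (m - i - 1) + 3/2 * real (j - m - 1) + 3/2"
      unfolding tree_cost_split[OF True] m_def[symmetric]
      by (intro add_mono less.IH node_excess_le) (use m in auto)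
    also have "\<dots> = 3/2 * real ((m - i - 1) + (j - m - 1) + 1)" by (simp only: of_nat_add) simp
    also have "(m - i - 1) + (j - m - 1) + 1 = j - i - 1" using m by simp
    finally show ?thesis .
  qed simp
qed

text \<open>
  The size of the smaller subtree controls the excess. The exponent \<open>-2/3\<close> is weakened to \<open>-1/2\<close>, which is strong enough
  for the moment bounds and turns into square roots there.
\<close>
lemma node_excess_le_powr:
  fixes u :: "nat \<Rightarrow> 'a::linorder"
  assumes "i + 1 < j"
  defines "m \<equiv> argmin_between u i j"
  shows "(node_excess u i j)\<^sup>2 \<le> 4 * real (min (m - i) (j - m)) powr (-1/2)"
proof -
  have m: "i < m" "m < j" using argmin_between_props(1,2)[OF assms(1), where u=u] by (auto simp: m_def)
  define p q d where "p = tree_cost u i m" and "q = tree_cost u m j" and "d = real (min (m - i) (j - m))"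
  have d1: "1 \<le> d" using m by (simp add: d_def Suc_le_eq)
  have d2: "d / 2 \<le> max 1 (min p q)"
  proof (cases "d < 2")
    case False
    then have "i + 1 < m" "m + 1 < j" by (auto simp: d_def)
    then have "real (m - i) / 2 \<le> p" "real (j - m) / 2 \<le> q" unfolding p_def q_def by (intro tree_cost_ge; simp)+
    then show ?thesis by (auto simp: d_def min_def max_def)
  qed auto
  have "node_excess u i j \<le> 3/2 * max 1 (min p q) powr (-1/3)"
  proof -
    have "node_excess u i j = excess p q"
      using assms(1) by (simp add: node_excess_def p_def q_def m_def)
    then show ?thesis using excess_le_cbrt[of p q] by (simp only: p_def q_def tree_cost_0_or simp_thms)
  qed
  also have "\<dots> \<le> 3/2 * (d / 2) powr (-1/3)"
    using d1 d2 by (intro mult_left_mono powr_mono2') auto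
  also have "(d / 2) powr (-1/3) = 2 powr (1/3) * d powr (-1/3)"
    using d1 by (simp add: powr_divide powr_minus_divide)
  finally have le: "node_excess u i j \<le> 3/2 * (2 powr (1/3) * d powr (-1/3))" .
  have "(2::real) powr (1/3) \<le> 4/3"
  proof -
    have "(2::real) \<le> (4/3) powr 3" by (simp add: power3_eq_cube)
    then have "(2::real) powr (1/3) \<le> ((4/3) powr 3) powr (1/3)" by (intro powr_mono2) auto
    also have "\<dots> = 4/3" by (subst powr_powr) simp
    finally show ?thesis .
  qed
  then have "2 powr (1/3) * d powr (-1/3) \<le> 4/3 * d powr (-1/3)" by (intro mult_right_mono) auto
  then have "node_excess u i j \<le> 2 * d powr (-1/3)" using le by simp
  then have "(node_excess u i j)\<^sup>2 \<le> (2 * d powr (-1/3))\<^sup>2"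
    by (intro power_mono node_excess_nonneg)
  also have "\<dots> = 4 * d powr (-2/3)" using d1 by (simp add: power2_eq_square flip: powr_add)
  also have "\<dots> \<le> 4 * d powr (-1/2)" using d1 by (intro mult_left_mono powr_mono) auto
  finally show ?thesis unfolding d_def .
qed

section \<open>Decomposition over the intervals owned by nodes\<close>

text \<open>
  The interval between \<open>i\<close> and \<open>j\<close> is the territory of a node exactly if both walls are inserted before all
  positions between them. This is a local condition on \<open>u\<close>, which is what makes the sum below a sum of
  weakly dependent terms.
\<close>
definition is_node :: "(nat \<Rightarrow> 'a::linorder) \<Rightarrow> nat \<Rightarrow> nat \<Rightarrow> bool" where
  "is_node u i j \<longleftrightarrow> (\<forall>l. i < l \<and> l < j \<longrightarrow> u i < u l \<and> u j < u l)"

definition node_term :: "(nat \<Rightarrow> 'a::linorder) \<Rightarrow> nat \<Rightarrow> nat \<Rightarrow> real" where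
  "node_term u i j = (if is_node u i j then node_excess u i j else 0)"

lemma node_term_nonneg: "0 \<le> node_term u i j"
  by (simp add: node_term_def node_excess_nonneg)

lemma node_term_le: "node_term u i j \<le> 3/2"
  using node_excess_le[of u i j] by (simp add: node_term_def)

lemma node_term_empty [simp]: "j \<le> i + 1 \<Longrightarrow> node_term u i j = 0"
  by (simp add: node_term_def node_excess_def)

lemma node_excess_cong:
  fixes u :: "nat \<Rightarrow> 'a::linorder" and v :: "nat \<Rightarrow> 'b::linorder"
  assumes "\<And>a b. i < a \<Longrightarrow> a < j \<Longrightarrow> i < b \<Longrightarrow> b < j \<Longrightarrow> u a < u b \<longleftrightarrow> v a < v b"
  shows "node_excess u i j = node_excess v i j"
proof (cases "i + 1 < j")
  case True
  note p = argmin_between_props(1,2)[OF True, where u=v]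
  have e: "argmin_between u i j = argmin_between v i j"
    using True assms by (rule argmin_between_cong)
  have "tree_cost u i (argmin_between v i j) = tree_cost v i (argmin_between v i j)"
    using p by (intro tree_cost_cong assms) auto
  moreover have "tree_cost u (argmin_between v i j) j = tree_cost v (argmin_between v i j) j"
    using p by (intro tree_cost_cong assms) auto
  ultimately show ?thesis using e by (simp add: node_excess_def)
qed (simp add: node_excess_def)

lemma node_term_cong:
  assumes "\<And>l. i \<le> l \<Longrightarrow> l \<le> j \<Longrightarrow> u l = v l"
  shows "node_term u i j = node_term v i j"
proof (cases "i + 1 < j")
  case True
  have "is_node u i j = is_node v i j" unfolding is_node_def using assms by auto
  moreover have "node_excess u i j = node_excess v i j"
    by (intro node_excess_cong) (use assms in auto)
  ultimately show ?thesis by (simp add: node_term_def)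
qed simp

definition subintervals :: "nat \<Rightarrow> nat \<Rightarrow> (nat \<times> nat) set" where
  "subintervals i j = {(a, b). i \<le> a \<and> a < b \<and> b \<le> j}"

lemma finite_subintervals [simp]: "finite (subintervals i j)"
  by (rule finite_subset[of _ "{i..j} \<times> {i..j}"]) (auto simp: subintervals_def)

text \<open>
  An interval that crosses the root position \<open>m\<close> and is not the whole interval has a wall that is inserted
  after \<open>m\<close>, so it is not owned by any node. The other intervals lie on one side of \<open>m\<close>
  and belong to one of the subtrees.
\<close>
theorem tree_cost_eq_sum:
  assumes "is_node u i j" "inj_on u {i<..<j}"
  shows "tree_cost u i j = (\<Sum>(a, b)\<in>subintervals i j. node_term u a b)"
  using assms
proof (induction i j rule: interval_induct)
  case (less i j)
  show ?case
  proof (cases "i + 1 < j")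
    case False
    have "(\<Sum>(a, b)\<in>subintervals i j. node_term u a b) = 0"
      by (rule sum.neutral) (use False in \<open>auto simp: subintervals_def\<close>)
    then show ?thesis using False by simp
  next
    case True
    define m where "m = argmin_between u i j"
    have m: "i < m" "m < j" using argmin_between_props(1,2)[OF True, where u=u] by (auto simp: m_def)
    have less_m: "u m < u l" if "i < l" "l < j" "l \<noteq> m" for l
      using argmin_between_less[OF True less.prems(2)] that by (auto simp: m_def)
    define Rest where "Rest = {(a, b). i \<le> a \<and> a < m \<and> m < b \<and> b \<le> j \<and> (a, b) \<noteq> (i, j)}"
    have fin: "finite Rest"
      by (rule finite_subset[of _ "{i..j} \<times> {i..j}"]) (auto simp: Rest_def)
    have "subintervals i j = insert (i, j) (subintervals i m \<union> subintervals m j \<union> Rest)"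
      using m by (auto simp: subintervals_def Rest_def)
    also have "(\<Sum>(a, b)\<in>\<dots>. node_term u a b) = node_term u i j
      + ((\<Sum>(a, b)\<in>subintervals i m. node_term u a b) + (\<Sum>(a, b)\<in>subintervals m j. node_term u a b)
      + (\<Sum>(a, b)\<in>Rest. node_term u a b))"
      using m fin
      by (subst sum.insert; simp?; (subst sum.union_disjoint)?; simp?; (subst sum.union_disjoint)?; simp?)
         (auto simp: subintervals_def Rest_def)
    also have "(\<Sum>(a, b)\<in>Rest. node_term u a b) = 0"
    proof (rule sum.neutral, clarify)
      fix a b assume ab: "(a, b) \<in> Rest"
      have "\<not> is_node u a b"
      proof
        assume n: "is_node u a b"
        have "u a < u m" "u b < u m" using n ab by (auto simp: is_node_def Rest_def)
        moreover have "i < a \<Longrightarrow> u m < u a" "b < j \<Longrightarrow> u m < u b"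
          using less_m[of a] less_m[of b] ab by (auto simp: Rest_def)
        ultimately show False using ab by (force simp: Rest_def)
      qed
      then show "node_term u a b = 0" by (simp add: node_term_def)
    qed
    also have "(\<Sum>(a, b)\<in>subintervals i m. node_term u a b) = tree_cost u i m"
      by (rule less.IH[symmetric])
         (use m less.prems less_m in \<open>auto simp: is_node_def intro: inj_on_subset\<close>)
    also have "(\<Sum>(a, b)\<in>subintervals m j. node_term u a b) = tree_cost u m j"
      by (rule less.IH[symmetric])
         (use m less.prems less_m in \<open>auto simp: is_node_def intro: inj_on_subset\<close>)
    also have "node_term u i j = node_excess u i j" using less.prems by (simp add: node_term_def)
    finally show ?thesis using tree_cost_split[OF True, of u] by (simp add: m_def)
  qed
qed

section \<open>The effect of one swap on the cost\<close>

text \<open>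
  A lower bound for the product of the slopes of \<^const>\<open>root_cost\<close> along a path of nested intervals: a
  tree on an interval of length \<open>e\<close> has cost at least \<open>e / 2\<close>. The summand \<open>e = 0\<close> vanishes because
  \<open>0 powr x = 0\<close>.
\<close>
definition damping :: "nat \<Rightarrow> real" where
  "damping d = exp (- (\<Sum>e<d. 3 * (real e / 2) powr (-4/3)))"

definition damping_limit :: real where
  "damping_limit = exp (- (\<Sum>e. 3 * (real e / 2) powr (-4/3)))"

lemma damping_limit_le: "damping_limit \<le> damping d"
proof -
  have "summable (\<lambda>e. real e powr (-4/3))" by (subst summable_real_powr_iff) simp
  then have "summable (\<lambda>e. 3 * (real e powr (-4/3) / 2 powr (-4/3)))"
    by (intro summable_mult summable_divide)
  then have "summable (\<lambda>e. 3 * (real e / 2) powr (-4/3))" by (simp add: powr_divide)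
  then show ?thesis unfolding damping_def damping_limit_def
    by (auto intro!: sum_le_suminf)
qed

lemma damping_limit_pos: "0 < damping_limit"
  by (simp add: damping_limit_def)

lemma damping_antimono: "d \<le> d' \<Longrightarrow> damping d' \<le> damping d"
  unfolding damping_def by (auto intro!: sum_mono2)

lemma damping_le_1: "damping d \<le> 1"
  unfolding damping_def by (auto intro!: sum_nonneg)

lemma damping_Suc_le: "0 < d \<Longrightarrow> damping (Suc d) \<le> damping d / (1 + 3 * (real d / 2) powr (-4/3))"
proof -
  define x where "x = 3 * (real d / 2) powr (-4/3)"
  have x: "0 \<le> x" by (simp add: x_def)
  have "damping (Suc d) = damping d * exp (- x)"
    by (simp add: damping_def x_def flip: exp_add)
  also have "\<dots> \<le> damping d * (1 / (1 + x))"
  proof (rule mult_left_mono)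
    have "1 + x \<le> exp x" by (rule exp_ge_add_one_self)
    then show "exp (- x) \<le> 1 / (1 + x)" using x by (simp add: exp_minus field_simps)
  qed (simp add: damping_def)
  finally show ?thesis by (simp add: x_def)
qed

text \<open>
  Cost of a path of three nodes minus cost of a cherry.
\<close>
definition swap_gap :: real where
  "swap_gap = root_cost 0 (root_cost 0 1) - root_cost 1 1"

lemma swap_gap_pos: "0 < swap_gap"
  using root_cost_path3_greater_cherry by (simp add: swap_gap_def)

text \<open>
  The positions \<open>s + 1\<close>, \<open>s + 2\<close>, \<open>s + 3\<close> are owned by a node, and their insertion times are increasing, so they form a
  path; after exchanging the first two times the middle position is the root and they form a cherry. Above
  this interval the two trees agree, and each step towards the root keeps the fraction of the difference that \<open>root_cost_slope\<close>
  guarantees.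
\<close>
theorem tree_cost_swap:
  fixes u :: "nat \<Rightarrow> 'a::linorder"
  assumes ord: "u s < u (s+1)" "u (s+4) < u (s+1)" "u (s+1) < u (s+2)" "u (s+2) < u (s+3)"
    and ij: "i \<le> s" "s + 4 \<le> j" and inj: "inj_on u {i<..<j}"
  defines "v \<equiv> u \<circ> Transposition.transpose (s+1) (s+2)"
  shows "damping (j - i) * swap_gap \<le> tree_cost u i j - tree_cost v i j"
  using ij inj
proof (induction i j rule: interval_induct)
  case (less i j)
  have v: "v l = u l" if "l \<noteq> s + 1" "l \<noteq> s + 2" for l using that by (simp add: v_def Transposition.transpose_def)
  have v12: "v (s+1) = u (s+2)" "v (s+2) = u (s+1)" by (simp_all add: v_def Transposition.transpose_def)
  have ij: "i + 1 < j" using less.prems by linarith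
  show ?case
  proof (cases "i = s \<and> j = s + 4")
    case True
    have leaf: "tree_cost w a (a + 2) = 1" for w :: "nat \<Rightarrow> 'a" and a
    proof -
      have "argmin_between w a (a + 2) = a + 1" by (rule argmin_between_eqI) auto
      then show ?thesis by (simp add: tree_cost_rec root_cost_0_0)
    qed
    have u123: "u (s+1) \<le> u l" if "s + 1 < l" "l < s + 4" for l
    proof -
      have "l = s + 2 \<or> l = s + 3" using that by linarith
      then consider "l = s+2" | "l = s+3" by blast
      then show ?thesis using ord by cases (auto intro: less_imp_le less_trans)
    qed
    have u23: "u (s+2) \<le> u l" if "s + 2 < l" "l < s + 4" for l
    proof -
      have "l = s + 3" using that by linarith
      then show ?thesis using ord by auto
    qed
    have v13: "v (s+2) < v l" if "s < l" "l < s + 2" for l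
    proof -
      have "l = s + 1" using that by linarith
      then show ?thesis using ord v12 by auto
    qed
    have v23: "v (s+2) \<le> v l" if "s + 2 < l" "l < s + 4" for l
    proof -
      have "l = s + 3" using that by linarith
      moreover have "v (s+3) = u (s+3)" by (rule v) auto
      ultimately show ?thesis using ord v12 by simp
    qed
    have "argmin_between u s (s+4) = s+1"
      by (rule argmin_between_eqI) (use u123 in auto)
    moreover have "argmin_between u (s+1) (s+4) = s+2"
      by (rule argmin_between_eqI) (use u23 in auto)
    ultimately have "tree_cost u s (s+4) = root_cost 0 (root_cost 0 1)"
      using leaf[of u "s+2"] by (simp add: tree_cost_rec[of s] tree_cost_rec[of "Suc s"] numeral_eq_Suc)
    moreover have "argmin_between v s (s+4) = s+2"
      by (rule argmin_between_eqI) (use v13 v23 in auto)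
    then have "tree_cost v s (s+4) = root_cost 1 1"
      using leaf[of v "s"] leaf[of v "s+2"] by (simp add: tree_cost_rec[of s] numeral_eq_Suc)
    ultimately have "tree_cost u i j - tree_cost v i j = swap_gap"
      using True by (simp add: swap_gap_def)
    moreover have "damping (j - i) * swap_gap \<le> 1 * swap_gap"
      using swap_gap_pos damping_le_1 by (intro mult_right_mono) auto
    ultimately show ?thesis by simp
  next
    case False
    define m where "m = argmin_between u i j"
    have m: "i < m" "m < j" using argmin_between_props(1,2)[OF ij, where u=u] by (auto simp: m_def)
    have less_m: "u m < u l" if "i < l" "l < j" "l \<noteq> m" for l
      using argmin_between_less[OF ij less.prems(3)] that by (auto simp: m_def)
    \<comment> \<open>the walls of the window come before its interior, so no larger interval has its root inside the window\<close>
    have m_out: "m \<le> s \<or> s + 4 \<le> m"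
    proof (rule ccontr)
      assume out: "\<not> ?thesis"
      then have "m = s + 1 \<or> m = s + 2 \<or> m = s + 3" by linarith
      then consider "m = s + 1" | "m = s + 2" | "m = s + 3" by blast
      then have "u s < u m \<and> u (s+4) < u m" using ord by cases (auto intro: less_trans)
      moreover have "i < s \<or> s + 4 < j" using False less.prems by linarith
      ultimately show False
        using less_m[of s] less_m[of "s+4"] less.prems out by (auto simp: not_le)
    qed
    have mv: "argmin_between v i j = m"
    proof (rule argmin_between_eqI)
      have vm: "v m = u m" using m_out by (intro v) auto
      have "u m < v l" if "i < l" "l < j" "l \<noteq> m" for l
      proof -
        consider "l = s+1" | "l = s+2" | "l \<noteq> s+1" "l \<noteq> s+2" by blast
        then show ?thesis
          using less_m[of "s+1"] less_m[of "s+2"] less_m[of l] m_out less.prems v v12 that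
          by cases auto
      qed
      then show "v m < v l" if "i < l" "l < m" for l using vm that m by auto
      show "v m \<le> v l" if "m < l" "l < j" for l
        using vm that m \<open>\<And>l. i < l \<Longrightarrow> l < j \<Longrightarrow> l \<noteq> m \<Longrightarrow> u m < v l\<close>[of l] by auto
    qed (use m in auto)
    have step: "damping (j - i) * swap_gap \<le> root_cost p' q - root_cost p q"
      if d: "damping d * swap_gap \<le> p' - p" "0 < d" "d < j - i" "real d / 2 \<le> p" "1 \<le> p" "q = 0 \<or> 1 \<le> q"
      for p p' q d
    proof -
      have sg: "0 \<le> swap_gap" using swap_gap_pos by simp
      have "damping (j - i) * swap_gap \<le> damping (Suc d) * swap_gap"
        using d sg by (intro mult_right_mono damping_antimono) auto
      also have "\<dots> \<le> damping d / (1 + 3 * (real d / 2) powr (-4/3)) * swap_gap"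
        using d sg by (intro mult_right_mono damping_Suc_le) auto
      also have "\<dots> = (damping d * swap_gap) / (1 + 3 * (real d / 2) powr (-4/3))" by simp
      also have "\<dots> \<le> (damping d * swap_gap) / (1 + 3 * p powr (-4/3))"
      proof (rule divide_left_mono)
        show "1 + 3 * p powr (- 4 / 3) \<le> 1 + 3 * (real d / 2) powr (- 4 / 3)"
          using d powr_mono2'[of "-4/3" "real d / 2" p] by simp
        show "0 \<le> damping d * swap_gap" using sg by (simp add: damping_def)
      qed (auto intro!: mult_pos_pos add_pos_nonneg)
      also have "\<dots> \<le> (p' - p) / (1 + 3 * p powr (-4/3))"
        using d by (intro divide_right_mono) auto
      also have "\<dots> \<le> root_cost p' q - root_cost p q"
      proof (rule root_cost_slope)
        have "0 \<le> damping d * swap_gap" using sg by (simp add: damping_def)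
        then show "p \<le> p'" using d by linarith
      qed (use d in auto)
      finally show ?thesis .
    qed
    have rec: "tree_cost u i j = root_cost (tree_cost u i m) (tree_cost u m j)"
      "tree_cost v i j = root_cost (tree_cost v i m) (tree_cost v m j)"
      using ij mv by (simp_all add: tree_cost_rec m_def)
    show ?thesis
    proof (cases "m \<le> s")
      case True
      have "tree_cost v i m = tree_cost u i m"
        by (rule tree_cost_cong) (use True v in auto)
      moreover have "damping (j - m) * swap_gap \<le> tree_cost u m j - tree_cost v m j"
        by (rule less.IH) (use True less.prems m in \<open>auto intro: inj_on_subset\<close>)
      moreover have "m + 1 < j" using True less.prems by linarith
      then have "real (j - m) / 2 \<le> tree_cost v m j" "1 \<le> tree_cost v m j"
        by (rule tree_cost_ge, rule tree_cost_ge_1)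
      ultimately show ?thesis
        unfolding rec using step[of "j - m" "tree_cost u m j" "tree_cost v m j" "tree_cost u i m"] m
        by (simp add: root_cost_commute[of "tree_cost u i m"] tree_cost_0_or)
    next
      case False
      then have F: "s + 4 \<le> m" using m_out by simp
      have "tree_cost v m j = tree_cost u m j"
        by (rule tree_cost_cong) (use F v in auto)
      moreover have "damping (m - i) * swap_gap \<le> tree_cost u i m - tree_cost v i m"
        by (rule less.IH) (use F less.prems m in \<open>auto intro: inj_on_subset\<close>)
      moreover have "i + 1 < m" using F less.prems by linarith
      then have "real (m - i) / 2 \<le> tree_cost v i m" "1 \<le> tree_cost v i m"
        by (rule tree_cost_ge, rule tree_cost_ge_1)
      ultimately show ?thesis
        unfolding rec using step[of "m - i" "tree_cost u i m" "tree_cost v i m" "tree_cost u m j"] m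
        by (simp add: tree_cost_0_or)
    qed
  qed
qed

section \<open>Telescoping over the search tree\<close>

text \<open>
  When position \<open>y\<close> is inserted, its gap is bounded by the nearest positions that were inserted
  before it, or by the walls \<open>i\<close> and \<open>j\<close>.
\<close>
definition left_end :: "(nat \<Rightarrow> 'a::linorder) \<Rightarrow> nat \<Rightarrow> nat \<Rightarrow> nat" where
  "left_end u i y = Max (insert i {l. i < l \<and> l < y \<and> u l < u y})"

definition right_end :: "(nat \<Rightarrow> 'a::linorder) \<Rightarrow> nat \<Rightarrow> nat \<Rightarrow> nat" where
  "right_end u j y = Min (insert j {l. y < l \<and> l < j \<and> u l < u y})"

lemma left_end_props:
  assumes "i < y"
  shows "left_end u i y = i \<or> i < left_end u i y \<and> u (left_end u i y) < u y"
    "i \<le> left_end u i y" "left_end u i y < y"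
    "\<And>l. i < l \<Longrightarrow> l < y \<Longrightarrow> u l < u y \<Longrightarrow> l \<le> left_end u i y"
proof -
  let ?A = "insert i {l. i < l \<and> l < y \<and> u l < u y}"
  have fin: "finite ?A" by (rule finite_subset[of _ "{..y}"]) (use assms in auto)
  have "left_end u i y \<in> ?A" unfolding left_end_def by (rule Max_in) (use fin in auto)
  then show "left_end u i y = i \<or> i < left_end u i y \<and> u (left_end u i y) < u y"
    "i \<le> left_end u i y" "left_end u i y < y" using assms by auto
  show "l \<le> left_end u i y" if "i < l" "l < y" "u l < u y" for l
    unfolding left_end_def using fin that by (intro Max_ge) auto
qed

lemma right_end_props:
  assumes "y < j"
  shows "right_end u j y = j \<or> right_end u j y < j \<and> u (right_end u j y) < u y"
    "right_end u j y \<le> j" "y < right_end u j y"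
    "\<And>l. y < l \<Longrightarrow> l < j \<Longrightarrow> u l < u y \<Longrightarrow> right_end u j y \<le> l"
proof -
  let ?A = "insert j {l. y < l \<and> l < j \<and> u l < u y}"
  have fin: "finite ?A" by (rule finite_subset[of _ "{..j}"]) auto
  have "right_end u j y \<in> ?A" unfolding right_end_def by (rule Min_in) (use fin in auto)
  then show "right_end u j y = j \<or> right_end u j y < j \<and> u (right_end u j y) < u y"
    "right_end u j y \<le> j" "y < right_end u j y" using assms by auto
  show "right_end u j y \<le> l" if "y < l" "l < j" "u l < u y" for l
    unfolding right_end_def using fin that by (intro Min_le) auto
qed

lemma left_end_eqI:
  assumes "a = i \<or> i < a \<and> u a < u y" "a < y" "\<And>l. a < l \<Longrightarrow> l < y \<Longrightarrow> u y \<le> u l" "i < y"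
  shows "left_end u i y = a"
proof (rule antisym)
  note p = left_end_props[OF assms(4), where u=u]
  show "left_end u i y \<le> a"
  proof (rule ccontr)
    assume n: "\<not> left_end u i y \<le> a"
    then have "u (left_end u i y) < u y" using p(1) assms(1) by auto
    then show False using assms(3)[of "left_end u i y"] n p(3) by auto
  qed
  show "a \<le> left_end u i y" using assms p(2) p(4)[of a] by auto
qed

lemma right_end_eqI:
  assumes "b = j \<or> b < j \<and> u b < u y" "y < b" "\<And>l. y < l \<Longrightarrow> l < b \<Longrightarrow> u y \<le> u l" "y < j"
  shows "right_end u j y = b"
proof (rule antisym)
  note p = right_end_props[OF assms(4), where u=u]
  show "b \<le> right_end u j y"
  proof (rule ccontr)
    assume n: "\<not> b \<le> right_end u j y"
    then have "u (right_end u j y) < u y" using p(1) assms(1) by auto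
    then show False using assms(3)[of "right_end u j y"] n p(3) by auto
  qed
  show "right_end u j y \<le> b" using assms p(2) p(4)[of b] by auto
qed

text \<open>
  Value of the gap in which \<open>y\<close> is inserted, minus the values of the two gaps that it creates, when
  position \<open>l\<close> sits at height \<open>v l\<close>.
\<close>
definition node_drop :: "(nat \<Rightarrow> 'a::linorder) \<Rightarrow> nat \<Rightarrow> nat \<Rightarrow> (nat \<Rightarrow> real) \<Rightarrow> nat \<Rightarrow> real" where
  "node_drop u i j v y = (let a = left_end u i y; b = right_end u j y in
     (tree_cost u a b)\<^sup>2 / (v b - v a) - (tree_cost u a y)\<^sup>2 / (v y - v a) - (tree_cost u y b)\<^sup>2 / (v b - v y))"

context
  fixes u :: "nat \<Rightarrow> 'a::linorder" and i j m :: nat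
  assumes ij: "i + 1 < j" and inj: "inj_on u {i<..<j}"
  defines "m \<equiv> argmin_between u i j"
begin

lemma m_between: "i < m" "m < j"
  using argmin_between_props(1,2)[OF ij, where u=u] by (auto simp: m_def)

lemma m_less: "i < l \<Longrightarrow> l < j \<Longrightarrow> l \<noteq> m \<Longrightarrow> u m < u l"
  using argmin_between_less[OF ij inj, of l] by (auto simp: m_def)

lemma ends_root: "left_end u i m = i" "right_end u j m = j"
proof -
  show "left_end u i m = i"
    by (rule left_end_eqI) (use m_between m_less in \<open>auto intro: less_imp_le\<close>)
  show "right_end u j m = j"
    by (rule right_end_eqI) (use m_between m_less in \<open>auto intro: less_imp_le\<close>)
qed

lemma node_drop_left:
  assumes "i < y" "y < m" shows "node_drop u i j v y = node_drop u i m v y"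
proof -
  note p = right_end_props[OF assms(2), where u=u]
  have "right_end u j y = right_end u m y"
  proof (rule right_end_eqI)
    show "right_end u m y = j \<or> right_end u m y < j \<and> u (right_end u m y) < u y"
      using p(1,2) m_between m_less[of y] assms by auto
    show "u y \<le> u l" if "y < l" "l < right_end u m y" for l
      using p(2) p(4)[of l] that by (meson leD leI order_less_le_trans)
  qed (use p m_between assms in auto)
  then show ?thesis by (simp add: node_drop_def)
qed

lemma node_drop_right:
  assumes "m < y" "y < j" shows "node_drop u i j v y = node_drop u m j v y"
proof -
  note p = left_end_props[OF assms(1), where u=u]
  have "left_end u i y = left_end u m y"
  proof (rule left_end_eqI)
    show "left_end u m y = i \<or> i < left_end u m y \<and> u (left_end u m y) < u y"
      using p(1,2) m_between m_less[of y] assms by auto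
    show "u y \<le> u l" if "left_end u m y < l" "l < y" for l
      using p(2) p(4)[of l] that by (meson leD leI order_le_less_trans)
  qed (use p m_between assms in auto)
  then show ?thesis by (simp add: node_drop_def)
qed

lemma node_drop_root:
  "node_drop u i j v m = (tree_cost u i j)\<^sup>2 / (v j - v i) - (tree_cost u i m)\<^sup>2 / (v m - v i)
     - (tree_cost u m j)\<^sup>2 / (v j - v m)"
  unfolding node_drop_def ends_root by simp

lemma sum_node_drop_split:
  fixes P :: "nat set"
  assumes "m \<in> P"
  shows "(\<Sum>y\<in>{i<..<j} \<inter> P. node_drop u i j v y) = node_drop u i j v m
    + (\<Sum>y\<in>{i<..<m} \<inter> P. node_drop u i m v y) + (\<Sum>y\<in>{m<..<j} \<inter> P. node_drop u m j v y)"
proof -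
  have "{i<..<j} \<inter> P = insert m (({i<..<m} \<inter> P) \<union> ({m<..<j} \<inter> P))"
    using m_between assms by auto
  then have "(\<Sum>y\<in>{i<..<j} \<inter> P. node_drop u i j v y) = node_drop u i j v m
    + ((\<Sum>y\<in>{i<..<m} \<inter> P. node_drop u i j v y) + (\<Sum>y\<in>{m<..<j} \<inter> P. node_drop u i j v y))"
    by (simp, subst sum.union_disjoint) auto
  also have "(\<Sum>y\<in>{i<..<m} \<inter> P. node_drop u i j v y) = (\<Sum>y\<in>{i<..<m} \<inter> P. node_drop u i m v y)"
    by (intro sum.cong) (auto intro: node_drop_left)
  also have "(\<Sum>y\<in>{m<..<j} \<inter> P. node_drop u i j v y) = (\<Sum>y\<in>{m<..<j} \<inter> P. node_drop u m j v y)"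
    by (intro sum.cong) (auto intro: node_drop_right)
  finally show ?thesis by simp
qed

end

text \<open>
  Each gap is created once and filled once, except for the initial gap, which is only filled, and
  empty gaps, which have value zero.
\<close>
theorem sum_node_drop:
  assumes "inj_on u {i<..<j}"
  shows "(\<Sum>y\<in>{i<..<j}. node_drop u i j v y) = (tree_cost u i j)\<^sup>2 / (v j - v i)"
  using assms
proof (induction i j rule: interval_induct)
  case (less i j)
  show ?case
  proof (cases "i + 1 < j")
    case True
    define m where "m = argmin_between u i j"
    note m = m_between[OF True less.prems, folded m_def]
    have "(\<Sum>y\<in>{i<..<m}. node_drop u i m v y) = (tree_cost u i m)\<^sup>2 / (v m - v i)"
      by (rule less.IH) (use m less.prems in \<open>auto intro: inj_on_subset\<close>)
    moreover have "(\<Sum>y\<in>{m<..<j}. node_drop u m j v y) = (tree_cost u m j)\<^sup>2 / (v j - v m)"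
      by (rule less.IH) (use m less.prems in \<open>auto intro: inj_on_subset\<close>)
    ultimately show ?thesis
      using sum_node_drop_split[OF True less.prems, of UNIV v] node_drop_root[OF True less.prems, of v]
      by (simp add: m_def)
  next
    case False
    then have "{i<..<j} = {}" by auto
    then show ?thesis using False by simp
  qed
qed

text \<open>
  The same telescoping for an unfinished insertion process: the gaps that are still open have
  nonnegative value. The set \<open>P\<close> of positions inserted so far is closed under passing to smaller times, and \<open>v\<close>
  is meaningful on \<open>P\<close> and the walls only.
\<close>
theorem sum_node_drop_prefix_le:
  assumes "inj_on u {i<..<j}" "i < j"
    and down: "\<And>y l. y \<in> P \<Longrightarrow> i < y \<Longrightarrow> y < j \<Longrightarrow> i < l \<Longrightarrow> l < j \<Longrightarrow> u l < u y \<Longrightarrow> l \<in> P"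
    and mono: "\<And>l l'. l < l' \<Longrightarrow> l \<in> P \<or> l = i \<Longrightarrow> l' \<in> P \<or> l' = j \<Longrightarrow> i \<le> l \<Longrightarrow> l' \<le> j \<Longrightarrow> v l < v l'"
  shows "(\<Sum>y\<in>{i<..<j} \<inter> P. node_drop u i j v y) \<le> (tree_cost u i j)\<^sup>2 / (v j - v i)"
  using assms
proof (induction i j rule: interval_induct)
  case (less i j)
  have pos: "0 \<le> (tree_cost u i j)\<^sup>2 / (v j - v i)"
    using less.prems(4)[of i j] less.prems(2) by simp
  show ?case
  proof (cases "{i<..<j} \<inter> P = {}")
    case True
    then show ?thesis using pos by simp
  next
    case False
    then obtain y where y: "i < y" "y < j" "y \<in> P" by auto
    then have ij: "i + 1 < j" by simp
    define m where "m = argmin_between u i j"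
    note m = m_between[OF ij less.prems(1), folded m_def]
    have mP: "m \<in> P" using m_less[OF ij less.prems(1), of y] y m less.prems(3)[of y m] by (auto simp: m_def)
    have "(\<Sum>y\<in>{i<..<m} \<inter> P. node_drop u i m v y) \<le> (tree_cost u i m)\<^sup>2 / (v m - v i)"
      by (rule less.IH)
         (use m mP less.prems in \<open>auto intro: inj_on_subset dest: less.prems(3) intro!: less.prems(4)\<close>)
    moreover have "(\<Sum>y\<in>{m<..<j} \<inter> P. node_drop u m j v y) \<le> (tree_cost u m j)\<^sup>2 / (v j - v m)"
      by (rule less.IH)
         (use m mP less.prems in \<open>auto intro: inj_on_subset dest: less.prems(3) intro!: less.prems(4)\<close>)
    ultimately show ?thesis
      using sum_node_drop_split[OF ij less.prems(1), of P v] node_drop_root[OF ij less.prems(1), of v] mP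
      by (simp add: m_def)
  qed
qed

section \<open>The uniform sequence and fresh coordinates\<close>

abbreviation unif01 :: "real measure" where
  "unif01 \<equiv> uniform_measure lborel {0..1}"

lemma space_unif01 [simp]: "space unif01 = UNIV"
  by (simp add: uniform_measure_def)

lemma sets_unif01 [measurable_cong, simp]: "sets unif01 = sets borel"
  by (simp add: uniform_measure_def)

interpretation unif01: prob_space unif01
  by (rule prob_space_uniform_measure) auto

lemma emeasure_unif01_UNIV [simp]: "emeasure unif01 UNIV = 1"
  using unif01.emeasure_space_1 by simp

interpretation unif_seq: prob_space unif_seq
  unfolding unif_seq_def by (intro prob_space_PiM unif01.prob_space_axioms)

lemma space_unif_seq: "space unif_seq = {\<omega>. \<omega> 0 = undefined}"
  by (auto simp: unif_seq_def space_PiM PiE_def Pi_def extensional_def Suc_le_eq)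

lemma fun_upd_in_space_unif_seq: "\<omega> \<in> space unif_seq \<Longrightarrow> 1 \<le> s \<Longrightarrow> \<omega> (s := x) \<in> space unif_seq"
  by (auto simp: space_unif_seq)

lemma coordinate_measurable: "1 \<le> i \<Longrightarrow> (\<lambda>\<omega>. \<omega> i) \<in> borel_measurable unif_seq"
  unfolding unif_seq_def
  by (subst measurable_cong_sets[OF refl sets_unif01[symmetric]]) (rule measurable_component_singleton, simp)

lemma AE_unif_seq_between: "AE \<omega> in unif_seq. \<forall>i\<ge>1. 0 < \<omega> i \<and> \<omega> i < 1"
proof -
  have "AE x in unif01. 0 < x \<and> x < 1"
  proof (rule AE_uniform_measureI)
    have "AE x in lborel. x \<noteq> (0::real)" "AE x in lborel. x \<noteq> (1::real)"
      by (rule AE_lborel_singleton)+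
    then show "AE x in lborel. x \<in> {0..1} \<longrightarrow> 0 < x \<and> x < (1::real)"
      by eventually_elim auto
  qed simp
  then have "AE \<omega> in unif_seq. 1 \<le> i \<longrightarrow> 0 < \<omega> i \<and> \<omega> i < 1" for i
    unfolding unif_seq_def
    by (cases "1 \<le> i") (auto intro!: AE_PiM_component unif01.prob_space_axioms)
  then show ?thesis by (subst AE_all_countable) auto
qed

text \<open>
  A coordinate is independent of everything that does not look at it, so it may be integrated out separately.
  That \<open>G\<close> does not look at coordinate \<open>s\<close> is expressed by invariance under updates, which is
  directly checkable for stopping times and for recursively defined strategies.
\<close>
theorem nn_integral_fresh_coordinate:
  assumes s: "1 \<le> s"
    and meas [measurable]: "(\<lambda>(\<omega>, x). G \<omega> x) \<in> borel_measurable (unif_seq \<Otimes>\<^sub>M unif01)"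
    and indep: "\<And>\<omega> z x. \<omega> \<in> space unif_seq \<Longrightarrow> G (\<omega> (s := z)) x = G \<omega> x"
  shows "(\<integral>\<^sup>+\<omega>. G \<omega> (\<omega> s) \<partial>unif_seq) = (\<integral>\<^sup>+\<omega>. (\<integral>\<^sup>+x. G \<omega> x \<partial>unif01) \<partial>unif_seq)"
proof -
  define P where "P = PiM ({1..} - {s}) (\<lambda>_. unif01)"
  interpret P: prob_space P unfolding P_def by (intro prob_space_PiM unif01.prob_space_axioms)
  interpret PU: pair_prob_space unif01 P ..
  have ins: "insert s ({1..} - {s}) = {1..}" using s by auto
  have eq: "unif_seq = distr (unif01 \<Otimes>\<^sub>M P) unif_seq (\<lambda>(x, X). X(s := x))"
    using distr_pair_PiM_eq_PiM[of "{1..} - {s}" "\<lambda>_. unif01" s] unif01.prob_space_axioms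
    unfolding ins unif_seq_def P_def by simp
  have upd [measurable]: "(\<lambda>(x, X). X(s := x)) \<in> unif01 \<Otimes>\<^sub>M P \<rightarrow>\<^sub>M unif_seq"
    unfolding unif_seq_def P_def split_beta'
    by (rule measurable_fun_upd[where J="{1..} - {s}"]) (use s in auto)
  have sp: "X(s := x) \<in> space unif_seq" if "X \<in> space P" for x X
    using that s by (auto simp: space_unif_seq P_def space_PiM PiE_def extensional_def)
  have upd' [measurable]: "(\<lambda>X. X(s := 0)) \<in> P \<rightarrow>\<^sub>M unif_seq"
    using measurable_compose[OF measurable_Pair1'[of 0 unif01 P] upd] by simp
  have G0: "G (X(s := x)) x' = G (X(s := 0)) x'" if "X \<in> space P" for x x' X
    using indep[OF sp[OF that, of 0], of x x'] by simp
  have ms [measurable]: "(\<lambda>\<omega>. \<omega> s) \<in> unif_seq \<rightarrow>\<^sub>M unif01"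
    using coordinate_measurable[OF s] by (subst measurable_cong_sets[OF refl sets_unif01])
  have "(\<integral>\<^sup>+\<omega>. G \<omega> (\<omega> s) \<partial>unif_seq) = (\<integral>\<^sup>+(x, X). G (X(s := x)) x \<partial>(unif01 \<Otimes>\<^sub>M P))"
    by (subst eq, subst nn_integral_distr) (auto intro!: nn_integral_cong)
  also have "\<dots> = (\<integral>\<^sup>+X. (\<integral>\<^sup>+x. G (X(s := x)) x \<partial>unif01) \<partial>P)"
    by (subst PU.nn_integral_snd[symmetric]) auto
  also have "\<dots> = (\<integral>\<^sup>+X. (\<integral>\<^sup>+x. G (X(s := 0)) x \<partial>unif01) \<partial>P)"
  proof (intro nn_integral_cong)
    fix X x assume "X \<in> space P"
    then show "G (X(s := x)) x = G (X(s := 0)) x" by (rule G0)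
  qed
  also have "\<dots> = (\<integral>\<^sup>+X. (\<integral>\<^sup>+y. (\<integral>\<^sup>+x. G (X(s := 0)) x \<partial>unif01) \<partial>unif01) \<partial>P)"
    by simp
  also have "\<dots> = (\<integral>\<^sup>+X. (\<integral>\<^sup>+y. (\<integral>\<^sup>+x. G (X(s := y)) x \<partial>unif01) \<partial>unif01) \<partial>P)"
  proof (intro nn_integral_cong)
    fix X y x assume "X \<in> space P"
    then show "G (X(s := 0)) x = G (X(s := y)) x" by (rule G0[symmetric])
  qed
  also have "\<dots> = (\<integral>\<^sup>+(y, X). (\<integral>\<^sup>+x. G (X(s := y)) x \<partial>unif01) \<partial>(unif01 \<Otimes>\<^sub>M P))"
    by (subst PU.nn_integral_snd[symmetric]) auto
  also have "\<dots> = (\<integral>\<^sup>+\<omega>. (\<integral>\<^sup>+x. G \<omega> x \<partial>unif01) \<partial>unif_seq)"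
  proof -
    have "(\<integral>\<^sup>+\<omega>. (\<integral>\<^sup>+x. G \<omega> x \<partial>unif01) \<partial>unif_seq)
      = (\<integral>\<^sup>+\<omega>. (\<integral>\<^sup>+x. G \<omega> x \<partial>unif01) \<partial>distr (unif01 \<Otimes>\<^sub>M P) unif_seq (\<lambda>(x, X). X(s := x)))"
      by (rule arg_cong[OF eq])
    also have "\<dots> = (\<integral>\<^sup>+(y, X). (\<integral>\<^sup>+x. G (X(s := y)) x \<partial>unif01) \<partial>(unif01 \<Otimes>\<^sub>M P))"
      by (subst nn_integral_distr) (auto simp: split_beta')
    finally show ?thesis by simp
  qed
  finally show ?thesis .
qed

text \<open>
  The saving of an observation \<open>x\<close> in a gap from \<open>l\<close> to \<open>r\<close>. The value \<open>1\<close> for an invalid gap keeps the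
  expected saving equal to \<open>1\<close> for all arguments. A strategy that is only almost surely correct may produce
  invalid gaps on a null set.
\<close>
definition saving :: "real \<Rightarrow> real \<Rightarrow> real \<Rightarrow> real \<Rightarrow> real \<Rightarrow> real \<Rightarrow> ennreal" where
  "saving V A B l r x = (if 0 \<le> l \<and> l < r \<and> r \<le> 1
     then ennreal (V / (r - l) - A / (x - l) - B / (r - x)) * indicator {l<..<r} x else 1)"

lemma saving_measurable [measurable]:
  assumes [measurable]: "f \<in> borel_measurable M" "g \<in> borel_measurable M" "h \<in> borel_measurable M"
  shows "(\<lambda>\<omega>. saving V A B (f \<omega>) (g \<omega>) (h \<omega>)) \<in> borel_measurable M"
  unfolding saving_def indicator_def greaterThanLessThan_iff by measurable

text \<open>
  Scaling the gap to unit length multiplies the saving by the reciprocal of the length and the probability of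
  hitting the gap by the length. The remaining integral is the equation that defines the cost.
\<close>
lemma nn_integral_saving:
  assumes "0 \<le> A" "0 \<le> B"
  shows "(\<integral>\<^sup>+x. saving (cost A B) A B l r x \<partial>unif01) = 1"
proof (cases "0 \<le> l \<and> l < r \<and> r \<le> 1")
  case False
  then have "saving (cost A B) A B l r x = 1" for x unfolding saving_def by (rule if_not_P)
  then show ?thesis by simp
next
  case True
  let ?V = "cost A B"
  have "(\<integral>\<^sup>+x. saving ?V A B l r x \<partial>unif01)
      = (\<integral>\<^sup>+x. ennreal (?V / (r - l) - A / (x - l) - B / (r - x)) * indicator {l<..<r} x \<partial>lborel)"
  proof -
    have "(\<integral>\<^sup>+x. saving ?V A B l r x \<partial>unif01)
      = (\<integral>\<^sup>+x. saving ?V A B l r x * indicator {0..1} x \<partial>lborel) / emeasure lborel {0..1::real}"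
      by (rule nn_integral_uniform_measure) simp_all
    also have "\<dots> = (\<integral>\<^sup>+x. saving ?V A B l r x * indicator {0..1} x \<partial>lborel)"
      by (simp add: divide_ennreal_def)
    also have "\<dots> = (\<integral>\<^sup>+x. ennreal (?V / (r - l) - A / (x - l) - B / (r - x)) * indicator {l<..<r} x \<partial>lborel)"
      by (intro nn_integral_cong) (use True in \<open>simp add: saving_def indicator_def\<close>)
    finally show ?thesis .
  qed
  also have "\<dots> = ennreal (r - l) * (\<integral>\<^sup>+x. ennreal (?V / (r - l) - A / ((l + (r - l) * x) - l)
      - B / (r - (l + (r - l) * x))) * indicator {l<..<r} (l + (r - l) * x) \<partial>lborel)"
    using True by (subst nn_integral_real_affine[where c="r - l" and t=l]) auto
  also have "\<dots> = (\<integral>\<^sup>+x. ennreal (r - l) * (ennreal (?V / (r - l) - A / ((l + (r - l) * x) - l)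
      - B / (r - (l + (r - l) * x))) * indicator {l<..<r} (l + (r - l) * x)) \<partial>lborel)"
    by (subst nn_integral_cmult) auto
  also have "\<dots> = surplus ?V A B"
    unfolding surplus_def
  proof (rule nn_integral_cong)
    fix x :: real
    have ind: "indicator {l<..<r} (l + (r - l) * x) = (indicator {0<..<1} x :: ennreal)"
    proof -
      have "l + (r - l) * x < r \<longleftrightarrow> (r - l) * x < (r - l) * 1" by (simp add: algebra_simps)
      also have "\<dots> \<longleftrightarrow> x < 1" using True by (subst mult_less_cancel_left_pos) auto
      finally show ?thesis using True by (auto simp: indicator_def zero_less_mult_iff)
    qed
    have r: "r - (l + (r - l) * x) = (r - l) * (1 - x)" by (simp add: algebra_simps)
    have "?V / (r - l) - A / ((l + (r - l) * x) - l) - B / (r - (l + (r - l) * x))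
      = (?V - A / x - B / (1 - x)) / (r - l)"
      unfolding r by (simp add: diff_divide_distrib mult.commute)
    then have "ennreal (r - l) * ennreal (?V / (r - l) - A / ((l + (r - l) * x) - l) - B / (r - (l + (r - l) * x)))
      = ennreal (?V - A / x - B / (1 - x))"
      using True by (simp add: ennreal_mult'[symmetric])
    then show "ennreal (r - l) * (ennreal (?V / (r - l) - A / ((l + (r - l) * x) - l)
      - B / (r - (l + (r - l) * x))) * indicator {l<..<r} (l + (r - l) * x))
      = ennreal (?V - A / x - B / (1 - x)) * indicator {0<..<1} x"
      unfolding ind by (simp only: mult.assoc[symmetric])
  qed
  also have "\<dots> = 1" using assms by (rule surplus_cost)
  finally show ?thesis .
qed

section \<open>Stopping times do not anticipate\<close>

lemma space_nat_filtration [simp]: "space (nat_filtration t) = space unif_seq"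
  unfolding nat_filtration_def by (simp add: space_measure_of_conv)

lemma sets_nat_filtration:
  "sets (nat_filtration t) = sigma_sets (space unif_seq)
     {(\<lambda>\<omega>. \<omega> i) -` A \<inter> space unif_seq | i A. 1 \<le> i \<and> enat i \<le> t \<and> A \<in> sets (borel :: real measure)}"
  unfolding nat_filtration_def by (rule sets_measure_of) auto

lemma coordinate_measurable_nat_filtration:
  "1 \<le> i \<Longrightarrow> i \<le> t \<Longrightarrow> (\<lambda>\<omega>. \<omega> i) \<in> borel_measurable (nat_filtration (enat t))"
  by (rule measurableI) (auto simp: sets_nat_filtration intro!: sigma_sets.Basic)

lemma sets_nat_filtration_subset: "sets (nat_filtration t) \<subseteq> sets unif_seq"
  unfolding sets_nat_filtration
proof (rule sets.sigma_sets_subset, safe)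
  fix i :: nat and A :: "real set" assume "1 \<le> i" "A \<in> sets borel"
  then show "(\<lambda>\<omega>. \<omega> i) -` A \<inter> space unif_seq \<in> sets unif_seq"
    using measurable_sets[OF coordinate_measurable] by blast
qed

lemma pred_nat_filtration:
  "Measurable.pred (nat_filtration t) P \<Longrightarrow> Measurable.pred unif_seq P"
  using sets_nat_filtration_subset[of t] by (auto simp: pred_def)

text \<open>
  The generating events have this invariance, and it passes to complements and countable unions.
\<close>
lemma nat_filtration_nonanticipating:
  assumes "B \<in> sets (nat_filtration (enat t))" "t < s" "\<omega> \<in> space unif_seq"
  shows "\<omega> (s := z) \<in> B \<longleftrightarrow> \<omega> \<in> B"
  using assms(1) unfolding sets_nat_filtration
proof (induction B rule: sigma_sets.induct)
  case (Basic a)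
  then show ?case using assms(2,3) fun_upd_in_space_unif_seq[OF assms(3), of s z]
    by (auto simp del: fun_upd_apply simp: fun_upd_other)
next
  case (Compl a)
  then show ?case using assms(2,3) fun_upd_in_space_unif_seq[OF assms(3), of s z]
    by (auto simp del: fun_upd_apply)
qed auto

lemma pred_nonanticipating:
  assumes "Measurable.pred (nat_filtration (enat t)) P" "t < s" "\<omega> \<in> space unif_seq"
  shows "P (\<omega> (s := z)) \<longleftrightarrow> P \<omega>"
proof -
  have "{\<omega> \<in> space unif_seq. P \<omega>} \<in> sets (nat_filtration (enat t))"
    using assms(1) by (simp add: pred_def)
  from nat_filtration_nonanticipating[OF this assms(2,3), of z] show ?thesis
    using assms(2,3) fun_upd_in_space_unif_seq[OF assms(3), of s z] by (simp del: fun_upd_apply)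
qed

lemma enat_eq_iff_le: "(T = enat t) \<longleftrightarrow> (T \<le> enat t \<and> (\<forall>t'<t. \<not> T \<le> enat t'))"
proof (cases T)
  case (enat n)
  have "n = t \<longleftrightarrow> n \<le> t \<and> (\<forall>t'<t. \<not> n \<le> t')" by (metis le_neq_implies_less not_less order_refl)
  then show ?thesis using enat by simp
qed simp

lemma enat_measurable_if_le:
  fixes f :: "'b \<Rightarrow> enat"
  assumes "\<And>t. Measurable.pred M (\<lambda>\<omega>. f \<omega> \<le> enat t)"
  shows "f \<in> measurable M (count_space UNIV)"
proof (subst measurable_count_space_eq_countable, safe)
  fix a :: enat
  note [measurable] = assms
  have "Measurable.pred M (\<lambda>\<omega>. f \<omega> = a)"
  proof (cases a)
    case (enat t)
    have "(f \<omega> = a) = (f \<omega> \<le> enat t \<and> (\<forall>t'\<in>{..<t}. \<not> f \<omega> \<le> enat t'))" for \<omega>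
      unfolding enat enat_eq_iff_le by auto
    then show ?thesis by simp
  next
    case infinity
    have "(f \<omega> = a) = (\<forall>t. \<not> f \<omega> \<le> enat t)" for \<omega>
      unfolding infinity by (cases "f \<omega>") auto
    then show ?thesis by simp
  qed
  then show "f -` {a} \<inter> space M \<in> sets M"
    by (auto simp: pred_def vimage_def Int_def conj_commute)
qed auto

section \<open>No strategy beats the squared tree cost\<close>

locale pattern =
  fixes k :: nat and \<pi> :: "nat \<Rightarrow> nat"
  assumes k: "1 \<le> k" and perm: "\<pi> permutes {1..k}"
begin

text \<open>
  Rank \<open>y\<close> is selected in step \<open>u y\<close>; these are the insertion times of the search tree.
\<close>
definition u :: "nat \<Rightarrow> nat" where "u = inv \<pi>"

lemma u_permutes: "u permutes {1..k}"
  unfolding u_def by (rule permutes_inv[OF perm])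

lemma u_pi [simp]: "u (\<pi> i) = i" and pi_u [simp]: "\<pi> (u y) = y"
  unfolding u_def using permutes_inverses[OF perm] by auto

lemma u_inj: "inj_on u A"
  using permutes_inj_on[OF u_permutes] .

lemma u_in: "y \<in> {1..k} \<longleftrightarrow> u y \<in> {1..k}"
  using permutes_in_image[OF u_permutes, of y] by simp

lemma pi_in: "i < k \<Longrightarrow> \<pi> (Suc i) \<in> {1..k}"
  using u_in[of "\<pi> (Suc i)"] by simp

text \<open>
  The ranks between which rank \<open>y\<close> has to be inserted, with \<open>0\<close> and \<open>k + 1\<close> standing for the ends of
  the unit interval, and the values of its tree and of the two subtrees.
\<close>
definition lo :: "nat \<Rightarrow> nat" where "lo y = left_end u 0 y"
definition hi :: "nat \<Rightarrow> nat" where "hi y = right_end u (k + 1) y"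
definition V :: "nat \<Rightarrow> real" where "V y = (tree_cost u (lo y) (hi y))\<^sup>2"
definition A :: "nat \<Rightarrow> real" where "A y = (tree_cost u (lo y) y)\<^sup>2"
definition B :: "nat \<Rightarrow> real" where "B y = (tree_cost u y (hi y))\<^sup>2"

definition total :: real where "total = (tree_cost u 0 (k + 1))\<^sup>2"

text \<open>
  The saving of observation \<open>x\<close> while waiting for selection \<open>i + 1\<close>, when rank \<open>c\<close> has been given the
  value \<open>v c\<close>.
\<close>
definition saved :: "nat \<Rightarrow> (nat \<Rightarrow> real) \<Rightarrow> real \<Rightarrow> ennreal" where
  "saved i v x = (let y = \<pi> (Suc i) in saving (V y) (A y) (B y) (v (lo y)) (v (hi y)) x)"

text \<open>
  The ends \<open>0\<close> and \<open>k + 1\<close> count as known from the start, since they bound the first gap.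
\<close>
definition known :: "nat \<Rightarrow> nat \<Rightarrow> bool" where
  "known n c \<longleftrightarrow> c = 0 \<or> c = k + 1 \<or> c \<in> {1..k} \<and> u c \<le> n"

lemma lo_hi:
  assumes "y \<in> {1..k}"
  shows "lo y < y" "y < hi y" "hi y \<le> k + 1"
    "lo y = 0 \<or> lo y \<in> {1..k} \<and> u (lo y) < u y"
    "hi y = k + 1 \<or> hi y \<in> {1..k} \<and> u (hi y) < u y"
    "\<And>c. known (u y - 1) c \<Longrightarrow> c < y \<Longrightarrow> c \<le> lo y"
    "\<And>c. known (u y - 1) c \<Longrightarrow> y < c \<Longrightarrow> hi y \<le> c"
proof -
  have y: "0 < y" "y < k + 1" "1 \<le> u y" using assms u_in[of y] by auto
  note l = left_end_props[OF y(1), where u=u, folded lo_def]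
  note r = right_end_props[OF y(2), where u=u, folded hi_def]
  show "lo y < y" "y < hi y" "hi y \<le> k + 1" using l r by auto
  show "lo y = 0 \<or> lo y \<in> {1..k} \<and> u (lo y) < u y" using l y by auto
  show "hi y = k + 1 \<or> hi y \<in> {1..k} \<and> u (hi y) < u y" using r y by auto
  show "c \<le> lo y" if "known (u y - 1) c" "c < y" for c
    using that l(4)[of c] y by (auto simp: known_def)
  show "hi y \<le> c" if "known (u y - 1) c" "y < c" for c
    using that r(2) r(4)[of c] y by (auto simp: known_def)
qed

lemma known_lo_hi: "y \<in> {1..k} \<Longrightarrow> u y \<le> Suc n \<Longrightarrow> known n (lo y) \<and> known n (hi y)"
  using lo_hi(4,5)[of y] by (auto simp: known_def)

lemma V_eq_cost:
  assumes "y \<in> {1..k}" shows "V y = cost (A y) (B y)"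
proof -
  note p = lo_hi[OF assms]
  have less: "u y < u l" if "lo y < l" "l < hi y" "l \<noteq> y" for l
  proof (rule ccontr)
    assume "\<not> u y < u l"
    moreover have "u l \<noteq> u y" using inj_onD[OF u_inj[of UNIV], of l y] that by auto
    moreover have "l \<in> {1..k}" using that p(3) by auto
    ultimately have "known (u y - 1) l" by (auto simp: known_def)
    then show False using p(6,7)[of l] that by force
  qed
  have "argmin_between u (lo y) (hi y) = y"
    by (rule argmin_between_eqI) (use p less in \<open>auto intro: less_imp_le\<close>)
  then show ?thesis using p(1,2)
    unfolding V_def A_def B_def by (subst tree_cost_rec) (auto simp: root_cost_sq)
qed

lemma nn_integral_saved: "i < k \<Longrightarrow> (\<integral>\<^sup>+x. saved i v x \<partial>unif01) = 1"
  unfolding saved_def Let_def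
  by (subst V_eq_cost[OF pi_in]) (auto intro!: nn_integral_saving simp: A_def B_def)

lemma saved_measurable [measurable]:
  assumes [measurable]: "\<And>c. (\<lambda>\<omega>. v \<omega> c) \<in> borel_measurable M" "h \<in> borel_measurable M"
  shows "(\<lambda>\<omega>. saved i (v \<omega>) (h \<omega>)) \<in> borel_measurable M"
  unfolding saved_def Let_def by measurable

lemma node_drop_eq:
  "node_drop u 0 (k + 1) v y = V y / (v (hi y) - v (lo y)) - A y / (v y - v (lo y)) - B y / (v (hi y) - v y)"
  by (simp add: node_drop_def lo_def hi_def V_def A_def B_def Let_def)

text \<open>
  A selection saves at least the drop of its node. Equality fails only for an unprofitable selection,
  where the drop is negative and the saving zero.
\<close>
lemma saved_ge_node_drop:
  assumes "y \<in> {1..k}" "0 \<le> v (lo y)" "v (lo y) < v y" "v y < v (hi y)" "v (hi y) \<le> 1"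
  shows "ennreal (node_drop u 0 (k + 1) v y) \<le> saved (u y - 1) v (v y)"
proof -
  have "Suc (u y - 1) = u y" using assms(1) u_in[of y] by auto
  then show ?thesis unfolding node_drop_eq using assms by (simp add: saved_def saving_def)
qed

context
  fixes \<tau> assumes OA: "\<tau> \<in> OA k \<pi>"
begin

lemma tau_pred: "q \<in> {1..k} \<Longrightarrow> Measurable.pred (nat_filtration (enat t)) (\<lambda>\<omega>. \<tau> q \<omega> \<le> enat t)"
  using OA unfolding OA_def stopping_time_def by auto

lemma tau_eq_pred: "q \<in> {1..k} \<Longrightarrow> 1 \<le> r \<Longrightarrow> Measurable.pred unif_seq (\<lambda>\<omega>. \<tau> q \<omega> = enat r)"
proof -
  assume q: "q \<in> {1..k}" and r: "1 \<le> r"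
  have [measurable]: "Measurable.pred unif_seq (\<lambda>\<omega>. \<tau> q \<omega> \<le> enat t)" for t
    by (rule pred_nat_filtration[OF tau_pred[OF q]])
  have "\<tau> q \<omega> = enat r \<longleftrightarrow> \<tau> q \<omega> \<le> enat r \<and> \<not> \<tau> q \<omega> \<le> enat (r - 1)" for \<omega>
    using r by (cases "\<tau> q \<omega>") auto
  then show ?thesis by simp
qed

lemma tau_le_nonanticipating:
  "q \<in> {1..k} \<Longrightarrow> t < s \<Longrightarrow> \<omega> \<in> space unif_seq \<Longrightarrow> \<tau> q (\<omega> (s := z)) \<le> enat t \<longleftrightarrow> \<tau> q \<omega> \<le> enat t"
  by (rule pred_nonanticipating[OF tau_pred])

lemma tau_eq_nonanticipating:
  assumes "q \<in> {1..k}" "t < s" "\<omega> \<in> space unif_seq"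
  shows "\<tau> q (\<omega> (s := z)) = enat t \<longleftrightarrow> \<tau> q \<omega> = enat t"
proof -
  show ?thesis unfolding enat_eq_iff_le using tau_le_nonanticipating assms
    by (auto intro: less_trans)
qed

text \<open>
  Value of rank \<open>c\<close> as far as known at time \<open>t\<close>. The finite sum displays it as a function of the past, which
  \<open>\<omega> (the_enat (\<tau> (u c) \<omega>))\<close> would not.
\<close>
definition val :: "nat \<Rightarrow> (nat \<Rightarrow> real) \<Rightarrow> nat \<Rightarrow> real" where
  "val t \<omega> c = (if c = 0 then 0 else if c \<notin> {1..k} then 1
     else (\<Sum>r\<in>{1..t}. if \<tau> (u c) \<omega> = enat r then \<omega> r else 0))"

definition active :: "nat \<Rightarrow> nat \<Rightarrow> (nat \<Rightarrow> real) \<Rightarrow> bool" where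
  "active i t \<omega> \<longleftrightarrow> (i = 0 \<or> \<tau> i \<omega> \<le> enat t) \<and> \<not> \<tau> (Suc i) \<omega> \<le> enat t"

definition act :: "nat \<Rightarrow> nat \<Rightarrow> (nat \<Rightarrow> real) \<Rightarrow> ennreal" where
  "act i t \<omega> = (if active i t \<omega> then 1 else 0)"

lemma val_measurable: "(\<lambda>\<omega>. val t \<omega> c) \<in> borel_measurable unif_seq"
proof (cases "c \<in> {1..k}")
  case True
  have "(\<lambda>\<omega>. if \<tau> (u c) \<omega> = enat r then \<omega> r else 0) \<in> borel_measurable unif_seq" if "r \<in> {1..t}" for r
  proof -
    have [measurable]: "Measurable.pred unif_seq (\<lambda>\<omega>. \<tau> (u c) \<omega> = enat r)"
      using True that u_in[of c] by (intro tau_eq_pred) auto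
    have "(\<lambda>\<omega>. \<omega> r) \<in> borel_measurable unif_seq" using that by (intro coordinate_measurable) auto
    then show ?thesis by measurable
  qed
  then show ?thesis using True unfolding val_def by simp
next
  case False
  then have "val t \<omega> c = (if c = 0 then 0 else 1)" for \<omega> by (auto simp: val_def)
  then show ?thesis by simp
qed

lemma active_measurable: "i < k \<Longrightarrow> Measurable.pred unif_seq (active i t)"
proof -
  assume i: "i < k"
  have le: "Measurable.pred unif_seq (\<lambda>\<omega>. \<tau> q \<omega> \<le> enat t)" if "q \<in> {1..k}" for q
    by (rule pred_nat_filtration[OF tau_pred[OF that]])
  have "Measurable.pred unif_seq (\<lambda>\<omega>. i = 0 \<or> \<tau> i \<omega> \<le> enat t)"
    using i le[of i] by (cases "i = 0") auto
  moreover have "Measurable.pred unif_seq (\<lambda>\<omega>. \<tau> (Suc i) \<omega> \<le> enat t)"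
    using i by (intro le) auto
  ultimately show ?thesis
    unfolding pred_def active_def by (intro sets.sets_Collect_conj sets.sets_Collect_neg)
qed

lemma act_measurable:
  assumes "i < k" shows "act i t \<in> borel_measurable unif_seq"
proof -
  have [measurable]: "Measurable.pred unif_seq (active i t)" using assms by (rule active_measurable)
  show ?thesis unfolding act_def[abs_def] by measurable
qed

text \<open>
  Whether stage \<open>i\<close> is active at time \<open>t\<close>, and in which gap the next value has to fall, is determined by the
  observations up to time \<open>t\<close>; observation \<open>t + 1\<close> is fresh and saves \<open>1\<close> on average.
\<close>
lemma nn_integral_active:
  assumes i: "i < k"
  shows "(\<integral>\<^sup>+\<omega>. act i t \<omega> * saved i (val t \<omega>) (\<omega> (Suc t)) \<partial>unif_seq)
    = (\<integral>\<^sup>+\<omega>. act i t \<omega> \<partial>unif_seq)"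
proof -
  note act_measurable[OF i, measurable]
  have v1: "(\<lambda>p. val t (fst p) c) \<in> borel_measurable (unif_seq \<Otimes>\<^sub>M unif01)" for c
    by (rule measurable_compose[OF measurable_fst val_measurable])
  have a1: "(\<lambda>p. act i t (fst p)) \<in> borel_measurable (unif_seq \<Otimes>\<^sub>M unif01)"
    by (rule measurable_compose[OF measurable_fst act_measurable[OF i]])
  have s1: "(\<lambda>p. saved i (val t (fst p)) (snd p)) \<in> borel_measurable (unif_seq \<Otimes>\<^sub>M unif01)"
    by (rule saved_measurable[OF v1]) simp
  have "(\<integral>\<^sup>+\<omega>. act i t \<omega> * saved i (val t \<omega>) (\<omega> (Suc t)) \<partial>unif_seq)
    = (\<integral>\<^sup>+\<omega>. (\<integral>\<^sup>+x. act i t \<omega> * saved i (val t \<omega>) x \<partial>unif01) \<partial>unif_seq)"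
  proof (rule nn_integral_fresh_coordinate[where G="\<lambda>\<omega> x. act i t \<omega> * saved i (val t \<omega>) x"])
    show "(\<lambda>(\<omega>, x). act i t \<omega> * saved i (val t \<omega>) x)
      \<in> borel_measurable (unif_seq \<Otimes>\<^sub>M unif01)"
      using borel_measurable_times_ennreal[OF a1 s1] by (simp add: split_beta')
    fix \<omega> z x assume \<omega>: "\<omega> \<in> space unif_seq"
    have "active i t (\<omega> (Suc t := z)) = active i t \<omega>"
      unfolding active_def using i \<omega> tau_le_nonanticipating[of "Suc i" t "Suc t" \<omega> z]
        tau_le_nonanticipating[of i t "Suc t" \<omega> z] by (cases "i = 0") auto
    moreover have "val t (\<omega> (Suc t := z)) = val t \<omega>"
    proof
      fix c
      have "(if \<tau> (u c) (\<omega> (Suc t := z)) = enat r then (\<omega> (Suc t := z)) r else 0)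
        = (if \<tau> (u c) \<omega> = enat r then \<omega> r else 0)" if "r \<in> {1..t}" "c \<in> {1..k}" for r
        using that u_in[of c] \<omega> tau_eq_nonanticipating[of "u c" r "Suc t" \<omega> z] by auto
      then show "val t (\<omega> (Suc t := z)) c = val t \<omega> c"
        unfolding val_def by (auto intro!: sum.cong)
    qed
    ultimately show "act i t (\<omega> (Suc t := z)) * saved i (val t (\<omega> (Suc t := z))) x
      = act i t \<omega> * saved i (val t \<omega>) x"
      by (simp add: act_def)
  qed simp
  also have "\<dots> = (\<integral>\<^sup>+\<omega>. act i t \<omega> * (\<integral>\<^sup>+x. saved i (val t \<omega>) x \<partial>unif01) \<partial>unif_seq)"
    by (intro nn_integral_cong nn_integral_cmult saved_measurable) auto
  also have "\<dots> = (\<integral>\<^sup>+\<omega>. act i t \<omega> \<partial>unif_seq)"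
    using nn_integral_saved[OF i] by simp
  finally show ?thesis .
qed

text \<open>
  The time at which selection \<open>i + 1\<close> is made contributes at least the drop of its node, and all
  other times contribute nonnegative amounts. The drops add up to the value of the tree. In the second
  claim, the stages exclude each other, and some stage is active only before the last selection.
\<close>
lemma pathwise_lower:
  assumes fin: "\<forall>i\<in>{1..k}. 1 \<le> \<tau> i \<omega> \<and> \<tau> i \<omega> < \<infinity>"
    and smono: "strict_mono_on {1..k} (\<lambda>i. \<tau> i \<omega>)"
    and ord: "\<forall>i\<in>{1..k}. \<forall>j\<in>{1..k}. \<pi> i < \<pi> j \<longleftrightarrow> \<omega> (the_enat (\<tau> i \<omega>)) < \<omega> (the_enat (\<tau> j \<omega>))"
    and between: "\<forall>i\<ge>1. 0 < \<omega> i \<and> \<omega> i < 1"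
  shows "ennreal total \<le> (\<Sum>t. \<Sum>i<k. act i t \<omega> * saved i (val t \<omega>) (\<omega> (Suc t)))"
    "(\<Sum>i<k. act i t \<omega>) \<le> (if enat t < \<tau> k \<omega> then 1 else 0)"
proof -
  define T where "T i = the_enat (\<tau> i \<omega>)" for i
  have T: "\<tau> i \<omega> = enat (T i)" "1 \<le> T i" if "i \<in> {1..k}" for i
  proof -
    note f = bspec[OF fin that]
    have le: "1 \<le> \<tau> i \<omega>" by (rule conjunct1[OF f])
    have "\<tau> i \<omega> < \<infinity>" by (rule conjunct2[OF f])
    then obtain n where n: "\<tau> i \<omega> = enat n" by (cases "\<tau> i \<omega>") auto
    then show "\<tau> i \<omega> = enat (T i)" by (simp add: T_def)
    show "1 \<le> T i" using le by (simp add: T_def n one_enat_def)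
  qed
  have Tmono: "T i < T j" if "i \<in> {1..k}" "j \<in> {1..k}" "i < j" for i j
    using strict_mono_onD[OF smono that(1,2,3)] T that by simp
  have Tmono': "T i \<le> T j" if "i \<in> {1..k}" "j \<in> {1..k}" "i \<le> j" for i j
    using Tmono[of i j] that by (cases "i = j") (auto intro: less_imp_le)
  have pm: "\<pi> i \<in> {1..k}" if "i \<in> {1..k}" for i using that u_in[of "\<pi> i"] by simp
  define w where "w c = (if c = 0 then 0 else if c \<notin> {1..k} then 1 else \<omega> (T (u c)))" for c
  have w_mono: "w c < w d" if "c < d" "d \<le> k + 1" for c d
  proof -
    have in01: "0 < w y \<and> w y < 1" if "y \<in> {1..k}" for y
      using that u_in[of y] between T(2)[of "u y"] by (auto simp: w_def)
    have "c = 0 \<or> c \<in> {1..k}" "d = k + 1 \<or> d \<in> {1..k}" using that by auto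
    then consider "c = 0" "d = k + 1" | "c = 0" "d \<in> {1..k}" | "c \<in> {1..k}" "d = k + 1" | "c \<in> {1..k}" "d \<in> {1..k}"
      by blast
    then show ?thesis
    proof cases
      case 4
      then have "\<pi> (u c) < \<pi> (u d)" using that by simp
      then have "\<omega> (T (u c)) < \<omega> (T (u d))" using ord 4 u_in unfolding T_def by blast
      then show ?thesis using 4 by (auto simp: w_def)
    qed (use in01 in \<open>auto simp: w_def\<close>)
  qed
  have val: "val t \<omega> c = w c" if "c = 0 \<or> c = k + 1 \<or> c \<in> {1..k} \<and> T (u c) \<le> t" for c t
  proof (cases "c \<in> {1..k}")
    case True
    then have uc: "u c \<in> {1..k}" using u_in[of c] by blast
    have "(\<Sum>r\<in>{1..t}. if \<tau> (u c) \<omega> = enat r then \<omega> r else 0) = (\<Sum>r\<in>{1..t}. if r = T (u c) then \<omega> r else 0)"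
      using T[OF uc] by (intro sum.cong) auto
    also have "\<dots> = \<omega> (T (u c))" using that True T[OF uc] by (simp add: sum.delta)
    finally show ?thesis using True by (simp add: val_def w_def)
  qed (use that in \<open>auto simp: val_def w_def\<close>)
  have step: "ennreal (node_drop u 0 (k + 1) w (\<pi> (Suc i)))
     \<le> (\<Sum>t. act i t \<omega> * saved i (val t \<omega>) (\<omega> (Suc t)))" if i: "i < k" for i
  proof -
    define y t where "y = \<pi> (Suc i)" and "t = T (Suc i) - 1"
    have y: "y \<in> {1..k}" "u y = Suc i" using pi_in[OF i] by (auto simp: y_def)
    have St: "Suc t = T (Suc i)" using T(2)[of "Suc i"] i by (auto simp: t_def)
    note p = lo_hi[OF y(1)]
    have act: "active i t \<omega>"
      unfolding active_def using T(1)[of "Suc i"] T(1)[of i] Tmono[of i "Suc i"] i St by (cases "i = 0") auto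
    have Tle: "T (u c) \<le> t" if "c \<in> {1..k}" "u c < u y" for c
      using Tmono[of "u c" "Suc i"] that y u_in[of c] i St by auto
    have "val t \<omega> (lo y) = w (lo y)" "val t \<omega> (hi y) = w (hi y)"
      using p(4,5) Tle by (auto intro!: val)
    then have "saved i (val t \<omega>) (\<omega> (Suc t)) = saved (u y - 1) w (w y)"
      using y St by (simp add: saved_def y_def[symmetric] w_def)
    also have "\<dots> \<ge> ennreal (node_drop u 0 (k + 1) w y)"
    proof (rule saved_ge_node_drop[OF y(1)])
      show "w (lo y) < w y" "w y < w (hi y)" using p by (auto intro!: w_mono)
      show "0 \<le> w (lo y)" using w_mono[of 0 "lo y"] p by (cases "lo y = 0") (auto simp: w_def[of 0])
      show "w (hi y) \<le> 1" using w_mono[of "hi y" "k + 1"] p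
        by (cases "hi y = k + 1") (auto simp: w_def[of "k + 1"] w_def[of "Suc k"])
    qed
    finally have "ennreal (node_drop u 0 (k + 1) w y)
      \<le> (\<Sum>t\<in>{t}. act i t \<omega> * saved i (val t \<omega>) (\<omega> (Suc t)))"
      using act by (simp add: act_def)
    also have "\<dots> \<le> (\<Sum>t. act i t \<omega> * saved i (val t \<omega>) (\<omega> (Suc t)))"
      by (rule sum_le_suminf) auto
    finally show ?thesis by (simp add: y_def)
  qed
  have "total = (\<Sum>y\<in>{0<..<k + 1}. node_drop u 0 (k + 1) w y)"
    by (subst sum_node_drop[OF u_inj]) (use k in \<open>simp add: total_def w_def\<close>)
  also have "\<dots> = (\<Sum>i<k. node_drop u 0 (k + 1) w (\<pi> (Suc i)))"
  proof (rule sum.reindex_bij_betw[symmetric])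
    have uu: "Suc (u y - 1) = u y \<and> u y - 1 < k" if "y \<in> {1..k}" for y using u_in[of y] that by auto
    show "bij_betw (\<lambda>i. \<pi> (Suc i)) {..<k} {0<..<k + 1}"
      by (rule bij_betw_byWitness[where f'="\<lambda>y. u y - 1"])
         (use pi_in uu in \<open>auto simp: less_Suc_eq_le Suc_le_eq\<close>)
  qed
  finally have tot: "total = (\<Sum>i<k. node_drop u 0 (k + 1) w (\<pi> (Suc i)))" .
  have "ennreal total \<le> (\<Sum>i<k. ennreal (max 0 (node_drop u 0 (k + 1) w (\<pi> (Suc i)))))"
    unfolding tot by (subst sum_ennreal) (auto intro!: ennreal_leI sum_mono)
  also have "\<dots> = (\<Sum>i<k. ennreal (node_drop u 0 (k + 1) w (\<pi> (Suc i))))"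
    by (intro sum.cong) (auto simp: max_def ennreal_neg)
  also have "\<dots> \<le> (\<Sum>i<k. \<Sum>t. act i t \<omega> * saved i (val t \<omega>) (\<omega> (Suc t)))"
    by (intro sum_mono step) auto
  also have "\<dots> = (\<Sum>t. \<Sum>i<k. act i t \<omega> * saved i (val t \<omega>) (\<omega> (Suc t)))"
    by (rule suminf_sum[symmetric]) auto
  finally show "ennreal total \<le> (\<Sum>t. \<Sum>i<k. act i t \<omega> * saved i (val t \<omega>) (\<omega> (Suc t)))" .
  show "(\<Sum>i<k. act i t \<omega>) \<le> (if enat t < \<tau> k \<omega> then 1 else 0)"
  proof (cases "\<exists>i<k. active i t \<omega>")
    case True
    then obtain i where i: "i < k" "active i t \<omega>" by auto
    have TSi: "t < T (Suc i)" using i T(1)[of "Suc i"] by (auto simp: active_def)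
    have uniq: "i' = i" if "i' < k" "active i' t \<omega>" for i'
    proof (rule ccontr)
      assume "i' \<noteq> i"
      then consider "i' < i" | "i < i'" by linarith
      then show False
      proof cases
        case 1
        then have "T (Suc i') \<le> T i" using i by (intro Tmono') auto
        then show False using that i 1 T(1)[of "Suc i'"] T(1)[of i] by (auto simp: active_def)
      next
        case 2
        then have "T (Suc i) \<le> T i'" using that by (intro Tmono') auto
        then show False using that i 2 T(1)[of "Suc i"] T(1)[of i'] by (auto simp: active_def)
      qed
    qed
    have "(\<Sum>i'<k. act i' t \<omega>) = (\<Sum>i'<k. if i' = i then 1 else 0 :: ennreal)"
    proof (rule sum.cong[OF refl])
      fix i' assume i': "i' \<in> {..<k}"
      show "act i' t \<omega> = (if i' = i then 1 else 0)"
      proof (cases "active i' t \<omega>")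
        case True
        then have "i' = i" using uniq[of i'] i' by simp
        then show ?thesis using i by (simp add: act_def)
      next
        case False
        then show ?thesis using i by (auto simp: act_def)
      qed
    qed
    also have "\<dots> = 1" using i by simp
    finally have "(\<Sum>i<k. act i t \<omega>) = (1 :: ennreal)" .
    moreover have "enat t < \<tau> k \<omega>"
      using TSi Tmono'[of "Suc i" k] i T(1)[of k] k by auto
    ultimately show ?thesis by simp
  next
    case False
    then have "(\<Sum>i<k. act i t \<omega>) = (0 :: ennreal)" by (auto simp: act_def)
    then show ?thesis by simp
  qed
qed

text \<open>
  The expectation of \<open>\<tau> k\<close> is the sum of the probabilities of \<open>t < \<tau> k\<close>, that is, the expected number of
  active times, hence the expected total saving.
\<close>
theorem total_le: "ennreal total \<le> (\<integral>\<^sup>+\<omega>. ennreal_of_enat (\<tau> k \<omega>) \<partial>unif_seq)"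
proof -
  note [measurable] = val_measurable
  note [measurable] = act_measurable
  have [measurable]: "(\<lambda>\<omega>. \<omega> (Suc t)) \<in> borel_measurable unif_seq" for t by (rule coordinate_measurable) simp
  have tk: "k \<in> {1..k}" using k by simp
  have [measurable]: "Measurable.pred unif_seq (\<lambda>\<omega>. \<tau> k \<omega> \<le> enat t)" for t
    by (rule pred_nat_filtration[OF tau_pred[OF tk]])
  have good: "AE \<omega> in unif_seq. (\<forall>i\<in>{1..k}. 1 \<le> \<tau> i \<omega> \<and> \<tau> i \<omega> < \<infinity>) \<and>
        strict_mono_on {1..k} (\<lambda>i. \<tau> i \<omega>) \<and>
        (\<forall>i\<in>{1..k}. \<forall>j\<in>{1..k}.
           \<pi> i < \<pi> j \<longleftrightarrow> \<omega> (the_enat (\<tau> i \<omega>)) < \<omega> (the_enat (\<tau> j \<omega>)))"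
    using OA unfolding OA_def by auto
  have "ennreal total = (\<integral>\<^sup>+\<omega>. ennreal total \<partial>unif_seq)"
    by (simp add: unif_seq.emeasure_space_1)
  also have "\<dots> \<le> (\<integral>\<^sup>+\<omega>. (\<Sum>t. \<Sum>i<k. act i t \<omega> * saved i (val t \<omega>) (\<omega> (Suc t))) \<partial>unif_seq)"
    by (rule nn_integral_mono_AE) (use good AE_unif_seq_between in \<open>eventually_elim, intro pathwise_lower(1), auto\<close>)
  also have "\<dots> = (\<Sum>t. \<Sum>i<k. \<integral>\<^sup>+\<omega>. act i t \<omega> * saved i (val t \<omega>) (\<omega> (Suc t)) \<partial>unif_seq)"
    by (subst nn_integral_suminf, measurable, intro suminf_cong, subst nn_integral_sum) measurable
  also have "\<dots> = (\<Sum>t. \<Sum>i<k. \<integral>\<^sup>+\<omega>. act i t \<omega> \<partial>unif_seq)"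
    by (intro suminf_cong sum.cong nn_integral_active) auto
  also have "\<dots> = (\<Sum>t. \<integral>\<^sup>+\<omega>. (\<Sum>i<k. act i t \<omega>) \<partial>unif_seq)"
    by (intro suminf_cong nn_integral_sum[symmetric]) auto
  also have "\<dots> \<le> (\<Sum>t. emeasure unif_seq {\<omega> \<in> space unif_seq. enat t < \<tau> k \<omega>})"
  proof (intro suminf_le)
    fix t
    have "(\<integral>\<^sup>+\<omega>. (\<Sum>i<k. act i t \<omega>) \<partial>unif_seq)
      \<le> (\<integral>\<^sup>+\<omega>. indicator {\<omega> \<in> space unif_seq. enat t < \<tau> k \<omega>} \<omega> \<partial>unif_seq)"
    proof (rule nn_integral_mono_AE)
      show "AE \<omega> in unif_seq. (\<Sum>i<k. act i t \<omega>)
         \<le> (indicator {\<omega> \<in> space unif_seq. enat t < \<tau> k \<omega>} \<omega> :: ennreal)"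
        using good AE_unif_seq_between AE_space
      proof eventually_elim
        case (elim \<omega>)
        then have "(\<Sum>i<k. act i t \<omega>) \<le> (if enat t < \<tau> k \<omega> then 1 else 0)"
          by (intro pathwise_lower(2)) auto
        also have "\<dots> = indicator {\<omega> \<in> space unif_seq. enat t < \<tau> k \<omega>} \<omega>"
          using elim by (simp add: indicator_def)
        finally show ?case .
      qed
    qed
    also have "\<dots> = emeasure unif_seq {\<omega> \<in> space unif_seq. enat t < \<tau> k \<omega>}"
      by (rule nn_integral_indicator) (simp add: not_le[symmetric])
    finally show "(\<integral>\<^sup>+\<omega>. (\<Sum>i<k. act i t \<omega>) \<partial>unif_seq)
      \<le> emeasure unif_seq {\<omega> \<in> space unif_seq. enat t < \<tau> k \<omega>}" .
  qed auto
  also have "\<dots> = (\<integral>\<^sup>+\<omega>. ennreal_of_enat (\<tau> k \<omega>) \<partial>unif_seq)"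
    by (rule nn_integral_enat_function[symmetric]) (rule enat_measurable_if_le, measurable)
  finally show ?thesis .
qed

end

end

context pattern
begin

section \<open>The profitable strategy attains the squared tree cost\<close>

text \<open>
  Refusing exactly the values with nonpositive drop makes savings and drops agree.
\<close>
definition accept :: "nat \<Rightarrow> (nat \<Rightarrow> real) \<Rightarrow> real \<Rightarrow> bool" where
  "accept i v x \<longleftrightarrow> (let y = \<pi> (Suc i); l = v (lo y); r = v (hi y) in
     l < x \<and> x < r \<and> 0 < V y / (r - l) - A y / (x - l) - B y / (r - x))"

text \<open>
  The number of selections up to time \<open>t\<close> and the values given to the ranks. Unselected
  ranks hold the dummy value \<open>1\<close>; the convention \<open>0\<close> at the lower end and \<open>1\<close> at the upper end is the initial gap.
\<close>
fun state :: "nat \<Rightarrow> (nat \<Rightarrow> real) \<Rightarrow> nat \<times> (nat \<Rightarrow> real)" where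
  "state 0 \<omega> = (0, \<lambda>c. if c = 0 then 0 else 1)"
| "state (Suc t) \<omega> = (let n = fst (state t \<omega>); v = snd (state t \<omega>) in
     if n < k \<and> accept n v (\<omega> (Suc t)) then (Suc n, v(\<pi> (Suc n) := \<omega> (Suc t))) else (n, v))"

abbreviation "cnt t \<omega> \<equiv> fst (state t \<omega>)"
abbreviation "vals t \<omega> \<equiv> snd (state t \<omega>)"

definition taken :: "nat \<Rightarrow> (nat \<Rightarrow> real) \<Rightarrow> bool" where
  "taken t \<omega> \<longleftrightarrow> cnt t \<omega> < k \<and> accept (cnt t \<omega>) (vals t \<omega>) (\<omega> (Suc t))"

lemma cnt_Suc: "cnt (Suc t) \<omega> = (if taken t \<omega> then Suc (cnt t \<omega>) else cnt t \<omega>)"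
  by (simp add: taken_def Let_def)

lemma vals_Suc: "vals (Suc t) \<omega> = (if taken t \<omega> then (vals t \<omega>)(\<pi> (Suc (cnt t \<omega>)) := \<omega> (Suc t)) else vals t \<omega>)"
  by (simp add: taken_def Let_def)

declare state.simps(2) [simp del]

lemma cnt_mono: "s \<le> t \<Longrightarrow> cnt s \<omega> \<le> cnt t \<omega>"
  by (rule lift_Suc_mono_le[of "\<lambda>t. cnt t \<omega>"]) (auto simp: cnt_Suc)

lemma state_nonanticipating: "t < s \<Longrightarrow> state t (\<omega> (s := z)) = state t \<omega>"
  by (induction t) (auto simp: state.simps(2) Let_def)

lemma state_measurable:
  assumes "\<And>i. 1 \<le> i \<Longrightarrow> i \<le> t \<Longrightarrow> (\<lambda>\<omega>. \<omega> i) \<in> borel_measurable F"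
  shows "(\<lambda>\<omega>. cnt t \<omega>) \<in> measurable F (count_space UNIV) \<and> (\<forall>c. (\<lambda>\<omega>. vals t \<omega> c) \<in> borel_measurable F)"
  using assms
proof (induction t)
  case 0
  then show ?case by simp
next
  case (Suc t)
  have IH: "(\<lambda>\<omega>. cnt t \<omega>) \<in> measurable F (count_space UNIV)" "\<And>c. (\<lambda>\<omega>. vals t \<omega> c) \<in> borel_measurable F"
    using Suc by auto
  have x: "(\<lambda>\<omega>. \<omega> (Suc t)) \<in> borel_measurable F" using Suc.prems[of "Suc t"] by simp
  have acc: "Measurable.pred F (\<lambda>\<omega>. accept i (vals t \<omega>) (\<omega> (Suc t)))" for i
  proof -
    note [measurable] = IH(2)[of "lo (\<pi> (Suc i))"] IH(2)[of "hi (\<pi> (Suc i))"] x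
    show ?thesis unfolding accept_def Let_def by measurable
  qed
  have eqn: "Measurable.pred F (\<lambda>\<omega>. cnt t \<omega> = i)" for i
    by (rule measurable_compose[OF IH(1)]) simp
  have at: "Measurable.pred F (\<lambda>\<omega>. cnt t \<omega> = i \<and> accept i (vals t \<omega>) (\<omega> (Suc t)))" for i
    using eqn[of i] acc[of i] by (rule pred_intros_logic)
  have taken_eq: "taken t \<omega> \<longleftrightarrow> (\<exists>i\<in>{..<k}. cnt t \<omega> = i \<and> accept i (vals t \<omega>) (\<omega> (Suc t)))" for \<omega>
    by (auto simp: taken_def)
  have taken: "Measurable.pred F (\<lambda>\<omega>. taken t \<omega>)"
    unfolding taken_eq by (intro pred_intros_finite at) auto
  have "(\<lambda>\<omega>. Suc (cnt t \<omega>)) \<in> measurable F (count_space UNIV)"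
    by (rule measurable_compose[OF IH(1)]) simp
  then have 1: "(\<lambda>\<omega>. cnt (Suc t) \<omega>) \<in> measurable F (count_space UNIV)"
    unfolding cnt_Suc using IH(1) taken by (intro measurable_If) (auto simp: pred_def)
  have 2: "(\<lambda>\<omega>. vals (Suc t) \<omega> c) \<in> borel_measurable F" for c
  proof -
    have put_eq: "(taken t \<omega> \<and> \<pi> (Suc (cnt t \<omega>)) = c)
      \<longleftrightarrow> (\<exists>i\<in>{i. i < k \<and> \<pi> (Suc i) = c}. cnt t \<omega> = i \<and> accept i (vals t \<omega>) (\<omega> (Suc t)))" for \<omega>
      by (auto simp: taken_def)
    have put: "Measurable.pred F (\<lambda>\<omega>. taken t \<omega> \<and> \<pi> (Suc (cnt t \<omega>)) = c)"
      unfolding put_eq by (intro pred_intros_finite at) auto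
    have eq: "vals (Suc t) \<omega> c = (if taken t \<omega> \<and> \<pi> (Suc (cnt t \<omega>)) = c then \<omega> (Suc t) else vals t \<omega> c)" for \<omega>
      by (auto simp: vals_Suc)
    show ?thesis unfolding eq using put x IH(2)[of c] by (intro measurable_If) (auto simp: pred_def)
  qed
  show ?case using 1 2 by auto
qed

lemma cnt_measurable_seq: "(\<lambda>\<omega>. cnt t \<omega>) \<in> measurable unif_seq (count_space UNIV)"
  and vals_measurable_seq: "(\<lambda>\<omega>. vals t \<omega> c) \<in> borel_measurable unif_seq"
  using state_measurable[of t unif_seq] coordinate_measurable by auto

text \<open>
  The strategy keeps the selected values in the order of their ranks, for every outcome. A new value
  lies strictly between those of the neighbouring known ranks.
\<close>
lemma vals_mono:
  "known (cnt t \<omega>) c \<Longrightarrow> known (cnt t \<omega>) d \<Longrightarrow> c < d \<Longrightarrow> vals t \<omega> c < vals t \<omega> d"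
proof (induction t arbitrary: c d)
  case 0
  have no: "0 < u y" if "y \<in> {1..k}" for y using u_in[of y] that by auto
  have "c = 0" "d = k + 1" using 0 no[of c] no[of d] by (auto simp: known_def)
  then show ?case by simp
next
  case (Suc t)
  show ?case
  proof (cases "taken t \<omega>")
    case False
    then show ?thesis using Suc by (simp add: cnt_Suc vals_Suc)
  next
    case True
    define n where "n = cnt t \<omega>"
    define y where "y = \<pi> (Suc n)"
    have n: "n < k" using True by (simp add: taken_def n_def)
    have y: "y \<in> {1..k}" "u y = Suc n" using pi_in[OF n] by (auto simp: y_def)
    note p = lo_hi[OF y(1)]
    have acc: "vals t \<omega> (lo y) < \<omega> (Suc t)" "\<omega> (Suc t) < vals t \<omega> (hi y)"
      using True by (auto simp: taken_def accept_def Let_def n_def y_def)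
    have kn: "known n e" if "known (Suc n) e" "e \<noteq> y" for e
    proof -
      have "u e = Suc n \<Longrightarrow> e = y" unfolding y_def by (metis pi_u)
      then show ?thesis using that by (auto simp: known_def le_Suc_eq)
    qed
    have klh: "known n (lo y)" "known n (hi y)" using known_lo_hi[OF y(1), of n] y by auto
    have v: "vals (Suc t) \<omega> = (vals t \<omega>)(y := \<omega> (Suc t))" "cnt (Suc t) \<omega> = Suc n"
      using True by (simp_all add: vals_Suc cnt_Suc y_def n_def)
    have IH: "known n c \<Longrightarrow> known n d \<Longrightarrow> c < d \<Longrightarrow> vals t \<omega> c < vals t \<omega> d" for c d
      using Suc.IH unfolding n_def by blast
    have IH': "vals t \<omega> c \<le> vals t \<omega> d" if "known n c" "known n d" "c \<le> d" for c d
      using IH[of c d] that by (cases "c = d") auto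
    consider "c = y" | "d = y" | "c \<noteq> y" "d \<noteq> y" by blast
    then show ?thesis
    proof cases
      case 1
      then have dy: "d \<noteq> y" "known n d" using Suc.prems kn v(2) by auto
      then have "hi y \<le> d" using p(7)[of d] Suc.prems 1 y by auto
      then have "vals t \<omega> (hi y) \<le> vals t \<omega> d" using klh dy by (intro IH') auto
      then show ?thesis using acc 1 dy v by simp
    next
      case 2
      then have cy: "c \<noteq> y" "known n c" using Suc.prems kn v(2) by auto
      then have "c \<le> lo y" using p(6)[of c] Suc.prems 2 y by auto
      then have "vals t \<omega> c \<le> vals t \<omega> (lo y)" using klh cy by (intro IH') auto
      then show ?thesis using acc 2 cy v by simp
    next
      case 3
      then show ?thesis using IH kn Suc.prems v by simp
    qed
  qed
qed

lemma vals_ends: "vals t \<omega> 0 = 0" "vals t \<omega> (k + 1) = 1"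
proof (induction t)
  case (Suc t)
  have "cnt t \<omega> < k \<Longrightarrow> \<pi> (Suc (cnt t \<omega>)) \<in> {1..k}" by (rule pi_in)
  {
    case 1
    show ?case using Suc \<open>cnt t \<omega> < k \<Longrightarrow> \<pi> (Suc (cnt t \<omega>)) \<in> {1..k}\<close> by (auto simp: vals_Suc taken_def)
  next
    case 2
    show ?case using Suc \<open>cnt t \<omega> < k \<Longrightarrow> \<pi> (Suc (cnt t \<omega>)) \<in> {1..k}\<close> by (auto simp: vals_Suc taken_def)
  }
qed auto

definition gained :: "nat \<Rightarrow> (nat \<Rightarrow> real) \<Rightarrow> ennreal" where
  "gained t \<omega> = (if cnt t \<omega> < k then saved (cnt t \<omega>) (vals t \<omega>) (\<omega> (Suc t)) else 0)"

text \<open>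
  Along this strategy the gap is always valid, so the default value of \<^const>\<open>saving\<close> never occurs.
\<close>
lemma gained_valid:
  assumes "cnt t \<omega> < k"
  defines "y \<equiv> \<pi> (Suc (cnt t \<omega>))"
  shows "0 \<le> vals t \<omega> (lo y)" "vals t \<omega> (lo y) < vals t \<omega> (hi y)" "vals t \<omega> (hi y) \<le> 1"
proof -
  have y: "y \<in> {1..k}" "u y = Suc (cnt t \<omega>)" using pi_in[OF assms(1)] by (auto simp: y_def)
  note p = lo_hi[OF y(1)]
  have k: "known (cnt t \<omega>) (lo y)" "known (cnt t \<omega>) (hi y)" using known_lo_hi[OF y(1), of "cnt t \<omega>"] y by auto
  have k0: "known (cnt t \<omega>) 0" "known (cnt t \<omega>) (k + 1)" by (auto simp: known_def)
  show "vals t \<omega> (lo y) < vals t \<omega> (hi y)" using p k by (intro vals_mono) auto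
  show "0 \<le> vals t \<omega> (lo y)"
    using vals_mono[OF k0(1) k(1)] vals_ends(1)[of t \<omega>] by (cases "lo y = 0") auto
  show "vals t \<omega> (hi y) \<le> 1"
    using vals_mono[OF k(2) k0(2)] vals_ends(2)[of t \<omega>] p by (cases "hi y = k + 1") auto
qed

text \<open>
  The savings are the drops: a refused value saves nothing, because it was unprofitable, and an accepted one saves exactly the
  drop. Later selections do not change the drops of earlier nodes.
\<close>
lemma sum_gained:
  defines "D \<equiv> \<lambda>t \<omega>. \<Sum>y\<in>{0<..<k + 1} \<inter> {y. u y \<le> cnt t \<omega>}. node_drop u 0 (k + 1) (vals t \<omega>) y"
  shows "0 \<le> D t \<omega> \<and> (\<Sum>s<t. gained s \<omega>) = ennreal (D t \<omega>)"
proof (induction t)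
  case 0
  have no: "0 < u y" if "y \<in> {1..k}" for y using u_in[of y] that by auto
  have "{0<..<k + 1} \<inter> {y. u y \<le> 0} = {}"
  proof (rule ccontr)
    assume "{0<..<k + 1} \<inter> {y. u y \<le> 0} \<noteq> {}"
    then obtain y where "0 < y" "y < k + 1" "u y = 0" by auto
    then show False using no[of y] by simp
  qed
  then show ?case by (simp add: D_def)
next
  case (Suc t)
  show ?case
  proof (cases "taken t \<omega>")
    case False
    have "gained t \<omega> = 0"
    proof (cases "cnt t \<omega> < k")
      case True
      then have "\<not> accept (cnt t \<omega>) (vals t \<omega>) (\<omega> (Suc t))" using False by (simp add: taken_def)
      then show ?thesis using gained_valid[OF True]
        by (auto simp: gained_def saved_def saving_def accept_def Let_def ennreal_neg indicator_def)
    qed (simp add: gained_def)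
    then show ?thesis using Suc False by (simp add: D_def cnt_Suc vals_Suc)
  next
    case True
    define n where "n = cnt t \<omega>"
    define y where "y = \<pi> (Suc n)"
    have n: "n < k" using True by (simp add: taken_def n_def)
    have y: "y \<in> {1..k}" "u y = Suc n" using pi_in[OF n] by (auto simp: y_def)
    note p = lo_hi[OF y(1)]
    have v: "vals (Suc t) \<omega> = (vals t \<omega>)(y := \<omega> (Suc t))" "cnt (Suc t) \<omega> = Suc n"
      using True by (simp_all add: vals_Suc cnt_Suc y_def n_def)
    have acc: "accept n (vals t \<omega>) (\<omega> (Suc t))" using True by (simp add: taken_def n_def)
    have set: "{0<..<k + 1} \<inter> {z. u z \<le> Suc n} = insert y ({0<..<k + 1} \<inter> {z. u z \<le> n})"
    proof -
      have "u z = Suc n \<longleftrightarrow> z = y" for z unfolding y_def by (metis pi_u u_pi)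
      then show ?thesis using y by (auto simp: le_Suc_eq)
    qed
    have same: "node_drop u 0 (k + 1) (vals (Suc t) \<omega>) z = node_drop u 0 (k + 1) (vals t \<omega>) z"
      if z: "z \<in> {0<..<k + 1} \<inter> {z. u z \<le> n}" for z
    proof -
      have z1: "z \<in> {1..k}" "u z \<le> n" using z by auto
      note q = lo_hi[OF z1(1)]
      have "z \<noteq> y" "lo z \<noteq> y" "hi z \<noteq> y" using q(4,5) z1 y by auto
      then show ?thesis unfolding node_drop_eq v by simp
    qed
    have new: "node_drop u 0 (k + 1) (vals (Suc t) \<omega>) y
      = V y / (vals t \<omega> (hi y) - vals t \<omega> (lo y)) - A y / (\<omega> (Suc t) - vals t \<omega> (lo y)) - B y / (vals t \<omega> (hi y) - \<omega> (Suc t))"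
      unfolding node_drop_eq v using p by simp
    have g: "gained t \<omega> = ennreal (node_drop u 0 (k + 1) (vals (Suc t) \<omega>) y)"
      "0 \<le> node_drop u 0 (k + 1) (vals (Suc t) \<omega>) y"
      unfolding new using n gained_valid[of t \<omega>] acc
      by (auto simp: gained_def saved_def saving_def accept_def Let_def n_def[symmetric] y_def[symmetric])
    have "D (Suc t) \<omega> = node_drop u 0 (k + 1) (vals (Suc t) \<omega>) y + D t \<omega>"
      unfolding D_def v(2) set
      by (subst sum.insert) (use y same in \<open>auto simp: n_def[symmetric] intro!: sum.cong\<close>)
    then show ?thesis using Suc g by (simp add: add.commute ennreal_plus)
  qed
qed

lemma sum_gained_le: "(\<Sum>s<t. gained s \<omega>) \<le> ennreal total"
proof -
  have "(\<Sum>y\<in>{0<..<k + 1} \<inter> {y. u y \<le> cnt t \<omega>}. node_drop u 0 (k + 1) (vals t \<omega>) y)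
     \<le> (tree_cost u 0 (k + 1))\<^sup>2 / (vals t \<omega> (k + 1) - vals t \<omega> 0)"
  proof (rule sum_node_drop_prefix_le[OF u_inj])
    fix l l' assume a: "l < l'" "l \<in> {y. u y \<le> cnt t \<omega>} \<or> l = 0" "l' \<in> {y. u y \<le> cnt t \<omega>} \<or> l' = k + 1"
      "0 \<le> l" "l' \<le> k + 1"
    then have "known (cnt t \<omega>) l" "known (cnt t \<omega>) l'" by (auto simp: known_def)
    then show "vals t \<omega> l < vals t \<omega> l'" using a by (intro vals_mono)
  qed auto
  also have "\<dots> = total" unfolding vals_ends total_def by simp
  finally show ?thesis using sum_gained[of t \<omega>] by (auto intro: ennreal_leI)
qed

definition at_stage :: "nat \<Rightarrow> nat \<Rightarrow> (nat \<Rightarrow> real) \<Rightarrow> ennreal" where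
  "at_stage t i \<omega> = (if cnt t \<omega> = i then 1 else 0)"

lemma at_stage_measurable: "at_stage t i \<in> borel_measurable unif_seq"
proof -
  have "Measurable.pred unif_seq (\<lambda>\<omega>. cnt t \<omega> = i)" by (rule measurable_compose[OF cnt_measurable_seq]) simp
  then show ?thesis unfolding at_stage_def[abs_def] by (intro measurable_If) (auto simp: pred_def)
qed

lemma gained_eq: "gained t \<omega> = (\<Sum>i<k. at_stage t i \<omega> * saved i (vals t \<omega>) (\<omega> (Suc t)))"
proof (cases "cnt t \<omega> < k")
  case True
  have "(\<Sum>i<k. at_stage t i \<omega> * saved i (vals t \<omega>) (\<omega> (Suc t)))
    = (\<Sum>i<k. if i = cnt t \<omega> then saved i (vals t \<omega>) (\<omega> (Suc t)) else 0)"
    by (intro sum.cong) (auto simp: at_stage_def)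
  then show ?thesis using True by (simp add: gained_def)
qed (auto simp: gained_def at_stage_def intro!: sum.neutral)

lemma gained_measurable: "gained t \<in> borel_measurable unif_seq"
  unfolding gained_eq[abs_def]
  by (intro borel_measurable_sum borel_measurable_times_ennreal at_stage_measurable saved_measurable
      vals_measurable_seq coordinate_measurable) auto

text \<open>
  As long as selections remain to be made, the next observation is fresh and saves \<open>1\<close> on average.
\<close>
lemma nn_integral_gained: "(\<integral>\<^sup>+\<omega>. gained t \<omega> \<partial>unif_seq) = emeasure unif_seq {\<omega> \<in> space unif_seq. cnt t \<omega> < k}"
proof -
  let ?G = "\<lambda>\<omega> x. \<Sum>i<k. at_stage t i \<omega> * saved i (vals t \<omega>) x"
  have v1: "(\<lambda>p. vals t (fst p) c) \<in> borel_measurable (unif_seq \<Otimes>\<^sub>M unif01)" for c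
    by (rule measurable_compose[OF measurable_fst vals_measurable_seq])
  have s1: "(\<lambda>p. saved i (vals t (fst p)) (snd p)) \<in> borel_measurable (unif_seq \<Otimes>\<^sub>M unif01)" for i
    by (rule saved_measurable[OF v1]) simp
  have c1: "(\<lambda>p. at_stage t i (fst p)) \<in> borel_measurable (unif_seq \<Otimes>\<^sub>M unif01)" for i
    by (rule measurable_compose[OF measurable_fst at_stage_measurable])
  have sx: "(\<lambda>x. saved i v x) \<in> borel_measurable unif01" for i v
    by (rule saved_measurable) auto
  have "(\<integral>\<^sup>+\<omega>. gained t \<omega> \<partial>unif_seq) = (\<integral>\<^sup>+\<omega>. ?G \<omega> (\<omega> (Suc t)) \<partial>unif_seq)"
    unfolding gained_eq by simp
  also have "\<dots> = (\<integral>\<^sup>+\<omega>. (\<integral>\<^sup>+x. ?G \<omega> x \<partial>unif01) \<partial>unif_seq)"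
  proof (rule nn_integral_fresh_coordinate[where G="?G"])
    show "(\<lambda>(\<omega>, x). ?G \<omega> x) \<in> borel_measurable (unif_seq \<Otimes>\<^sub>M unif01)"
      unfolding split_beta' by (intro borel_measurable_sum borel_measurable_times_ennreal c1 s1)
    show "?G (\<omega> (Suc t := z)) x = ?G \<omega> x" for \<omega> z x
      by (simp add: state_nonanticipating at_stage_def)
  qed simp
  also have "\<dots> = (\<integral>\<^sup>+\<omega>. (\<Sum>i<k. at_stage t i \<omega>) \<partial>unif_seq)"
    by (intro nn_integral_cong, subst nn_integral_sum)
       (auto intro!: sum.cong borel_measurable_times_ennreal sx simp: nn_integral_cmult[OF sx] nn_integral_saved)
  also have "\<dots> = (\<integral>\<^sup>+\<omega>. indicator {\<omega> \<in> space unif_seq. cnt t \<omega> < k} \<omega> \<partial>unif_seq)"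
  proof (intro nn_integral_cong)
    fix \<omega> assume "\<omega> \<in> space unif_seq"
    then show "(\<Sum>i<k. at_stage t i \<omega>) = indicator {\<omega> \<in> space unif_seq. cnt t \<omega> < k} \<omega>"
      by (auto simp: indicator_def at_stage_def intro!: sum.neutral)
  qed
  also have "\<dots> = emeasure unif_seq {\<omega> \<in> space unif_seq. cnt t \<omega> < k}"
  proof (rule nn_integral_indicator)
    have "Measurable.pred unif_seq (\<lambda>\<omega>. cnt t \<omega> < k)" by (rule measurable_compose[OF cnt_measurable_seq]) simp
    then show "{\<omega> \<in> space unif_seq. cnt t \<omega> < k} \<in> sets unif_seq" by (simp add: pred_def)
  qed
  finally show ?thesis .
qed

text \<open>
  The time of selection \<open>i\<close>. It may be infinite; that this has probability zero follows from
  the bound on the expectation.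
\<close>
definition opt :: "nat \<Rightarrow> (nat \<Rightarrow> real) \<Rightarrow> enat" where
  "opt i \<omega> = (if \<exists>t. i \<le> cnt t \<omega> then enat (LEAST t. i \<le> cnt t \<omega>) else \<infinity>)"

lemma opt_le_iff: "opt i \<omega> \<le> enat t \<longleftrightarrow> i \<le> cnt t \<omega>"
proof (cases "\<exists>t. i \<le> cnt t \<omega>")
  case True
  define L where "L = (LEAST t. i \<le> cnt t \<omega>)"
  have L: "i \<le> cnt L \<omega>" unfolding L_def using True by (rule LeastI_ex)
  have "L \<le> t \<longleftrightarrow> i \<le> cnt t \<omega>"
  proof
    assume "L \<le> t" then show "i \<le> cnt t \<omega>" using L cnt_mono[of L t \<omega>] by linarith
  next
    assume "i \<le> cnt t \<omega>" then show "L \<le> t" unfolding L_def by (rule Least_le)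
  qed
  then show ?thesis using True by (simp add: opt_def L_def)
qed (auto simp: opt_def)

lemma opt_stopping: "stopping_time nat_filtration (opt i)"
  unfolding stopping_time_def
proof
  fix t :: enat
  show "Measurable.pred (nat_filtration t) (\<lambda>\<omega>. opt i \<omega> \<le> t)"
  proof (cases t)
    case (enat m)
    have "(\<lambda>\<omega>. cnt m \<omega>) \<in> measurable (nat_filtration (enat m)) (count_space UNIV)"
      using state_measurable[of m "nat_filtration (enat m)"] coordinate_measurable_nat_filtration by auto
    then have "Measurable.pred (nat_filtration (enat m)) (\<lambda>\<omega>. i \<le> cnt m \<omega>)"
      by (rule measurable_compose) simp
    then show ?thesis unfolding enat opt_le_iff .
  qed simp
qed

text \<open>
  Summing the savings up to a finite time avoids any prior knowledge that the strategy
  terminates.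
\<close>
lemma nn_integral_opt_le: "(\<integral>\<^sup>+\<omega>. ennreal_of_enat (opt k \<omega>) \<partial>unif_seq) \<le> ennreal total"
proof -
  have pred: "Measurable.pred unif_seq (\<lambda>\<omega>. opt k \<omega> \<le> enat t)" for t
    by (rule pred_nat_filtration[OF stopping_timeD[OF opt_stopping]])
  have "(\<integral>\<^sup>+\<omega>. ennreal_of_enat (opt k \<omega>) \<partial>unif_seq) = (\<Sum>t. emeasure unif_seq {\<omega> \<in> space unif_seq. enat t < opt k \<omega>})"
    by (rule nn_integral_enat_function[OF enat_measurable_if_le[OF pred]])
  also have "\<dots> = (\<Sum>t. \<integral>\<^sup>+\<omega>. gained t \<omega> \<partial>unif_seq)"
    unfolding nn_integral_gained by (simp add: not_le[symmetric] opt_le_iff)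
  also have "\<dots> \<le> ennreal total"
  proof (rule suminf_le_const)
    fix n
    have "(\<Sum>t<n. \<integral>\<^sup>+\<omega>. gained t \<omega> \<partial>unif_seq) = (\<integral>\<^sup>+\<omega>. (\<Sum>t<n. gained t \<omega>) \<partial>unif_seq)"
      by (intro nn_integral_sum[symmetric] gained_measurable)
    also have "\<dots> \<le> (\<integral>\<^sup>+\<omega>. ennreal total \<partial>unif_seq)"
      by (intro nn_integral_mono sum_gained_le)
    also have "\<dots> = ennreal total" by (simp add: unif_seq.emeasure_space_1)
    finally show "(\<Sum>t<n. \<integral>\<^sup>+\<omega>. gained t \<omega> \<partial>unif_seq) \<le> ennreal total" .
  qed simp
  finally show ?thesis .
qed

lemma vals_eq_opt: "y \<in> {1..k} \<Longrightarrow> u y \<le> cnt t \<omega> \<Longrightarrow> vals t \<omega> y = \<omega> (the_enat (opt (u y) \<omega>))"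
proof (induction t)
  case 0
  then show ?case using u_in[of y] by auto
next
  case (Suc t)
  show ?case
  proof (cases "u y \<le> cnt t \<omega>")
    case True
    then have "y \<noteq> \<pi> (Suc (cnt t \<omega>))" by auto
    then show ?thesis using Suc True by (simp add: vals_Suc)
  next
    case False
    then have t: "taken t \<omega>" "u y = Suc (cnt t \<omega>)" using Suc.prems by (auto simp: cnt_Suc split: if_splits)
    have "opt (u y) \<omega> \<le> enat (Suc t)" "\<not> opt (u y) \<omega> \<le> enat t"
      using Suc.prems False by (simp_all only: opt_le_iff) simp
    then have "opt (u y) \<omega> = enat (Suc t)" by (cases "opt (u y) \<omega>") auto
    moreover have "y = \<pi> (Suc (cnt t \<omega>))" using t(2) by (metis pi_u)
    ultimately show ?thesis using t by (simp add: vals_Suc)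
  qed
qed

lemma opt_in_OA: "opt \<in> OA k \<pi>"
proof -
  have pred: "Measurable.pred unif_seq (\<lambda>\<omega>. opt k \<omega> \<le> enat t)" for t
    by (rule pred_nat_filtration[OF stopping_timeD[OF opt_stopping]])
  have "AE \<omega> in unif_seq. ennreal_of_enat (opt k \<omega>) \<noteq> \<infinity>"
  proof (rule nn_integral_PInf_AE)
    show "(\<lambda>\<omega>. ennreal_of_enat (opt k \<omega>)) \<in> borel_measurable unif_seq"
      by (rule measurable_compose[OF enat_measurable_if_le[OF pred]]) simp
    show "(\<integral>\<^sup>+\<omega>. ennreal_of_enat (opt k \<omega>) \<partial>unif_seq) \<noteq> \<infinity>"
      using nn_integral_opt_le by (auto simp: top_unique)
  qed
  then have "AE \<omega> in unif_seq.
        (\<forall>i\<in>{1..k}. 1 \<le> opt i \<omega> \<and> opt i \<omega> < \<infinity>) \<and>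
        strict_mono_on {1..k} (\<lambda>i. opt i \<omega>) \<and>
        (\<forall>i\<in>{1..k}. \<forall>j\<in>{1..k}.
           \<pi> i < \<pi> j \<longleftrightarrow> \<omega> (the_enat (opt i \<omega>)) < \<omega> (the_enat (opt j \<omega>)))"
  proof eventually_elim
    case (elim \<omega>)
    then obtain T where T: "opt k \<omega> = enat T" by (cases "opt k \<omega>") auto
    then have kT: "k \<le> cnt T \<omega>" using opt_le_iff[of k \<omega> T] by simp
    have fin: "opt i \<omega> \<le> enat T" if "i \<le> k" for i using kT that by (simp add: opt_le_iff)
    have ge1: "1 \<le> opt i \<omega>" if "1 \<le> i" for i
    proof -
      have "\<not> opt i \<omega> \<le> enat 0" using that by (simp only: opt_le_iff) simp
      then show ?thesis by (cases "opt i \<omega>") (auto simp: one_enat_def)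
    qed
    have less: "opt i \<omega> < opt j \<omega>" if "1 \<le> i" "i < j" "j \<le> k" for i j
    proof -
      have "opt j \<omega> \<le> enat T" using that by (intro fin) auto
      then obtain s where s: "opt j \<omega> = enat s" by (cases "opt j \<omega>") auto
      have "s \<noteq> 0" using ge1[of j] s that by (auto simp: one_enat_def)
      then obtain s' where s': "s = Suc s'" by (cases s) auto
      have "j \<le> cnt (Suc s') \<omega>" "\<not> j \<le> cnt s' \<omega>"
        using s s' opt_le_iff[of j \<omega> "Suc s'"] opt_le_iff[of j \<omega> s'] by auto
      then have "i \<le> cnt s' \<omega>" using that by (auto simp: cnt_Suc split: if_splits)
      then have "opt i \<omega> \<le> enat s'" by (simp add: opt_le_iff)
      then show ?thesis using s s' by (cases "opt i \<omega>") auto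
    qed
    have val: "vals T \<omega> (\<pi> i) = \<omega> (the_enat (opt i \<omega>))" "known (cnt T \<omega>) (\<pi> i)" if "i \<in> {1..k}" for i
      using vals_eq_opt[of "\<pi> i" T \<omega>] kT that u_in[of "\<pi> i"] by (auto simp: known_def)
    have mono: "\<omega> (the_enat (opt i \<omega>)) < \<omega> (the_enat (opt j \<omega>))"
      if "i \<in> {1..k}" "j \<in> {1..k}" "\<pi> i < \<pi> j" for i j
      using vals_mono[OF val(2)[OF that(1)] val(2)[OF that(2)] that(3)] val(1)[OF that(1)] val(1)[OF that(2)] by simp
    have "\<pi> i < \<pi> j \<longleftrightarrow> \<omega> (the_enat (opt i \<omega>)) < \<omega> (the_enat (opt j \<omega>))"
      if "i \<in> {1..k}" "j \<in> {1..k}" for i j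
    proof
      assume a: "\<omega> (the_enat (opt i \<omega>)) < \<omega> (the_enat (opt j \<omega>))"
      show "\<pi> i < \<pi> j"
      proof (rule ccontr)
        assume "\<not> \<pi> i < \<pi> j"
        then have "\<pi> j < \<pi> i \<or> i = j" by (metis linorder_neqE_nat u_pi)
        then show False using a mono[of j i] that by auto
      qed
    qed (rule mono[OF that])
    moreover have "strict_mono_on {1..k} (\<lambda>i. opt i \<omega>)"
      by (rule strict_mono_onI) (use less in auto)
    moreover have "1 \<le> opt i \<omega> \<and> opt i \<omega> < \<infinity>" if "i \<in> {1..k}" for i
      using ge1[of i] fin[of i] that by (cases "opt i \<omega>") auto
    ultimately show ?case by blast
  qed
  then show ?thesis unfolding OA_def using opt_stopping by blast
qed

theorem beta_eq_tree_cost: "beta k \<pi> = (tree_cost (inv \<pi>) 0 (k + 1))\<^sup>2"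
proof -
  have "(INF \<tau>\<in>OA k \<pi>. \<integral>\<^sup>+ \<omega>. ennreal_of_enat (\<tau> k \<omega>) \<partial>unif_seq) = ennreal total"
  proof (rule antisym)
    show "(INF \<tau>\<in>OA k \<pi>. \<integral>\<^sup>+ \<omega>. ennreal_of_enat (\<tau> k \<omega>) \<partial>unif_seq) \<le> ennreal total"
      by (rule order_trans[OF INF_lower[OF opt_in_OA]]) (rule nn_integral_opt_le)
    show "ennreal total \<le> (INF \<tau>\<in>OA k \<pi>. \<integral>\<^sup>+ \<omega>. ennreal_of_enat (\<tau> k \<omega>) \<partial>unif_seq)"
      by (rule INF_greatest) (rule total_le)
  qed
  then show ?thesis by (simp add: beta_def total_def u_def)
qed

end

section \<open>Measurability, exchangeability and ranks of random sequences\<close>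

lemma argmin_between_iff:
  assumes "i + 1 < j"
  shows "argmin_between u i j = m \<longleftrightarrow>
    m \<in> {i<..<j} \<and> (\<forall>l\<in>{i<..<m}. u m < u l) \<and> (\<forall>l\<in>{m<..<j}. u m \<le> u l)"
proof
  assume "argmin_between u i j = m"
  then show "m \<in> {i<..<j} \<and> (\<forall>l\<in>{i<..<m}. u m < u l) \<and> (\<forall>l\<in>{m<..<j}. u m \<le> u l)"
    using argmin_between_props[OF assms, where u=u] by auto
qed (auto intro: argmin_between_eqI)

lemma argmin_between_measurable:
  fixes X :: "'a \<Rightarrow> nat \<Rightarrow> real"
  assumes X: "\<And>l. i < l \<Longrightarrow> l < j \<Longrightarrow> (\<lambda>a. X a l) \<in> borel_measurable N" and "i + 1 < j"
  shows "Measurable.pred N (\<lambda>a. argmin_between (X a) i j = m)"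
proof (cases "m \<in> {i<..<j}")
  case True
  have "Measurable.pred N (\<lambda>a. X a m < X a l)" "Measurable.pred N (\<lambda>a. X a m \<le> X a l)" if "l \<in> {i<..<j}" for l
  proof -
    have [measurable]: "(\<lambda>a. X a m) \<in> borel_measurable N" "(\<lambda>a. X a l) \<in> borel_measurable N"
      using True that by (auto intro: X)
    show "Measurable.pred N (\<lambda>a. X a m < X a l)" "Measurable.pred N (\<lambda>a. X a m \<le> X a l)" by measurable
  qed
  then show ?thesis unfolding argmin_between_iff[OF assms(2)]
    using True by (intro pred_intros_logic pred_intros_finite) auto
next
  case False
  then have "argmin_between (X a) i j \<noteq> m" for a using argmin_between_iff[OF assms(2)] by blast
  then show ?thesis by simp
qed

lemma tree_cost_measurable:
  fixes X :: "'a \<Rightarrow> nat \<Rightarrow> real"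
  assumes "\<And>l. i < l \<Longrightarrow> l < j \<Longrightarrow> (\<lambda>a. X a l) \<in> borel_measurable N"
  shows "(\<lambda>a. tree_cost (X a) i j) \<in> borel_measurable N"
  using assms
proof (induction i j rule: interval_induct)
  case (less i j)
  show ?case
  proof (cases "i + 1 < j")
    case True
    have eq: "tree_cost (X a) i j = (\<Sum>m\<in>{i<..<j}. if argmin_between (X a) i j = m
      then root_cost (tree_cost (X a) i m) (tree_cost (X a) m j) else 0)" for a
    proof -
      have "argmin_between (X a) i j \<in> {i<..<j}" using argmin_between_props(1,2)[OF True, where u="X a"] by simp
      then show ?thesis using True by (simp add: tree_cost_rec sum.delta')
    qed
    show ?thesis unfolding eq
    proof (rule borel_measurable_sum)
      fix m assume m: "m \<in> {i<..<j}"
      have [measurable]: "(\<lambda>a. tree_cost (X a) i m) \<in> borel_measurable N" "(\<lambda>a. tree_cost (X a) m j) \<in> borel_measurable N"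
        using m by (auto intro!: less.IH less.prems)
      have [measurable]: "Measurable.pred N (\<lambda>a. argmin_between (X a) i j = m)"
        by (rule argmin_between_measurable[OF less.prems True])
      show "(\<lambda>a. if argmin_between (X a) i j = m then root_cost (tree_cost (X a) i m) (tree_cost (X a) m j) else 0)
        \<in> borel_measurable N" by measurable
    qed
  qed simp
qed

lemma node_term_measurable:
  fixes X :: "'a \<Rightarrow> nat \<Rightarrow> real"
  assumes X: "\<And>l. i \<le> l \<Longrightarrow> l \<le> j \<Longrightarrow> (\<lambda>a. X a l) \<in> borel_measurable N"
  shows "(\<lambda>a. node_term (X a) i j) \<in> borel_measurable N"
proof (cases "i + 1 < j")
  case True
  have eq: "node_excess (X a) i j = tree_cost (X a) i j - (\<Sum>m\<in>{i<..<j}. if argmin_between (X a) i j = m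
      then tree_cost (X a) i m + tree_cost (X a) m j else 0)" for a
  proof -
    have "argmin_between (X a) i j \<in> {i<..<j}" using argmin_between_props(1,2)[OF True, where u="X a"] by simp
    then show ?thesis using tree_cost_split[OF True, of "X a"] by (simp add: sum.delta')
  qed
  have X': "(\<lambda>a. X a l) \<in> borel_measurable N" if "i < l" "l < j" for l using X that by auto
  have 1: "(\<lambda>a. node_excess (X a) i j) \<in> borel_measurable N"
    unfolding eq
  proof (intro borel_measurable_diff borel_measurable_sum tree_cost_measurable X')
    fix m assume m: "m \<in> {i<..<j}"
    have [measurable]: "(\<lambda>a. tree_cost (X a) i m) \<in> borel_measurable N" "(\<lambda>a. tree_cost (X a) m j) \<in> borel_measurable N"
      using m by (auto intro!: tree_cost_measurable X')
    have [measurable]: "Measurable.pred N (\<lambda>a. argmin_between (X a) i j = m)"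
      by (rule argmin_between_measurable[OF X' True])
    show "(\<lambda>a. if argmin_between (X a) i j = m then tree_cost (X a) i m + tree_cost (X a) m j else 0)
        \<in> borel_measurable N" by measurable
  qed auto
  have "Measurable.pred N (\<lambda>a. X a b < X a l)" if "l \<in> {i..j}" "b \<in> {i..j}" for l b
  proof -
    have [measurable]: "(\<lambda>a. X a b) \<in> borel_measurable N" "(\<lambda>a. X a l) \<in> borel_measurable N"
      using that by (auto intro: X)
    show ?thesis by measurable
  qed
  moreover have "is_node (X a) i j \<longleftrightarrow> (\<forall>l\<in>{i<..<j}. X a i < X a l) \<and> (\<forall>l\<in>{i<..<j}. X a j < X a l)" for a
    by (auto simp: is_node_def)
  ultimately have "Measurable.pred N (\<lambda>a. is_node (X a) i j)"
    using True by (simp only:) (intro pred_intros_logic pred_intros_finite; auto)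
  then show ?thesis unfolding node_term_def using 1 by measurable
qed simp

text \<open>
  The restriction to positive indices keeps the result in the product space, whose elements are undefined at \<open>0\<close>.
\<close>
definition reindex :: "(nat \<Rightarrow> nat) \<Rightarrow> (nat \<Rightarrow> real) \<Rightarrow> nat \<Rightarrow> real" where
  "reindex f \<omega> = (\<lambda>n\<in>{1..}. \<omega> (f n))"

lemma reindex_apply [simp]: "1 \<le> n \<Longrightarrow> reindex f \<omega> n = \<omega> (f n)"
  by (simp add: reindex_def)

context
  fixes f :: "nat \<Rightarrow> nat"
  assumes f: "inj_on f {1..}" "f \<in> {1..} \<rightarrow> {1..}"
begin

lemma distr_reindex: "distr unif_seq unif_seq (reindex f) = unif_seq"
  using distr_PiM_reindex[of "{1..}" "\<lambda>_. unif01" f "{1..}"] f unif01.prob_space_axioms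
  unfolding unif_seq_def reindex_def[abs_def] by auto

lemma reindex_measurable: "reindex f \<in> unif_seq \<rightarrow>\<^sub>M unif_seq"
  unfolding unif_seq_def reindex_def[abs_def] using f(2)
  by (intro measurable_restrict measurable_component_singleton) auto

lemma integral_reindex:
  fixes g :: "(nat \<Rightarrow> real) \<Rightarrow> real"
  assumes "g \<in> borel_measurable unif_seq"
  shows "(\<integral>\<omega>. g (reindex f \<omega>) \<partial>unif_seq) = (\<integral>\<omega>. g \<omega> \<partial>unif_seq)"
  using integral_distr[OF reindex_measurable assms] by (simp add: distr_reindex)

lemma measure_reindex:
  assumes "Measurable.pred unif_seq P"
  shows "measure unif_seq {\<omega> \<in> space unif_seq. P (reindex f \<omega>)} = measure unif_seq {\<omega> \<in> space unif_seq. P \<omega>}"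
proof -
  have "measure unif_seq {\<omega> \<in> space unif_seq. P \<omega>} = measure (distr unif_seq unif_seq (reindex f)) {\<omega> \<in> space unif_seq. P \<omega>}"
    by (simp add: distr_reindex)
  also have "\<dots> = measure unif_seq (reindex f -` {\<omega> \<in> space unif_seq. P \<omega>} \<inter> space unif_seq)"
    using assms by (intro measure_distr reindex_measurable) (simp add: pred_def)
  also have "reindex f -` {\<omega> \<in> space unif_seq. P \<omega>} \<inter> space unif_seq = {\<omega> \<in> space unif_seq. P (reindex f \<omega>)}"
    using measurable_space[OF reindex_measurable] by auto
  finally show ?thesis by simp
qed

end

text \<open>
  Given coordinate \<open>a\<close>, the fresh coordinate \<open>b\<close> hits it with probability zero.
\<close>
lemma AE_unif_seq_inj: "AE \<omega> in unif_seq. inj_on \<omega> {1..}"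
proof -
  have "AE \<omega> in unif_seq. \<omega> b \<noteq> \<omega> a" if ab: "1 \<le> a" "1 \<le> b" "a \<noteq> b" for a b :: nat
  proof -
    have [measurable]: "(\<lambda>\<omega>. \<omega> a) \<in> borel_measurable unif_seq" "(\<lambda>\<omega>. \<omega> b) \<in> borel_measurable unif_seq"
      using ab by (auto intro: coordinate_measurable)
    have [measurable]: "(\<lambda>p. fst p a) \<in> borel_measurable (unif_seq \<Otimes>\<^sub>M unif01)"
      by (rule measurable_compose[OF measurable_fst]) simp
    have "emeasure unif_seq {\<omega> \<in> space unif_seq. \<omega> b = \<omega> a} = (\<integral>\<^sup>+\<omega>. (if \<omega> b = \<omega> a then 1 else 0) \<partial>unif_seq)"
    proof -
      have "emeasure unif_seq {\<omega> \<in> space unif_seq. \<omega> b = \<omega> a}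
        = (\<integral>\<^sup>+\<omega>. indicator {\<omega> \<in> space unif_seq. \<omega> b = \<omega> a} \<omega> \<partial>unif_seq)"
        by (rule nn_integral_indicator[symmetric]) measurable
      also have "\<dots> = (\<integral>\<^sup>+\<omega>. (if \<omega> b = \<omega> a then 1 else 0) \<partial>unif_seq)"
        by (intro nn_integral_cong) (auto simp: indicator_def)
      finally show ?thesis .
    qed
    also have "\<dots> = (\<integral>\<^sup>+\<omega>. (\<integral>\<^sup>+x. (if x = \<omega> a then 1 else 0) \<partial>unif01) \<partial>unif_seq)"
    proof (rule nn_integral_fresh_coordinate[where G="\<lambda>\<omega> x. if x = \<omega> a then 1 else 0"])
      show "(\<lambda>(\<omega>, x). if x = \<omega> a then 1 else 0) \<in> borel_measurable (unif_seq \<Otimes>\<^sub>M unif01)"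
        unfolding split_beta' by measurable
    qed (use ab in auto)
    also have "\<dots> = 0"
    proof -
      have "(\<integral>\<^sup>+x. (if x = c then 1 else 0) \<partial>unif01) = 0" for c :: real
      proof -
        have "AE x in unif01. x \<noteq> c"
          by (rule AE_uniform_measureI) (auto intro: AE_mp[OF AE_lborel_singleton[of c]])
        then have "(\<integral>\<^sup>+x. (if x = c then 1 else 0) \<partial>unif01) = (\<integral>\<^sup>+x. 0 \<partial>unif01)"
          by (intro nn_integral_cong_AE) auto
        then show ?thesis by simp
      qed
      then show ?thesis by simp
    qed
    finally have "emeasure unif_seq {\<omega> \<in> space unif_seq. \<omega> b = \<omega> a} = 0" .
    then show ?thesis by (subst AE_iff_measurable[OF _ refl]) auto
  qed
  then have "AE \<omega> in unif_seq. 1 \<le> a \<longrightarrow> 1 \<le> b \<longrightarrow> a \<noteq> b \<longrightarrow> \<omega> b \<noteq> \<omega> a" for a b :: nat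
    by (cases "1 \<le> a \<and> 1 \<le> b \<and> a \<noteq> b") auto
  then have "AE \<omega> in unif_seq. \<forall>a b. 1 \<le> a \<longrightarrow> 1 \<le> b \<longrightarrow> a \<noteq> b \<longrightarrow> \<omega> b \<noteq> \<omega> a"
    by (simp only: AE_all_countable) blast
  then show ?thesis
  proof eventually_elim
    case (elim \<omega>)
    show ?case
    proof (rule inj_onI)
      fix x y assume "x \<in> {1..}" "y \<in> {1..}" "\<omega> x = \<omega> y"
      then show "x = y" using elim[rule_format, of y x] by auto
    qed
  qed
qed

definition lowest :: "nat set \<Rightarrow> nat list \<Rightarrow> (nat \<Rightarrow> 'a::linorder) \<Rightarrow> bool" where
  "lowest S xs \<omega> \<longleftrightarrow> sorted_wrt (\<lambda>a b. \<omega> a < \<omega> b) xs \<and> (\<forall>x\<in>set xs. \<forall>l\<in>S - set xs. \<omega> x < \<omega> l)"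

lemma lowest_unique:
  "lowest S xs \<omega> \<Longrightarrow> lowest S ys \<omega> \<Longrightarrow> length xs = length ys \<Longrightarrow> distinct xs \<Longrightarrow> distinct ys
    \<Longrightarrow> set xs \<subseteq> S \<Longrightarrow> set ys \<subseteq> S \<Longrightarrow> xs = ys"
proof (induction xs arbitrary: S ys)
  case (Cons x xs)
  then obtain y ys' where ys: "ys = y # ys'" by (cases ys) auto
  have x: "\<omega> x < \<omega> l" if "l \<in> S" "l \<noteq> x" for l
    using Cons.prems(1) that by (cases "l \<in> set xs") (auto simp: lowest_def)
  have y: "\<omega> y < \<omega> l" if "l \<in> S" "l \<noteq> y" for l
    using Cons.prems(2) that ys by (cases "l \<in> set ys'") (auto simp: lowest_def)
  have "x = y" using x[of y] y[of x] Cons.prems ys by fastforce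
  moreover have "xs = ys'"
  proof (rule Cons.IH[of "S - {x}"])
    show "lowest (S - {x}) xs \<omega>" using Cons.prems(1) by (auto simp: lowest_def)
    show "lowest (S - {x}) ys' \<omega>" using Cons.prems(2) ys \<open>x = y\<close> by (auto simp: lowest_def)
  qed (use Cons.prems ys \<open>x = y\<close> in auto)
  ultimately show ?case using ys by simp
qed simp

lemma ex_permutes_map:
  "distinct xs \<Longrightarrow> distinct ys \<Longrightarrow> length xs = length ys \<Longrightarrow> set xs \<subseteq> S \<Longrightarrow> set ys \<subseteq> S
    \<Longrightarrow> \<exists>p. p permutes S \<and> map p xs = ys"
proof (induction xs arbitrary: ys)
  case Nil
  have "id permutes S \<and> map id [] = ys" using Nil permutes_id[of S] by simp
  then show ?case by blast
next
  case (Cons x xs)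
  then obtain y ys' where ys: "ys = y # ys'" by (cases ys) auto
  obtain p where p: "p permutes S" "map p xs = ys'" using Cons.IH[of ys'] Cons.prems ys by auto
  define q where "q = Transposition.transpose (p x) y \<circ> p"
  have "p x \<in> S" using permutes_in_image[OF p(1)] Cons.prems by auto
  then have "q permutes S" unfolding q_def
    using Cons.prems ys by (intro permutes_compose[OF p(1)] permutes_swap_id) auto
  moreover have "q x = y" by (simp add: q_def)
  moreover have "map q xs = ys'"
  proof -
    have "q z = p z" if "z \<in> set xs" for z
    proof -
      have "p z \<noteq> p x" using permutes_inj[OF p(1)] that Cons.prems by (metis distinct.simps(2) injD)
      moreover have "p z \<in> set ys'" using p(2) that by auto
      then have "p z \<noteq> y" using Cons.prems ys by auto
      ultimately show ?thesis by (simp add: q_def Transposition.transpose_def)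
    qed
    then show ?thesis using p(2) by auto
  qed
  ultimately show ?case using ys by auto
qed

lemma permutes_reindex_ok:
  assumes "p permutes S" "S \<subseteq> {1..}"
  shows "inj_on p {1..}" "p \<in> {1..} \<rightarrow> {1..}"
  using permutes_inj_on[OF assms(1)] permutes_in_image[OF permutes_subset[OF assms]] by auto

lemma lowest_measurable:
  assumes "finite S" "S \<subseteq> {1..}" "set xs \<subseteq> S"
  shows "Measurable.pred unif_seq (lowest S xs)"
proof -
  have less: "Measurable.pred unif_seq (\<lambda>\<omega>. \<omega> a < \<omega> b)" if "a \<in> S" "b \<in> S" for a b
  proof -
    have [measurable]: "(\<lambda>\<omega>. \<omega> a) \<in> borel_measurable unif_seq" "(\<lambda>\<omega>. \<omega> b) \<in> borel_measurable unif_seq"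
      using assms that by (auto intro!: coordinate_measurable)
    show ?thesis by measurable
  qed
  have "Measurable.pred unif_seq (\<lambda>\<omega>. sorted_wrt (\<lambda>a b. \<omega> a < \<omega> b) xs)"
    using assms(3)
  proof (induction xs)
    case (Cons x xs)
    have "Measurable.pred unif_seq (\<lambda>\<omega>. \<forall>y\<in>set xs. \<omega> x < \<omega> y)"
      by (intro pred_intros_finite less) (use Cons.prems in auto)
    moreover have "Measurable.pred unif_seq (\<lambda>\<omega>. sorted_wrt (\<lambda>a b. \<omega> a < \<omega> b) xs)"
      using Cons by auto
    ultimately show ?case unfolding sorted_wrt.simps by (rule pred_intros_logic)
  qed simp
  moreover have "Measurable.pred unif_seq (\<lambda>\<omega>. \<forall>x\<in>set xs. \<forall>l\<in>S - set xs. \<omega> x < \<omega> l)"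
    by (intro pred_intros_finite less) (use assms in auto)
  ultimately show ?thesis unfolding lowest_def[abs_def] by (rule pred_intros_logic)
qed

text \<open>
  The events for different lists of the same length are disjoint, and they are equally likely by exchangeability. The
  product counts the lists.
\<close>
lemma lowest_prob:
  assumes S: "finite S" "S \<subseteq> {1..}" and xs: "distinct xs" "set xs \<subseteq> S"
  shows "measure unif_seq {\<omega> \<in> space unif_seq. lowest S xs \<omega>} * real (\<Prod>{card S - length xs + 1..card S}) \<le> 1"
proof -
  let ?Q = "\<lambda>ys. {\<omega> \<in> space unif_seq. lowest S ys \<omega>}"
  define Ls where "Ls = {ys. length ys = length xs \<and> distinct ys \<and> set ys \<subseteq> S}"
  have finL: "finite Ls"
    by (rule finite_subset[OF _ finite_lists_length_eq[OF S(1), of "length xs"]]) (auto simp: Ls_def)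
  have cardL: "card Ls = \<Prod>{card S - length xs + 1..card S}"
    unfolding Ls_def using xs S card_mono[OF S(1) xs(2)] distinct_card[OF xs(1)]
    by (intro card_lists_distinct_length_eq) auto
  have same: "measure unif_seq (?Q ys) = measure unif_seq (?Q xs)" if ys: "ys \<in> Ls" for ys
  proof -
    obtain p where p: "p permutes S" "map p ys = xs"
      using ex_permutes_map[of ys xs S] ys xs by (auto simp: Ls_def)
    have "lowest S ys (reindex p \<omega>) \<longleftrightarrow> lowest S xs \<omega>" for \<omega>
    proof -
      have re: "reindex p \<omega> l = \<omega> (p l)" if "l \<in> S" for l using that S(2) by auto
      have ysS: "ys ! i \<in> S" if "i < length ys" for i using that ys by (auto simp: Ls_def)
      have "sorted_wrt (\<lambda>a b. reindex p \<omega> a < reindex p \<omega> b) ys \<longleftrightarrow> sorted_wrt (\<lambda>a b. \<omega> a < \<omega> b) xs"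
        unfolding p(2)[symmetric] sorted_wrt_map by (auto simp: sorted_wrt_iff_nth_less re ysS)
      moreover have "p ` (S - set ys) = S - set xs"
        using permutes_image[OF p(1)] p(2) by (subst image_set_diff[OF permutes_inj[OF p(1)]]) auto
      then have "(\<forall>x\<in>set xs. \<forall>l\<in>S - set xs. \<omega> x < \<omega> l) \<longleftrightarrow> (\<forall>x\<in>set ys. \<forall>l\<in>S - set ys. \<omega> (p x) < \<omega> (p l))"
        unfolding p(2)[symmetric] by force
      moreover have "(\<forall>x\<in>set ys. \<forall>l\<in>S - set ys. reindex p \<omega> x < reindex p \<omega> l)
         \<longleftrightarrow> (\<forall>x\<in>set ys. \<forall>l\<in>S - set ys. \<omega> (p x) < \<omega> (p l))"
        using re ys by (auto simp: Ls_def subset_iff)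
      ultimately show ?thesis unfolding lowest_def by simp
    qed
    then show ?thesis
      using measure_reindex[OF permutes_reindex_ok[OF p(1) S(2)] lowest_measurable[OF S, of ys]] ys
      by (simp add: Ls_def)
  qed
  have "measure unif_seq (?Q xs) * real (card Ls) = (\<Sum>ys\<in>Ls. measure unif_seq (?Q ys))"
    using same by simp
  also have "\<dots> = measure unif_seq (\<Union>ys\<in>Ls. ?Q ys)"
  proof (rule unif_seq.finite_measure_finite_Union[symmetric, OF finL])
    show "?Q ` Ls \<subseteq> sets unif_seq" using lowest_measurable[OF S] by (auto simp: Ls_def pred_def)
    show "disjoint_family_on ?Q Ls"
      unfolding disjoint_family_on_def
    proof (intro ballI impI)
      fix ys zs assume yz: "ys \<in> Ls" "zs \<in> Ls" "ys \<noteq> zs"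
      have "\<not> (lowest S ys \<omega> \<and> lowest S zs \<omega>)" for \<omega>
        using lowest_unique[of S ys \<omega> zs] yz by (auto simp: Ls_def)
      then show "?Q ys \<inter> ?Q zs = {}" by blast
    qed
  qed
  also have "\<dots> \<le> 1" by (rule unif_seq.prob_le_1)
  finally show ?thesis unfolding cardL .
qed

text \<open>
  Comparison of the sum with the integral of \<open>x powr (-a)\<close>.
\<close>
lemma sum_powr_le:
  fixes a :: real
  assumes "0 < a" "a < 1"
  shows "(\<Sum>j=1..n. real j powr (-a)) \<le> real n powr (1 - a) / (1 - a)"
proof (induction n)
  case (Suc n)
  have "(1 - a) * real (Suc n) powr (-a) \<le> real (Suc n) powr (1 - a) - real n powr (1 - a)"
  proof (cases "n = 0")
    case False
    have "\<exists>z>real n. z < real (Suc n) \<and> real (Suc n) powr (1 - a) - real n powr (1 - a)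
       = (real (Suc n) - real n) * ((1 - a) * z powr (1 - a - 1))"
    proof (rule MVT2)
      fix x assume "real n \<le> x" "x \<le> real (Suc n)"
      then show "((\<lambda>x. x powr (1 - a)) has_real_derivative (1 - a) * x powr (1 - a - 1)) (at x)"
        using False by (intro has_real_derivative_powr) auto
    qed simp
    then obtain z where z: "real n < z" "z < real (Suc n)"
      "real (Suc n) powr (1 - a) - real n powr (1 - a) = (1 - a) * z powr (-a)" by auto
    have "real (Suc n) powr (-a) \<le> z powr (-a)" using z False assms by (intro powr_mono2') auto
    then show ?thesis unfolding z(3) using assms by (intro mult_left_mono) auto
  qed (use assms in simp)
  then have "real (Suc n) powr (-a) \<le> (real (Suc n) powr (1 - a) - real n powr (1 - a)) / (1 - a)"
    using assms by (simp add: pos_le_divide_eq mult.commute)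
  then show ?case using Suc by (simp add: diff_divide_distrib)
qed simp

lemma sum_min_powr_le:
  assumes "i < j"
  shows "(\<Sum>l\<in>{i<..<j}. real (min (l - i) (j - l)) powr (-1/2)) \<le> 4 * sqrt (real (j - i))"
proof -
  have half: "(\<Sum>e=1..d. real e powr (-1/2)) \<le> 2 * sqrt (real d)" for d
    using sum_powr_le[of "1/2" d] by (simp add: powr_half_sqrt)
  have "(\<Sum>l\<in>{i<..<j}. real (min (l - i) (j - l)) powr (-1/2))
    \<le> (\<Sum>l\<in>{i<..<j}. real (l - i) powr (-1/2) + real (j - l) powr (-1/2))"
    by (intro sum_mono) (auto simp: min_def)
  also have "\<dots> = (\<Sum>l\<in>{i<..<j}. real (l - i) powr (-1/2)) + (\<Sum>l\<in>{i<..<j}. real (j - l) powr (-1/2))"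
    by (rule sum.distrib)
  also have "(\<Sum>l\<in>{i<..<j}. real (l - i) powr (-1/2)) = (\<Sum>e\<in>{1..<j - i}. real e powr (-1/2))"
    by (rule sum.reindex_bij_witness[of _ "\<lambda>e. e + i" "\<lambda>l. l - i"]) auto
  also have "(\<Sum>l\<in>{i<..<j}. real (j - l) powr (-1/2)) = (\<Sum>e\<in>{1..<j - i}. real e powr (-1/2))"
    by (rule sum.reindex_bij_witness[of _ "\<lambda>e. j - e" "\<lambda>l. j - l"]) auto
  also have "(\<Sum>e\<in>{1..<j - i}. real e powr (-1/2)) \<le> (\<Sum>e=1..j - i. real e powr (-1/2))"
    by (intro sum_mono2) auto
  finally show ?thesis using half[of "j - i"] by simp
qed

section \<open>Second moments of the node terms\<close>

lemma node_term_measurable_seq: "1 \<le> i \<Longrightarrow> (\<lambda>\<omega>. node_term \<omega> i j) \<in> borel_measurable unif_seq"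
  by (rule node_term_measurable) (auto intro: coordinate_measurable)

lemma integrable_bounded:
  fixes g :: "_ \<Rightarrow> real"
  assumes "g \<in> borel_measurable unif_seq" "\<And>\<omega>. \<bar>g \<omega>\<bar> \<le> C"
  shows "integrable unif_seq g"
  using assms by (intro unif_seq.integrable_const_bound[of g C]) auto

text \<open>
  Up to a constant, this bounds the squared excess of a node whose root is at \<open>l\<close>.
\<close>
definition split_weight :: "nat \<Rightarrow> nat \<Rightarrow> nat \<Rightarrow> real" where
  "split_weight i j l = real (min (l - i) (j - l)) powr (-1/2)"

text \<open>
  The role of \<open>Q l\<close> is to be an event that happens whenever the interval from \<open>i\<close> to \<open>j\<close> is
  owned by a node with root \<open>l\<close>. The weights sum to at most \<open>4 * sqrt (j - i)\<close>.
\<close>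
lemma second_moment_bound:
  assumes ij: "i < j" and B0: "0 \<le> B" and g: "g \<in> borel_measurable unif_seq" "\<And>\<omega>. \<bar>g \<omega>\<bar> \<le> C"
    and Q: "\<And>l. l \<in> {i<..<j} \<Longrightarrow> Measurable.pred unif_seq (Q l)"
    and B: "\<And>l. l \<in> {i<..<j} \<Longrightarrow> measure unif_seq {\<omega> \<in> space unif_seq. Q l \<omega>} \<le> B"
    and le: "AE \<omega> in unif_seq. (g \<omega>)\<^sup>2 \<le> (\<Sum>l\<in>{i<..<j}. 4 * split_weight i j l * (if Q l \<omega> then 1 else 0))"
  shows "(\<integral>\<omega>. (g \<omega>)\<^sup>2 \<partial>unif_seq) \<le> 16 * sqrt (real (j - i)) * B"
proof (cases "j = i + 1")
  case True
  then have "{i<..<j} = {}" by auto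
  then have "AE \<omega> in unif_seq. (g \<omega>)\<^sup>2 = 0" using le by auto
  then have "(\<integral>\<omega>. (g \<omega>)\<^sup>2 \<partial>unif_seq) = (\<integral>\<omega>. 0 \<partial>unif_seq)"
    using g by (intro integral_cong_AE) auto
  then show ?thesis using B0 by simp
next
  case False
  have ind: "(\<lambda>\<omega>. if Q l \<omega> then 1 else 0 :: real) \<in> borel_measurable unif_seq" if "l \<in> {i<..<j}" for l
    using Q[OF that] by (intro measurable_If) (auto simp: pred_def)
  have intI: "integrable unif_seq (\<lambda>\<omega>. if Q l \<omega> then 1 else 0 :: real)" if "l \<in> {i<..<j}" for l
    by (rule integrable_bounded[OF ind[OF that], of 1]) auto
  have int: "(\<integral>\<omega>. (if Q l \<omega> then 1 else 0) \<partial>unif_seq) = measure unif_seq {\<omega> \<in> space unif_seq. Q l \<omega>}" if "l \<in> {i<..<j}" for l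
  proof -
    have "(\<integral>\<omega>. (if Q l \<omega> then 1 else 0 :: real) \<partial>unif_seq) = (\<integral>\<omega>. indicator {\<omega> \<in> space unif_seq. Q l \<omega>} \<omega> \<partial>unif_seq)"
      by (intro Bochner_Integration.integral_cong) (auto simp: indicator_def)
    then show ?thesis using Q[OF that] by (simp add: pred_def)
  qed
  have g2: "integrable unif_seq (\<lambda>\<omega>. (g \<omega>)\<^sup>2)"
    by (rule integrable_bounded[of _ "C\<^sup>2"])
       (use g in \<open>auto intro!: borel_measurable_power simp: abs_le_square_iff[symmetric] intro: order_trans[OF g(2)]\<close>)
  have "(\<integral>\<omega>. (g \<omega>)\<^sup>2 \<partial>unif_seq)
    \<le> (\<integral>\<omega>. (\<Sum>l\<in>{i<..<j}. 4 * split_weight i j l * (if Q l \<omega> then 1 else 0)) \<partial>unif_seq)"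
    using g2 le by (intro integral_mono_AE) (auto intro!: Bochner_Integration.integrable_sum integrable_mult_right intI)
  also have "\<dots> = (\<Sum>l\<in>{i<..<j}. 4 * split_weight i j l * measure unif_seq {\<omega> \<in> space unif_seq. Q l \<omega>})"
    using intI int by (subst Bochner_Integration.integral_sum) (auto intro!: sum.cong)
  also have "\<dots> \<le> (\<Sum>l\<in>{i<..<j}. 4 * split_weight i j l * B)"
    using B by (intro sum_mono mult_left_mono) (auto simp: split_weight_def)
  also have "\<dots> = 4 * B * (\<Sum>l\<in>{i<..<j}. split_weight i j l)"
    by (simp add: sum_distrib_left mult_ac)
  also have "\<dots> \<le> 4 * B * (4 * sqrt (real (j - i)))"
  proof (rule mult_left_mono)
    show "(\<Sum>l\<in>{i<..<j}. split_weight i j l) \<le> 4 * sqrt (real (j - i))"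
      using sum_min_powr_le[OF ij] by (simp add: split_weight_def)
  qed (use B0 in simp)
  finally show ?thesis by (simp add: mult_ac)
qed

lemma node_term_sq_le:
  fixes v :: "nat \<Rightarrow> real"
  assumes ij: "i + 1 < j" and node: "is_node v i j" and Q: "Q (argmin_between v i j)"
  shows "(node_term v i j)\<^sup>2 \<le> (\<Sum>l\<in>{i<..<j}. 4 * split_weight i j l * (if Q l then 1 else 0))"
proof -
  define m where "m = argmin_between v i j"
  have m: "m \<in> {i<..<j}" using argmin_between_props(1,2)[OF ij, where u=v] by (simp add: m_def)
  have "(node_term v i j)\<^sup>2 \<le> 4 * split_weight i j m"
    using node_excess_le_powr[OF ij, of v] node by (simp add: node_term_def m_def split_weight_def)
  also have "\<dots> = (\<Sum>l\<in>{m}. 4 * split_weight i j l * (if Q l then 1 else 0))" using Q by (simp add: m_def)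
  also have "\<dots> \<le> (\<Sum>l\<in>{i<..<j}. 4 * split_weight i j l * (if Q l then 1 else 0))"
    by (rule sum_mono2) (use m in \<open>auto simp: split_weight_def\<close>)
  finally show ?thesis .
qed

lemma node_term_sq_le':
  fixes v :: "nat \<Rightarrow> real"
  assumes "i < j" and Q: "i + 1 < j \<Longrightarrow> is_node v i j \<Longrightarrow> Q (argmin_between v i j)"
  shows "(node_term v i j)\<^sup>2 \<le> (\<Sum>l\<in>{i<..<j}. 4 * split_weight i j l * (if Q l then 1 else 0))"
proof (cases "i + 1 < j \<and> is_node v i j")
  case True
  then show ?thesis using Q by (intro node_term_sq_le) auto
next
  case False
  then have "node_term v i j = 0" by (auto simp: node_term_def node_excess_def)
  then show ?thesis by (auto intro!: sum_nonneg simp: split_weight_def)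
qed

definition moment_const :: "nat \<Rightarrow> real" where
  "moment_const d = 64 * real d powr (-5/2)"

text \<open>
  The interval from \<open>i\<close> to \<open>i + d\<close> is owned by a node with root \<open>l\<close> only if the two walls carry the two smallest values and \<open>l\<close> the third
  smallest. This has probability of order \<open>d powr (-3)\<close>, and the sum of the weights over the possible
  roots is of order \<open>d powr (1/2)\<close>.
\<close>
theorem node_term_second_moment:
  assumes i: "1 \<le> i" and d: "1 \<le> d"
  shows "(\<integral>\<omega>. (node_term \<omega> i (i + d))\<^sup>2 \<partial>unif_seq) \<le> moment_const d"
proof (cases "d = 1")
  case True
  then show ?thesis by (simp add: moment_const_def)
next
  case False
  then have d2: "2 \<le> d" using d by simp
  define S where "S = {i..i + d}"
  define Q where "Q l \<omega> \<longleftrightarrow> lowest S [i, i + d, l] \<omega> \<or> lowest S [i + d, i, l] \<omega>" for l and \<omega> :: "nat \<Rightarrow> real"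
  have S: "finite S" "S \<subseteq> {1..}" "card S = d + 1" using i by (auto simp: S_def)
  have prd: "\<Prod>{d + 1 - 3 + 1..d + 1} = (d - 1) * d * (d + 1)"
  proof -
    obtain d' where d': "d = Suc (Suc d')" using d2 by (metis add_2_eq_Suc le_Suc_ex)
    have "{d + 1 - 3 + 1..d + 1} = {d - 1, d, d + 1}" using d2 by auto
    then show ?thesis unfolding d' by (simp add: algebra_simps)
  qed
  have P: "measure unif_seq {\<omega> \<in> space unif_seq. lowest S xs \<omega>} \<le> 2 / real d ^ 3"
    if "distinct xs" "set xs \<subseteq> S" "length xs = 3" for xs
  proof -
    have "measure unif_seq {\<omega> \<in> space unif_seq. lowest S xs \<omega>} * (real (d - 1) * real d * real (d + 1)) \<le> 1"
      using lowest_prob[OF S(1,2) that(1,2)] unfolding S(3) that(3) prd by (simp only: of_nat_mult)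
    moreover have "real d ^ 3 / 2 \<le> real (d - 1) * real d * real (d + 1)"
    proof -
      have "4 \<le> real d * real d" using d2 mult_mono[of 2 "real d" 2 "real d"] by simp
      then have "real d * (real d * real d / 2) \<le> real d * (real d * real d - 1)" by (intro mult_left_mono) auto
      then show ?thesis using d2 by (simp add: power3_eq_cube of_nat_diff algebra_simps)
    qed
    ultimately have "measure unif_seq {\<omega> \<in> space unif_seq. lowest S xs \<omega>} * (real d ^ 3 / 2) \<le> 1"
      by (meson measure_nonneg mult_left_mono order_trans)
    then show ?thesis using d2 by (simp add: field_simps)
  qed
  \<comment> \<open>either wall may be the lower one, and each of the two orders has probability at most \<open>2 / d ^ 3\<close>\<close>
  have "(\<integral>\<omega>. (node_term \<omega> i (i + d))\<^sup>2 \<partial>unif_seq) \<le> 16 * sqrt (real (i + d - i)) * (4 / real d ^ 3)"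
  proof (rule second_moment_bound[where C="3/2" and Q=Q])
    show "\<bar>node_term \<omega> i (i + d)\<bar> \<le> 3/2" for \<omega> :: "nat \<Rightarrow> real"
      using node_term_le[of \<omega> i "i + d"] node_term_nonneg[of \<omega> i "i + d"] by simp
    fix l assume l: "l \<in> {i<..<i + d}"
    have m: "Measurable.pred unif_seq (lowest S [i, i + d, l])" "Measurable.pred unif_seq (lowest S [i + d, i, l])"
      by (rule lowest_measurable[OF S(1,2)]; use l in \<open>auto simp: S_def\<close>)+
    then show "Measurable.pred unif_seq (Q l)" unfolding Q_def by (rule pred_intros_logic)
    have "{\<omega> \<in> space unif_seq. Q l \<omega>} = {\<omega> \<in> space unif_seq. lowest S [i, i + d, l] \<omega>} \<union> {\<omega> \<in> space unif_seq. lowest S [i + d, i, l] \<omega>}"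
      by (auto simp: Q_def)
    also have "measure unif_seq \<dots> \<le> measure unif_seq {\<omega> \<in> space unif_seq. lowest S [i, i + d, l] \<omega>}
      + measure unif_seq {\<omega> \<in> space unif_seq. lowest S [i + d, i, l] \<omega>}"
      using m by (intro measure_Un_le) (auto simp: pred_def)
    also have "\<dots> \<le> 2 / real d ^ 3 + 2 / real d ^ 3"
      using l by (intro add_mono P) (auto simp: S_def)
    finally show "measure unif_seq {\<omega> \<in> space unif_seq. Q l \<omega>} \<le> 4 / real d ^ 3" by simp
  next
    show "AE \<omega> in unif_seq. (node_term \<omega> i (i + d))\<^sup>2
      \<le> (\<Sum>l\<in>{i<..<i + d}. 4 * split_weight i (i + d) l * (if Q l \<omega> then 1 else 0))"
      using AE_unif_seq_inj
    proof eventually_elim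
      case (elim \<omega>)
      show ?case
      proof (rule node_term_sq_le')
        assume ij: "i + 1 < i + d" and node: "is_node \<omega> i (i + d)"
        define m where "m = argmin_between \<omega> i (i + d)"
        have m: "i < m" "m < i + d" using argmin_between_props(1,2)[OF ij, where u=\<omega>] by (auto simp: m_def)
        have inj: "inj_on \<omega> {i<..<i + d}" using elim i by (rule_tac inj_on_subset) auto
        have less: "\<omega> m < \<omega> l" if "l \<in> S" "l \<noteq> i" "l \<noteq> i + d" "l \<noteq> m" for l
          using argmin_between_less[OF ij inj, of l] that by (auto simp: m_def S_def)
        have nd: "\<omega> i < \<omega> m" "\<omega> (i + d) < \<omega> m" using node m by (auto simp: is_node_def)
        have nd': "\<omega> i < \<omega> l" "\<omega> (i + d) < \<omega> l" if "l \<in> S" "l \<noteq> i" "l \<noteq> i + d" for l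
          using node that by (auto simp: is_node_def S_def)
        have "\<omega> i \<noteq> \<omega> (i + d)" using inj_onD[OF elim, of i "i + d"] i d by auto
        then show "Q m \<omega>" using nd nd' less by (auto simp: Q_def lowest_def neq_iff)
      qed (use d in auto)
    qed
  qed (use d i in \<open>auto intro: node_term_measurable_seq\<close>)
  also have "16 * sqrt (real (i + d - i)) * (4 / real d ^ 3) = moment_const d"
  proof -
    have "sqrt (real d) / real d ^ 3 = real d powr (1/2) / real d powr 3"
      using d by (simp add: powr_half_sqrt)
    also have "\<dots> = real d powr (-5/2)" by (subst powr_diff[symmetric]) simp
    finally show ?thesis by (simp add: moment_const_def)
  qed
  finally show ?thesis .
qed

text \<open>
  Positions \<open>0\<close> and \<open>n + 1\<close> are walls of the whole tree. A value below the range of the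
  coordinates makes them walls in the sense of \<^const>\<open>is_node\<close>.
\<close>
definition framed :: "nat \<Rightarrow> (nat \<Rightarrow> real) \<Rightarrow> nat \<Rightarrow> real" where
  "framed n \<omega> = \<omega> (0 := -1, n + 1 := -1)"

lemma framed_simps [simp]: "framed n \<omega> 0 = -1" "framed n \<omega> (n + 1) = -1" "framed n \<omega> (Suc n) = -1"
  "1 \<le> l \<Longrightarrow> l \<le> n \<Longrightarrow> framed n \<omega> l = \<omega> l"
  by (auto simp: framed_def)

lemma framed_coordinate_measurable: "l \<le> n + 1 \<Longrightarrow> (\<lambda>\<omega>. framed n \<omega> l) \<in> borel_measurable unif_seq"
  by (cases "l = 0 \<or> l = n + 1") (auto intro: coordinate_measurable)

lemma framed_node_term_measurable: "j \<le> n + 1 \<Longrightarrow> (\<lambda>\<omega>. node_term (framed n \<omega>) i j) \<in> borel_measurable unif_seq"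
  by (rule node_term_measurable) (auto intro: framed_coordinate_measurable)

lemma pair_lowest_prob:
  assumes S: "finite S" "S \<subseteq> {1..}" "card S = d" "2 \<le> d" and xs: "distinct xs" "set xs \<subseteq> S" "length xs = 2"
  shows "measure unif_seq {\<omega> \<in> space unif_seq. lowest S xs \<omega>} \<le> 2 / real d ^ 2"
proof -
  have "{d - 2 + 1..d} = {d - 1, d}" using S(4) by auto
  then have prd: "\<Prod>{d - 2 + 1..d} = (d - 1) * d" using S(4) by simp
  have "measure unif_seq {\<omega> \<in> space unif_seq. lowest S xs \<omega>} * (real (d - 1) * real d) \<le> 1"
    using lowest_prob[OF S(1,2) xs(1,2)] unfolding S(3) xs(3) prd by simp
  moreover have "real d ^ 2 / 2 \<le> real (d - 1) * real d"
  proof -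
    have "real d * (real d / 2) \<le> real d * (real d - 1)" using S(4) by (intro mult_left_mono) auto
    then show ?thesis using S(4) by (simp add: power2_eq_square of_nat_diff algebra_simps)
  qed
  ultimately have "measure unif_seq {\<omega> \<in> space unif_seq. lowest S xs \<omega>} * (real d ^ 2 / 2) \<le> 1"
    by (meson measure_nonneg mult_left_mono order_trans)
  then show ?thesis using S(4) by (simp add: field_simps)
qed

text \<open>
  An interval at the boundary has only one random wall, at \<open>e\<close>. So only the two smallest values are prescribed, and
  the second moment loses one power: \<open>d powr (1/2 - 2)\<close>.
\<close>
lemma boundary_second_moment:
  assumes d: "1 \<le> d" "d \<le> n" and ij: "(i, j, e) = (0, d, d) \<or> (i, j, e) = (n + 1 - d, n + 1, n + 1 - d)"
  shows "(\<integral>\<omega>. (node_term (framed n \<omega>) i j)\<^sup>2 \<partial>unif_seq) \<le> 32 * (real d powr (-3/4))\<^sup>2"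
proof (cases "d = 1")
  case True
  then have "node_term (framed n \<omega>) i j = 0" for \<omega> using ij d by auto
  then show ?thesis by simp
next
  case False
  then have d2: "2 \<le> d" using d by simp
  define S where "S = insert e {i<..<j}"
  have ijd: "i < j" "j - i = d" "j \<le> n + 1" "e \<notin> {i<..<j}" "1 \<le> e" "e \<le> n" using ij d by auto
  have S: "finite S" "S \<subseteq> {1..}" "card S = d" using ijd d by (auto simp: S_def)
  have "(\<integral>\<omega>. (node_term (framed n \<omega>) i j)\<^sup>2 \<partial>unif_seq) \<le> 16 * sqrt (real (j - i)) * (2 / real d ^ 2)"
  proof (rule second_moment_bound[where C="3/2" and Q="\<lambda>l. lowest S [e, l]"])
    show "\<bar>node_term (framed n \<omega>) i j\<bar> \<le> 3/2" for \<omega>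
      using node_term_le[of "framed n \<omega>" i j] node_term_nonneg[of "framed n \<omega>" i j] by simp
    fix l assume l: "l \<in> {i<..<j}"
    show "Measurable.pred unif_seq (lowest S [e, l])"
      using l by (intro lowest_measurable S) (auto simp: S_def)
    show "measure unif_seq {\<omega> \<in> space unif_seq. lowest S [e, l] \<omega>} \<le> 2 / (real d)\<^sup>2"
      using l ijd by (intro pair_lowest_prob S d2) (auto simp: S_def)
  next
    show "AE \<omega> in unif_seq. (node_term (framed n \<omega>) i j)\<^sup>2
      \<le> (\<Sum>l\<in>{i<..<j}. 4 * split_weight i j l * (if lowest S [e, l] \<omega> then 1 else 0))"
      using AE_unif_seq_inj
    proof eventually_elim
      case (elim \<omega>)
      show ?case
      proof (rule node_term_sq_le')
        assume i1: "i + 1 < j" and node: "is_node (framed n \<omega>) i j"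
        define m where "m = argmin_between (framed n \<omega>) i j"
        have m: "i < m" "m < j" using argmin_between_props(1,2)[OF i1, where u="framed n \<omega>"] by (auto simp: m_def)
        have fr: "framed n \<omega> l = \<omega> l" if "l \<in> S" for l using that ijd by (auto simp: S_def)
        have inj: "inj_on (framed n \<omega>) {i<..<j}"
        proof (rule inj_onI)
          fix x y assume "x \<in> {i<..<j}" "y \<in> {i<..<j}" "framed n \<omega> x = framed n \<omega> y"
          then show "x = y" using fr[of x] fr[of y] inj_onD[OF elim, of x y] by (auto simp: S_def)
        qed
        have less: "\<omega> m < \<omega> l" if "l \<in> {i<..<j}" "l \<noteq> m" for l
          using argmin_between_less[OF i1 inj, of l] that m fr[of l] fr[of m] by (auto simp: m_def[symmetric] S_def)
        have nd: "\<omega> e < \<omega> l" if "l \<in> {i<..<j}" for l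
          using node that ij fr[of l] fr[of e] by (auto simp: is_node_def S_def)
        show "lowest S [e, m] \<omega>" using m nd less by (auto simp: lowest_def S_def)
      qed (use ijd in auto)
    qed
  qed (use ijd in \<open>auto intro!: framed_node_term_measurable\<close>)
  also have "16 * sqrt (real (j - i)) * (2 / real d ^ 2) = 32 * (real d powr (-3/4))\<^sup>2"
  proof -
    have "sqrt (real d) / real d ^ 2 = real d powr (1/2) / real d powr 2"
      using d by (simp add: powr_half_sqrt)
    also have "\<dots> = real d powr (-3/2)" by (subst powr_diff[symmetric]) simp
    also have "\<dots> = (real d powr (-3/4))\<^sup>2" by (simp add: power2_eq_square powr_add[symmetric])
    finally show ?thesis using ijd by simp
  qed
  finally show ?thesis .
qed

lemma weighted_Cauchy_Schwarz:
  fixes x w :: "'i \<Rightarrow> real"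
  assumes "\<And>i. i \<in> I \<Longrightarrow> 0 < w i"
  shows "(\<Sum>i\<in>I. x i)\<^sup>2 \<le> (\<Sum>i\<in>I. w i) * (\<Sum>i\<in>I. (x i)\<^sup>2 / w i)"
proof -
  have "(\<Sum>i\<in>I. x i) = (\<Sum>i\<in>I. sqrt (w i) * (x i / sqrt (w i)))"
    using assms by (intro sum.cong) (force dest: less_imp_neq)+
  then have "(\<Sum>i\<in>I. x i)\<^sup>2 = (\<Sum>i\<in>I. sqrt (w i) * (x i / sqrt (w i)))\<^sup>2" by simp
  also have "\<dots> \<le> (\<Sum>i\<in>I. (sqrt (w i))\<^sup>2) * (\<Sum>i\<in>I. (x i / sqrt (w i))\<^sup>2)"
    by (rule Cauchy_Schwarz_ineq_sum)
  also have "\<dots> = (\<Sum>i\<in>I. w i) * (\<Sum>i\<in>I. (x i)\<^sup>2 / w i)"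
    using assms by (intro arg_cong2[where f="(*)"] sum.cong) (auto simp: power_divide less_imp_le)
  finally show ?thesis .
qed

text \<open>
  Every random variable below is of this kind. The class is closed under the ring operations, so integrability is
  automatic.
\<close>
definition bounded_rv :: "((nat \<Rightarrow> real) \<Rightarrow> real) \<Rightarrow> bool" where
  "bounded_rv g \<longleftrightarrow> g \<in> borel_measurable unif_seq \<and> (\<exists>C. \<forall>\<omega>. \<bar>g \<omega>\<bar> \<le> C)"

lemma bounded_rv_integrable: "bounded_rv g \<Longrightarrow> integrable unif_seq g"
  by (auto simp: bounded_rv_def intro: integrable_bounded)

lemma bounded_rv_const: "bounded_rv (\<lambda>_. c)"
  by (auto simp: bounded_rv_def)

lemma bounded_rv_add:
  assumes "bounded_rv f" "bounded_rv g" shows "bounded_rv (\<lambda>\<omega>. f \<omega> + g \<omega>)"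
proof -
  obtain C D where "\<forall>\<omega>. \<bar>f \<omega>\<bar> \<le> C" "\<forall>\<omega>. \<bar>g \<omega>\<bar> \<le> D" using assms by (auto simp: bounded_rv_def)
  then have "\<bar>f \<omega> + g \<omega>\<bar> \<le> C + D" for \<omega> by (meson abs_triangle_ineq add_mono order_trans)
  then show ?thesis using assms by (auto simp: bounded_rv_def)
qed

lemma bounded_rv_mult:
  assumes "bounded_rv f" "bounded_rv g" shows "bounded_rv (\<lambda>\<omega>. f \<omega> * g \<omega>)"
proof -
  obtain C D where CD: "\<forall>\<omega>. \<bar>f \<omega>\<bar> \<le> C" "\<forall>\<omega>. \<bar>g \<omega>\<bar> \<le> D" using assms by (auto simp: bounded_rv_def)
  have "\<bar>f \<omega> * g \<omega>\<bar> \<le> C * D" for \<omega>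
    unfolding abs_mult by (rule mult_mono) (use CD abs_ge_zero order_trans in \<open>blast+\<close>)
  then show ?thesis using assms by (auto simp: bounded_rv_def)
qed

lemma bounded_rv_sum: "(\<And>i. i \<in> I \<Longrightarrow> bounded_rv (f i)) \<Longrightarrow> bounded_rv (\<lambda>\<omega>. \<Sum>i\<in>I. f i \<omega>)"
  by (induction I rule: infinite_finite_induct) (auto intro: bounded_rv_const bounded_rv_add)

lemma bounded_rv_diff: "bounded_rv f \<Longrightarrow> bounded_rv g \<Longrightarrow> bounded_rv (\<lambda>\<omega>. f \<omega> - g \<omega>)"
  using bounded_rv_add[of f "\<lambda>\<omega>. (-1) * g \<omega>"] bounded_rv_mult[OF bounded_rv_const[of "-1"], of g] by simp

lemma bounded_rv_power2: "bounded_rv f \<Longrightarrow> bounded_rv (\<lambda>\<omega>. (f \<omega>)\<^sup>2)"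
  unfolding power2_eq_square by (rule bounded_rv_mult)

lemma bounded_rv_node_term: "1 \<le> i \<Longrightarrow> bounded_rv (\<lambda>\<omega>. node_term \<omega> i j)"
  unfolding bounded_rv_def
  using node_term_measurable_seq[of i j] node_term_le[of _ i j]
  by (intro conjI exI[of _ "3/2"] allI) (auto simp only: abs_of_nonneg[OF node_term_nonneg])

lemma bounded_rv_framed: "j \<le> n + 1 \<Longrightarrow> bounded_rv (\<lambda>\<omega>. node_term (framed n \<omega>) i j)"
  unfolding bounded_rv_def
  using framed_node_term_measurable[of j n i] node_term_le[of _ i j]
  by (intro conjI exI[of _ "3/2"] allI) (auto simp only: abs_of_nonneg[OF node_term_nonneg])

text \<open>
  Minkowski's inequality in the weighted form of Cauchy and Schwarz: a term with second
  moment \<open>c i * w i\<close> is charged the weight \<open>w i\<close>.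
\<close>
lemma integral_square_sum_le:
  assumes I: "finite I" "\<And>i. i \<in> I \<Longrightarrow> bounded_rv (x i)" "\<And>i. i \<in> I \<Longrightarrow> 0 < w i"
    and le: "\<And>i. i \<in> I \<Longrightarrow> (\<integral>\<omega>. (x i \<omega>)\<^sup>2 \<partial>unif_seq) \<le> c i * w i"
  shows "(\<integral>\<omega>. (\<Sum>i\<in>I. x i \<omega>)\<^sup>2 \<partial>unif_seq) \<le> (\<Sum>i\<in>I. w i) * (\<Sum>i\<in>I. c i)"
proof -
  have int: "integrable unif_seq (\<lambda>\<omega>. (x i \<omega>)\<^sup>2 / w i)" if "i \<in> I" for i
    using bounded_rv_integrable[OF bounded_rv_power2[OF I(2)[OF that]]] by simp
  have "(\<integral>\<omega>. (\<Sum>i\<in>I. x i \<omega>)\<^sup>2 \<partial>unif_seq) \<le> (\<integral>\<omega>. (\<Sum>i\<in>I. w i) * (\<Sum>i\<in>I. (x i \<omega>)\<^sup>2 / w i) \<partial>unif_seq)"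
    using int I by (intro integral_mono weighted_Cauchy_Schwarz bounded_rv_integrable[OF bounded_rv_power2] bounded_rv_sum)
      (auto intro!: integrable_mult_right Bochner_Integration.integrable_sum)
  also have "\<dots> = (\<Sum>i\<in>I. w i) * (\<Sum>i\<in>I. (\<integral>\<omega>. (x i \<omega>)\<^sup>2 \<partial>unif_seq) / w i)"
    using int by (simp add: Bochner_Integration.integral_sum)
  also have "\<dots> \<le> (\<Sum>i\<in>I. w i) * (\<Sum>i\<in>I. c i)"
    using I le by (intro mult_left_mono sum_mono sum_nonneg) (auto simp: divide_le_eq less_imp_le)
  finally show ?thesis .
qed

text \<open>
  Intervals away from the boundary have two random walls, so their terms are stationary; \<open>outer\<close> collects the others.
\<close>
definition inner :: "nat \<Rightarrow> (nat \<Rightarrow> real) \<Rightarrow> real" where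
  "inner n \<omega> = (\<Sum>(a, b)\<in>subintervals 1 n. node_term \<omega> a b)"

definition outer :: "nat \<Rightarrow> (nat \<Rightarrow> real) \<Rightarrow> real" where
  "outer n \<omega> = (\<Sum>d=1..n. node_term (framed n \<omega>) 0 d) + (\<Sum>d=1..n. node_term (framed n \<omega>) (n + 1 - d) (n + 1))
     + node_term (framed n \<omega>) 0 (n + 1)"

lemma outer_nonneg: "0 \<le> outer n \<omega>"
  unfolding outer_def by (intro add_nonneg_nonneg sum_nonneg node_term_nonneg)

lemma bounded_rv_inner: "bounded_rv (inner n)"
  unfolding inner_def[abs_def] split_beta
  by (intro bounded_rv_sum bounded_rv_node_term) (auto simp: subintervals_def)

lemma bounded_rv_outer: "bounded_rv (outer n)"
  unfolding outer_def[abs_def]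
  by (intro bounded_rv_sum bounded_rv_add bounded_rv_framed) auto

lemma AE_tree_cost_eq: "AE \<omega> in unif_seq. tree_cost \<omega> 0 (n + 1) = inner n \<omega> + outer n \<omega>"
  using AE_unif_seq_inj AE_unif_seq_between
proof eventually_elim
  case (elim \<omega>)
  have "tree_cost \<omega> 0 (n + 1) = tree_cost (framed n \<omega>) 0 (n + 1)"
    by (intro tree_cost_cong) auto
  also have "\<dots> = (\<Sum>(a, b)\<in>subintervals 0 (n + 1). node_term (framed n \<omega>) a b)"
  proof (rule tree_cost_eq_sum)
    show "is_node (framed n \<omega>) 0 (n + 1)"
      unfolding is_node_def using elim(2) by (auto intro: less_trans[of "-1" 0])
    show "inj_on (framed n \<omega>) {0<..<n + 1}"
    proof (rule inj_onI)
      fix x y assume "x \<in> {0<..<n + 1}" "y \<in> {0<..<n + 1}" "framed n \<omega> x = framed n \<omega> y"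
      then show "x = y" using inj_onD[OF elim(1), of x y] by auto
    qed
  qed
  also have "subintervals 0 (n + 1) = subintervals 1 n \<union> (Pair 0 ` {1..n} \<union> ((\<lambda>d. (n + 1 - d, n + 1)) ` {1..n} \<union> {(0, n + 1)}))"
  proof (intro set_eqI iffI)
    fix p assume "p \<in> subintervals 0 (n + 1)"
    then obtain a b where p: "p = (a, b)" "a < b" "b \<le> n + 1" by (auto simp: subintervals_def)
    consider "1 \<le> a" "b \<le> n" | "a = 0" "b \<le> n" | "1 \<le> a" "b = n + 1" | "a = 0" "b = n + 1" using p by linarith
    then show "p \<in> subintervals 1 n \<union> (Pair 0 ` {1..n} \<union> ((\<lambda>d. (n + 1 - d, n + 1)) ` {1..n} \<union> {(0, n + 1)}))"
    proof cases
      case 3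
      then have "p = (\<lambda>d. (n + 1 - d, n + 1)) (n + 1 - a)" "n + 1 - a \<in> {1..n}" using p by auto
      then show ?thesis by blast
    qed (use p in \<open>auto simp: subintervals_def\<close>)
  qed (auto simp: subintervals_def)
  also have "(\<Sum>(a, b)\<in>\<dots>. node_term (framed n \<omega>) a b) = (\<Sum>(a, b)\<in>subintervals 1 n. node_term (framed n \<omega>) a b) + outer n \<omega>"
  proof -
    have i1: "inj_on (Pair 0) {1..n}" by (auto intro: inj_onI)
    have i2: "inj_on (\<lambda>d. (n + 1 - d, n + 1)) {1..n}" by (auto simp: inj_on_def)
    let ?g = "\<lambda>(a, b). node_term (framed n \<omega>) a b"
    have "sum ?g (subintervals 1 n \<union> (Pair 0 ` {1..n} \<union> ((\<lambda>d. (n + 1 - d, n + 1)) ` {1..n} \<union> {(0, n + 1)})))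
      = sum ?g (subintervals 1 n) + (sum ?g (Pair 0 ` {1..n}) + (sum ?g ((\<lambda>d. (n + 1 - d, n + 1)) ` {1..n}) + sum ?g {(0, n + 1)}))"
      by (intro sum.union_disjoint[THEN trans] arg_cong2[where f="(+)"] refl) (simp_all, auto simp: subintervals_def)
    also have "sum ?g (Pair 0 ` {1..n}) = (\<Sum>d=1..n. node_term (framed n \<omega>) 0 d)"
      by (subst sum.reindex[OF i1]) simp
    also have "sum ?g ((\<lambda>d. (n + 1 - d, n + 1)) ` {1..n}) = (\<Sum>d=1..n. node_term (framed n \<omega>) (n + 1 - d) (n + 1))"
      by (subst sum.reindex[OF i2]) simp
    finally show ?thesis by (simp add: outer_def)
  qed
  also have "(\<Sum>(a, b)\<in>subintervals 1 n. node_term (framed n \<omega>) a b) = inner n \<omega>"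
    unfolding inner_def by (intro sum.cong refl) (auto simp: subintervals_def intro!: node_term_cong)
  finally show ?case .
qed

text \<open>
  Negligible against the variance, which is linear in \<open>n\<close>. The weights \<open>d powr (-3/4)\<close> split the exponent
  \<open>-3/2\<close> of the boundary moments evenly and sum to \<open>4 * n powr (1/4)\<close>.
\<close>
lemma outer_second_moment:
  assumes n: "1 \<le> n"
  shows "(\<integral>\<omega>. (outer n \<omega>)\<^sup>2 \<partial>unif_seq) \<le> 3100 * sqrt (real n)"
proof -
  define s where "s = (\<Sum>d=1..n. real d powr (-3/4))"
  have s: "0 \<le> s" "s \<le> 4 * real n powr (1/4)"
    using sum_powr_le[of "3/4" n] by (auto simp: s_def intro!: sum_nonneg)
  have "s\<^sup>2 \<le> (4 * real n powr (1/4))\<^sup>2" using s by (intro power_mono) auto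
  also have "\<dots> = 16 * sqrt (real n)" by (simp add: power2_eq_square powr_add[symmetric] powr_half_sqrt)
  finally have s2: "s\<^sup>2 \<le> 16 * sqrt (real n)" .
  define x1 x2 x3 where "x1 = (\<lambda>\<omega>. \<Sum>d=1..n. node_term (framed n \<omega>) 0 d)"
    and "x2 = (\<lambda>\<omega>. \<Sum>d=1..n. node_term (framed n \<omega>) (n + 1 - d) (n + 1))"
    and "x3 = (\<lambda>\<omega>. node_term (framed n \<omega>) 0 (n + 1))"
  have b: "bounded_rv x1" "bounded_rv x2" "bounded_rv x3"
    unfolding x1_def x2_def x3_def by (intro bounded_rv_sum bounded_rv_framed; simp)+
  have 1: "(\<integral>\<omega>. (x1 \<omega>)\<^sup>2 \<partial>unif_seq) \<le> s * (\<Sum>d=1..n. 32 * real d powr (-3/4))"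
    unfolding x1_def s_def
  proof (rule integral_square_sum_le)
    fix d assume d: "d \<in> {1..n}"
    show "(\<integral>\<omega>. (node_term (framed n \<omega>) 0 d)\<^sup>2 \<partial>unif_seq) \<le> 32 * real d powr (-3/4) * real d powr (-3/4)"
      using boundary_second_moment[of d n 0 d d] d by (simp add: power2_eq_square)
  qed (auto intro: bounded_rv_framed)
  have 2: "(\<integral>\<omega>. (x2 \<omega>)\<^sup>2 \<partial>unif_seq) \<le> s * (\<Sum>d=1..n. 32 * real d powr (-3/4))"
    unfolding x2_def s_def
  proof (rule integral_square_sum_le)
    fix d assume d: "d \<in> {1..n}"
    show "(\<integral>\<omega>. (node_term (framed n \<omega>) (n + 1 - d) (n + 1))\<^sup>2 \<partial>unif_seq) \<le> 32 * real d powr (-3/4) * real d powr (-3/4)"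
      using boundary_second_moment[of d n "n + 1 - d" "n + 1" "n + 1 - d"] d by (simp add: power2_eq_square)
  qed (auto intro!: bounded_rv_framed)
  have 3: "(\<integral>\<omega>. (x3 \<omega>)\<^sup>2 \<partial>unif_seq) \<le> (\<integral>\<omega>. 9/4 \<partial>unif_seq)"
  proof (intro integral_mono bounded_rv_integrable bounded_rv_power2 b bounded_rv_const)
    fix \<omega>
    have "(x3 \<omega>)\<^sup>2 \<le> (3/2)\<^sup>2" unfolding x3_def by (intro power_mono node_term_le node_term_nonneg)
    then show "(x3 \<omega>)\<^sup>2 \<le> 9/4" by (simp add: power_divide)
  qed
  have "(\<integral>\<omega>. (outer n \<omega>)\<^sup>2 \<partial>unif_seq) \<le> (\<integral>\<omega>. 3 * (x1 \<omega>)\<^sup>2 + 3 * (x2 \<omega>)\<^sup>2 + 3 * (x3 \<omega>)\<^sup>2 \<partial>unif_seq)"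
  proof (intro integral_mono bounded_rv_integrable bounded_rv_power2 bounded_rv_outer bounded_rv_add bounded_rv_mult b bounded_rv_const)
    fix \<omega>
    have "0 \<le> (x1 \<omega> - x2 \<omega>)\<^sup>2 + (x1 \<omega> - x3 \<omega>)\<^sup>2 + (x2 \<omega> - x3 \<omega>)\<^sup>2" by simp
    then show "(outer n \<omega>)\<^sup>2 \<le> 3 * (x1 \<omega>)\<^sup>2 + 3 * (x2 \<omega>)\<^sup>2 + 3 * (x3 \<omega>)\<^sup>2"
      unfolding outer_def x1_def[symmetric] x2_def[symmetric] x3_def[symmetric]
      by (simp add: outer_def x1_def x2_def x3_def power2_eq_square algebra_simps)
  qed
  also have "\<dots> = 3 * (\<integral>\<omega>. (x1 \<omega>)\<^sup>2 \<partial>unif_seq) + 3 * (\<integral>\<omega>. (x2 \<omega>)\<^sup>2 \<partial>unif_seq) + 3 * (\<integral>\<omega>. (x3 \<omega>)\<^sup>2 \<partial>unif_seq)"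
    using b[THEN bounded_rv_power2, THEN bounded_rv_integrable] by simp
  also have "\<dots> \<le> 3 * (32 * s\<^sup>2) + 3 * (32 * s\<^sup>2) + 3 * (9/4)"
  proof -
    have "s * (\<Sum>d=1..n. 32 * real d powr (-3/4)) = 32 * s\<^sup>2"
      unfolding s_def power2_eq_square by (simp add: sum_distrib_left[symmetric])
    then show ?thesis using 1 2 3 by (simp add: unif_seq.prob_space)
  qed
  also have "\<dots> \<le> 3100 * sqrt (real n)"
  proof -
    have "1 \<le> sqrt (real n)" using n by simp
    then show ?thesis using s2 by linarith
  qed
  finally show ?thesis .
qed

section \<open>Independence and blocks\<close>

lemma coordinates_indep: "unif_seq.indep_vars (\<lambda>_. unif01) (\<lambda>i \<omega>. \<omega> i) {1..}"
proof (subst unif_seq.indep_vars_iff_distr_eq_PiM')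
  have comp: "distr unif_seq unif01 (\<lambda>\<omega>. \<omega> i) = unif01" if "i \<in> {1..}" for i
    unfolding unif_seq_def using that by (intro distr_PiM_component unif01.prob_space_axioms)
  have id: "reindex (\<lambda>n. n) = (\<lambda>\<omega>. \<lambda>i\<in>{1..}. \<omega> i)" by (simp add: reindex_def[abs_def])
  have "distr unif_seq (\<Pi>\<^sub>M i\<in>{1..}. unif01) (\<lambda>\<omega>. \<lambda>i\<in>{1..}. \<omega> i) = distr unif_seq unif_seq (reindex (\<lambda>n. n))"
    unfolding id unif_seq_def by simp
  also have "\<dots> = unif_seq" by (rule distr_reindex) auto
  also have "\<dots> = (\<Pi>\<^sub>M i\<in>{1..}. distr unif_seq unif01 (\<lambda>\<omega>. \<omega> i))"
    unfolding unif_seq_def[of] by (rule PiM_cong) (use comp in \<open>auto simp: unif_seq_def\<close>)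
  finally show "distr unif_seq (\<Pi>\<^sub>M i\<in>{1..}. unif01) (\<lambda>\<omega>. \<lambda>i\<in>{1..}. \<omega> i)
    = (\<Pi>\<^sub>M i\<in>{1..}. distr unif_seq unif01 (\<lambda>\<omega>. \<omega> i))" .
qed (auto simp: coordinate_measurable measurable_cong_sets[OF refl sets_unif01])

lemma blocks_indep:
  assumes K: "disjoint_family_on K J" "\<And>j. j \<in> J \<Longrightarrow> K j \<subseteq> {1..}"
    and g: "\<And>j. j \<in> J \<Longrightarrow> g j \<in> borel_measurable (PiM (K j) (\<lambda>_. unif01))"
  shows "unif_seq.indep_vars (\<lambda>_. borel) (\<lambda>j \<omega>. g j (restrict \<omega> (K j)) :: real) J"
  using unif_seq.indep_vars_compose2[OF unif_seq.indep_vars_restrict[OF coordinates_indep K(2,1)] g] by simp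

lemma expectation_mult_disjoint:
  assumes AB: "A \<inter> B = {}" "A \<subseteq> {1..}" "B \<subseteq> {1..}"
    and g: "g \<in> borel_measurable (PiM A (\<lambda>_. unif01))" "h \<in> borel_measurable (PiM B (\<lambda>_. unif01))"
    and gh: "\<And>\<omega>. g' \<omega> = g (restrict \<omega> A)" "\<And>\<omega>. h' \<omega> = h (restrict \<omega> B)"
    and int: "integrable unif_seq g'" "integrable unif_seq h'"
  shows "(\<integral>\<omega>. g' \<omega> * h' \<omega> \<partial>unif_seq) = (\<integral>\<omega>. g' \<omega> \<partial>unif_seq) * (\<integral>\<omega>. h' \<omega> \<partial>unif_seq :: real)"
proof -
  define K where "K = (\<lambda>b. if b then A else B)"
  define X where "X = (\<lambda>b. if b then g' else h')"
  have "unif_seq.indep_vars (\<lambda>_. borel) (\<lambda>b \<omega>. (if b then g else h) (restrict \<omega> (K b))) (UNIV :: bool set)"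
    by (rule blocks_indep) (use AB g in \<open>auto simp: K_def disjoint_family_on_def\<close>)
  also have "(\<lambda>b \<omega>. (if b then g else h) (restrict \<omega> (K b))) = X"
    by (auto simp: X_def K_def gh fun_eq_iff)
  finally have "unif_seq.indep_vars (\<lambda>_. borel) X UNIV" .
  then have "(\<integral>\<omega>. (\<Prod>b\<in>UNIV. X b \<omega>) \<partial>unif_seq) = (\<Prod>b\<in>UNIV. \<integral>\<omega>. X b \<omega> \<partial>unif_seq)"
    using int by (intro unif_seq.indep_vars_lebesgue_integral) (auto simp: X_def)
  then show ?thesis by (simp add: UNIV_bool X_def mult.commute)
qed

lemma node_term_restrict: "{i..j} \<subseteq> A \<Longrightarrow> node_term \<omega> i j = node_term (restrict \<omega> A) i j"
  by (rule node_term_cong) auto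

lemma node_term_measurable_PiM:
  assumes "{i..j} \<subseteq> A" shows "(\<lambda>\<omega>. node_term \<omega> i j) \<in> borel_measurable (PiM A (\<lambda>_. unif01))"
proof (rule node_term_measurable)
  fix l assume "i \<le> l" "l \<le> j"
  then have "l \<in> A" using assms by auto
  then have "(\<lambda>\<omega>. \<omega> l) \<in> measurable (PiM A (\<lambda>_. unif01)) unif01" by (rule measurable_component_singleton)
  then show "(\<lambda>\<omega>. \<omega> l) \<in> borel_measurable (PiM A (\<lambda>_. unif01))"
    by (simp add: measurable_cong_sets[OF refl sets_unif01])
qed

text \<open>
  Two overlapping intervals of the same length cannot both be owned by nodes: each would have a wall in the interior of
  the other one.
\<close>
lemma node_term_overlap:
  assumes "i < i'" "i' < i + d"
  shows "node_term u i (i + d) * node_term u i' (i' + d) = 0"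
proof -
  have "\<not> (is_node u i (i + d) \<and> is_node u i' (i' + d))"
  proof
    assume "is_node u i (i + d) \<and> is_node u i' (i' + d)"
    then have "u (i + d) < u i'" "u i' < u (i + d)" using assms by (auto simp: is_node_def)
    then show False by simp
  qed
  then show ?thesis by (auto simp: node_term_def)
qed

text \<open>
  Of the intervals of length \<open>d\<close>, those that overlap are never owned simultaneously, which makes the covariance
  nonpositive, and those that are disjoint are independent. Positive covariance is possible only if they coincide or share
  a wall, which leaves three partners per interval.
\<close>
theorem node_term_sum_variance:
  assumes I: "finite I" "I \<subseteq> {1..}" and d: "1 \<le> d"
  shows "(\<integral>\<omega>. (\<Sum>i\<in>I. node_term \<omega> i (i + d) - (\<integral>\<omega>. node_term \<omega> i (i + d) \<partial>unif_seq))\<^sup>2 \<partial>unif_seq)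
    \<le> 3 * real (card I) * moment_const d"
proof -
  define f where "f i \<omega> = node_term \<omega> i (i + d)" for i and \<omega> :: "nat \<Rightarrow> real"
  define e where "e i = (\<integral>\<omega>. f i \<omega> \<partial>unif_seq)" for i
  have b: "bounded_rv (f i)" if "i \<in> I" for i unfolding f_def using that I by (intro bounded_rv_node_term) auto
  have b': "bounded_rv (\<lambda>\<omega>. f i \<omega> - e i)" if "i \<in> I" for i by (intro bounded_rv_diff b that bounded_rv_const)
  have e0: "0 \<le> e i" for i unfolding e_def f_def by (intro integral_nonneg_AE) (simp add: node_term_nonneg)
  have M: "(\<integral>\<omega>. (f i \<omega>)\<^sup>2 \<partial>unif_seq) \<le> moment_const d" if "i \<in> I" for i
    unfolding f_def using that I d by (intro node_term_second_moment) auto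
  have M0: "0 \<le> moment_const d" by (simp add: moment_const_def)
  have cov: "(\<integral>\<omega>. (f i \<omega> - e i) * (f i' \<omega> - e i') \<partial>unif_seq) \<le> (if i' \<in> {i, i + d} \<or> i = i' + d then moment_const d else 0)"
    if ii: "i \<in> I" "i' \<in> I" for i i'
  proof -
    have int: "integrable unif_seq (f i)" "integrable unif_seq (f i')" "integrable unif_seq (\<lambda>\<omega>. f i \<omega> * f i' \<omega>)"
      by (intro bounded_rv_integrable bounded_rv_mult b ii)+
    have "(\<integral>\<omega>. (f i \<omega> - e i) * (f i' \<omega> - e i') \<partial>unif_seq)
      = (\<integral>\<omega>. f i \<omega> * f i' \<omega> - e i' * f i \<omega> - e i * f i' \<omega> + e i * e i' \<partial>unif_seq)"
      by (simp add: algebra_simps)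
    also have "\<dots> = (\<integral>\<omega>. f i \<omega> * f i' \<omega> \<partial>unif_seq) - e i * e i'"
      using int by (simp add: e_def[symmetric] unif_seq.prob_space)
    finally have eq: "(\<integral>\<omega>. (f i \<omega> - e i) * (f i' \<omega> - e i') \<partial>unif_seq) = (\<integral>\<omega>. f i \<omega> * f i' \<omega> \<partial>unif_seq) - e i * e i'" .
    show ?thesis
    proof (cases "i' \<in> {i, i + d} \<or> i = i' + d")
      case True
      have "(\<integral>\<omega>. f i \<omega> * f i' \<omega> \<partial>unif_seq) \<le> (\<integral>\<omega>. 1/2 * (f i \<omega>)\<^sup>2 + 1/2 * (f i' \<omega>)\<^sup>2 \<partial>unif_seq)"
      proof (intro integral_mono bounded_rv_integrable bounded_rv_mult bounded_rv_add bounded_rv_power2 b ii bounded_rv_const)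
        fix \<omega>
        have "0 \<le> (f i \<omega> - f i' \<omega>)\<^sup>2" by simp
        then show "f i \<omega> * f i' \<omega> \<le> 1/2 * (f i \<omega>)\<^sup>2 + 1/2 * (f i' \<omega>)\<^sup>2" by (simp add: power2_eq_square algebra_simps)
      qed
      also have "\<dots> = 1/2 * (\<integral>\<omega>. (f i \<omega>)\<^sup>2 \<partial>unif_seq) + 1/2 * (\<integral>\<omega>. (f i' \<omega>)\<^sup>2 \<partial>unif_seq)"
        using b[OF ii(1), THEN bounded_rv_power2, THEN bounded_rv_integrable] b[OF ii(2), THEN bounded_rv_power2, THEN bounded_rv_integrable]
        by simp
      also have "\<dots> \<le> moment_const d" using M[OF ii(1)] M[OF ii(2)] by simp
      finally have "(\<integral>\<omega>. f i \<omega> * f i' \<omega> \<partial>unif_seq) \<le> moment_const d" .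
      moreover have "0 \<le> e i * e i'" using e0 by simp
      ultimately have "(\<integral>\<omega>. (f i \<omega> - e i) * (f i' \<omega> - e i') \<partial>unif_seq) \<le> moment_const d"
        unfolding eq by linarith
      then show ?thesis using True by simp
    next
      case False
      have "(\<integral>\<omega>. f i \<omega> * f i' \<omega> \<partial>unif_seq) \<le> e i * e i'"
      proof (cases "i + d < i' \<or> i' + d < i")
        case True
        have "(\<integral>\<omega>. f i \<omega> * f i' \<omega> \<partial>unif_seq) = (\<integral>\<omega>. f i \<omega> \<partial>unif_seq) * (\<integral>\<omega>. f i' \<omega> \<partial>unif_seq)"
        proof (rule expectation_mult_disjoint[where A="{i..i + d}" and B="{i'..i' + d}"])
          show "f i \<omega> = node_term (restrict \<omega> {i..i + d}) i (i + d)" "f i' \<omega> = node_term (restrict \<omega> {i'..i' + d}) i' (i' + d)" for \<omega>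
            unfolding f_def by (rule node_term_restrict; simp)+
        qed (use True ii I int in \<open>auto intro!: node_term_measurable_PiM\<close>)
        then show ?thesis by (simp add: e_def)
      next
        case F: False
        then have "i < i' \<and> i' < i + d \<or> i' < i \<and> i < i' + d" using False by auto
        then have "f i \<omega> * f i' \<omega> = 0" for \<omega>
          unfolding f_def using node_term_overlap[of i i' d \<omega>] node_term_overlap[of i' i d \<omega>] by (metis mult.commute)
        then have "(\<lambda>\<omega>. f i \<omega> * f i' \<omega>) = (\<lambda>_. 0)" by (rule ext)
        then show ?thesis using e0 by (simp only:) simp
      qed
      then show ?thesis using eq False by simp
    qed
  qed
  have "(\<integral>\<omega>. (\<Sum>i\<in>I. f i \<omega> - e i)\<^sup>2 \<partial>unif_seq) = (\<integral>\<omega>. (\<Sum>i\<in>I. \<Sum>i'\<in>I. (f i \<omega> - e i) * (f i' \<omega> - e i')) \<partial>unif_seq)"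
    by (simp add: power2_eq_square sum_product)
  also have "\<dots> = (\<Sum>i\<in>I. \<Sum>i'\<in>I. (\<integral>\<omega>. (f i \<omega> - e i) * (f i' \<omega> - e i') \<partial>unif_seq))"
    using b' by (subst Bochner_Integration.integral_sum) (auto intro!: bounded_rv_integrable bounded_rv_sum bounded_rv_mult sum.cong Bochner_Integration.integral_sum)
  also have "\<dots> \<le> (\<Sum>i\<in>I. \<Sum>i'\<in>I. (if i' \<in> {i, i + d} \<or> i = i' + d then moment_const d else 0))"
    by (intro sum_mono cov)
  also have "\<dots> \<le> (\<Sum>i\<in>I. 3 * moment_const d)"
  proof (rule sum_mono)
    fix i assume "i \<in> I"
    have "(\<Sum>i'\<in>I. (if i' \<in> {i, i + d} \<or> i = i' + d then moment_const d else 0))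
      = real (card {i' \<in> I. i' \<in> {i, i + d} \<or> i = i' + d}) * moment_const d"
      using I(1) by (subst sum.inter_filter[symmetric]) auto
    also have "\<dots> \<le> 3 * moment_const d"
    proof (rule mult_right_mono[OF _ M0])
      have "card {i' \<in> I. i' \<in> {i, i + d} \<or> i = i' + d} \<le> card {i, i + d, i - d}"
        by (rule card_mono) auto
      also have "\<dots> \<le> 3" by (auto simp: card_insert_if)
      finally show "real (card {i' \<in> I. i' \<in> {i, i + d} \<or> i = i' + d}) \<le> 3" by simp
    qed
    finally show "(\<Sum>i'\<in>I. (if i' \<in> {i, i + d} \<or> i = i' + d then moment_const d else 0)) \<le> 3 * moment_const d" .
  qed
  finally show ?thesis unfolding f_def e_def by (simp add: mult_ac)
qed

lemma argmin_between_shift: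
  assumes "i + 1 < j"
  shows "argmin_between u (i + c) (j + c) = argmin_between (\<lambda>n. u (n + c)) i j + c"
proof (rule argmin_between_eqI)
  note p = argmin_between_props[OF assms, where u="\<lambda>n. u (n + c)"]
  let ?m = "argmin_between (\<lambda>n. u (n + c)) i j"
  show "i + c < ?m + c" "?m + c < j + c" using p(1,2) by auto
  show "u (?m + c) < u l" if "i + c < l" "l < ?m + c" for l using p(4)[of "l - c"] that by auto
  show "u (?m + c) \<le> u l" if "?m + c < l" "l < j + c" for l using p(1) p(3)[of "l - c"] that by auto
qed

lemma tree_cost_shift: "tree_cost (\<lambda>n. u (n + c)) i j = tree_cost u (i + c) (j + c)"
proof (induction i j rule: interval_induct)
  case (less i j)
  show ?case
  proof (cases "i + 1 < j")
    case True
    note p = argmin_between_props(1,2)[OF True, where u="\<lambda>n. u (n + c)"]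
    show ?thesis
      using True less.IH[of "argmin_between (\<lambda>n. u (n + c)) i j" i] less.IH[of j "argmin_between (\<lambda>n. u (n + c)) i j"] p
      by (simp add: tree_cost_rec[of i] tree_cost_rec[of "i + c"] argmin_between_shift[OF True])
  qed simp
qed

lemma node_term_shift: "node_term (\<lambda>n. u (n + c)) i j = node_term u (i + c) (j + c)"
proof -
  have "is_node (\<lambda>n. u (n + c)) i j \<longleftrightarrow> is_node u (i + c) (j + c)"
  proof
    assume n: "is_node (\<lambda>n. u (n + c)) i j"
    show "is_node u (i + c) (j + c)" unfolding is_node_def
    proof (intro allI impI)
      fix l assume "i + c < l \<and> l < j + c"
      then have "i < l - c \<and> l - c < j" "l - c + c = l" by auto
      then show "u (i + c) < u l \<and> u (j + c) < u l" using n[unfolded is_node_def, rule_format, of "l - c"] by auto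
    qed
  qed (auto simp: is_node_def)
  moreover have "node_excess (\<lambda>n. u (n + c)) i j = node_excess u (i + c) (j + c)"
  proof (cases "i + 1 < j")
    case True
    then show ?thesis by (simp add: node_excess_def tree_cost_shift argmin_between_shift[OF True])
  qed (simp add: node_excess_def)
  ultimately show ?thesis by (simp add: node_term_def)
qed

definition shift :: "nat \<Rightarrow> (nat \<Rightarrow> real) \<Rightarrow> nat \<Rightarrow> real" where
  "shift c = reindex (\<lambda>n. n + c)"

lemma shift_ok: "inj_on (\<lambda>n. n + c) {1..}" "(\<lambda>n. n + c) \<in> {1..} \<rightarrow> {1::nat..}"
  by (auto intro: inj_onI)

lemma node_term_shift_seq: "1 \<le> i \<Longrightarrow> node_term (shift c \<omega>) i j = node_term \<omega> (i + c) (j + c)"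
  unfolding node_term_shift[symmetric] by (rule node_term_cong) (auto simp: shift_def)

definition node_mean :: "nat \<Rightarrow> real" where
  "node_mean d = (\<integral>\<omega>. node_term \<omega> 1 (1 + d) \<partial>unif_seq)"

lemma expectation_node_term: "1 \<le> i \<Longrightarrow> (\<integral>\<omega>. node_term \<omega> i (i + d) \<partial>unif_seq) = node_mean d"
proof -
  assume i: "1 \<le> i"
  have "node_mean d = (\<integral>\<omega>. node_term (shift (i - 1) \<omega>) 1 (1 + d) \<partial>unif_seq)"
    unfolding node_mean_def shift_def
    by (rule integral_reindex[OF shift_ok, symmetric]) (rule node_term_measurable_seq, simp)
  also have "\<dots> = (\<integral>\<omega>. node_term \<omega> i (i + d) \<partial>unif_seq)"
    using i by (simp add: node_term_shift_seq add.commute)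
  finally show ?thesis ..
qed

definition block :: "nat \<Rightarrow> nat \<Rightarrow> (nat \<Rightarrow> real) \<Rightarrow> real" where
  "block L b \<omega> = (\<Sum>(i, j)\<in>subintervals (b * L + 1) ((b + 1) * L). node_term \<omega> i j)"

lemma bounded_rv_block: "bounded_rv (block L b)"
  unfolding block_def[abs_def] split_beta
  by (intro bounded_rv_sum bounded_rv_node_term) (auto simp: subintervals_def)

lemma block_shift: "block L b \<omega> = block L 0 (shift (b * L) \<omega>)"
  unfolding block_def
proof (rule sum.reindex_bij_witness[of _ "\<lambda>(i, j). (i + b * L, j + b * L)" "\<lambda>(i, j). (i - b * L, j - b * L)"], goal_cases)
  case (5 a)
  then show ?case by (auto simp: subintervals_def node_term_shift_seq)
qed (auto simp: subintervals_def)

lemma distr_block: "distr unif_seq borel (block L b) = distr unif_seq borel (block L 0)"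
proof -
  have "distr unif_seq borel (block L 0) = distr (distr unif_seq unif_seq (shift (b * L))) borel (block L 0)"
    unfolding shift_def by (simp only: distr_reindex[OF shift_ok])
  also have "\<dots> = distr unif_seq borel (block L 0 \<circ> shift (b * L))"
    using bounded_rv_block[of L 0] unfolding shift_def
    by (intro distr_distr reindex_measurable[OF shift_ok]) (simp add: bounded_rv_def)
  also have "block L 0 \<circ> shift (b * L) = block L b" by (auto simp: block_shift[of L b])
  finally show ?thesis ..
qed

lemma blocks_iid_indep: "unif_seq.indep_vars (\<lambda>_. borel) (block L) UNIV"
proof -
  define K where "K b = {b * L + 1..(b + 1) * L}" for b
  have "disjoint_family_on K UNIV"
    unfolding disjoint_family_on_def
  proof (intro ballI impI)
    fix a b :: nat assume "a \<noteq> b"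
    then consider "a + 1 \<le> b" | "b + 1 \<le> a" by linarith
    then show "K a \<inter> K b = {}"
    proof cases
      case 1
      then have "(a + 1) * L \<le> b * L" by (rule mult_le_mono1)
      then show ?thesis by (auto simp: K_def)
    next
      case 2
      then have "(b + 1) * L \<le> a * L" by (rule mult_le_mono1)
      then show ?thesis by (auto simp: K_def)
    qed
  qed
  then have "unif_seq.indep_vars (\<lambda>_. borel) (\<lambda>b \<omega>. block L b (restrict \<omega> (K b))) UNIV"
  proof (rule blocks_indep)
    fix b
    show "block L b \<in> borel_measurable (PiM (K b) (\<lambda>_. unif01))"
      unfolding block_def[abs_def] split_beta
      by (intro borel_measurable_sum node_term_measurable_PiM) (auto simp: subintervals_def K_def)
  qed (auto simp: K_def)
  also have "(\<lambda>b \<omega>. block L b (restrict \<omega> (K b))) = block L"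
    unfolding block_def[abs_def] fun_eq_iff
    by (intro allI sum.cong refl) (auto simp: subintervals_def K_def intro!: node_term_restrict[symmetric])
  finally show ?thesis .
qed

definition straddling :: "nat \<Rightarrow> nat \<Rightarrow> nat \<Rightarrow> nat set" where
  "straddling n L d = {i \<in> {1..n - d}. \<forall>b<n div L. \<not> (b * L + 1 \<le> i \<and> i + d \<le> (b + 1) * L)}"

lemma finite_straddling [simp]: "finite (straddling n L d)"
  by (simp add: straddling_def)

lemma straddling_subset: "straddling n L d \<subseteq> {1..}"
  by (auto simp: straddling_def)

text \<open>
  There are at most \<open>n\<close> such intervals, and at most \<open>L + (n div L) * d\<close>, since an interval inside the
  range of the blocks ends beyond its own block only if it starts among the last \<open>d\<close> positions. The power \<open>1/8\<close> interpolates between the bounds. It is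
  positive, so the bound is small for large \<open>L\<close>, and small enough for \<open>d powr (1/8 - 5/4)\<close> to be summable.
\<close>
lemma card_straddling:
  assumes L: "1 \<le> L" and d: "1 \<le> d"
  shows "real (card (straddling n L d)) \<le> real L + real n * (real d / real L) powr (1/8)"
proof -
  define N where "N = n div L"
  have n: "n = N * L + n mod L" "n mod L < L" using L by (simp_all add: N_def)
  have c1: "card (straddling n L d) \<le> n"
  proof -
    have "straddling n L d \<subseteq> {1..n}" by (auto simp: straddling_def)
    from card_mono[OF _ this] show ?thesis by simp
  qed
  have c2: "card (straddling n L d) \<le> N * d + L"
  proof -
    have "straddling n L d \<subseteq> (\<Union>b<N. {(b + 1) * L + 1 - d..(b + 1) * L}) \<union> {N * L + 1..N * L + L}"
    proof
      fix i assume i: "i \<in> straddling n L d"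
      have in': "1 \<le> i" "i \<le> n" using i by (auto simp: straddling_def)
      show "i \<in> (\<Union>b<N. {(b + 1) * L + 1 - d..(b + 1) * L}) \<union> {N * L + 1..N * L + L}"
      proof (cases "i \<le> N * L")
        case True
        define b where "b = (i - 1) div L"
        have b: "b * L \<le> i - 1" "i - 1 < b * L + L"
          using L div_mult_mod_eq[of "i - 1" L] mod_less_divisor[of L "i - 1"] unfolding b_def by linarith+
        have "b * L < N * L" using b True in' by linarith
        then have bN: "b < N" by simp
        have "\<not> (b * L + 1 \<le> i \<and> i + d \<le> (b + 1) * L)" using i bN by (auto simp: straddling_def N_def)
        then have "(b + 1) * L < i + d" using b in' by auto
        then have "i \<in> {(b + 1) * L + 1 - d..(b + 1) * L}" using b in' by auto
        then show ?thesis using bN by blast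
      next
        case False
        then show ?thesis using in' n by auto
      qed
    qed
    then have "card (straddling n L d) \<le> card ((\<Union>b<N. {(b + 1) * L + 1 - d..(b + 1) * L}) \<union> {N * L + 1..N * L + L})"
      by (intro card_mono) auto
    also have "\<dots> \<le> (\<Sum>b<N. card {(b + 1) * L + 1 - d..(b + 1) * L}) + card {N * L + 1..N * L + L}"
      by (intro order_trans[OF card_Un_le] add_mono card_UN_le) auto
    also have "(\<Sum>b<N. card {(b + 1) * L + 1 - d..(b + 1) * L}) \<le> (\<Sum>b<N. d)"
      by (intro sum_mono) auto
    finally show ?thesis by simp
  qed
  have L0: "0 < real L" using L by simp
  show ?thesis
  proof (cases "L \<le> d")
    case True
    then have "1 \<le> (real d / real L) powr (1/8)" using L by (intro ge_one_powr_ge_zero) auto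
    then have "real n * 1 \<le> real n * (real d / real L) powr (1/8)" by (intro mult_left_mono) auto
    then show ?thesis using c1 by linarith
  next
    case False
    have "N * L \<le> n" by (simp add: N_def)
    then have "real N * real L \<le> real n" by (metis of_nat_le_iff of_nat_mult)
    then have "real N \<le> real n / real L" using L0 by (simp add: pos_le_divide_eq)
    then have "real N * real d \<le> real n * (real d / real L)"
      using mult_right_mono[of "real N" "real n / real L" "real d"] by simp
    also have "(real d / real L) = (real d / real L) powr 1" using d L by simp
    also have "(real d / real L) powr 1 \<le> (real d / real L) powr (1/8)"
      using False d L by (intro powr_mono') auto
    finally have "real N * real d \<le> real n * (real d / real L) powr (1/8)" by (simp add: mult_left_mono)
    moreover have "real (card (straddling n L d)) \<le> real N * real d + real L"
      using c2 by (metis of_nat_add of_nat_le_iff of_nat_mult)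
    ultimately show ?thesis by linarith
  qed
qed

lemma inner_minus_blocks:
  assumes L: "1 \<le> L"
  shows "inner n \<omega> - (\<Sum>b<n div L. block L b \<omega>) = (\<Sum>d=1..n. \<Sum>i\<in>straddling n L d. node_term \<omega> i (i + d))"
proof -
  define N where "N = n div L"
  define SB where "SB b = subintervals (b * L + 1) ((b + 1) * L)" for b
  have NL: "N * L \<le> n" by (simp add: N_def)
  have sub: "(\<Union>b<N. SB b) \<subseteq> subintervals 1 n"
  proof (rule UN_least)
    fix b assume "b \<in> {..<N}"
    then have "(b + 1) * L \<le> N * L" by (intro mult_le_mono1) auto
    then show "SB b \<subseteq> subintervals 1 n" using NL by (auto simp: SB_def subintervals_def)
  qed
  have disj: "SB a \<inter> SB b = {}" if "a \<noteq> b" for a b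
  proof -
    have "a + 1 \<le> b \<or> b + 1 \<le> a" using that by linarith
    then consider "a + 1 \<le> b" | "b + 1 \<le> a" by blast
    then show ?thesis
    proof cases
      case 1
      then have "(a + 1) * L \<le> b * L" by (rule mult_le_mono1)
      then show ?thesis by (auto simp: SB_def subintervals_def)
    next
      case 2
      then have "(b + 1) * L \<le> a * L" by (rule mult_le_mono1)
      then show ?thesis by (auto simp: SB_def subintervals_def)
    qed
  qed
  let ?g = "\<lambda>(i, j). node_term \<omega> i j"
  have "(\<Sum>b<N. block L b \<omega>) = sum ?g (\<Union>b<N. SB b)"
    unfolding block_def SB_def[symmetric] by (subst sum.UNION_disjoint) (use disj in \<open>auto simp: SB_def\<close>)
  then have "inner n \<omega> - (\<Sum>b<N. block L b \<omega>) = sum ?g (subintervals 1 n - (\<Union>b<N. SB b))"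
    unfolding inner_def using sub by (subst sum_diff) auto
  also have "\<dots> = (\<Sum>(d, i)\<in>Sigma {1..n} (straddling n L). node_term \<omega> i (i + d))"
    by (rule sum.reindex_bij_witness[of _ "\<lambda>(d, i). (i, i + d)" "\<lambda>(i, j). (j - i, i)"])
       (force simp: subintervals_def straddling_def SB_def N_def)+
  also have "\<dots> = (\<Sum>d=1..n. \<Sum>i\<in>straddling n L d. node_term \<omega> i (i + d))"
    by (subst sum.Sigma) auto
  finally show ?thesis by (simp add: N_def)
qed

section \<open>Approximation by independent blocks\<close>

lemma expectation_sum:
  "(\<And>i. i \<in> I \<Longrightarrow> bounded_rv (f i)) \<Longrightarrow> (\<integral>\<omega>. (\<Sum>i\<in>I. f i \<omega>) \<partial>unif_seq) = (\<Sum>i\<in>I. \<integral>\<omega>. f i \<omega> \<partial>unif_seq)"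
  by (intro Bochner_Integration.integral_sum bounded_rv_integrable)

lemma bounded_rv_tree_cost: "bounded_rv (\<lambda>\<omega>. tree_cost \<omega> 0 (n + 1))"
  unfolding bounded_rv_def
proof (intro conjI exI[of _ "3/2 * real n"] allI)
  show "(\<lambda>\<omega>. tree_cost \<omega> 0 (n + 1)) \<in> borel_measurable unif_seq"
    by (rule tree_cost_measurable) (auto intro: coordinate_measurable)
  show "\<bar>tree_cost \<omega> 0 (n + 1)\<bar> \<le> 3/2 * real n" for \<omega> :: "nat \<Rightarrow> real"
    using tree_cost_le[of \<omega> 0 "n + 1"] tree_cost_nonneg[of \<omega> 0 "n + 1"] by simp
qed

definition mean_cost :: "nat \<Rightarrow> real" where
  "mean_cost n = (\<integral>\<omega>. tree_cost \<omega> 0 (n + 1) \<partial>unif_seq)"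

definition deviation :: "nat \<Rightarrow> (nat \<Rightarrow> real) \<Rightarrow> real" where
  "deviation n \<omega> = tree_cost \<omega> 0 (n + 1) - mean_cost n"

lemma bounded_rv_deviation: "bounded_rv (deviation n)"
  unfolding deviation_def[abs_def] by (intro bounded_rv_diff bounded_rv_tree_cost bounded_rv_const)

lemma variance_le_second_moment:
  assumes "bounded_rv g"
  shows "(\<integral>\<omega>. (g \<omega> - (\<integral>\<omega>. g \<omega> \<partial>unif_seq))\<^sup>2 \<partial>unif_seq) \<le> (\<integral>\<omega>. (g \<omega>)\<^sup>2 \<partial>unif_seq)"
    "(\<integral>\<omega>. g \<omega> \<partial>unif_seq)\<^sup>2 \<le> (\<integral>\<omega>. (g \<omega>)\<^sup>2 \<partial>unif_seq)"
proof -
  note int = bounded_rv_integrable[OF assms] bounded_rv_integrable[OF bounded_rv_power2[OF assms]]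
  let ?e = "\<integral>\<omega>. g \<omega> \<partial>unif_seq"
  have "(\<integral>\<omega>. (g \<omega> - ?e)\<^sup>2 \<partial>unif_seq) = (\<integral>\<omega>. (g \<omega>)\<^sup>2 - 2 * ?e * g \<omega> + ?e\<^sup>2 \<partial>unif_seq)"
    by (simp add: power2_eq_square algebra_simps)
  also have "\<dots> = (\<integral>\<omega>. (g \<omega>)\<^sup>2 \<partial>unif_seq) - ?e\<^sup>2"
    using int by (simp add: unif_seq.prob_space power2_eq_square)
  finally have eq: "(\<integral>\<omega>. (g \<omega> - ?e)\<^sup>2 \<partial>unif_seq) = (\<integral>\<omega>. (g \<omega>)\<^sup>2 \<partial>unif_seq) - ?e\<^sup>2" .
  have "0 \<le> (\<integral>\<omega>. (g \<omega> - ?e)\<^sup>2 \<partial>unif_seq)" by (intro integral_nonneg_AE) simp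
  then show "?e\<^sup>2 \<le> (\<integral>\<omega>. (g \<omega>)\<^sup>2 \<partial>unif_seq)" using eq by simp
  show "(\<integral>\<omega>. (g \<omega> - ?e)\<^sup>2 \<partial>unif_seq) \<le> (\<integral>\<omega>. (g \<omega>)\<^sup>2 \<partial>unif_seq)" unfolding eq by simp
qed

definition zeta54 :: real where "zeta54 = (\<Sum>d. real d powr (-5/4))"
definition zeta98 :: real where "zeta98 = (\<Sum>d. real d powr (-9/8))"

lemma partial_zeta_le:
  "(\<Sum>d=1..n. real d powr (-5/4)) \<le> zeta54" "(\<Sum>d=1..n. real d powr (-9/8)) \<le> zeta98"
  unfolding zeta54_def zeta98_def by (auto intro!: sum_le_suminf simp: summable_real_powr_iff)

lemma zeta_nonneg: "0 \<le> zeta54" "0 \<le> zeta98"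
  unfolding zeta54_def zeta98_def by (auto intro!: suminf_nonneg simp: summable_real_powr_iff)

text \<open>
  For each length \<open>d\<close> the variance is at most \<open>192 * d powr (-5/2)\<close> times the number of intervals. Half of the exponent serves as the
  weight in the inequality of Cauchy and Schwarz, the other half makes the remaining sum converge.
\<close>
lemma straddling_variance:
  fixes n L :: nat
  assumes L: "1 \<le> L"
  defines "S \<equiv> \<lambda>d \<omega>. \<Sum>i\<in>straddling n L d. node_term \<omega> i (i + d) - (\<integral>\<omega>. node_term \<omega> i (i + d) \<partial>unif_seq)"
  shows "(\<integral>\<omega>. (\<Sum>d=1..n. S d \<omega>)\<^sup>2 \<partial>unif_seq)
    \<le> zeta54 * (192 * (real L * zeta54 + real n * real L powr (-1/8) * zeta98))"
proof -
  have w: "real d powr (-5/2) = real d powr (-5/4) * real d powr (-5/4)" for d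
    by (simp add: powr_add[symmetric])
  have main: "(\<integral>\<omega>. (\<Sum>d=1..n. S d \<omega>)\<^sup>2 \<partial>unif_seq)
    \<le> (\<Sum>d=1..n. real d powr (-5/4)) * (\<Sum>d=1..n. 192 * real (card (straddling n L d)) * real d powr (-5/4))"
  proof (rule integral_square_sum_le)
    fix d assume d: "d \<in> {1..n}"
    show "bounded_rv (S d)" unfolding S_def
      by (intro bounded_rv_sum bounded_rv_diff bounded_rv_const bounded_rv_node_term) (auto simp: straddling_def)
    have "(\<integral>\<omega>. (S d \<omega>)\<^sup>2 \<partial>unif_seq) \<le> 3 * real (card (straddling n L d)) * moment_const d"
      unfolding S_def by (rule node_term_sum_variance) (use d straddling_subset in auto)
    also have "\<dots> = 192 * real (card (straddling n L d)) * real d powr (-5/4) * real d powr (-5/4)"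
      unfolding moment_const_def w by simp
    finally show "(\<integral>\<omega>. (S d \<omega>)\<^sup>2 \<partial>unif_seq) \<le> 192 * real (card (straddling n L d)) * real d powr (-5/4) * real d powr (-5/4)" .
  qed auto
  have "(\<Sum>d=1..n. 192 * real (card (straddling n L d)) * real d powr (-5/4))
    \<le> (\<Sum>d=1..n. 192 * (real L * real d powr (-5/4) + real n * real L powr (-1/8) * real d powr (-9/8)))"
  proof (rule sum_mono)
    fix d assume d: "d \<in> {1..n}"
    have "real (card (straddling n L d)) * real d powr (-5/4) \<le> (real L + real n * (real d / real L) powr (1/8)) * real d powr (-5/4)"
      using d L by (intro mult_right_mono card_straddling) auto
    also have "(real d / real L) powr (1/8) = real d powr (1/8) * real L powr (-1/8)"
      by (simp add: powr_divide powr_minus_divide)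
    also have "(real L + real n * (real d powr (1/8) * real L powr (-1/8))) * real d powr (-5/4)
      = real L * real d powr (-5/4) + real n * real L powr (-1/8) * (real d powr (1/8) * real d powr (-5/4))"
      by (simp add: algebra_simps)
    also have "real d powr (1/8) * real d powr (-5/4) = real d powr (-9/8)" by (simp add: powr_add[symmetric])
    finally show "192 * real (card (straddling n L d)) * real d powr (-5/4)
      \<le> 192 * (real L * real d powr (-5/4) + real n * real L powr (-1/8) * real d powr (-9/8))" by simp
  qed
  also have "\<dots> = 192 * (real L * (\<Sum>d=1..n. real d powr (-5/4)) + real n * real L powr (-1/8) * (\<Sum>d=1..n. real d powr (-9/8)))"
    by (simp add: sum_distrib_left sum.distrib)
  also have "\<dots> \<le> 192 * (real L * zeta54 + real n * real L powr (-1/8) * zeta98)"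
    by (intro mult_left_mono add_mono partial_zeta_le) auto
  finally have c: "(\<Sum>d=1..n. 192 * real (card (straddling n L d)) * real d powr (-5/4))
    \<le> 192 * (real L * zeta54 + real n * real L powr (-1/8) * zeta98)" .
  note main
  also have "(\<Sum>d=1..n. real d powr (-5/4)) * (\<Sum>d=1..n. 192 * real (card (straddling n L d)) * real d powr (-5/4))
    \<le> zeta54 * (192 * (real L * zeta54 + real n * real L powr (-1/8) * zeta98))"
    by (intro mult_mono c partial_zeta_le zeta_nonneg sum_nonneg) auto
  finally show ?thesis .
qed

definition centred_block :: "nat \<Rightarrow> nat \<Rightarrow> (nat \<Rightarrow> real) \<Rightarrow> real" where
  "centred_block L b \<omega> = block L b \<omega> - (\<integral>\<omega>. block L 0 \<omega> \<partial>unif_seq)"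

lemma expectation_block: "(\<integral>\<omega>. block L b \<omega> \<partial>unif_seq) = (\<integral>\<omega>. block L 0 \<omega> \<partial>unif_seq)"
proof -
  have m: "block L b \<in> borel_measurable unif_seq" for b using bounded_rv_block[of L b] by (simp add: bounded_rv_def)
  have "(\<integral>\<omega>. block L b \<omega> \<partial>unif_seq) = (\<integral>x. x \<partial>distr unif_seq borel (block L b))"
    by (subst integral_distr[OF m]) auto
  also have "\<dots> = (\<integral>x. x \<partial>distr unif_seq borel (block L 0))"
    by (rule arg_cong[where f="\<lambda>M. \<integral>x. x \<partial>M", OF distr_block])
  also have "\<dots> = (\<integral>\<omega>. block L 0 \<omega> \<partial>unif_seq)" by (subst integral_distr[OF m]) auto
  finally show ?thesis .
qed

lemma bounded_rv_centred_block: "bounded_rv (centred_block L b)"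
  unfolding centred_block_def[abs_def] by (intro bounded_rv_diff bounded_rv_block bounded_rv_const)

text \<open>
  What the blocks miss are the straddling intervals and the boundary. The point of the estimate
  is that, divided by \<open>n\<close>, it tends to a multiple of \<open>L powr (-1/8)\<close> as \<open>n\<close> tends to infinity.
\<close>
theorem deviation_approx:
  assumes L: "1 \<le> L" and n: "1 \<le> n"
  shows "(\<integral>\<omega>. (deviation n \<omega> - (\<Sum>b<n div L. centred_block L b \<omega>))\<^sup>2 \<partial>unif_seq)
    \<le> 384 * zeta54 * (real L * zeta54 + real n * real L powr (-1/8) * zeta98) + 6200 * sqrt (real n)"
proof -
  define D where "D \<omega> = inner n \<omega> - (\<Sum>b<n div L. block L b \<omega>)" for \<omega>
  define e where "e i d = (\<integral>\<omega>. node_term \<omega> i (i + d) \<partial>unif_seq)" for i d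
  define T where "T \<omega> = (\<Sum>d=1..n. \<Sum>i\<in>straddling n L d. node_term \<omega> i (i + d) - e i d)" for \<omega> :: "nat \<Rightarrow> real"
  define R where "R \<omega> = outer n \<omega> - (\<integral>\<omega>. outer n \<omega> \<partial>unif_seq)" for \<omega>
  have bD: "bounded_rv D" unfolding D_def[abs_def] by (intro bounded_rv_diff bounded_rv_inner bounded_rv_sum bounded_rv_block)
  have bR: "bounded_rv R" unfolding R_def[abs_def] by (intro bounded_rv_diff bounded_rv_outer bounded_rv_const)
  have Deq: "D \<omega> = (\<Sum>d=1..n. \<Sum>i\<in>straddling n L d. node_term \<omega> i (i + d))" for \<omega>
    unfolding D_def by (rule inner_minus_blocks[OF L])
  have bn: "bounded_rv (\<lambda>\<omega>. node_term \<omega> i (i + d))" if "i \<in> straddling n L d" for i d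
    using that by (intro bounded_rv_node_term) (auto simp: straddling_def)
  have ED: "(\<integral>\<omega>. D \<omega> \<partial>unif_seq) = (\<Sum>d=1..n. \<Sum>i\<in>straddling n L d. e i d)"
  proof -
    have "(\<integral>\<omega>. D \<omega> \<partial>unif_seq) = (\<Sum>d=1..n. \<integral>\<omega>. (\<Sum>i\<in>straddling n L d. node_term \<omega> i (i + d)) \<partial>unif_seq)"
      unfolding Deq by (intro expectation_sum bounded_rv_sum bn)
    also have "\<dots> = (\<Sum>d=1..n. \<Sum>i\<in>straddling n L d. e i d)"
      unfolding e_def by (intro sum.cong refl expectation_sum bn)
    finally show ?thesis .
  qed
  have T: "T \<omega> = D \<omega> - (\<integral>\<omega>. D \<omega> \<partial>unif_seq)" for \<omega>
  proof -
    have "D \<omega> - (\<integral>\<omega>. D \<omega> \<partial>unif_seq) = (\<Sum>d=1..n. \<Sum>i\<in>straddling n L d. node_term \<omega> i (i + d))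
      - (\<Sum>d=1..n. \<Sum>i\<in>straddling n L d. e i d)"
      by (rule arg_cong2[where f="(-)", OF Deq ED])
    then show ?thesis unfolding T_def by (simp add: sum_subtractf)
  qed
  have Teq: "T = (\<lambda>\<omega>. D \<omega> - (\<integral>\<omega>. D \<omega> \<partial>unif_seq))" by (rule ext) (rule T)
  have bT: "bounded_rv T" unfolding Teq by (rule bounded_rv_diff[OF bD bounded_rv_const])
  have mean: "mean_cost n = (\<integral>\<omega>. inner n \<omega> \<partial>unif_seq) + (\<integral>\<omega>. outer n \<omega> \<partial>unif_seq)"
  proof -
    have "mean_cost n = (\<integral>\<omega>. inner n \<omega> + outer n \<omega> \<partial>unif_seq)"
      unfolding mean_cost_def using AE_tree_cost_eq[of n] bounded_rv_tree_cost[of n] bounded_rv_add[OF bounded_rv_inner bounded_rv_outer]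
      by (intro integral_cong_AE) (auto simp: bounded_rv_def)
    then show ?thesis using bounded_rv_integrable[OF bounded_rv_inner] bounded_rv_integrable[OF bounded_rv_outer] by simp
  qed
  define I where "I = (\<integral>\<omega>. inner n \<omega> \<partial>unif_seq)"
  define E where "E = (\<integral>\<omega>. outer n \<omega> \<partial>unif_seq)"
  define B where "B = (\<integral>\<omega>. block L 0 \<omega> \<partial>unif_seq)"
  have EDI: "(\<integral>\<omega>. D \<omega> \<partial>unif_seq) = I - real (n div L) * B"
  proof -
    have "(\<integral>\<omega>. D \<omega> \<partial>unif_seq) = I - (\<integral>\<omega>. (\<Sum>b<n div L. block L b \<omega>) \<partial>unif_seq)"
      unfolding D_def I_def
      by (intro Bochner_Integration.integral_diff bounded_rv_integrable bounded_rv_inner bounded_rv_sum bounded_rv_block)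
    also have "(\<integral>\<omega>. (\<Sum>b<n div L. block L b \<omega>) \<partial>unif_seq) = (\<Sum>b<n div L. \<integral>\<omega>. block L b \<omega> \<partial>unif_seq)"
      by (intro expectation_sum bounded_rv_block)
    also have "\<dots> = (\<Sum>b<n div L. B)" unfolding B_def by (intro sum.cong refl expectation_block)
    finally show ?thesis by simp
  qed
  have ae: "AE \<omega> in unif_seq. deviation n \<omega> - (\<Sum>b<n div L. centred_block L b \<omega>) = T \<omega> + R \<omega>"
    using AE_tree_cost_eq[of n]
  proof eventually_elim
    case (elim \<omega>)
    have 1: "T \<omega> = inner n \<omega> - (\<Sum>b<n div L. block L b \<omega>) - (I - real (n div L) * B)"
      using T[of \<omega>] unfolding EDI by (simp only: D_def)
    have 2: "(\<Sum>b<n div L. centred_block L b \<omega>) = (\<Sum>b<n div L. block L b \<omega>) - real (n div L) * B"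
      by (simp only: centred_block_def sum_subtractf B_def[symmetric]) simp
    have 3: "deviation n \<omega> = inner n \<omega> + outer n \<omega> - (I + E)"
      by (simp only: deviation_def elim mean I_def E_def)
    have 4: "R \<omega> = outer n \<omega> - E" by (simp only: R_def E_def)
    show ?case unfolding 1 2 3 4 by linarith
  qed
  have m: "(\<lambda>\<omega>. (deviation n \<omega> - (\<Sum>b<n div L. centred_block L b \<omega>))\<^sup>2) \<in> borel_measurable unif_seq"
    "(\<lambda>\<omega>. (T \<omega> + R \<omega>)\<^sup>2) \<in> borel_measurable unif_seq"
  proof -
    have "bounded_rv (\<lambda>\<omega>. (deviation n \<omega> - (\<Sum>b<n div L. centred_block L b \<omega>))\<^sup>2)"
      by (intro bounded_rv_power2 bounded_rv_diff bounded_rv_deviation bounded_rv_sum bounded_rv_centred_block)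
    then show "(\<lambda>\<omega>. (deviation n \<omega> - (\<Sum>b<n div L. centred_block L b \<omega>))\<^sup>2) \<in> borel_measurable unif_seq"
      by (simp only: bounded_rv_def)
    have "bounded_rv (\<lambda>\<omega>. (T \<omega> + R \<omega>)\<^sup>2)" by (intro bounded_rv_power2 bounded_rv_add bT bR)
    then show "(\<lambda>\<omega>. (T \<omega> + R \<omega>)\<^sup>2) \<in> borel_measurable unif_seq" by (simp only: bounded_rv_def)
  qed
  have "(\<integral>\<omega>. (deviation n \<omega> - (\<Sum>b<n div L. centred_block L b \<omega>))\<^sup>2 \<partial>unif_seq) = (\<integral>\<omega>. (T \<omega> + R \<omega>)\<^sup>2 \<partial>unif_seq)"
  proof (rule integral_cong_AE[OF m])
    show "AE \<omega> in unif_seq. (deviation n \<omega> - (\<Sum>b<n div L. centred_block L b \<omega>))\<^sup>2 = (T \<omega> + R \<omega>)\<^sup>2"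
      using ae by eventually_elim simp
  qed
  also have "\<dots> \<le> (\<integral>\<omega>. 2 * (T \<omega>)\<^sup>2 + 2 * (R \<omega>)\<^sup>2 \<partial>unif_seq)"
  proof (intro integral_mono bounded_rv_integrable bounded_rv_power2 bounded_rv_add bounded_rv_mult bounded_rv_const bT bR)
    fix \<omega>
    have "0 \<le> (T \<omega> - R \<omega>)\<^sup>2" by simp
    then show "(T \<omega> + R \<omega>)\<^sup>2 \<le> 2 * (T \<omega>)\<^sup>2 + 2 * (R \<omega>)\<^sup>2" by (simp add: power2_eq_square algebra_simps)
  qed
  also have "\<dots> = 2 * (\<integral>\<omega>. (T \<omega>)\<^sup>2 \<partial>unif_seq) + 2 * (\<integral>\<omega>. (R \<omega>)\<^sup>2 \<partial>unif_seq)"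
    using bounded_rv_integrable[OF bounded_rv_power2[OF bT]] bounded_rv_integrable[OF bounded_rv_power2[OF bR]] by simp
  also have "\<dots> \<le> 2 * (zeta54 * (192 * (real L * zeta54 + real n * real L powr (-1/8) * zeta98))) + 2 * (3100 * sqrt (real n))"
  proof (intro add_mono mult_left_mono)
    show "(\<integral>\<omega>. (T \<omega>)\<^sup>2 \<partial>unif_seq) \<le> zeta54 * (192 * (real L * zeta54 + real n * real L powr (-1/8) * zeta98))"
      unfolding T_def e_def by (rule straddling_variance[OF L])
    show "(\<integral>\<omega>. (R \<omega>)\<^sup>2 \<partial>unif_seq) \<le> 3100 * sqrt (real n)"
      unfolding R_def by (rule order_trans[OF variance_le_second_moment(1)[OF bounded_rv_outer] outer_second_moment[OF n]])
  qed auto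
  finally show ?thesis by (simp add: algebra_simps)
qed

text \<open>
  There is about one interval of each length per position.
\<close>
definition growth :: real where "growth = (\<Sum>d. node_mean d)"

lemma node_mean_bounds: "0 \<le> node_mean d" "node_mean d \<le> 8 * real d powr (-5/4)"
proof -
  show n0: "0 \<le> node_mean d" unfolding node_mean_def by (intro integral_nonneg_AE) (simp add: node_term_nonneg)
  show "node_mean d \<le> 8 * real d powr (-5/4)"
  proof (cases "d = 0")
    case False
    have "(node_mean d)\<^sup>2 \<le> moment_const d"
      unfolding node_mean_def
      by (rule order_trans[OF variance_le_second_moment(2)[OF bounded_rv_node_term] node_term_second_moment]) (use False in auto)
    also have "\<dots> = (8 * real d powr (-5/4))\<^sup>2"
      by (simp add: moment_const_def power2_eq_square powr_add[symmetric])
    finally show ?thesis by (rule power2_le_imp_le) simp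
  qed (simp add: node_mean_def)
qed

lemma mean_cost_eq: "mean_cost n = (\<Sum>d=1..n. real (n - d) * node_mean d) + (\<integral>\<omega>. outer n \<omega> \<partial>unif_seq)"
proof -
  have "mean_cost n = (\<integral>\<omega>. inner n \<omega> + outer n \<omega> \<partial>unif_seq)"
    unfolding mean_cost_def using AE_tree_cost_eq[of n] bounded_rv_tree_cost[of n] bounded_rv_add[OF bounded_rv_inner bounded_rv_outer]
    by (intro integral_cong_AE) (auto simp: bounded_rv_def)
  also have "\<dots> = (\<integral>\<omega>. inner n \<omega> \<partial>unif_seq) + (\<integral>\<omega>. outer n \<omega> \<partial>unif_seq)"
    using bounded_rv_integrable[OF bounded_rv_inner] bounded_rv_integrable[OF bounded_rv_outer] by simp
  also have "(\<integral>\<omega>. inner n \<omega> \<partial>unif_seq) = (\<integral>\<omega>. (\<Sum>d=1..n. \<Sum>i\<in>{1..n - d}. node_term \<omega> i (i + d)) \<partial>unif_seq)"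
  proof -
    have "n div (n + 1) = 0" by simp
    moreover have "straddling n (n + 1) d = {1..n - d}" for d by (auto simp: straddling_def)
    ultimately show ?thesis using inner_minus_blocks[of "n + 1" n] by simp
  qed
  also have "\<dots> = (\<Sum>d=1..n. \<Sum>i\<in>{1..n - d}. node_mean d)"
  proof -
    have "(\<integral>\<omega>. (\<Sum>d=1..n. \<Sum>i\<in>{1..n - d}. node_term \<omega> i (i + d)) \<partial>unif_seq)
      = (\<Sum>d=1..n. \<integral>\<omega>. (\<Sum>i\<in>{1..n - d}. node_term \<omega> i (i + d)) \<partial>unif_seq)"
      by (intro expectation_sum bounded_rv_sum bounded_rv_node_term) auto
    also have "\<dots> = (\<Sum>d=1..n. \<Sum>i\<in>{1..n - d}. \<integral>\<omega>. node_term \<omega> i (i + d) \<partial>unif_seq)"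
      by (intro sum.cong refl expectation_sum bounded_rv_node_term) auto
    also have "\<dots> = (\<Sum>d=1..n. \<Sum>i\<in>{1..n - d}. node_mean d)"
      by (intro sum.cong refl expectation_node_term) auto
    finally show ?thesis .
  qed
  finally show ?thesis by simp
qed

theorem mean_cost_limit: "(\<lambda>n. mean_cost n / real n) \<longlonglongrightarrow> growth"
proof -
  define a where "a d n = (if d \<in> {1..n} then real (n - d) / real n * node_mean d else 0)" for d n :: nat
  have "(\<lambda>n. \<Sum>d. a d n) \<longlonglongrightarrow> (\<Sum>d. node_mean d)"
  proof (rule conjunct2[OF conjunct2[OF tannerys_theorem[where M="\<lambda>d. 8 * real d powr (-5/4)"]]])
    show "(\<lambda>n. a d n) \<longlonglongrightarrow> node_mean d" for d
    proof (cases "d = 0")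
      case True
      then show ?thesis by (simp add: a_def node_mean_def)
    next
      case False
      have "(\<lambda>n. (1 - real d / real n) * node_mean d) \<longlonglongrightarrow> (1 - 0) * node_mean d"
        by (intro tendsto_intros tendsto_divide_0[OF tendsto_const] filterlim_at_top_imp_at_infinity filterlim_real_sequentially)
      then have "(\<lambda>n. (1 - real d / real n) * node_mean d) \<longlonglongrightarrow> node_mean d" by simp
      moreover have "\<forall>\<^sub>F n in sequentially. (1 - real d / real n) * node_mean d = a d n"
        using eventually_ge_at_top[of d]
        by eventually_elim (use False in \<open>auto simp: a_def of_nat_diff diff_divide_distrib\<close>)
      ultimately show ?thesis by (rule Lim_transform_eventually)
    qed
    have le: "norm (a d n) \<le> 8 * real d powr (-5/4)" for d n
    proof -
      have "real (n - d) / real n * node_mean d \<le> 1 * node_mean d"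
        using node_mean_bounds[of d] by (intro mult_right_mono) (auto simp: divide_le_eq)
      then show ?thesis using node_mean_bounds[of d] by (auto simp: a_def)
    qed
    show "\<forall>\<^sub>F (d, n) in sequentially \<times>\<^sub>F sequentially. norm (a d n) \<le> 8 * real d powr (-5/4)"
      by (rule always_eventually) (use le in auto)
    show "summable (\<lambda>d. 8 * real d powr (-5/4))" by (intro summable_mult) (simp add: summable_real_powr_iff)
  qed simp
  moreover have "(\<Sum>d. a d n) = (\<Sum>d=1..n. real (n - d) * node_mean d) / real n" for n
  proof -
    have "(\<Sum>d. a d n) = (\<Sum>d\<in>{1..n}. a d n)" by (rule suminf_finite) (auto simp: a_def)
    then show ?thesis by (simp add: a_def sum_divide_distrib)
  qed
  ultimately have 1: "(\<lambda>n. (\<Sum>d=1..n. real (n - d) * node_mean d) / real n) \<longlonglongrightarrow> growth"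
    by (simp add: growth_def)
  have "(\<lambda>n. (\<integral>\<omega>. outer n \<omega> \<partial>unif_seq) / real n) \<longlonglongrightarrow> 0"
  proof (rule tendsto_sandwich[OF _ _ tendsto_const])
    show "\<forall>\<^sub>F n in sequentially. 0 \<le> (\<integral>\<omega>. outer n \<omega> \<partial>unif_seq) / real n"
      by (intro always_eventually allI divide_nonneg_nonneg integral_nonneg_AE) (auto simp: outer_nonneg)
    show "\<forall>\<^sub>F n in sequentially. (\<integral>\<omega>. outer n \<omega> \<partial>unif_seq) / real n \<le> sqrt 3100 * real n powr (-3/4)"
      using eventually_ge_at_top[of 1]
    proof eventually_elim
      case (elim n)
      have "(\<integral>\<omega>. outer n \<omega> \<partial>unif_seq)\<^sup>2 \<le> 3100 * sqrt (real n)"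
        using elim by (rule order_trans[OF variance_le_second_moment(2)[OF bounded_rv_outer] outer_second_moment])
      then have "(\<integral>\<omega>. outer n \<omega> \<partial>unif_seq) \<le> sqrt (3100 * sqrt (real n))" by (rule real_le_rsqrt)
      also have "\<dots> = sqrt 3100 * real n powr (1/4)"
        by (simp add: real_sqrt_mult powr_half_sqrt[symmetric] powr_powr)
      finally have "(\<integral>\<omega>. outer n \<omega> \<partial>unif_seq) / real n \<le> sqrt 3100 * (real n powr (1/4) / real n powr 1)"
        using elim by (simp add: divide_right_mono)
      also have "real n powr (1/4) / real n powr 1 = real n powr (-3/4)" by (subst powr_diff[symmetric]) simp
      finally show ?case .
    qed
    show "(\<lambda>n. sqrt 3100 * real n powr (-3/4)) \<longlonglongrightarrow> 0"
      by (intro tendsto_mult_right_zero tendsto_neg_powr filterlim_real_sequentially) simp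
  qed
  from tendsto_add[OF 1 this] show ?thesis unfolding mean_cost_eq by (simp add: add_divide_distrib)
qed

lemma growth_pos: "0 < growth"
proof -
  have "1/2 \<le> growth"
  proof (rule LIMSEQ_le_const[OF mean_cost_limit], intro exI[of _ 1] allI impI)
    fix n :: nat assume n: "1 \<le> n"
    have "(\<integral>\<omega>. real (n + 1) / 2 \<partial>unif_seq) \<le> mean_cost n"
      unfolding mean_cost_def
      by (intro integral_mono bounded_rv_integrable bounded_rv_const bounded_rv_tree_cost)
         (use n tree_cost_ge[of 0 "n + 1"] in auto)
    then have "real (n + 1) / 2 \<le> mean_cost n" by (simp add: unif_seq.prob_space)
    then show "1/2 \<le> mean_cost n / real n" using n by (simp add: field_simps)
  qed
  then show ?thesis by simp
qed

section \<open>The variance is at least linear\<close>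

definition window_swap :: "nat \<Rightarrow> nat \<Rightarrow> nat" where
  "window_swap j = Transposition.transpose (5 * j + 2) (5 * j + 3)"

text \<open>
  In the window of the positions \<open>5 * j + 1, \<dots>, 5 * j + 5\<close> the outer two are walls of a node and the inner three form a path. The
  windows for different \<open>j\<close> are disjoint.
\<close>
definition path_window :: "nat \<Rightarrow> (nat \<Rightarrow> real) \<Rightarrow> bool" where
  "path_window j \<omega> \<longleftrightarrow> \<omega> (5*j+1) < \<omega> (5*j+2) \<and> \<omega> (5*j+5) < \<omega> (5*j+2)
     \<and> \<omega> (5*j+2) < \<omega> (5*j+3) \<and> \<omega> (5*j+3) < \<omega> (5*j+4)"

lemma window_swap_ok: "inj_on (window_swap j) {1..}" "window_swap j \<in> {1..} \<rightarrow> {1..}"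
  by (auto simp: window_swap_def Transposition.transpose_def inj_on_def split: if_splits)

lemma window_swap_simps:
  "window_swap j (5*j+2) = 5*j+3" "window_swap j (5*j+3) = 5*j+2"
  "l \<noteq> 5*j+2 \<Longrightarrow> l \<noteq> 5*j+3 \<Longrightarrow> window_swap j l = l"
  by (auto simp: window_swap_def Transposition.transpose_def)

lemma window_swap_involutory [simp]: "window_swap j (window_swap j l) = l"
  by (simp add: window_swap_def)

lemma window_swap_ge_1 [simp]: "1 \<le> l \<Longrightarrow> 1 \<le> window_swap j l"
  by (auto simp: window_swap_def Transposition.transpose_def)

abbreviation swapped :: "nat \<Rightarrow> (nat \<Rightarrow> real) \<Rightarrow> nat \<Rightarrow> real" where
  "swapped j \<equiv> reindex (window_swap j)"

lemma swapped_apply: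
  "swapped j \<omega> (5*j+2) = \<omega> (5*j+3)" "swapped j \<omega> (5*j+3) = \<omega> (5*j+2)"
  "1 \<le> l \<Longrightarrow> l \<noteq> 5*j+2 \<Longrightarrow> l \<noteq> 5*j+3 \<Longrightarrow> swapped j \<omega> l = \<omega> l"
  using window_swap_simps[of j] window_swap_simps(3)[of l j] by (simp_all add: reindex_def)

lemma swapped_swapped: "1 \<le> l \<Longrightarrow> swapped j (swapped j \<omega>) l = \<omega> l"
  by (simp add: window_swap_ge_1[unfolded One_nat_def])

lemma path_window_measurable: "Measurable.pred unif_seq (path_window j)"
proof -
  have c: "(\<lambda>\<omega>. \<omega> (5*j+i)) \<in> borel_measurable unif_seq" if "1 \<le> i" for i
    using that by (intro coordinate_measurable) auto
  have [measurable]: "(\<lambda>\<omega>. \<omega> (5*j+1)) \<in> borel_measurable unif_seq" "(\<lambda>\<omega>. \<omega> (5*j+2)) \<in> borel_measurable unif_seq"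
    "(\<lambda>\<omega>. \<omega> (5*j+3)) \<in> borel_measurable unif_seq" "(\<lambda>\<omega>. \<omega> (5*j+4)) \<in> borel_measurable unif_seq"
    "(\<lambda>\<omega>. \<omega> (5*j+5)) \<in> borel_measurable unif_seq"
    by (rule c, simp)+
  show ?thesis unfolding path_window_def[abs_def] by measurable
qed

definition path_ind :: "nat \<Rightarrow> (nat \<Rightarrow> real) \<Rightarrow> real" where
  "path_ind j \<omega> = (if path_window j \<omega> then 1 else 0)"

text \<open>
  The sign is \<open>1\<close> if the window holds the path, \<open>-1\<close> if it holds the cherry obtained by the swap, and \<open>0\<close>
  otherwise. It is reversed by the swap, which preserves the measure.
\<close>
definition window_sign :: "nat \<Rightarrow> (nat \<Rightarrow> real) \<Rightarrow> real" where
  "window_sign j \<omega> = path_ind j \<omega> - path_ind j (swapped j \<omega>)"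

lemma bounded_rv_path_ind: "bounded_rv (path_ind j)"
proof -
  have "path_ind j \<in> borel_measurable unif_seq"
    unfolding path_ind_def[abs_def] using path_window_measurable by (intro measurable_If) (auto simp: pred_def)
  then show ?thesis unfolding bounded_rv_def by (auto intro!: exI[of _ 1] simp: path_ind_def)
qed

lemma bounded_rv_swapped: "bounded_rv g \<Longrightarrow> bounded_rv (\<lambda>\<omega>. g (swapped j \<omega>))"
  unfolding bounded_rv_def using measurable_compose[OF reindex_measurable[OF window_swap_ok]] by blast

lemma expectation_swapped: "bounded_rv g \<Longrightarrow> (\<integral>\<omega>. g (swapped j \<omega>) \<partial>unif_seq) = (\<integral>\<omega>. g \<omega> \<partial>unif_seq)"
  by (rule integral_reindex[OF window_swap_ok]) (simp add: bounded_rv_def)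

lemma path_window_cong: "(\<And>l. 5*j+1 \<le> l \<Longrightarrow> l \<le> 5*j+5 \<Longrightarrow> \<omega> l = \<omega>' l) \<Longrightarrow> path_window j \<omega> = path_window j \<omega>'"
  by (simp add: path_window_def)

lemma path_ind_swapped_swapped: "path_ind j (swapped j (swapped j \<omega>)) = path_ind j \<omega>"
  unfolding path_ind_def by (subst path_window_cong[of j _ \<omega>]) (auto intro!: swapped_swapped simp del: reindex_apply)

lemma path_ind_swapped_other:
  assumes "j \<noteq> l" shows "path_ind l (swapped j \<omega>) = path_ind l \<omega>"
  unfolding path_ind_def
  by (subst path_window_cong[of l _ \<omega>]) (use assms in \<open>auto intro!: swapped_apply(3) simp del: reindex_apply\<close>)

lemma window_sign_swapped: "window_sign j (swapped j \<omega>) = - window_sign j \<omega>"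
  by (simp add: window_sign_def path_ind_swapped_swapped)

lemma window_sign_swapped_other:
  assumes "j \<noteq> l" shows "window_sign l (swapped j \<omega>) = window_sign l \<omega>"
proof -
  have "path_ind l (swapped l (swapped j \<omega>)) = path_ind l (swapped l \<omega>)"
    unfolding path_ind_def
  proof (subst path_window_cong[of l _ "swapped l \<omega>"])
    fix m assume m: "5*l+1 \<le> m" "m \<le> 5*l+5"
    have in_w: "5*l+1 \<le> window_swap l m" "window_swap l m \<le> 5*l+5"
      using m by (auto simp: window_swap_def Transposition.transpose_def)
    have "swapped l (swapped j \<omega>) m = swapped j \<omega> (window_swap l m)" using m by simp
    also have "\<dots> = \<omega> (window_swap l m)" by (rule swapped_apply(3)) (use in_w assms in auto)
    also have "\<dots> = swapped l \<omega> m" using m by simp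
    finally show "swapped l (swapped j \<omega>) m = swapped l \<omega> m" .
  qed simp
  then show ?thesis using assms by (simp add: window_sign_def path_ind_swapped_other)
qed

lemma bounded_rv_window_sign: "bounded_rv (window_sign j)"
  unfolding window_sign_def[abs_def] by (intro bounded_rv_diff bounded_rv_path_ind bounded_rv_swapped)

definition path_prob :: "nat \<Rightarrow> real" where
  "path_prob j = (\<integral>\<omega>. path_ind j \<omega> \<partial>unif_seq)"

lemma path_prob_eq: "path_prob j = path_prob 0"
proof -
  have "path_prob 0 = (\<integral>\<omega>. path_ind 0 (shift (5 * j) \<omega>) \<partial>unif_seq)"
    unfolding path_prob_def shift_def
    by (rule integral_reindex[OF shift_ok, symmetric]) (use bounded_rv_path_ind in \<open>simp add: bounded_rv_def\<close>)
  also have "\<dots> = path_prob j"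
    unfolding path_prob_def
    by (rule Bochner_Integration.integral_cong[OF refl])
       (simp add: path_ind_def path_window_def shift_def add.commute)
  finally show ?thesis ..
qed

text \<open>
  A box of positive volume on which the order relations of the window hold.
\<close>
lemma path_prob_pos: "0 < path_prob 0"
proof -
  define X :: "nat \<Rightarrow> real set" where "X i = (if i = 1 \<or> i = 5 then {0..1/4} else if i = 2 then {1/4<..1/2}
     else if i = 3 then {1/2<..3/4} else {3/4<..1})" for i
  interpret P: product_prob_space "\<lambda>_. unif01" "{1::nat..}" by unfold_locales
  define S where "S = prod_emb {1::nat..} (\<lambda>_. unif01) {1..5} (Pi\<^sub>E {1..5} X)"
  have "measure unif_seq S = (\<Prod>i\<in>{1..5}. measure unif01 (X i))"
    unfolding S_def unif_seq_def by (rule P.measure_PiM_emb) (auto simp: X_def)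
  also have "\<dots> = (\<Prod>i\<in>{1..5::nat}. 1/4)"
  proof (rule prod.cong[OF refl])
    fix i :: nat assume "i \<in> {1..5}"
    have "measure unif01 Y = measure lborel ({0..1} \<inter> Y)" if "Y \<in> sets borel" for Y
      using that by (subst measure_uniform_measure) auto
    moreover have "{0..1} \<inter> X i = X i" "X i \<in> sets borel" by (auto simp: X_def)
    ultimately have "measure unif01 (X i) = measure lborel (X i)" by metis
    also have "\<dots> = 1/4" by (auto simp: X_def)
    finally show "measure unif01 (X i) = 1/4" .
  qed
  finally have S: "measure unif_seq S > 0" by simp
  have memS: "path_window 0 \<omega>" if "\<omega> \<in> S" for \<omega>
  proof -
    have "\<omega> i \<in> X i" if "i \<in> {1..5}" for i
      using \<open>\<omega> \<in> S\<close> that unfolding S_def prod_emb_def by (auto simp: PiE_iff restrict_def Pi_iff split: if_splits)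
    from this[of 1] this[of 2] this[of 3] this[of 4] this[of 5] show ?thesis
      by (auto simp: X_def path_window_def numeral_2_eq_2)
  qed
  have "path_prob 0 = measure unif_seq {\<omega> \<in> space unif_seq. path_window 0 \<omega>}"
  proof -
    have "path_prob 0 = (\<integral>\<omega>. indicator {\<omega> \<in> space unif_seq. path_window 0 \<omega>} \<omega> \<partial>unif_seq)"
      unfolding path_prob_def by (intro Bochner_Integration.integral_cong) (auto simp: path_ind_def indicator_def)
    then show ?thesis using path_window_measurable[of 0] by (simp add: pred_def)
  qed
  moreover have "measure unif_seq S \<le> measure unif_seq {\<omega> \<in> space unif_seq. path_window 0 \<omega>}"
  proof (rule unif_seq.finite_measure_mono)
    have "S \<subseteq> space unif_seq" unfolding S_def unif_seq_def space_PiM by (auto simp: prod_emb_def)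
    then show "S \<subseteq> {\<omega> \<in> space unif_seq. path_window 0 \<omega>}" using memS by auto
    show "{\<omega> \<in> space unif_seq. path_window 0 \<omega>} \<in> sets unif_seq" using path_window_measurable[of 0] by (simp add: pred_def)
  qed
  ultimately show ?thesis using S by linarith
qed

text \<open>
  By invariance under the swap, the correlation is the expected effect of the swap on the cost over the
  event that the window holds the path.
\<close>
lemma expectation_deviation_window_sign:
  assumes j: "5 * j + 5 \<le> n"
  shows "damping_limit * swap_gap * path_prob 0 \<le> (\<integral>\<omega>. deviation n \<omega> * window_sign j \<omega> \<partial>unif_seq)"
proof -
  let ?G = "deviation n"
  have b1: "bounded_rv (\<lambda>\<omega>. ?G \<omega> * path_ind j \<omega>)" "bounded_rv (\<lambda>\<omega>. ?G (swapped j \<omega>) * path_ind j \<omega>)"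
    "bounded_rv (\<lambda>\<omega>. ?G \<omega> * path_ind j (swapped j \<omega>))"
    by (intro bounded_rv_mult bounded_rv_deviation bounded_rv_path_ind bounded_rv_swapped)+
  have Gss: "?G (swapped j (swapped j \<omega>)) = ?G \<omega>" for \<omega>
    unfolding deviation_def by (subst tree_cost_cong[where v=\<omega>]) (auto simp: swapped_swapped simp del: reindex_apply)
  have "(\<integral>\<omega>. ?G \<omega> * path_ind j (swapped j \<omega>) \<partial>unif_seq)
    = (\<integral>\<omega>. ?G (swapped j (swapped j \<omega>)) * path_ind j (swapped j \<omega>) \<partial>unif_seq)" by (simp only: Gss)
  also have "\<dots> = (\<integral>\<omega>. ?G (swapped j \<omega>) * path_ind j \<omega> \<partial>unif_seq)"
    by (rule expectation_swapped[OF b1(2)])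
  finally have sw: "(\<integral>\<omega>. ?G \<omega> * path_ind j (swapped j \<omega>) \<partial>unif_seq) = (\<integral>\<omega>. ?G (swapped j \<omega>) * path_ind j \<omega> \<partial>unif_seq)" .
  have "damping_limit * swap_gap * path_prob 0 = (\<integral>\<omega>. damping_limit * swap_gap * path_ind j \<omega> \<partial>unif_seq)"
  proof -
    have "path_prob 0 = (\<integral>\<omega>. path_ind j \<omega> \<partial>unif_seq)"
      using path_prob_eq[of j] by (simp only: path_prob_def)
    then show ?thesis by simp
  qed
  also have "\<dots> \<le> (\<integral>\<omega>. ?G \<omega> * path_ind j \<omega> - ?G (swapped j \<omega>) * path_ind j \<omega> \<partial>unif_seq)"
  proof (rule integral_mono_AE)
    show "AE \<omega> in unif_seq. damping_limit * swap_gap * path_ind j \<omega> \<le> ?G \<omega> * path_ind j \<omega> - ?G (swapped j \<omega>) * path_ind j \<omega>"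
      using AE_unif_seq_inj
    proof eventually_elim
      case (elim \<omega>)
      show ?case
      proof (cases "path_window j \<omega>")
        case True
        define s where "s = 5 * j + 1"
        have w: "\<omega> s < \<omega> (s+1)" "\<omega> (s+4) < \<omega> (s+1)" "\<omega> (s+1) < \<omega> (s+2)" "\<omega> (s+2) < \<omega> (s+3)"
          using True by (simp_all add: path_window_def s_def add.commute numeral_eq_Suc)
        have "damping (n + 1 - 0) * swap_gap \<le> tree_cost \<omega> 0 (n + 1) - tree_cost (\<omega> \<circ> Transposition.transpose (s+1) (s+2)) 0 (n + 1)"
          by (rule tree_cost_swap[OF w]) (use j elim in \<open>auto simp: s_def intro: inj_on_subset\<close>)
        also have "tree_cost (\<omega> \<circ> Transposition.transpose (s+1) (s+2)) 0 (n + 1) = tree_cost (swapped j \<omega>) 0 (n + 1)"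
          by (rule tree_cost_cong) (auto simp: reindex_def window_swap_def s_def numeral_eq_Suc)
        also have "tree_cost \<omega> 0 (n + 1) - tree_cost (swapped j \<omega>) 0 (n + 1) = ?G \<omega> - ?G (swapped j \<omega>)"
          by (simp add: deviation_def)
        finally have "damping (n + 1) * swap_gap \<le> ?G \<omega> - ?G (swapped j \<omega>)" by simp
        moreover have "damping_limit * swap_gap \<le> damping (n + 1) * swap_gap"
          using swap_gap_pos by (intro mult_right_mono damping_limit_le) auto
        ultimately show ?thesis using True by (simp add: path_ind_def)
      qed (simp add: path_ind_def)
    qed
  qed (intro bounded_rv_integrable bounded_rv_mult bounded_rv_const bounded_rv_path_ind bounded_rv_diff b1)+
  also have "\<dots> = (\<integral>\<omega>. ?G \<omega> * path_ind j \<omega> \<partial>unif_seq) - (\<integral>\<omega>. ?G \<omega> * path_ind j (swapped j \<omega>) \<partial>unif_seq)"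
    unfolding sw by (intro Bochner_Integration.integral_diff bounded_rv_integrable b1)
  also have "\<dots> = (\<integral>\<omega>. ?G \<omega> * path_ind j \<omega> - ?G \<omega> * path_ind j (swapped j \<omega>) \<partial>unif_seq)"
    by (intro Bochner_Integration.integral_diff[symmetric] bounded_rv_integrable b1)
  also have "\<dots> = (\<integral>\<omega>. ?G \<omega> * window_sign j \<omega> \<partial>unif_seq)"
    by (simp add: window_sign_def right_diff_distrib)
  finally show ?thesis .
qed

lemma window_sign_orthogonal:
  assumes "j \<noteq> l" shows "(\<integral>\<omega>. window_sign j \<omega> * window_sign l \<omega> \<partial>unif_seq) = 0"
proof -
  have "(\<integral>\<omega>. window_sign j \<omega> * window_sign l \<omega> \<partial>unif_seq)
    = (\<integral>\<omega>. window_sign j (swapped j \<omega>) * window_sign l (swapped j \<omega>) \<partial>unif_seq)"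
    by (rule expectation_swapped[symmetric]) (intro bounded_rv_mult bounded_rv_window_sign)
  also have "\<dots> = (\<integral>\<omega>. - (window_sign j \<omega> * window_sign l \<omega>) \<partial>unif_seq)"
    by (simp add: window_sign_swapped window_sign_swapped_other[OF assms])
  also have "\<dots> = - (\<integral>\<omega>. window_sign j \<omega> * window_sign l \<omega> \<partial>unif_seq)" by simp
  finally show ?thesis by simp
qed

definition swap_effect :: real where "swap_effect = damping_limit * swap_gap * path_prob 0"

lemma swap_effect_pos: "0 < swap_effect"
  unfolding swap_effect_def using damping_limit_pos swap_gap_pos path_prob_pos by simp

text \<open>
  Let \<open>Y\<close> be the sum of the signs of the \<open>n div 5\<close> windows. The signs are orthogonal, so the second moment of \<open>Y\<close> is at most
  their number, while each sign has correlation at least \<open>swap_effect\<close> with the cost. Now apply the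
  inequality of Cauchy and Schwarz, in the form that the second moment of \<open>G - t * Y\<close> is nonnegative for \<open>t = swap_effect\<close>.
\<close>
theorem deviation_variance_ge:
  "real (n div 5) * swap_effect\<^sup>2 \<le> (\<integral>\<omega>. (deviation n \<omega>)\<^sup>2 \<partial>unif_seq)"
proof -
  define N where "N = n div 5"
  define Y where "Y \<omega> = (\<Sum>j<N. window_sign j \<omega>)" for \<omega>
  let ?G = "deviation n"
  have bY: "bounded_rv Y" unfolding Y_def[abs_def] by (intro bounded_rv_sum bounded_rv_window_sign)
  have GY: "real N * swap_effect \<le> (\<integral>\<omega>. ?G \<omega> * Y \<omega> \<partial>unif_seq)"
  proof -
    have "real N * swap_effect = (\<Sum>j<N. swap_effect)" by simp
    also have "\<dots> \<le> (\<Sum>j<N. \<integral>\<omega>. ?G \<omega> * window_sign j \<omega> \<partial>unif_seq)"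
    proof (rule sum_mono)
      fix j assume "j \<in> {..<N}"
      then have "5 * j + 5 \<le> n" by (auto simp: N_def)
      then show "swap_effect \<le> (\<integral>\<omega>. ?G \<omega> * window_sign j \<omega> \<partial>unif_seq)"
        unfolding swap_effect_def by (rule expectation_deviation_window_sign)
    qed
    also have "\<dots> = (\<integral>\<omega>. (\<Sum>j<N. ?G \<omega> * window_sign j \<omega>) \<partial>unif_seq)"
      by (intro expectation_sum[symmetric] bounded_rv_mult bounded_rv_deviation bounded_rv_window_sign)
    finally show ?thesis by (simp add: Y_def sum_distrib_left)
  qed
  have YY: "(\<integral>\<omega>. (Y \<omega>)\<^sup>2 \<partial>unif_seq) \<le> real N"
  proof -
    have "(\<integral>\<omega>. (Y \<omega>)\<^sup>2 \<partial>unif_seq) = (\<integral>\<omega>. (\<Sum>j<N. \<Sum>l<N. window_sign j \<omega> * window_sign l \<omega>) \<partial>unif_seq)"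
      by (simp add: Y_def power2_eq_square sum_product)
    also have "\<dots> = (\<Sum>j<N. \<integral>\<omega>. (\<Sum>l<N. window_sign j \<omega> * window_sign l \<omega>) \<partial>unif_seq)"
      by (intro expectation_sum bounded_rv_sum bounded_rv_mult bounded_rv_window_sign)
    also have "\<dots> = (\<Sum>j<N. \<Sum>l<N. \<integral>\<omega>. window_sign j \<omega> * window_sign l \<omega> \<partial>unif_seq)"
      by (intro sum.cong refl expectation_sum bounded_rv_mult bounded_rv_window_sign)
    also have "\<dots> \<le> (\<Sum>j<N. \<Sum>l<N. if l = j then 1 else 0)"
    proof (intro sum_mono)
      fix j l
      show "(\<integral>\<omega>. window_sign j \<omega> * window_sign l \<omega> \<partial>unif_seq) \<le> (if l = j then 1 else 0)"
      proof (cases "l = j")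
        case True
        have "(\<integral>\<omega>. window_sign j \<omega> * window_sign j \<omega> \<partial>unif_seq) \<le> (\<integral>\<omega>. 1 \<partial>unif_seq)"
          by (intro integral_mono bounded_rv_integrable bounded_rv_mult bounded_rv_window_sign bounded_rv_const)
             (auto simp: window_sign_def path_ind_def)
        then show ?thesis using True by (simp add: unif_seq.prob_space)
      qed (use window_sign_orthogonal in simp)
    qed
    also have "\<dots> = real N" by simp
    finally show ?thesis .
  qed
  let ?t = swap_effect
  have "0 \<le> (\<integral>\<omega>. (?G \<omega> - ?t * Y \<omega>)\<^sup>2 \<partial>unif_seq)" by (intro integral_nonneg_AE) simp
  also have "\<dots> = (\<integral>\<omega>. (?G \<omega>)\<^sup>2 - 2 * ?t * (?G \<omega> * Y \<omega>) + ?t\<^sup>2 * (Y \<omega>)\<^sup>2 \<partial>unif_seq)"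
    by (simp add: power2_eq_square algebra_simps)
  also have "\<dots> = (\<integral>\<omega>. (?G \<omega>)\<^sup>2 \<partial>unif_seq) - 2 * ?t * (\<integral>\<omega>. ?G \<omega> * Y \<omega> \<partial>unif_seq) + ?t\<^sup>2 * (\<integral>\<omega>. (Y \<omega>)\<^sup>2 \<partial>unif_seq)"
    using bounded_rv_integrable[OF bounded_rv_power2[OF bounded_rv_deviation[of n]]]
      bounded_rv_integrable[OF bounded_rv_mult[OF bounded_rv_deviation[of n] bY]]
      bounded_rv_integrable[OF bounded_rv_power2[OF bY]] by simp
  finally have "2 * ?t * (\<integral>\<omega>. ?G \<omega> * Y \<omega> \<partial>unif_seq) \<le> (\<integral>\<omega>. (?G \<omega>)\<^sup>2 \<partial>unif_seq) + ?t\<^sup>2 * (\<integral>\<omega>. (Y \<omega>)\<^sup>2 \<partial>unif_seq)"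
    by simp
  moreover have "2 * ?t * (real N * ?t) \<le> 2 * ?t * (\<integral>\<omega>. ?G \<omega> * Y \<omega> \<partial>unif_seq)"
    using GY swap_effect_pos by (intro mult_left_mono) auto
  moreover have "?t\<^sup>2 * (\<integral>\<omega>. (Y \<omega>)\<^sup>2 \<partial>unif_seq) \<le> ?t\<^sup>2 * real N"
    using YY by (intro mult_left_mono) auto
  ultimately show ?thesis by (simp add: N_def[symmetric] power2_eq_square algebra_simps)
qed

section \<open>From random sequences to random permutations\<close>

definition rank :: "nat \<Rightarrow> (nat \<Rightarrow> real) \<Rightarrow> nat \<Rightarrow> nat" where
  "rank k \<omega> i = (if i \<in> {1..k} then card {l \<in> {1..k}. \<omega> l \<le> \<omega> i} else i)"

lemma rank_less_iff:
  assumes "i \<in> {1..k}" "j \<in> {1..k}" shows "rank k \<omega> i < rank k \<omega> j \<longleftrightarrow> \<omega> i < \<omega> j"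
proof -
  have "rank k \<omega> a < rank k \<omega> b" if "a \<in> {1..k}" "b \<in> {1..k}" "\<omega> a < \<omega> b" for a b
  proof -
    have "{l \<in> {1..k}. \<omega> l \<le> \<omega> a} \<subseteq> {l \<in> {1..k}. \<omega> l \<le> \<omega> b}" using that by auto
    moreover have "b \<in> {l \<in> {1..k}. \<omega> l \<le> \<omega> b} - {l \<in> {1..k}. \<omega> l \<le> \<omega> a}" using that by auto
    ultimately have "{l \<in> {1..k}. \<omega> l \<le> \<omega> a} \<subset> {l \<in> {1..k}. \<omega> l \<le> \<omega> b}" by blast
    then have "card {l \<in> {1..k}. \<omega> l \<le> \<omega> a} < card {l \<in> {1..k}. \<omega> l \<le> \<omega> b}" by (intro psubset_card_mono) auto
    then show ?thesis using that by (simp add: rank_def)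
  qed
  moreover have "rank k \<omega> i = rank k \<omega> j" if "\<omega> i = \<omega> j" using that assms by (simp add: rank_def)
  ultimately show ?thesis using assms by (metis less_asym' less_irrefl linorder_neqE)
qed

lemma rank_permutes:
  assumes "inj_on \<omega> {1..}" shows "rank k \<omega> permutes {1..k}"
proof (rule bij_imp_permutes)
  have inj: "inj_on (rank k \<omega>) {1..k}"
  proof (rule inj_onI)
    fix x y assume xy: "x \<in> {1..k}" "y \<in> {1..k}" "rank k \<omega> x = rank k \<omega> y"
    then have "\<omega> x = \<omega> y" using rank_less_iff[of x k y \<omega>] rank_less_iff[of y k x \<omega>] by auto
    then show "x = y" using inj_onD[OF assms, of x y] xy by auto
  qed
  have "rank k \<omega> ` {1..k} \<subseteq> {1..k}"
  proof
    fix r assume "r \<in> rank k \<omega> ` {1..k}"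
    then obtain i where i: "i \<in> {1..k}" "r = card {l \<in> {1..k}. \<omega> l \<le> \<omega> i}" by (auto simp: rank_def)
    have "card {l \<in> {1..k}. \<omega> l \<le> \<omega> i} \<le> card {1..k}" by (intro card_mono) auto
    moreover have "0 < card {l \<in> {1..k}. \<omega> l \<le> \<omega> i}" by (subst card_gt_0_iff) (use i in auto)
    ultimately have "1 \<le> r" "r \<le> k" unfolding i(2) by simp_all
    then show "r \<in> {1..k}" by simp
  qed
  then show "bij_betw (rank k \<omega>) {1..k} {1..k}"
    using inj by (simp add: bij_betw_def endo_inj_surj)
qed (simp only: rank_def if_False)

lemma finite_perms: "finite (perms k)"
  unfolding perms_def by (rule finite_permutations) simp

lemma perms_nonempty: "perms k \<noteq> {}"
  using permutes_id[of "{1..k}"] unfolding perms_def by blast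

text \<open>
  Permuting the coordinates by \<open>p\<close> does not change the distribution. For a fixed sequence without ties, the order type of
  the permuted sequence runs through all permutations once as \<open>p\<close> does, so the average over \<open>p\<close> is a
  constant, the average over all permutations. The tree cost of the sequence only depends on its order type.
\<close>
theorem uniform_perm_average:
  fixes \<phi> :: "real \<Rightarrow> real"
  assumes \<phi>: "\<phi> \<in> borel_measurable borel" "\<And>x. \<bar>x\<bar> \<le> 3/2 * real k \<Longrightarrow> \<bar>\<phi> x\<bar> \<le> C"
  shows "(\<Sum>\<pi>\<in>perms k. \<phi> (tree_cost (inv \<pi>) 0 (k + 1))) / real (card (perms k))
    = (\<integral>\<omega>. \<phi> (tree_cost \<omega> 0 (k + 1)) \<partial>unif_seq)"
proof -
  define T where "T = (\<Sum>\<pi>\<in>perms k. \<phi> (tree_cost \<pi> 0 (k + 1)))"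
  have b: "bounded_rv (\<lambda>\<omega>. \<phi> (tree_cost \<omega> 0 (k + 1)))"
  proof -
    have "\<bar>\<phi> (tree_cost \<omega> 0 (k + 1))\<bar> \<le> C" for \<omega> :: "nat \<Rightarrow> real"
      using tree_cost_le[of \<omega> 0 "k + 1"] tree_cost_nonneg[of \<omega> 0 "k + 1"] by (intro \<phi>(2)) simp
    moreover have "(\<lambda>\<omega>. \<phi> (tree_cost \<omega> 0 (k + 1))) \<in> borel_measurable unif_seq"
      using measurable_compose[OF _ \<phi>(1)] bounded_rv_tree_cost[of k] by (auto simp: bounded_rv_def)
    ultimately show ?thesis unfolding bounded_rv_def by blast
  qed
  let ?E = "\<integral>\<omega>. \<phi> (tree_cost \<omega> 0 (k + 1)) \<partial>unif_seq"
  have ok: "inj_on p {1..}" "p \<in> {1..} \<rightarrow> {1..}" if "p \<in> perms k" for p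
    using that permutes_reindex_ok[of p "{1..k}"] by (auto simp: perms_def)
  have sum_eq: "(\<Sum>p\<in>perms k. \<phi> (tree_cost (reindex p \<omega>) 0 (k + 1))) = T" if inj: "inj_on \<omega> {1..}" for \<omega>
    unfolding T_def
  proof (rule sum.reindex_bij_witness[of _ "\<lambda>q. inv (rank k \<omega>) \<circ> q" "\<lambda>p. rank k \<omega> \<circ> p"])
    note r = rank_permutes[OF inj, of k]
    fix p assume p: "p \<in> perms k"
    then have pp: "p permutes {1..k}" by (simp add: perms_def)
    show "inv (rank k \<omega>) \<circ> (rank k \<omega> \<circ> p) = p" "rank k \<omega> \<circ> (inv (rank k \<omega>) \<circ> p) = p"
      using permutes_inv_o[OF r] by (simp_all add: comp_assoc[symmetric])
    show "rank k \<omega> \<circ> p \<in> perms k" "inv (rank k \<omega>) \<circ> p \<in> perms k"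
      using permutes_compose[OF pp r] permutes_compose[OF pp permutes_inv[OF r]] by (simp_all add: perms_def)
    have "tree_cost (rank k \<omega> \<circ> p) 0 (k + 1) = tree_cost (reindex p \<omega>) 0 (k + 1)"
    proof (rule tree_cost_cong)
      fix a b assume "0 < a" "a < k + 1" "0 < b" "b < k + 1"
      then have "a \<in> {1..k}" "b \<in> {1..k}" by auto
      then have "p a \<in> {1..k}" "p b \<in> {1..k}" using permutes_in_image[OF pp] by blast+
      then show "(rank k \<omega> \<circ> p) a < (rank k \<omega> \<circ> p) b \<longleftrightarrow> reindex p \<omega> a < reindex p \<omega> b"
        using \<open>0 < a\<close> \<open>0 < b\<close> rank_less_iff[of "p a" k "p b" \<omega>] by (simp add: Suc_le_eq)
    qed
    then show "\<phi> (tree_cost (rank k \<omega> \<circ> p) 0 (k + 1)) = \<phi> (tree_cost (reindex p \<omega>) 0 (k + 1))" by simp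
  qed
  have "real (card (perms k)) * ?E = (\<Sum>p\<in>perms k. \<integral>\<omega>. \<phi> (tree_cost (reindex p \<omega>) 0 (k + 1)) \<partial>unif_seq)"
  proof -
    have "(\<integral>\<omega>. \<phi> (tree_cost (reindex p \<omega>) 0 (k + 1)) \<partial>unif_seq) = ?E" if "p \<in> perms k" for p
      using b by (intro integral_reindex ok[OF that]) (simp add: bounded_rv_def)
    then show ?thesis by simp
  qed
  also have "\<dots> = (\<integral>\<omega>. (\<Sum>p\<in>perms k. \<phi> (tree_cost (reindex p \<omega>) 0 (k + 1))) \<partial>unif_seq)"
  proof (rule expectation_sum[symmetric])
    fix p assume p: "p \<in> perms k"
    show "bounded_rv (\<lambda>\<omega>. \<phi> (tree_cost (reindex p \<omega>) 0 (k + 1)))"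
      using b measurable_compose[OF reindex_measurable[OF ok[OF p]], of "\<lambda>\<omega>. \<phi> (tree_cost \<omega> 0 (k + 1))" borel]
      unfolding bounded_rv_def by blast
  qed
  also have "\<dots> = (\<integral>\<omega>. T \<partial>unif_seq)"
  proof (rule integral_cong_AE)
    show "(\<lambda>\<omega>. \<Sum>p\<in>perms k. \<phi> (tree_cost (reindex p \<omega>) 0 (k + 1))) \<in> borel_measurable unif_seq"
    proof (rule borel_measurable_sum)
      fix p assume p: "p \<in> perms k"
      show "(\<lambda>\<omega>. \<phi> (tree_cost (reindex p \<omega>) 0 (k + 1))) \<in> borel_measurable unif_seq"
        using b measurable_compose[OF reindex_measurable[OF ok[OF p]], of "\<lambda>\<omega>. \<phi> (tree_cost \<omega> 0 (k + 1))" borel]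
        unfolding bounded_rv_def by blast
    qed
    show "AE \<omega> in unif_seq. (\<Sum>p\<in>perms k. \<phi> (tree_cost (reindex p \<omega>) 0 (k + 1))) = T"
      using AE_unif_seq_inj by eventually_elim (rule sum_eq)
  qed simp
  also have "\<dots> = T" by (simp add: unif_seq.prob_space)
  finally have "real (card (perms k)) * ?E = T" .
  moreover have "T = (\<Sum>\<pi>\<in>perms k. \<phi> (tree_cost (inv \<pi>) 0 (k + 1)))"
    unfolding T_def
    by (rule sum.reindex_bij_witness[of _ inv inv]) (auto simp: perms_def permutes_inv permutes_inv_inv)
  moreover have "0 < card (perms k)" using finite_perms perms_nonempty by (simp add: card_gt_0_iff)
  ultimately show ?thesis by (simp add: field_simps)
qed

section \<open>Mean-square approximation and characteristic functions\<close>

definition l2 :: "((nat \<Rightarrow> real) \<Rightarrow> real) \<Rightarrow> real" where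
  "l2 X = sqrt (\<integral>\<omega>. (X \<omega>)\<^sup>2 \<partial>unif_seq)"

lemma l2_nonneg: "0 \<le> l2 X"
  unfolding l2_def by (intro real_sqrt_ge_zero integral_nonneg_AE) auto

lemma l2_power2: "(l2 X)\<^sup>2 = (\<integral>\<omega>. (X \<omega>)\<^sup>2 \<partial>unif_seq)"
  unfolding l2_def by (intro real_sqrt_pow2 integral_nonneg_AE) auto

lemma l2_scale: "l2 (\<lambda>\<omega>. c * X \<omega>) = \<bar>c\<bar> * l2 X"
  unfolding l2_def by (simp add: power_mult_distrib real_sqrt_mult)

text \<open>
  With \<open>a\<close> and \<open>b\<close> slightly above the two norms, to avoid division by zero, the inequality
  \<open>2 * X * Y \<le> b / a * X\<^sup>2 + a / b * Y\<^sup>2\<close> integrates to the claim.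
\<close>
lemma l2_triangle:
  assumes X: "bounded_rv X" and Y: "bounded_rv Y"
  shows "l2 (\<lambda>\<omega>. X \<omega> + Y \<omega>) \<le> l2 X + l2 Y"
proof (rule field_le_epsilon)
  fix e :: real assume e: "0 < e"
  define a where "a = l2 X + e / 2"
  define b where "b = l2 Y + e / 2"
  have ab: "0 < a" "0 < b" "l2 X \<le> a" "l2 Y \<le> b"
    unfolding a_def b_def using e l2_nonneg[of X] l2_nonneg[of Y] by auto
  have iX: "integrable unif_seq (\<lambda>\<omega>. (X \<omega>)\<^sup>2)" and iY: "integrable unif_seq (\<lambda>\<omega>. (Y \<omega>)\<^sup>2)"
    and iXY: "integrable unif_seq (\<lambda>\<omega>. (X \<omega> + Y \<omega>)\<^sup>2)"
    by (intro bounded_rv_integrable bounded_rv_power2 bounded_rv_add X Y)+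
  have "(X \<omega> + Y \<omega>)\<^sup>2 \<le> (1 + b / a) * (X \<omega>)\<^sup>2 + (1 + a / b) * (Y \<omega>)\<^sup>2" for \<omega>
  proof -
    have "0 \<le> (b * X \<omega> - a * Y \<omega>)\<^sup>2 / (a * b)" using ab by simp
    also have "\<dots> = b / a * (X \<omega>)\<^sup>2 + a / b * (Y \<omega>)\<^sup>2 - 2 * X \<omega> * Y \<omega>"
      using ab by (simp add: field_simps power2_eq_square)
    finally show ?thesis by (simp add: algebra_simps power2_eq_square)
  qed
  then have "(\<integral>\<omega>. (X \<omega> + Y \<omega>)\<^sup>2 \<partial>unif_seq) \<le> (\<integral>\<omega>. (1 + b / a) * (X \<omega>)\<^sup>2 + (1 + a / b) * (Y \<omega>)\<^sup>2 \<partial>unif_seq)"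
    by (intro integral_mono iXY Bochner_Integration.integrable_add integrable_mult_right iX iY) auto
  also have "\<dots> = (1 + b / a) * (l2 X)\<^sup>2 + (1 + a / b) * (l2 Y)\<^sup>2"
    using iX iY by (simp add: l2_power2)
  also have "\<dots> \<le> (1 + b / a) * a\<^sup>2 + (1 + a / b) * b\<^sup>2"
    using ab l2_nonneg by (intro add_mono mult_left_mono power_mono) auto
  also have "\<dots> = (a + b)\<^sup>2"
    using ab by (simp add: field_simps power2_eq_square)
  finally have "(l2 (\<lambda>\<omega>. X \<omega> + Y \<omega>))\<^sup>2 \<le> (a + b)\<^sup>2" by (simp only: l2_power2)
  then have "l2 (\<lambda>\<omega>. X \<omega> + Y \<omega>) \<le> a + b" using ab by (elim power2_le_imp_le) simp
  then show "l2 (\<lambda>\<omega>. X \<omega> + Y \<omega>) \<le> l2 X + l2 Y + e" by (simp add: a_def b_def)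
qed

lemma l2_diff_le:
  assumes X: "bounded_rv X" and Y: "bounded_rv Y"
  shows "\<bar>l2 X - l2 Y\<bar> \<le> l2 (\<lambda>\<omega>. X \<omega> - Y \<omega>)"
proof -
  have "l2 X \<le> l2 (\<lambda>\<omega>. X \<omega> - Y \<omega>) + l2 Y"
    using l2_triangle[OF bounded_rv_diff[OF X Y] Y] by simp
  moreover have "l2 Y \<le> l2 (\<lambda>\<omega>. Y \<omega> - X \<omega>) + l2 X"
    using l2_triangle[OF bounded_rv_diff[OF Y X] X] by simp
  moreover have "l2 (\<lambda>\<omega>. Y \<omega> - X \<omega>) = l2 (\<lambda>\<omega>. X \<omega> - Y \<omega>)"
    unfolding l2_def by (simp add: power2_commute)
  ultimately show ?thesis by linarith
qed

lemma bounded_rv_abs: "bounded_rv X \<Longrightarrow> bounded_rv (\<lambda>\<omega>. \<bar>X \<omega>\<bar>)"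
  unfolding bounded_rv_def by auto

lemma mean_abs_le_l2:
  assumes "bounded_rv X" shows "(\<integral>\<omega>. \<bar>X \<omega>\<bar> \<partial>unif_seq) \<le> l2 X"
  unfolding l2_def using variance_le_second_moment(2)[OF bounded_rv_abs[OF assms]]
  by (intro real_le_rsqrt) simp

lemma norm_iexp_diff_le: "cmod (iexp a - iexp b) \<le> \<bar>a - b\<bar>"
proof -
  have "b + (a - b) = a" by simp
  then have "iexp b * iexp (a - b) = iexp a"
    by (simp only: exp_add[symmetric] distrib_left[symmetric] of_real_add[symmetric])
  then have "iexp a - iexp b = iexp b * (iexp (a - b) - 1)"
    by (simp only: right_diff_distrib mult_1_right)
  then have "cmod (iexp a - iexp b) = cmod (iexp (a - b) - 1)"
    by (simp only: norm_mult norm_exp_i_times mult_1_left)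
  then show ?thesis using iexp_approx1[of "a - b" 0] by simp
qed

text \<open>
  Characteristic functions are Lipschitz in the random variable, so approximation in mean transfers to
  them.
\<close>
lemma char_distr_le:
  assumes X: "bounded_rv X" and Y: "bounded_rv Y"
  shows "cmod (char (distr unif_seq borel X) t - char (distr unif_seq borel Y) t)
    \<le> \<bar>t\<bar> * (\<integral>\<omega>. \<bar>X \<omega> - Y \<omega>\<bar> \<partial>unif_seq)"
proof -
  have m [measurable]: "X \<in> borel_measurable unif_seq" "Y \<in> borel_measurable unif_seq"
    using X Y by (auto simp: bounded_rv_def)
  have i: "integrable unif_seq (\<lambda>\<omega>. iexp (t * X \<omega>))" "integrable unif_seq (\<lambda>\<omega>. iexp (t * Y \<omega>))"
    by (intro unif_seq.integrable_iexp; simp)+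
  have "char (distr unif_seq borel X) t - char (distr unif_seq borel Y) t
    = (CLINT \<omega>|unif_seq. iexp (t * X \<omega>) - iexp (t * Y \<omega>))"
    unfolding char_def using i by (simp add: integral_distr)
  also have "cmod \<dots> \<le> (\<integral>\<omega>. cmod (iexp (t * X \<omega>) - iexp (t * Y \<omega>)) \<partial>unif_seq)"
    by (rule integral_norm_bound)
  also have "\<dots> \<le> (\<integral>\<omega>. \<bar>t\<bar> * \<bar>X \<omega> - Y \<omega>\<bar> \<partial>unif_seq)"
  proof (rule integral_mono)
    show "integrable unif_seq (\<lambda>\<omega>. cmod (iexp (t * X \<omega>) - iexp (t * Y \<omega>)))"
      using i by (intro integrable_norm Bochner_Integration.integrable_diff)
    show "integrable unif_seq (\<lambda>\<omega>. \<bar>t\<bar> * \<bar>X \<omega> - Y \<omega>\<bar>)"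
      by (intro integrable_mult_right bounded_rv_integrable bounded_rv_abs bounded_rv_diff X Y)
    show "cmod (iexp (t * X \<omega>) - iexp (t * Y \<omega>)) \<le> \<bar>t\<bar> * \<bar>X \<omega> - Y \<omega>\<bar>" for \<omega>
      using norm_iexp_diff_le[of "t * X \<omega>" "t * Y \<omega>"] by (simp only: right_diff_distrib[symmetric] abs_mult)
  qed
  finally show ?thesis by simp
qed

lemma char_distr_le_l2:
  assumes X: "bounded_rv X" and Y: "bounded_rv Y"
  shows "cmod (char (distr unif_seq borel X) t - char (distr unif_seq borel Y) t)
    \<le> \<bar>t\<bar> * l2 (\<lambda>\<omega>. X \<omega> - Y \<omega>)"
  by (rule order_trans[OF char_distr_le[OF X Y] mult_left_mono[OF mean_abs_le_l2[OF bounded_rv_diff[OF X Y]] abs_ge_zero]])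

lemma char_distr_scale:
  assumes "X \<in> borel_measurable M"
  shows "char (distr M borel (\<lambda>\<omega>. c * X \<omega>)) t = char (distr M borel X) (c * t)"
  unfolding char_def using assms by (simp add: integral_distr mult.assoc mult.left_commute)

text \<open>
  The standard approximation argument for limits of double sequences, here with an error that is small only in the
  limit of large \<open>n\<close>. It is applied twice below: to norms, where the limit of \<open>a\<close> is not known in
  advance, and to characteristic functions.
\<close>
lemma interchange_limits:
  fixes s :: "nat \<Rightarrow> 'a::banach" and w :: "nat \<Rightarrow> nat \<Rightarrow> 'a"
  assumes w: "\<And>L. 1 \<le> L \<Longrightarrow> (\<lambda>n. w L n) \<longlonglongrightarrow> a L"
    and close: "\<And>L n. 1 \<le> L \<Longrightarrow> 1 \<le> n \<Longrightarrow> norm (s n - w L n) \<le> e L n"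
    and e: "\<And>L. 1 \<le> L \<Longrightarrow> (\<lambda>n. e L n) \<longlonglongrightarrow> \<epsilon> L" "\<epsilon> \<longlonglongrightarrow> 0"
  obtains l where "s \<longlonglongrightarrow> l" "a \<longlonglongrightarrow> l"
proof -
  have "Cauchy s"
  proof (rule CauchyI)
    fix \<eta> :: real assume \<eta>: "0 < \<eta>"
    have "\<forall>\<^sub>F L in sequentially. \<epsilon> L < \<eta> / 3" using e(2) \<eta> by (intro order_tendstoD) auto
    then have "\<forall>\<^sub>F L in sequentially. \<epsilon> L < \<eta> / 3 \<and> 1 \<le> L" using eventually_ge_at_top by (rule eventually_conj)
    then obtain L where L: "\<epsilon> L < \<eta> / 3" "1 \<le> L" by (auto simp: eventually_sequentially)
    have "\<forall>\<^sub>F n in sequentially. e L n < \<eta> / 3" using e(1)[OF L(2)] L(1) by (rule order_tendstoD)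
    then have "\<forall>\<^sub>F n in sequentially. e L n < \<eta> / 3 \<and> 1 \<le> n" using eventually_ge_at_top by (rule eventually_conj)
    then obtain M where M: "\<And>n. M \<le> n \<Longrightarrow> e L n < \<eta> / 3 \<and> 1 \<le> n" by (auto simp: eventually_sequentially)
    have "Cauchy (w L)" using w[OF L(2)] by (rule LIMSEQ_imp_Cauchy)
    then obtain M' where M': "\<And>m n. M' \<le> m \<Longrightarrow> M' \<le> n \<Longrightarrow> norm (w L m - w L n) < \<eta> / 3"
      using \<eta> by (metis CauchyD divide_pos_pos zero_less_numeral)
    show "\<exists>M. \<forall>m\<ge>M. \<forall>n\<ge>M. norm (s m - s n) < \<eta>"
    proof (intro exI allI impI)
      fix m n assume mn: "max M M' \<le> m" "max M M' \<le> n"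
      have "norm (s m - w L m) < \<eta> / 3" "norm (s n - w L n) < \<eta> / 3"
        using close[OF L(2), of m] close[OF L(2), of n] M[of m] M[of n] mn by auto
      moreover have "norm (w L m - w L n) < \<eta> / 3" using M' mn by auto
      ultimately have "norm ((s m - w L m) + (w L m - w L n) - (s n - w L n)) < \<eta>"
        using norm_triangle_ineq4[of "(s m - w L m) + (w L m - w L n)" "s n - w L n"]
          norm_triangle_ineq[of "s m - w L m" "w L m - w L n"] by linarith
      then show "norm (s m - s n) < \<eta>" by simp
    qed
  qed
  then obtain l where l: "s \<longlonglongrightarrow> l" using Cauchy_convergent convergent_def by blast
  have "norm (a L - l) \<le> \<epsilon> L" if L: "1 \<le> L" for L
  proof -
    have "(\<lambda>n. norm (s n - w L n)) \<longlonglongrightarrow> norm (l - a L)" by (intro tendsto_intros l w L)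
    then have "norm (l - a L) \<le> \<epsilon> L"
      using e(1)[OF L] close[OF L] by (intro LIMSEQ_le[of _ _ "e L"]) auto
    then show ?thesis by (simp add: norm_minus_commute)
  qed
  then have "a \<longlonglongrightarrow> l"
    by (intro Lim_transform_bound[OF _ e(2), THEN LIM_zero_cancel])
      (auto simp: eventually_sequentially intro!: exI[of _ 1] intro: order_trans[OF _ abs_ge_self])
  with l show ?thesis by (rule that)
qed

section \<open>The central limit theorem for the tree cost\<close>

definition block_sum :: "nat \<Rightarrow> nat \<Rightarrow> (nat \<Rightarrow> real) \<Rightarrow> real" where
  "block_sum L m \<omega> = (\<Sum>b<m. centred_block L b \<omega>)"

definition block_sd :: "nat \<Rightarrow> real" where
  "block_sd L = l2 (centred_block L 0)"

lemma bounded_rv_block_sum: "bounded_rv (block_sum L m)"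
  unfolding block_sum_def[abs_def] by (intro bounded_rv_sum bounded_rv_centred_block)

lemma expectation_centred_block: "(\<integral>\<omega>. centred_block L b \<omega> \<partial>unif_seq) = 0"
proof -
  have "(\<integral>\<omega>. centred_block L b \<omega> \<partial>unif_seq)
    = (\<integral>\<omega>. block L b \<omega> \<partial>unif_seq) - (\<integral>\<omega>. block L 0 \<omega> \<partial>unif_seq)"
    unfolding centred_block_def
    using bounded_rv_integrable[OF bounded_rv_block[of L b]] by (simp add: unif_seq.prob_space)
  then show ?thesis using expectation_block[of L b] by linarith
qed

lemma centred_blocks_indep: "unif_seq.indep_vars (\<lambda>_. borel) (centred_block L) UNIV"
  unfolding centred_block_def[abs_def]
  by (rule unif_seq.indep_vars_compose2[OF blocks_iid_indep]) auto

lemma distr_centred_block: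
  "distr unif_seq borel (centred_block L b) = distr unif_seq borel (centred_block L 0)"
proof -
  define c where "c = (\<integral>\<omega>. block L 0 \<omega> \<partial>unif_seq)"
  have m: "block L b \<in> borel_measurable unif_seq" for b
    using bounded_rv_block[of L b] by (simp add: bounded_rv_def)
  have *: "distr unif_seq borel (centred_block L b) = distr (distr unif_seq borel (block L b)) borel (\<lambda>x. x - c)" for b
    by (subst distr_distr[OF _ m]) (auto simp: centred_block_def[abs_def] c_def comp_def)
  show ?thesis unfolding * by (simp only: distr_block[of L b])
qed

lemma centred_block_second_moment:
  "(\<integral>\<omega>. (centred_block L b \<omega>)\<^sup>2 \<partial>unif_seq) = (block_sd L)\<^sup>2"
proof -
  have m: "centred_block L b \<in> borel_measurable unif_seq" for b
    using bounded_rv_centred_block[of L b] by (simp add: bounded_rv_def)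
  have *: "(\<integral>\<omega>. (centred_block L b \<omega>)\<^sup>2 \<partial>unif_seq) = (\<integral>x. x\<^sup>2 \<partial>distr unif_seq borel (centred_block L b))" for b
    by (subst integral_distr[OF m]) auto
  show ?thesis unfolding block_sd_def l2_power2 * by (simp only: distr_centred_block[of L b])
qed

lemma l2_block_sum: "l2 (block_sum L m) = sqrt (real m) * block_sd L"
proof -
  have cross: "(\<integral>\<omega>. centred_block L a \<omega> * centred_block L b \<omega> \<partial>unif_seq) = 0" if "a \<noteq> b" for a b
  proof -
    have "(\<integral>\<omega>. (\<Prod>c\<in>{a, b}. centred_block L c \<omega>) \<partial>unif_seq) = (\<Prod>c\<in>{a, b}. \<integral>\<omega>. centred_block L c \<omega> \<partial>unif_seq)"
      by (rule unif_seq.indep_vars_lebesgue_integral[OF _ unif_seq.indep_vars_subset[OF centred_blocks_indep]])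
        (auto intro: bounded_rv_integrable bounded_rv_centred_block)
    with that have "(\<integral>\<omega>. centred_block L a \<omega> * centred_block L b \<omega> \<partial>unif_seq)
      = (\<integral>\<omega>. centred_block L a \<omega> \<partial>unif_seq) * (\<integral>\<omega>. centred_block L b \<omega> \<partial>unif_seq)" by simp
    then show ?thesis by (simp add: expectation_centred_block)
  qed
  have "(\<integral>\<omega>. (block_sum L m \<omega>)\<^sup>2 \<partial>unif_seq)
    = (\<integral>\<omega>. (\<Sum>a<m. \<Sum>b<m. centred_block L a \<omega> * centred_block L b \<omega>) \<partial>unif_seq)"
    by (simp add: block_sum_def power2_eq_square sum_product)
  also have "\<dots> = (\<Sum>a<m. \<Sum>b<m. \<integral>\<omega>. centred_block L a \<omega> * centred_block L b \<omega> \<partial>unif_seq)"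
    by (subst expectation_sum; (subst expectation_sum)?; intro bounded_rv_sum bounded_rv_mult bounded_rv_centred_block sum.cong refl)
  also have "\<dots> = (\<Sum>a<m. \<Sum>b<m. if a = b then (block_sd L)\<^sup>2 else 0)"
    using cross centred_block_second_moment[of L] by (intro sum.cong refl) (auto simp: power2_eq_square)
  also have "\<dots> = real m * (block_sd L)\<^sup>2" by simp
  finally have "l2 (block_sum L m) = sqrt (real m * (block_sd L)\<^sup>2)" by (simp add: l2_def)
  then show ?thesis using l2_nonneg[of "centred_block L 0"] by (simp add: real_sqrt_mult block_sd_def)
qed

lemma div_ratio_limit:
  assumes L: "1 \<le> (L::nat)" shows "(\<lambda>n. sqrt (real (n div L)) / sqrt (real n)) \<longlonglongrightarrow> 1 / sqrt (real L)"
proof -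
  have "(\<lambda>n. real (n div L) / real n) \<longlonglongrightarrow> 1 / real L"
  proof (rule real_tendsto_sandwich)
    have b: "real n / real L - 1 \<le> real (n div L)" "real (n div L) \<le> real n / real L" for n
    proof -
      have "n < L + n div L * L" using L by (intro dividend_less_div_times) simp
      then have "real n \<le> (real (n div L) + 1) * real L"
        unfolding of_nat_less_iff[where 'a=real, symmetric] by (simp add: algebra_simps)
      then show "real n / real L - 1 \<le> real (n div L)" using L by (simp add: pos_divide_le_eq diff_le_eq)
    qed (rule of_nat_div_le_of_nat)
    show "\<forall>\<^sub>F n in sequentially. 1 / real L - 1 / real n \<le> real (n div L) / real n"
      using eventually_gt_at_top[of 0]
    proof eventually_elim
      case (elim n)
      have "1 / real L - 1 / real n = (real n / real L - 1) / real n" using elim by (simp add: diff_divide_distrib)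
      then show ?case using b(1)[of n] elim by (simp only:) (rule divide_right_mono, auto)
    qed
    show "\<forall>\<^sub>F n in sequentially. real (n div L) / real n \<le> 1 / real L"
      using eventually_gt_at_top[of 0]
    proof eventually_elim
      case (elim n)
      have "real (n div L) / real n \<le> real n / real L / real n" using b(2)[of n] by (rule divide_right_mono) auto
      then show ?case using elim by simp
    qed
    show "(\<lambda>n. 1 / real L - 1 / real n) \<longlonglongrightarrow> 1 / real L"
      using tendsto_diff[OF tendsto_const lim_1_over_n, of "1 / real L"] by simp
  qed auto
  then have "(\<lambda>n. sqrt (real (n div L) / real n)) \<longlonglongrightarrow> sqrt (1 / real L)" by (rule tendsto_real_sqrt)
  then show ?thesis by (simp add: real_sqrt_divide)
qed

text \<open>
  The classical central limit theorem requires positive variance; for variance zero the sum vanishes almost surely and the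
  claim is trivial. The normalisation by \<open>sqrt n\<close> instead of the number of blocks is a convergent
  scale factor.
\<close>
lemma char_block_sum_limit:
  assumes L: "1 \<le> L"
  shows "(\<lambda>n. char (distr unif_seq borel (\<lambda>\<omega>. block_sum L (n div L) \<omega> / sqrt (real n))) t)
    \<longlonglongrightarrow> complex_of_real (exp (- (block_sd L / sqrt (real L) * t)\<^sup>2 / 2))"
proof (cases "block_sd L = 0")
  case True
  have "char (distr unif_seq borel (\<lambda>\<omega>. block_sum L (n div L) \<omega> / sqrt (real n))) t = 1" for n
  proof -
    have "l2 (\<lambda>\<omega>. block_sum L (n div L) \<omega> / sqrt (real n) - 0) = 0"
      using l2_scale[of "1 / sqrt (real n)" "block_sum L (n div L)"] True by (simp add: l2_block_sum)
    moreover have "bounded_rv (\<lambda>\<omega>. block_sum L (n div L) \<omega> / sqrt (real n))"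
      using bounded_rv_mult[OF bounded_rv_const[of "1 / sqrt (real n)"] bounded_rv_block_sum] by simp
    ultimately have "cmod (char (distr unif_seq borel (\<lambda>\<omega>. block_sum L (n div L) \<omega> / sqrt (real n))) t
        - char (distr unif_seq borel (\<lambda>_. 0)) t) \<le> 0"
      using char_distr_le_l2[OF _ bounded_rv_const[of 0], of "\<lambda>\<omega>. block_sum L (n div L) \<omega> / sqrt (real n)" t] by simp
    moreover have "char (distr unif_seq borel (\<lambda>_. 0)) t = 1"
      unfolding char_def by (subst integral_distr) (simp_all add: unif_seq.prob_space)
    ultimately show ?thesis by simp
  qed
  with True show ?thesis by simp
next
  case False
  define s where "s = block_sd L"
  have s: "0 < s" using False l2_nonneg[of "centred_block L 0"] unfolding s_def block_sd_def by linarith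
  define Z where "Z m \<omega> = block_sum L m \<omega> / sqrt (real m * s\<^sup>2)" for m \<omega>
  define c where "c n = s * (sqrt (real (n div L)) / sqrt (real n))" for n :: nat
  have rvZ: "bounded_rv (Z m)" for m
    using bounded_rv_mult[OF bounded_rv_const[of "1 / sqrt (real m * s\<^sup>2)"] bounded_rv_block_sum] by (simp add: Z_def[abs_def])
  have "weak_conv_m (\<lambda>m. distr unif_seq borel (Z m)) std_normal_distribution"
    unfolding Z_def[abs_def] block_sum_def
  proof (rule unif_seq.central_limit_theorem_zero_mean[OF centred_blocks_indep expectation_centred_block s _ _ distr_centred_block])
    show "integrable unif_seq (\<lambda>x. (centred_block L n x)\<^sup>2)" for n
      by (intro bounded_rv_integrable bounded_rv_power2 bounded_rv_centred_block)
    show "unif_seq.variance (centred_block L n) = s\<^sup>2" for n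
      by (simp add: expectation_centred_block centred_block_second_moment s_def)
  qed
  then have Zlim: "(\<lambda>m. char (distr unif_seq borel (Z m)) u) \<longlonglongrightarrow> char std_normal_distribution u" for u
  proof (intro levy_continuity1)
    show "real_distribution (distr unif_seq borel (Z m))" for m
      using rvZ[of m] by (intro unif_seq.real_distribution_distr) (simp add: bounded_rv_def)
  qed (auto intro: real_dist_normal_dist)
  define \<sigma> where "\<sigma> = s / sqrt (real L)"
  have c_lim: "c \<longlonglongrightarrow> \<sigma>"
    unfolding c_def[abs_def] \<sigma>_def using tendsto_mult[OF tendsto_const[of s] div_ratio_limit[OF L]] by simp
  have Zn: "block_sum L (n div L) \<omega> / sqrt (real n) = c n * Z (n div L) \<omega>" for n \<omega>
  proof (cases "n div L = 0")
    case True then show ?thesis by (simp add: block_sum_def Z_def)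
  next
    case False then show ?thesis using s by (simp add: c_def Z_def real_sqrt_mult)
  qed
  have div: "filterlim (\<lambda>n. n div L) at_top sequentially"
    unfolding filterlim_at_top
  proof
    fix Z show "\<forall>\<^sub>F n in sequentially. Z \<le> n div L"
      using eventually_ge_at_top[of "Z * L"] by eventually_elim (metis L div_le_mono nonzero_mult_div_cancel_right not_one_le_zero)
  qed
  have main: "(\<lambda>n. char (distr unif_seq borel (Z (n div L))) (\<sigma> * t)) \<longlonglongrightarrow> char std_normal_distribution (\<sigma> * t)"
    by (rule filterlim_compose[OF Zlim div])
  have small: "(\<lambda>n. char (distr unif_seq borel (\<lambda>\<omega>. c n * Z (n div L) \<omega>)) t
      - char (distr unif_seq borel (Z (n div L))) (\<sigma> * t)) \<longlonglongrightarrow> 0"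
  proof (rule Lim_null_comparison)
    have l2Z: "l2 (Z m) \<le> 1" for m
    proof -
      have "l2 (Z m) = 1 / sqrt (real m * s\<^sup>2) * l2 (block_sum L m)"
        using l2_scale[of "1 / sqrt (real m * s\<^sup>2)" "block_sum L m"] by (simp add: Z_def[abs_def])
      also have "\<dots> \<le> 1" using s by (simp add: l2_block_sum real_sqrt_mult flip: s_def)
      finally show ?thesis .
    qed
    have "cmod (char (distr unif_seq borel (\<lambda>\<omega>. c n * Z (n div L) \<omega>)) t
      - char (distr unif_seq borel (Z (n div L))) (\<sigma> * t)) \<le> \<bar>t\<bar> * \<bar>c n - \<sigma>\<bar>" for n
    proof -
      have "Z (n div L) \<in> borel_measurable unif_seq" using rvZ by (simp add: bounded_rv_def)
      then have "cmod (char (distr unif_seq borel (\<lambda>\<omega>. c n * Z (n div L) \<omega>)) t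
          - char (distr unif_seq borel (Z (n div L))) (\<sigma> * t))
        \<le> \<bar>t\<bar> * l2 (\<lambda>\<omega>. c n * Z (n div L) \<omega> - \<sigma> * Z (n div L) \<omega>)"
        using char_distr_le_l2[OF bounded_rv_mult[OF bounded_rv_const[of "c n"] rvZ[of "n div L"]]
            bounded_rv_mult[OF bounded_rv_const[of \<sigma>] rvZ[of "n div L"]], of t]
        by (simp only: char_distr_scale)
      also have "\<dots> = \<bar>t\<bar> * (\<bar>c n - \<sigma>\<bar> * l2 (Z (n div L)))"
        by (simp only: left_diff_distrib[symmetric] l2_scale)
      also have "\<dots> \<le> \<bar>t\<bar> * (\<bar>c n - \<sigma>\<bar> * 1)" using l2Z by (intro mult_left_mono) auto
      finally show ?thesis by simp
    qed
    then show "\<forall>\<^sub>F n in sequentially. cmod (char (distr unif_seq borel (\<lambda>\<omega>. c n * Z (n div L) \<omega>)) t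
      - char (distr unif_seq borel (Z (n div L))) (\<sigma> * t)) \<le> \<bar>t\<bar> * \<bar>c n - \<sigma>\<bar>" by simp
    have "(\<lambda>n. \<bar>t\<bar> * \<bar>c n - \<sigma>\<bar>) \<longlonglongrightarrow> \<bar>t\<bar> * \<bar>\<sigma> - \<sigma>\<bar>" by (intro tendsto_intros c_lim)
    then show "(\<lambda>n. \<bar>t\<bar> * \<bar>c n - \<sigma>\<bar>) \<longlonglongrightarrow> 0" by simp
  qed
  have "(\<lambda>n. char (distr unif_seq borel (\<lambda>\<omega>. c n * Z (n div L) \<omega>)) t) \<longlonglongrightarrow> char std_normal_distribution (\<sigma> * t)"
    using tendsto_add[OF small main] by simp
  then show ?thesis unfolding Zn \<sigma>_def s_def char_std_normal_distribution .
qed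

text \<open>
  Both the standard deviation and the characteristic function of the normalised cost are
  limits, as the block length grows, of the limits for block sums. The lower bound on the variance makes the limit
  positive.
\<close>
theorem tree_cost_clt:
  obtains \<sigma> :: real where "0 < \<sigma>" "(\<lambda>n. l2 (\<lambda>\<omega>. deviation n \<omega> / sqrt (real n))) \<longlonglongrightarrow> \<sigma>"
    "\<And>t. (\<lambda>n. char (distr unif_seq borel (\<lambda>\<omega>. deviation n \<omega> / sqrt (real n))) t)
        \<longlonglongrightarrow> complex_of_real (exp (- (\<sigma> * t)\<^sup>2 / 2))"
proof -
  let ?D = "\<lambda>n \<omega>. deviation n \<omega> / sqrt (real n)" and ?W = "\<lambda>L n \<omega>. block_sum L (n div L) \<omega> / sqrt (real n)"
  define r where "r L n = (384 * zeta54 * (real L * zeta54 + real n * real L powr (-1/8) * zeta98) + 6200 * sqrt (real n)) / real n"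
    for L n :: nat
  define v where "v L = sqrt (384 * zeta54 * zeta98 * real L powr (-1/8))" for L :: nat
  have rvD: "bounded_rv (?D n)" for n
    using bounded_rv_mult[OF bounded_rv_const[of "1 / sqrt (real n)"] bounded_rv_deviation] by simp
  have rvW: "bounded_rv (?W L n)" for L n
    using bounded_rv_mult[OF bounded_rv_const[of "1 / sqrt (real n)"] bounded_rv_block_sum] by simp
  have close: "l2 (\<lambda>\<omega>. ?D n \<omega> - ?W L n \<omega>) \<le> sqrt (r L n)" if "1 \<le> L" "1 \<le> n" for L n
  proof -
    have "l2 (\<lambda>\<omega>. ?D n \<omega> - ?W L n \<omega>) = 1 / sqrt (real n) * l2 (\<lambda>\<omega>. deviation n \<omega> - block_sum L (n div L) \<omega>)"
      using l2_scale[of "1 / sqrt (real n)" "\<lambda>\<omega>. deviation n \<omega> - block_sum L (n div L) \<omega>"] by (simp add: diff_divide_distrib)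
    also have "\<dots> = sqrt ((\<integral>\<omega>. (deviation n \<omega> - block_sum L (n div L) \<omega>)\<^sup>2 \<partial>unif_seq) / real n)"
      by (simp add: l2_def real_sqrt_divide)
    also have "\<dots> \<le> sqrt (r L n)"
      unfolding r_def block_sum_def using deviation_approx[OF that] by (intro real_sqrt_le_mono divide_right_mono) auto
    finally show ?thesis .
  qed
  have r_lim: "(\<lambda>n. sqrt (r L n)) \<longlonglongrightarrow> v L" for L
  proof -
    have "\<forall>\<^sub>F n in sequentially. 384 * zeta54\<^sup>2 * real L * (1 / real n) + 384 * zeta54 * zeta98 * real L powr (-1/8)
        + 6200 * (1 / sqrt (real n)) = r L n"
      using eventually_gt_at_top[of 0]
    proof eventually_elim
      case (elim n)
      have "1 / sqrt (real n) = sqrt (real n) / real n" using real_div_sqrt[of "real n"] elim by (simp add: field_simps)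
      then show ?case using elim unfolding r_def by (simp add: field_simps power2_eq_square)
    qed
    moreover have "(\<lambda>n. 384 * zeta54\<^sup>2 * real L * (1 / real n) + 384 * zeta54 * zeta98 * real L powr (-1/8)
        + 6200 * (1 / sqrt (real n))) \<longlonglongrightarrow> 384 * zeta54\<^sup>2 * real L * 0 + 384 * zeta54 * zeta98 * real L powr (-1/8) + 6200 * 0"
      by (intro tendsto_add tendsto_mult tendsto_const lim_1_over_n) real_asymp
    ultimately have "r L \<longlonglongrightarrow> 384 * zeta54 * zeta98 * real L powr (-1/8)"
      using Lim_transform_eventually by fastforce
    then show ?thesis unfolding v_def by (rule tendsto_real_sqrt)
  qed
  have v_lim: "v \<longlonglongrightarrow> 0"
  proof -
    have "(\<lambda>L. real L powr (-1/8)) \<longlonglongrightarrow> 0" by real_asymp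
    then have "(\<lambda>L. sqrt (384 * zeta54 * zeta98 * real L powr (-1/8))) \<longlonglongrightarrow> sqrt (384 * zeta54 * zeta98 * 0)"
      by (intro tendsto_intros)
    then show ?thesis by (simp add: v_def[abs_def])
  qed
  have l2W: "(\<lambda>n. l2 (?W L n)) \<longlonglongrightarrow> block_sd L / sqrt (real L)" if L: "1 \<le> L" for L
  proof -
    have "l2 (?W L n) = block_sd L * (sqrt (real (n div L)) / sqrt (real n))" for n
      using l2_scale[of "1 / sqrt (real n)" "block_sum L (n div L)"] by (simp add: l2_block_sum)
    then show ?thesis using tendsto_mult[OF tendsto_const[of "block_sd L"] div_ratio_limit[OF L]] by simp
  qed
  have "norm (l2 (?D n) - l2 (?W L n)) \<le> sqrt (r L n)" if "1 \<le> L" "1 \<le> n" for L n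
    unfolding real_norm_def by (rule order_trans[OF l2_diff_le[OF rvD rvW] close[OF that]])
  from interchange_limits[OF l2W this r_lim v_lim]
  obtain \<sigma> where \<sigma>: "(\<lambda>n. l2 (?D n)) \<longlonglongrightarrow> \<sigma>" "(\<lambda>L. block_sd L / sqrt (real L)) \<longlonglongrightarrow> \<sigma>" by blast
  have "0 < \<sigma>"
  proof -
    have "swap_effect * (sqrt (real (n div 5)) / sqrt (real n)) \<le> l2 (?D n)" for n
    proof -
      have "swap_effect * sqrt (real (n div 5)) \<le> l2 (deviation n)"
        unfolding l2_def using deviation_variance_ge[of n] swap_effect_pos
        by (intro real_le_rsqrt) (simp add: power_mult_distrib mult.commute)
      from divide_right_mono[OF this, of "sqrt (real n)"]
      show ?thesis using l2_scale[of "1 / sqrt (real n)" "deviation n"] by simp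
    qed
    then have "swap_effect * (1 / sqrt (real 5)) \<le> \<sigma>"
      by (intro LIMSEQ_le[OF tendsto_mult[OF tendsto_const div_ratio_limit[of 5]] \<sigma>(1)]) auto
    moreover have "0 < swap_effect * (1 / sqrt (real 5))" using swap_effect_pos by simp
    ultimately show ?thesis by linarith
  qed
  moreover have "(\<lambda>n. char (distr unif_seq borel (?D n)) t) \<longlonglongrightarrow> complex_of_real (exp (- (\<sigma> * t)\<^sup>2 / 2))" for t
  proof -
    have e: "norm (char (distr unif_seq borel (?D n)) t - char (distr unif_seq borel (?W L n)) t) \<le> \<bar>t\<bar> * sqrt (r L n)"
      if "1 \<le> L" "1 \<le> n" for L n
      by (rule order_trans[OF char_distr_le_l2[OF rvD rvW] mult_left_mono[OF close[OF that] abs_ge_zero]])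
    have e_lim: "(\<lambda>n. \<bar>t\<bar> * sqrt (r L n)) \<longlonglongrightarrow> \<bar>t\<bar> * v L" for L by (intro tendsto_intros r_lim)
    have v0: "(\<lambda>L. \<bar>t\<bar> * v L) \<longlonglongrightarrow> 0" using tendsto_mult[OF tendsto_const v_lim] by simp
    obtain l where l: "(\<lambda>n. char (distr unif_seq borel (?D n)) t) \<longlonglongrightarrow> l"
      "(\<lambda>L. complex_of_real (exp (- (block_sd L / sqrt (real L) * t)\<^sup>2 / 2))) \<longlonglongrightarrow> l"
      by (rule interchange_limits[OF char_block_sum_limit e e_lim v0])
    have "(\<lambda>L. complex_of_real (exp (- (block_sd L / sqrt (real L) * t)\<^sup>2 / 2))) \<longlonglongrightarrow> complex_of_real (exp (- (\<sigma> * t)\<^sup>2 / 2))"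
      by (intro tendsto_intros \<sigma>(2)) simp_all
    with l show ?thesis using LIMSEQ_unique by blast
  qed
  ultimately show ?thesis using \<sigma>(1) that by blast
qed

section \<open>Transfer to uniformly random permutations\<close>

text \<open>
  Averages of indicator functions over all permutations are probabilities.
\<close>
lemma tree_cost_law:
  "distr (measure_pmf (pmf_of_set (perms k))) borel (\<lambda>\<pi>. tree_cost (inv \<pi>) 0 (k + 1))
    = distr unif_seq borel (\<lambda>\<omega>. tree_cost \<omega> 0 (k + 1))" (is "?P = ?Q")
proof (rule measure_eqI)
  show "sets ?P = sets ?Q" by simp
  fix A assume "A \<in> sets ?P"
  then have A: "A \<in> sets borel" by simp
  have m [measurable]: "(\<lambda>\<omega>. tree_cost \<omega> 0 (k + 1)) \<in> borel_measurable unif_seq"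
    using bounded_rv_tree_cost[of k] by (simp only: bounded_rv_def)
  interpret P: prob_space ?P by (rule measure_pmf.prob_space_distr) simp
  interpret Q: prob_space ?Q by (rule unif_seq.prob_space_distr[OF m])
  have "measure ?P A = measure_pmf.prob (pmf_of_set (perms k)) {\<pi>. tree_cost (inv \<pi>) 0 (k + 1) \<in> A}"
    using A by (subst measure_distr) (auto simp: vimage_def)
  also have "\<dots> = real (card (perms k \<inter> {\<pi>. tree_cost (inv \<pi>) 0 (k + 1) \<in> A})) / real (card (perms k))"
    by (rule measure_pmf_of_set[OF perms_nonempty finite_perms])
  also have "real (card (perms k \<inter> {\<pi>. tree_cost (inv \<pi>) 0 (k + 1) \<in> A}))
    = (\<Sum>\<pi>\<in>perms k. indicator A (tree_cost (inv \<pi>) 0 (k + 1)))"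
    using finite_perms[of k] by (simp add: sum.If_cases indicator_def of_bool_def)
  also have "\<dots> / real (card (perms k)) = (\<integral>\<omega>. indicator A (tree_cost \<omega> 0 (k + 1)) \<partial>unif_seq)"
    by (rule uniform_perm_average[where C=1]) (use A in \<open>auto simp: indicator_def\<close>)
  also have "\<dots> = (\<integral>x. indicator A x \<partial>?Q)"
    using A by (subst integral_distr[OF m]) auto
  also have "\<dots> = measure ?Q A" using A by simp
  finally show "emeasure ?P A = emeasure ?Q A"
    by (simp only: P.emeasure_eq_measure Q.emeasure_eq_measure)
qed

lemma AE_beta:
  assumes "1 \<le> k"
  shows "AE \<pi> in measure_pmf (pmf_of_set (perms k)). beta k \<pi> = (tree_cost (inv \<pi>) 0 (k + 1))\<^sup>2"
proof (subst AE_measure_pmf_iff, intro ballI)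
  fix \<pi> assume "\<pi> \<in> set_pmf (pmf_of_set (perms k))"
  then have "\<pi> permutes {1..k}"
    unfolding set_pmf_of_set[OF perms_nonempty finite_perms] by (simp only: perms_def mem_Collect_eq)
  with assms have "pattern k \<pi>" by (simp add: pattern_def)
  then show "beta k \<pi> = (tree_cost (inv \<pi>) 0 (k + 1))\<^sup>2" by (rule pattern.beta_eq_tree_cost)
qed

lemma beta_law:
  assumes k: "1 \<le> k" and h: "h \<in> borel_measurable borel"
  shows "distr (measure_pmf (pmf_of_set (perms k))) borel (\<lambda>\<pi>. h (beta k \<pi>))
    = distr unif_seq borel (\<lambda>\<omega>. h ((tree_cost \<omega> 0 (k + 1))\<^sup>2) :: real)"
proof -
  have m: "(\<lambda>\<omega>. tree_cost \<omega> 0 (k + 1)) \<in> borel_measurable unif_seq"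
    using bounded_rv_tree_cost[of k] by (simp only: bounded_rv_def)
  have h2: "(\<lambda>x. h (x\<^sup>2)) \<in> borel_measurable borel" using h by measurable
  have "distr (measure_pmf (pmf_of_set (perms k))) borel (\<lambda>\<pi>. h (beta k \<pi>))
    = distr (measure_pmf (pmf_of_set (perms k))) borel (\<lambda>\<pi>. h ((tree_cost (inv \<pi>) 0 (k + 1))\<^sup>2))"
    by (rule distr_cong_AE) (use AE_beta[OF k] in auto)
  also have "\<dots> = distr (distr (measure_pmf (pmf_of_set (perms k))) borel (\<lambda>\<pi>. tree_cost (inv \<pi>) 0 (k + 1))) borel (\<lambda>x. h (x\<^sup>2))"
    by (subst distr_distr[OF h2]) (auto simp: comp_def)
  also have "\<dots> = distr unif_seq borel (\<lambda>\<omega>. h ((tree_cost \<omega> 0 (k + 1))\<^sup>2))"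
    unfolding tree_cost_law by (subst distr_distr[OF h2 m]) (auto simp: comp_def)
  finally show ?thesis .
qed

lemma tree_cost_power2: "(tree_cost \<omega> 0 (k + 1))\<^sup>2 = (mean_cost k)\<^sup>2 + 2 * mean_cost k * deviation k \<omega> + (deviation k \<omega>)\<^sup>2"
  by (simp add: deviation_def power2_eq_square algebra_simps)

lemma expectation_deviation: "(\<integral>\<omega>. deviation k \<omega> \<partial>unif_seq) = 0"
  unfolding deviation_def mean_cost_def
  using bounded_rv_integrable[OF bounded_rv_tree_cost[of k]] by (simp add: unif_seq.prob_space)

lemma beta_typ_eq:
  assumes k: "1 \<le> k" shows "beta_typ k = (mean_cost k)\<^sup>2 + (l2 (deviation k))\<^sup>2"
proof -
  let ?p = "measure_pmf (pmf_of_set (perms k))"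
  have m: "(\<lambda>\<omega>. tree_cost \<omega> 0 (k + 1)) \<in> borel_measurable unif_seq"
    using bounded_rv_tree_cost[of k] by (simp only: bounded_rv_def)
  have i: "integrable unif_seq (deviation k)" "integrable unif_seq (\<lambda>\<omega>. (deviation k \<omega>)\<^sup>2)"
    by (intro bounded_rv_integrable bounded_rv_power2 bounded_rv_deviation)+
  have "beta_typ k = (\<integral>x. x \<partial>distr ?p borel (\<lambda>\<pi>. beta k \<pi>))"
    unfolding beta_typ_def by (subst integral_distr) auto
  also have "\<dots> = (\<integral>x. x \<partial>distr unif_seq borel (\<lambda>\<omega>. (tree_cost \<omega> 0 (k + 1))\<^sup>2))"
    by (subst beta_law[OF k, of "\<lambda>x. x"]) auto
  also have "\<dots> = (\<integral>\<omega>. (tree_cost \<omega> 0 (k + 1))\<^sup>2 \<partial>unif_seq)"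
    using m by (subst integral_distr) auto
  also have "\<dots> = (mean_cost k)\<^sup>2 + (l2 (deviation k))\<^sup>2"
    unfolding tree_cost_power2 using i by (simp add: expectation_deviation unif_seq.prob_space l2_power2)
  finally show ?thesis .
qed

lemma l2_deviation_normalised: "l2 (\<lambda>\<omega>. deviation k \<omega> / sqrt (real k)) = l2 (deviation k) / sqrt (real k)"
  using l2_scale[of "1 / sqrt (real k)" "deviation k"] by simp

lemma l2_deviation_over_limit: "(\<lambda>k. l2 (deviation k) / real k) \<longlonglongrightarrow> 0"
proof -
  obtain \<sigma> where "(\<lambda>n. l2 (\<lambda>\<omega>. deviation n \<omega> / sqrt (real n))) \<longlonglongrightarrow> \<sigma>" using tree_cost_clt by metis
  then have "(\<lambda>k. l2 (deviation k) / sqrt (real k)) \<longlonglongrightarrow> \<sigma>" by (simp only: l2_deviation_normalised)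
  moreover have "(\<lambda>k. 1 / sqrt (real k)) \<longlonglongrightarrow> 0" by real_asymp
  ultimately have "(\<lambda>k. l2 (deviation k) / sqrt (real k) * (1 / sqrt (real k))) \<longlonglongrightarrow> \<sigma> * 0" by (rule tendsto_mult)
  then show ?thesis by (simp add: divide_divide_eq_left)
qed

text \<open>
  The variance of the cost is of smaller order than the square of its mean.
\<close>
lemma c_typ_eq: "c_typ = growth\<^sup>2"
  unfolding c_typ_def
proof (rule limI, rule Lim_transform_eventually)
  have "(\<lambda>k. (mean_cost k / real k)\<^sup>2 + (l2 (deviation k) / real k)\<^sup>2) \<longlonglongrightarrow> growth\<^sup>2 + 0\<^sup>2"
    by (intro tendsto_intros mean_cost_limit l2_deviation_over_limit)
  then show "(\<lambda>k. (mean_cost k / real k)\<^sup>2 + (l2 (deviation k) / real k)\<^sup>2) \<longlonglongrightarrow> growth\<^sup>2" by simp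
  show "\<forall>\<^sub>F k in sequentially. (mean_cost k / real k)\<^sup>2 + (l2 (deviation k) / real k)\<^sup>2 = beta_typ k / (real k)\<^sup>2"
    using eventually_ge_at_top[of 1] by eventually_elim (simp add: beta_typ_eq power_divide add_divide_distrib)
qed

text \<open>
  Write \<open>G\<close> for the cost, \<open>\<mu>\<close> for its mean and \<open>D\<close> for its deviation divided by \<open>sqrt k\<close>. Then
  \<open>G\<^sup>2\<close> minus its mean, divided by \<open>k powr (3/2)\<close>, is \<open>2 * (\<mu> / k) * D\<close> plus a term of order
  \<open>1 / sqrt k\<close> in mean. So it has the same limit as \<open>2 * growth * D\<close>.
\<close>
theorem beta_clt:
  obtains \<sigma> :: real where "0 < \<sigma>"
    "weak_conv_m
       (\<lambda>k. distr (measure_pmf (pmf_of_set (perms k))) borel (\<lambda>\<pi>. (beta k \<pi> - beta_typ k) / real k powr (3/2)))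
       (distr std_normal_distribution borel (\<lambda>z. \<sigma> * z))"
proof -
  obtain s where s: "0 < s" "(\<lambda>n. l2 (\<lambda>\<omega>. deviation n \<omega> / sqrt (real n))) \<longlonglongrightarrow> s"
    and char_lim: "\<And>t. (\<lambda>n. char (distr unif_seq borel (\<lambda>\<omega>. deviation n \<omega> / sqrt (real n))) t)
        \<longlonglongrightarrow> complex_of_real (exp (- (s * t)\<^sup>2 / 2))" by (rule tree_cost_clt) (rule that)
  let ?D = "\<lambda>n \<omega>. deviation n \<omega> / sqrt (real n)"
  let ?Y = "\<lambda>k \<omega>. ((tree_cost \<omega> 0 (k + 1))\<^sup>2 - beta_typ k) / real k powr (3/2)"
  define \<sigma> where "\<sigma> = 2 * growth * s"
  have rvD: "bounded_rv (?D n)" for n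
    using bounded_rv_mult[OF bounded_rv_const[of "1 / sqrt (real n)"] bounded_rv_deviation] by simp
  have rvY: "bounded_rv (?Y k)" for k
    using bounded_rv_mult[OF bounded_rv_const[of "1 / real k powr (3/2)"]
        bounded_rv_diff[OF bounded_rv_power2[OF bounded_rv_tree_cost[of k]] bounded_rv_const[of "beta_typ k"]]] by simp
  have mD: "?D n \<in> borel_measurable unif_seq" for n using rvD[of n] by (simp only: bounded_rv_def)
  define e where "e k = 2 * \<bar>mean_cost k / real k - growth\<bar> * l2 (?D k) + 2 * (l2 (?D k))\<^sup>2 * (1 / sqrt (real k))" for k
  have L1: "(\<integral>\<omega>. \<bar>?Y k \<omega> - 2 * growth * ?D k \<omega>\<bar> \<partial>unif_seq) \<le> e k" if k: "1 \<le> k" for k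
  proof -
    define v where "v = l2 (?D k)"
    have pw: "real k powr (3/2) = real k * sqrt (real k)"
      using k powr_add[of "real k" 1 "1/2"] by (simp add: powr_half_sqrt)
    have Y: "?Y k \<omega> - 2 * growth * ?D k \<omega>
      = 2 * (mean_cost k / real k - growth) * ?D k \<omega> + ((?D k \<omega>)\<^sup>2 - v\<^sup>2) * (1 / sqrt (real k))" for \<omega>
    proof -
      have "?Y k \<omega> = (2 * mean_cost k * deviation k \<omega> + ((deviation k \<omega>)\<^sup>2 - (l2 (deviation k))\<^sup>2)) / (real k * sqrt (real k))"
        unfolding tree_cost_power2 beta_typ_eq[OF k] pw by (simp add: algebra_simps)
      also have "\<dots> = 2 * (mean_cost k / real k) * ?D k \<omega> + ((deviation k \<omega>)\<^sup>2 - (l2 (deviation k))\<^sup>2) / real k * (1 / sqrt (real k))"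
        by (simp add: add_divide_distrib)
      also have "((deviation k \<omega>)\<^sup>2 - (l2 (deviation k))\<^sup>2) / real k = (?D k \<omega>)\<^sup>2 - v\<^sup>2"
        unfolding v_def l2_deviation_normalised by (simp add: power_divide diff_divide_distrib)
      finally show ?thesis by (simp add: algebra_simps)
    qed
    have i: "integrable unif_seq (\<lambda>\<omega>. \<bar>?D k \<omega>\<bar>)" "integrable unif_seq (\<lambda>\<omega>. (?D k \<omega>)\<^sup>2)"
      by (intro bounded_rv_integrable bounded_rv_abs bounded_rv_power2 rvD)+
    let ?R = "\<lambda>\<omega>. 2 * \<bar>mean_cost k / real k - growth\<bar> * \<bar>?D k \<omega>\<bar> + ((?D k \<omega>)\<^sup>2 + v\<^sup>2) * (1 / sqrt (real k))"
    have iR: "integrable unif_seq ?R"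
      by (intro Bochner_Integration.integrable_add integrable_mult_right integrable_mult_left i unif_seq.integrable_const)
    have linear: "(\<integral>\<omega>. a * f \<omega> + (g \<omega> + b) * c \<partial>unif_seq) = a * (\<integral>\<omega>. f \<omega> \<partial>unif_seq) + ((\<integral>\<omega>. g \<omega> \<partial>unif_seq) + b) * c"
      if "integrable unif_seq f" "integrable unif_seq g" for a b c and f g :: "(nat \<Rightarrow> real) \<Rightarrow> real"
      using that by (simp add: unif_seq.prob_space)
    have "(\<integral>\<omega>. \<bar>?Y k \<omega> - 2 * growth * ?D k \<omega>\<bar> \<partial>unif_seq) \<le> (\<integral>\<omega>. ?R \<omega> \<partial>unif_seq)"
    proof (rule integral_mono[OF _ iR])
      show "integrable unif_seq (\<lambda>\<omega>. \<bar>?Y k \<omega> - 2 * growth * ?D k \<omega>\<bar>)"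
        by (intro bounded_rv_integrable bounded_rv_abs bounded_rv_diff bounded_rv_mult[OF bounded_rv_const] rvY rvD)
      show "\<bar>?Y k \<omega> - 2 * growth * ?D k \<omega>\<bar> \<le> ?R \<omega>" for \<omega>
      proof -
        have "\<bar>(?D k \<omega>)\<^sup>2 - v\<^sup>2\<bar> \<le> (?D k \<omega>)\<^sup>2 + v\<^sup>2" by (simp add: abs_le_iff)
        then have "\<bar>((?D k \<omega>)\<^sup>2 - v\<^sup>2) * (1 / sqrt (real k))\<bar> \<le> ((?D k \<omega>)\<^sup>2 + v\<^sup>2) * (1 / sqrt (real k))"
          unfolding abs_mult by (intro mult_mono) auto
        moreover have "\<bar>2 * (mean_cost k / real k - growth) * ?D k \<omega>\<bar> = 2 * \<bar>mean_cost k / real k - growth\<bar> * \<bar>?D k \<omega>\<bar>"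
          by (simp only: abs_mult abs_numeral)
        ultimately show ?thesis unfolding Y by linarith
      qed
    qed
    also have "\<dots> = 2 * \<bar>mean_cost k / real k - growth\<bar> * (\<integral>\<omega>. \<bar>?D k \<omega>\<bar> \<partial>unif_seq)
        + ((\<integral>\<omega>. (?D k \<omega>)\<^sup>2 \<partial>unif_seq) + v\<^sup>2) * (1 / sqrt (real k))"
      by (rule linear[OF i])
    also have "\<dots> \<le> e k"
    proof -
      have "2 * \<bar>mean_cost k / real k - growth\<bar> * (\<integral>\<omega>. \<bar>?D k \<omega>\<bar> \<partial>unif_seq) \<le> 2 * \<bar>mean_cost k / real k - growth\<bar> * l2 (?D k)"
        by (intro mult_left_mono mean_abs_le_l2 rvD) auto
      moreover have "(\<integral>\<omega>. (?D k \<omega>)\<^sup>2 \<partial>unif_seq) + v\<^sup>2 = 2 * (l2 (?D k))\<^sup>2" unfolding v_def l2_power2 by (rule mult_2[symmetric])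
      ultimately show ?thesis unfolding e_def by (simp only: add_right_mono)
    qed
    finally show ?thesis .
  qed
  have e_lim: "e \<longlonglongrightarrow> 0"
  proof -
    have "(\<lambda>k. 1 / sqrt (real k)) \<longlonglongrightarrow> 0" by real_asymp
    then have "e \<longlonglongrightarrow> 2 * \<bar>growth - growth\<bar> * s + 2 * s\<^sup>2 * 0"
      unfolding e_def[abs_def] by (intro tendsto_intros mean_cost_limit s(2))
    then show ?thesis by simp
  qed
  have "weak_conv_m
       (\<lambda>k. distr (measure_pmf (pmf_of_set (perms k))) borel (\<lambda>\<pi>. (beta k \<pi> - beta_typ k) / real k powr (3/2)))
       (distr std_normal_distribution borel (\<lambda>z. \<sigma> * z))"
  proof (rule levy_continuity)
    show "real_distribution (distr (measure_pmf (pmf_of_set (perms k))) borel (\<lambda>\<pi>. (beta k \<pi> - beta_typ k) / real k powr (3/2)))" for k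
      by (rule prob_space.real_distribution_distr[OF measure_pmf.prob_space_axioms]) simp
    interpret N: prob_space std_normal_distribution by (rule prob_space_normal_density) simp
    show "real_distribution (distr std_normal_distribution borel (\<lambda>z. \<sigma> * z))"
      by (rule N.real_distribution_distr) simp
    fix t
    have small: "(\<lambda>k. char (distr unif_seq borel (?Y k)) t - char (distr unif_seq borel (\<lambda>\<omega>. 2 * growth * ?D k \<omega>)) t) \<longlonglongrightarrow> 0"
    proof (rule Lim_null_comparison)
      show "\<forall>\<^sub>F k in sequentially. norm (char (distr unif_seq borel (?Y k)) t - char (distr unif_seq borel (\<lambda>\<omega>. 2 * growth * ?D k \<omega>)) t) \<le> \<bar>t\<bar> * e k"
        using eventually_ge_at_top[of 1]
      proof eventually_elim
        case (elim k)
        show ?case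
          by (rule order_trans[OF char_distr_le[OF rvY bounded_rv_mult[OF bounded_rv_const rvD]] mult_left_mono[OF L1[OF elim] abs_ge_zero]])
      qed
      show "(\<lambda>k. \<bar>t\<bar> * e k) \<longlonglongrightarrow> 0" using tendsto_mult[OF tendsto_const e_lim] by simp
    qed
    have main: "(\<lambda>k. char (distr unif_seq borel (\<lambda>\<omega>. 2 * growth * ?D k \<omega>)) t) \<longlonglongrightarrow> complex_of_real (exp (- (s * (2 * growth * t))\<^sup>2 / 2))"
      unfolding char_distr_scale[OF mD] by (rule char_lim)
    have Y_lim: "(\<lambda>k. char (distr unif_seq borel (?Y k)) t) \<longlonglongrightarrow> complex_of_real (exp (- (s * (2 * growth * t))\<^sup>2 / 2))"
      using tendsto_add[OF small main] by simp
    have "char (distr std_normal_distribution borel (\<lambda>z. \<sigma> * z)) t = char (distr std_normal_distribution borel (\<lambda>z. z)) (\<sigma> * t)"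
      by (rule char_distr_scale) simp
    also have "distr std_normal_distribution borel (\<lambda>z. z) = std_normal_distribution"
      by (rule distr_id2) simp
    also have "char std_normal_distribution (\<sigma> * t) = complex_of_real (exp (- (s * (2 * growth * t))\<^sup>2 / 2))"
      by (simp add: char_std_normal_distribution \<sigma>_def mult_ac)
    finally have N: "char (distr std_normal_distribution borel (\<lambda>z. \<sigma> * z)) t = complex_of_real (exp (- (s * (2 * growth * t))\<^sup>2 / 2))" .
    show "(\<lambda>k. char (distr (measure_pmf (pmf_of_set (perms k))) borel (\<lambda>\<pi>. (beta k \<pi> - beta_typ k) / real k powr (3/2))) t)
      \<longlonglongrightarrow> char (distr std_normal_distribution borel (\<lambda>z. \<sigma> * z)) t"
      unfolding N
    proof (rule Lim_transform_eventually[OF Y_lim])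
      show "\<forall>\<^sub>F k in sequentially. char (distr unif_seq borel (?Y k)) t
        = char (distr (measure_pmf (pmf_of_set (perms k))) borel (\<lambda>\<pi>. (beta k \<pi> - beta_typ k) / real k powr (3/2))) t"
        using eventually_ge_at_top[of 1]
      proof eventually_elim
        case (elim k)
        show ?case
          by (subst beta_law[OF elim, of "\<lambda>x. (x - beta_typ k) / real k powr (3/2)"]) simp_all
      qed
    qed
  qed
  moreover have "0 < \<sigma>" using s(1) growth_pos by (simp add: \<sigma>_def)
  ultimately show ?thesis using that by blast
qed

text \<open>
  Markov's inequality for \<open>\<bar>G\<^sup>2 / k\<^sup>2 - c_typ\<bar>\<close>, whose mean is controlled by the mean and the standard
  deviation of \<open>G\<close>.
\<close>
theorem beta_concentration:
  assumes \<epsilon>: "0 < \<epsilon>"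
  shows "(\<lambda>k. real (card {\<pi> \<in> perms k. beta k \<pi> \<in> {c_typ * real k ^ 2 - \<epsilon> * real k ^ 2 .. c_typ * real k ^ 2 + \<epsilon> * real k ^ 2}})
    / real (card (perms k))) \<longlonglongrightarrow> 1"
proof -
  let ?I = "\<lambda>k::nat. {c_typ * real k ^ 2 - \<epsilon> * real k ^ 2 .. c_typ * real k ^ 2 + \<epsilon> * real k ^ 2}"
  let ?f = "\<lambda>k. real (card {\<pi> \<in> perms k. beta k \<pi> \<in> ?I k}) / real (card (perms k))"
  define d where "d k = l2 (deviation k) / real k" for k
  define e where "e k = \<bar>(mean_cost k / real k)\<^sup>2 - growth\<^sup>2\<bar> + 2 * (mean_cost k / real k) * d k + (d k)\<^sup>2" for k
  have "e \<longlonglongrightarrow> \<bar>growth\<^sup>2 - growth\<^sup>2\<bar> + 2 * growth * 0 + 0\<^sup>2"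
    unfolding e_def[abs_def] d_def by (intro tendsto_intros mean_cost_limit l2_deviation_over_limit)
  then have e_lim: "e \<longlonglongrightarrow> 0" by simp
  have bounds: "1 - e k / \<epsilon> \<le> ?f k \<and> ?f k \<le> 1" if k: "1 \<le> k" for k
  proof -
    let ?G = "\<lambda>\<omega>. (tree_cost \<omega> 0 (k + 1))\<^sup>2"
    let ?Q = "distr unif_seq borel ?G"
    define V where "V \<omega> = \<bar>?G \<omega> / (real k)\<^sup>2 - c_typ\<bar>" for \<omega> :: "nat \<Rightarrow> real"
    have rvG: "bounded_rv ?G" by (intro bounded_rv_power2 bounded_rv_tree_cost)
    then have m [measurable]: "?G \<in> borel_measurable unif_seq" by (simp only: bounded_rv_def)
    have "bounded_rv (\<lambda>\<omega>. 1 / (real k)\<^sup>2 * ?G \<omega>)" by (intro bounded_rv_mult bounded_rv_const rvG)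
    then have rvV: "bounded_rv V" unfolding V_def[abs_def]
      by (intro bounded_rv_abs bounded_rv_diff bounded_rv_const) simp
    then have mV [measurable]: "V \<in> borel_measurable unif_seq" by (simp only: bounded_rv_def)
    have V0: "0 \<le> V \<omega>" for \<omega> by (simp add: V_def)
    have k0: "0 < real k" using k by simp
    have "?f k = measure_pmf.prob (pmf_of_set (perms k)) {\<pi>. beta k \<pi> \<in> ?I k}"
      by (subst measure_pmf_of_set[OF perms_nonempty finite_perms]) (simp add: Int_def)
    also have "\<dots> = measure (distr (measure_pmf (pmf_of_set (perms k))) borel (\<lambda>\<pi>. beta k \<pi>)) (?I k)"
      by (subst measure_distr) (auto simp: vimage_def)
    also have "distr (measure_pmf (pmf_of_set (perms k))) borel (\<lambda>\<pi>. beta k \<pi>) = ?Q"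
      by (rule beta_law[OF k, of "\<lambda>x. x"]) simp
    also have "measure ?Q (?I k) = unif_seq.prob {\<omega> \<in> space unif_seq. ?G \<omega> \<in> ?I k}"
      by (subst measure_distr[OF m]) (auto simp: vimage_def Int_def conj_commute)
    also have "{\<omega> \<in> space unif_seq. ?G \<omega> \<in> ?I k} = {\<omega> \<in> space unif_seq. \<not> \<epsilon> < V \<omega>}"
    proof -
      have "?G \<omega> \<in> ?I k \<longleftrightarrow> V \<omega> \<le> \<epsilon>" for \<omega> :: "nat \<Rightarrow> real"
      proof -
        have "?G \<omega> \<in> ?I k \<longleftrightarrow> \<bar>?G \<omega> - c_typ * (real k)\<^sup>2\<bar> \<le> \<epsilon> * (real k)\<^sup>2" by (auto simp: abs_le_iff)
        also have "\<dots> \<longleftrightarrow> \<bar>?G \<omega> - c_typ * (real k)\<^sup>2\<bar> / (real k)\<^sup>2 \<le> \<epsilon>" using k0 by (simp add: pos_divide_le_eq)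
        also have "\<bar>?G \<omega> - c_typ * (real k)\<^sup>2\<bar> / (real k)\<^sup>2 = \<bar>(?G \<omega> - c_typ * (real k)\<^sup>2) / (real k)\<^sup>2\<bar>" by simp
        also have "\<dots> = V \<omega>" using k0 by (simp add: V_def diff_divide_distrib)
        finally show ?thesis .
      qed
      then show ?thesis by (simp add: not_less)
    qed
    also have "unif_seq.prob \<dots> = 1 - unif_seq.prob {\<omega> \<in> space unif_seq. \<epsilon> < V \<omega>}"
      by (rule unif_seq.prob_neg) measurable
    finally have f: "?f k = 1 - unif_seq.prob {\<omega> \<in> space unif_seq. \<epsilon> < V \<omega>}" .
    have "unif_seq.prob {\<omega> \<in> space unif_seq. \<epsilon> < V \<omega>} \<le> unif_seq.prob {\<omega> \<in> space unif_seq. \<epsilon> \<le> V \<omega>}"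
      by (intro unif_seq.finite_measure_mono) auto
    also have "\<dots> \<le> (\<integral>\<omega>. V \<omega> \<partial>unif_seq) / \<epsilon>"
      by (rule integral_Markov_inequality_measure[where A="{}"]) (use \<epsilon> bounded_rv_integrable[OF rvV] V0 in auto)
    also have "\<dots> \<le> e k / \<epsilon>"
    proof (rule divide_right_mono)
      have mu: "0 \<le> mean_cost k" unfolding mean_cost_def by (intro integral_nonneg_AE) (simp add: tree_cost_nonneg)
      have i: "integrable unif_seq (\<lambda>\<omega>. \<bar>deviation k \<omega>\<bar>)" "integrable unif_seq (\<lambda>\<omega>. (deviation k \<omega>)\<^sup>2)"
        by (intro bounded_rv_integrable bounded_rv_abs bounded_rv_power2 bounded_rv_deviation)+
      let ?c = "\<bar>(mean_cost k / real k)\<^sup>2 - growth\<^sup>2\<bar>" and ?b = "2 * (mean_cost k / real k) / real k" and ?a = "1 / (real k)\<^sup>2"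
      let ?R = "\<lambda>\<omega>. ?c + ?b * \<bar>deviation k \<omega>\<bar> + ?a * (deviation k \<omega>)\<^sup>2"
      have iR: "integrable unif_seq ?R"
        by (intro Bochner_Integration.integrable_add integrable_mult_right i unif_seq.integrable_const)
      have "(\<integral>\<omega>. V \<omega> \<partial>unif_seq) \<le> (\<integral>\<omega>. ?R \<omega> \<partial>unif_seq)"
      proof (rule integral_mono[OF bounded_rv_integrable[OF rvV] iR])
        fix \<omega>
        have "?G \<omega> / (real k)\<^sup>2 - c_typ = ((mean_cost k / real k)\<^sup>2 - growth\<^sup>2) + ?b * deviation k \<omega> + ?a * (deviation k \<omega>)\<^sup>2"
          unfolding tree_cost_power2 c_typ_eq by (simp add: add_divide_distrib power2_eq_square)
        then have "V \<omega> \<le> ?c + \<bar>?b * deviation k \<omega>\<bar> + \<bar>?a * (deviation k \<omega>)\<^sup>2\<bar>"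
          unfolding V_def by linarith
        moreover have "\<bar>?b * deviation k \<omega>\<bar> = ?b * \<bar>deviation k \<omega>\<bar>" using mu by (simp add: abs_mult)
        moreover have "\<bar>?a * (deviation k \<omega>)\<^sup>2\<bar> = ?a * (deviation k \<omega>)\<^sup>2" by simp
        ultimately show "V \<omega> \<le> ?R \<omega>" by (simp only:)
      qed
      also have "\<dots> = ?c + ?b * (\<integral>\<omega>. \<bar>deviation k \<omega>\<bar> \<partial>unif_seq) + ?a * (l2 (deviation k))\<^sup>2"
        using i by (simp add: unif_seq.prob_space l2_power2)
      also have "\<dots> \<le> ?c + ?b * l2 (deviation k) + ?a * (l2 (deviation k))\<^sup>2"
        using mu by (intro add_mono mult_left_mono mean_abs_le_l2 bounded_rv_deviation order_refl) auto
      also have "\<dots> = e k" by (simp add: e_def d_def power_divide)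
      finally show "(\<integral>\<omega>. V \<omega> \<partial>unif_seq) \<le> e k" .
    qed (use \<epsilon> in simp)
    finally show ?thesis unfolding f by (simp add: measure_nonneg)
  qed
  show "?f \<longlonglongrightarrow> 1"
  proof (rule real_tendsto_sandwich)
    show "\<forall>\<^sub>F k in sequentially. 1 - e k / \<epsilon> \<le> ?f k" "\<forall>\<^sub>F k in sequentially. ?f k \<le> 1"
      using eventually_ge_at_top[of 1] by (eventually_elim, use bounds in blast)+
    show "(\<lambda>k. 1 - e k / \<epsilon>) \<longlonglongrightarrow> 1"
    proof -
      have "(\<lambda>k. 1 - e k / \<epsilon>) \<longlonglongrightarrow> 1 - 0 / \<epsilon>" using \<epsilon> by (intro tendsto_intros e_lim) simp
      then show ?thesis by simp
    qed
  qed simp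
qed

section \<open>The limit theorem\<close>

theorem theorem1p7:
  shows "(\<exists>\<sigma>::real. \<sigma> > 0 \<and>
           weak_conv_m
             (\<lambda>k. distr (measure_pmf (pmf_of_set (perms k))) borel
                    (\<lambda>\<pi>. (beta k \<pi> - beta_typ k) / real k powr (3/2)))
             (distr std_normal_distribution borel (\<lambda>z. \<sigma> * z)))
       \<and> (\<forall>\<epsilon>>0.
           (\<lambda>k. real (card {\<pi> \<in> perms k.
                       beta k \<pi> \<in> {c_typ * real k ^ 2 - \<epsilon> * real k ^ 2 ..
                                    c_typ * real k ^ 2 + \<epsilon> * real k ^ 2}})
                 / real (card (perms k))) \<longlonglongrightarrow> 1)"
proof (intro conjI allI impI)
  show "\<exists>\<sigma>::real. \<sigma> > 0 \<and>
           weak_conv_m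
             (\<lambda>k. distr (measure_pmf (pmf_of_set (perms k))) borel
                    (\<lambda>\<pi>. (beta k \<pi> - beta_typ k) / real k powr (3/2)))
             (distr std_normal_distribution borel (\<lambda>z. \<sigma> * z))"
    by (rule beta_clt) (rule exI, rule conjI)
qed (rule beta_concentration)

end
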